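(* If $\mathbf G$ is a left-bounded complex of graded $S$-modules, then $$\operatorname{lin}(\mathbf R(\mathbf G))=\bigoplus_i\mathbf R(H^i(\mathbf G)),$$ where $H^i(\mathbf G)$ is regarded as a complex of one term, concentrated in cohomological degree $i$. Similarly, if $\mathbf G$ is a left-bounded complex of graded $E$-modules, then $\operatorname{lin}(\mathbf L(\mathbf G))=\bigoplus_i\mathbf L(H^i(\mathbf G))$, with $H^i(\mathbf G)$ concentrated in cohomological degree $i$.
   Context: $K$ is a field; $V$ and $W=V^*$ are dual $K$-vector spaces of finite dimension $v$, with $W$ in degree $1$ and $V$ in degree $-1$; $E=\bigwedge V$ and $S=\operatorname{Sym}(W)$ with induced gradings ($\bigwedge^jV$ in degree $-j$). $(e_i)$, $(x_i)$ are dual bases of $V$, $W$. Complexes are cohomological; left-bounded means $G^i=0$ for $i\ll0$. "=" means isomorphic. For a graded vector space $D$, $\operatorname{Hom}_K(E,D)$ is a graded left $E$-module via $(f\alpha)(e)=\alpha(ef)$. Functor $\mathbf R$: for a graded $S$-module $M=\bigoplus M_d$ in cohomological degree $0$, $\mathbf R(M)$ has $\operatorname{Hom}_K(E,M_d)$ in cohomological degree $d$ and differential $\alpha\mapsto[e\mapsto\sum_i x_i\alpha(e_ie)]$. For a complex $\mathbf F$ of graded $S$-modules, $\mathbf R(\mathbf F)$ is the total complex (direct sums, usual signs) of the double complex with terms $\operatorname{Hom}_K(E,(F^i)_j)$, of total cohomological degree $i+j$. Functor $\mathbf L$: for a graded $E$-module $P$ in cohomological degree $0$, $\mathbf L(P)$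 has $S\otimes_KP_j$ in cohomological degree $-j$ and differential $s\otimes p\mapsto\sum_i x_is\otimes e_ip$. For a complex $\mathbf G$ of graded $E$-modules, $\mathbf L(\mathbf G)$ is the total complex (direct sums) of the double complex with terms $S\otimes_K(G^i)_j$, of total cohomological degree $i-j$. Linear part: a graded free complex over $E$ or $S$ is minimal if its differentials are given by matrices with entries in the homogeneous maximal ideal. For a minimal one, $\operatorname{lin}$ is obtained by erasing from these matrices all terms of absolute degree $>1$. For any free complex $\mathbf F$, $\operatorname{lin}(\mathbf F)$ is the linear part of a minimal free complex homotopy equivalent to $\mathbf F$. *)

theory Defs
  imports "HOL-Algebra.Module" "HOL-Algebra.AbelCoset" "HOL-Library.Poly_Mapping"
begin

section \<open>Graded rings and graded modules\<close>

text \<open>A graded ring carries the projections onto its homogeneous components: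
  \<open>gcomp A d a\<close> is the degree \<open>d\<close> part of \<open>a\<close>.\<close>

record 'r graded_ring = "'r ring" +
  gcomp :: "int \<Rightarrow> 'r \<Rightarrow> 'r"

definition hom_part :: "('r, 'z) graded_ring_scheme \<Rightarrow> int \<Rightarrow> 'r set" where
  "hom_part A d = {a \<in> carrier A. gcomp A d a = a}"

text \<open>The rings used below are concentrated in degrees of one sign and have a field in
  degree 0, so the homogeneous maximal ideal consists of the elements without degree 0 part.\<close>

definition hom_max_ideal :: "('r, 'z) graded_ring_scheme \<Rightarrow> 'r set" where
  "hom_max_ideal A = {a \<in> carrier A. gcomp A 0 a = \<zero>\<^bsub>A\<^esub>}"

definition erase_above_linear :: "('r, 'z) graded_ring_scheme \<Rightarrow> 'r \<Rightarrow> 'r" where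
  "erase_above_linear A a = gcomp A (- 1) a \<oplus>\<^bsub>A\<^esub> gcomp A 0 a \<oplus>\<^bsub>A\<^esub> gcomp A 1 a"

text \<open>The \<open>mult\<close> and \<open>one\<close> fields inherited from the library record are meaningless for modules
  and left unspecified.  The library locale \<open>module\<close> needs a commutative ring, so that left
  modules over the exterior algebra require their own locale.\<close>

record ('r, 'a) gmodule = "('r, 'a) module" +
  hpart :: "int \<Rightarrow> 'a set"

locale left_module = R?: ring R + M?: abelian_group M
  for R (structure) and M (structure) +
  assumes smult_closed: "\<lbrakk>a \<in> carrier R; x \<in> carrier M\<rbrakk> \<Longrightarrow> a \<odot>\<^bsub>M\<^esub> x \<in> carrier M"
    and smult_l_distr: "\<lbrakk>a \<in> carrier R; b \<in> carrier R; x \<in> carrier M\<rbrakk> \<Longrightarrow>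
      (a \<oplus> b) \<odot>\<^bsub>M\<^esub> x = a \<odot>\<^bsub>M\<^esub> x \<oplus>\<^bsub>M\<^esub> b \<odot>\<^bsub>M\<^esub> x"
    and smult_r_distr: "\<lbrakk>a \<in> carrier R; x \<in> carrier M; y \<in> carrier M\<rbrakk> \<Longrightarrow>
      a \<odot>\<^bsub>M\<^esub> (x \<oplus>\<^bsub>M\<^esub> y) = a \<odot>\<^bsub>M\<^esub> x \<oplus>\<^bsub>M\<^esub> a \<odot>\<^bsub>M\<^esub> y"
    and smult_assoc: "\<lbrakk>a \<in> carrier R; b \<in> carrier R; x \<in> carrier M\<rbrakk> \<Longrightarrow>
      (a \<otimes> b) \<odot>\<^bsub>M\<^esub> x = a \<odot>\<^bsub>M\<^esub> (b \<odot>\<^bsub>M\<^esub> x)"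
    and smult_one: "x \<in> carrier M \<Longrightarrow> \<one> \<odot>\<^bsub>M\<^esub> x = x"

locale graded_module = left_module A M
  for A :: "('r, 'z) graded_ring_scheme" and M :: "('r, 'a, 'y) gmodule_scheme" +
  assumes hpart_subgroup: "additive_subgroup (hpart M d) M"
    and hpart_smult: "\<lbrakk>a \<in> hom_part A i; x \<in> hpart M d\<rbrakk> \<Longrightarrow> a \<odot>\<^bsub>M\<^esub> x \<in> hpart M (i + d)"
    and hpart_direct_sum: "x \<in> carrier M \<Longrightarrow>
      \<exists>!c. (\<forall>d. c d \<in> hpart M d) \<and> finite {d. c d \<noteq> \<zero>\<^bsub>M\<^esub>} \<and>
           x = (\<Oplus>\<^bsub>M\<^esub>d\<in>{d. c d \<noteq> \<zero>\<^bsub>M\<^esub>}. c d)"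

text \<open>Homomorphisms of graded modules are homogeneous of degree 0.\<close>

definition graded_hom ::
  "('r, 'z) graded_ring_scheme \<Rightarrow> ('r, 'a, 'x) gmodule_scheme \<Rightarrow> ('r, 'b, 'y) gmodule_scheme
    \<Rightarrow> ('a \<Rightarrow> 'b) set" where
  "graded_hom A M N = {f. f \<in> carrier M \<rightarrow> carrier N \<and>
     (\<forall>x\<in>carrier M. \<forall>y\<in>carrier M. f (x \<oplus>\<^bsub>M\<^esub> y) = f x \<oplus>\<^bsub>N\<^esub> f y) \<and>
     (\<forall>a\<in>carrier A. \<forall>x\<in>carrier M. f (a \<odot>\<^bsub>M\<^esub> x) = a \<odot>\<^bsub>N\<^esub> f x) \<and>
     (\<forall>d. f ` hpart M d \<subseteq> hpart N d)}"

definition zero_part :: "('r, 'a) gmodule \<Rightarrow> ('r, 'a) gmodule" where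
  "zero_part M = M\<lparr>carrier := {\<zero>\<^bsub>M\<^esub>}, hpart := (\<lambda>d. {\<zero>\<^bsub>M\<^esub>})\<rparr>"

definition direct_sum :: "(int \<Rightarrow> ('r, 'a) gmodule) \<Rightarrow> ('r, int \<Rightarrow> 'a) gmodule" where
  "direct_sum M =
    (let C = {\<phi>. (\<forall>i. \<phi> i \<in> carrier (M i)) \<and> finite {i. \<phi> i \<noteq> \<zero>\<^bsub>M i\<^esub>}} in
     \<lparr>carrier = C,
      mult = undefined, one = undefined,
      zero = (\<lambda>i. \<zero>\<^bsub>M i\<^esub>),
      add = (\<lambda>\<phi> \<psi> i. \<phi> i \<oplus>\<^bsub>M i\<^esub> \<psi> i),
      smult = (\<lambda>a \<phi> i. a \<odot>\<^bsub>M i\<^esub> \<phi> i),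
      hpart = (\<lambda>d. {\<phi> \<in> C. \<forall>i. \<phi> i \<in> hpart (M i) d})\<rparr>)"

definition quotient_gmodule :: "('r, 'a) gmodule \<Rightarrow> 'a set \<Rightarrow> ('r, 'a set) gmodule" where
  "quotient_gmodule M N =
    \<lparr>carrier = a_rcosets\<^bsub>M\<^esub> N,
     mult = undefined, one = undefined,
     zero = N,
     add = set_add M,
     smult = (\<lambda>a X. \<Union>x\<in>X. N +>\<^bsub>M\<^esub> (a \<odot>\<^bsub>M\<^esub> x)),
     hpart = (\<lambda>d. (\<lambda>x. N +>\<^bsub>M\<^esub> x) ` hpart M d)\<rparr>"


section \<open>Complexes of graded modules\<close>

text \<open>Cohomological indexing: \<open>Df C n\<close> goes from \<open>Ob C n\<close> to \<open>Ob C (n + 1)\<close>.\<close>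

record ('r, 'a) gcomplex =
  Ob :: "int \<Rightarrow> ('r, 'a) gmodule"
  Df :: "int \<Rightarrow> 'a \<Rightarrow> 'a"

definition graded_complex :: "('r, 'z) graded_ring_scheme \<Rightarrow> ('r, 'a) gcomplex \<Rightarrow> bool" where
  "graded_complex A C \<longleftrightarrow> (\<forall>n. graded_module A (Ob C n) \<and>
     Df C n \<in> graded_hom A (Ob C n) (Ob C (n + 1)) \<and>
     (\<forall>x\<in>carrier (Ob C n). Df C (n + 1) (Df C n x) = \<zero>\<^bsub>Ob C (n + 2)\<^esub>))"

definition left_bounded :: "('r, 'a) gcomplex \<Rightarrow> bool" where
  "left_bounded C \<longleftrightarrow> (\<exists>m. \<forall>i<m. carrier (Ob C i) = {\<zero>\<^bsub>Ob C i\<^esub>})"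

definition chain_map ::
  "('r, 'z) graded_ring_scheme \<Rightarrow> ('r, 'a) gcomplex \<Rightarrow> ('r, 'b) gcomplex
    \<Rightarrow> (int \<Rightarrow> 'a \<Rightarrow> 'b) \<Rightarrow> bool" where
  "chain_map A C D f \<longleftrightarrow> (\<forall>n. f n \<in> graded_hom A (Ob C n) (Ob D n) \<and>
     (\<forall>x\<in>carrier (Ob C n). f (n + 1) (Df C n x) = Df D n (f n x)))"

definition chain_isomorphic ::
  "('r, 'z) graded_ring_scheme \<Rightarrow> ('r, 'a) gcomplex \<Rightarrow> ('r, 'b) gcomplex \<Rightarrow> bool" where
  "chain_isomorphic A C D \<longleftrightarrow>
     (\<exists>f. chain_map A C D f \<and> (\<forall>n. bij_betw (f n) (carrier (Ob C n)) (carrier (Ob D n))))"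

definition homotopic_to_id ::
  "('r, 'z) graded_ring_scheme \<Rightarrow> ('r, 'a) gcomplex \<Rightarrow> (int \<Rightarrow> 'a \<Rightarrow> 'a) \<Rightarrow> bool" where
  "homotopic_to_id A C f \<longleftrightarrow>
     (\<exists>s. \<forall>n. s n \<in> graded_hom A (Ob C n) (Ob C (n - 1)) \<and>
       (\<forall>x\<in>carrier (Ob C n).
          f n x = x \<oplus>\<^bsub>Ob C n\<^esub> (Df C (n - 1) (s n x) \<oplus>\<^bsub>Ob C n\<^esub> s (n + 1) (Df C n x))))"

definition homotopy_equivalent ::
  "('r, 'z) graded_ring_scheme \<Rightarrow> ('r, 'a) gcomplex \<Rightarrow> ('r, 'b) gcomplex \<Rightarrow> bool" where
  "homotopy_equivalent A C D \<longleftrightarrow>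
     (\<exists>f g. chain_map A C D f \<and> chain_map A D C g \<and>
        homotopic_to_id A C (\<lambda>n x. g n (f n x)) \<and> homotopic_to_id A D (\<lambda>n y. f n (g n y)))"

definition cohomology :: "('r, 'a) gcomplex \<Rightarrow> int \<Rightarrow> ('r, 'a set) gmodule" where
  "cohomology C i =
    (let Z = {x \<in> carrier (Ob C i). Df C i x = \<zero>\<^bsub>Ob C (i + 1)\<^esub>} in
     quotient_gmodule
       ((Ob C i)\<lparr>carrier := Z, hpart := (\<lambda>d. hpart (Ob C i) d \<inter> Z)\<rparr>)
       (Df C (i - 1) ` carrier (Ob C (i - 1))))"

definition one_term :: "int \<Rightarrow> ('r, 'a) gmodule \<Rightarrow> ('r, 'a) gcomplex" where
  "one_term i M = \<lparr>Ob = (\<lambda>n. if n = i then M else zero_part M), Df = (\<lambda>n x. \<zero>\<^bsub>M\<^esub>)\<rparr>"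

definition direct_sum_complex :: "(int \<Rightarrow> ('r, 'a) gcomplex) \<Rightarrow> ('r, int \<Rightarrow> 'a) gcomplex" where
  "direct_sum_complex C =
    \<lparr>Ob = (\<lambda>n. direct_sum (\<lambda>i. Ob (C i) n)), Df = (\<lambda>n \<phi> i. Df (C i) n (\<phi> i))\<rparr>"


section \<open>Graded free complexes given by matrices, and linear parts\<close>

text \<open>The \<open>n\<close>-th term is the free module on \<open>Gens n\<close>, the generator \<open>b\<close> having degree
  \<open>gdeg n b\<close>; the differential is \<open>b \<mapsto> (\<Sum>c\<in>Gens (n + 1). Mat n c b \<odot> c)\<close>.\<close>

record ('r, 'b) free_data =
  Gens :: "int \<Rightarrow> 'b set"
  gdeg :: "int \<Rightarrow> 'b \<Rightarrow> int"
  Mat :: "int \<Rightarrow> 'b \<Rightarrow> 'b \<Rightarrow> 'r"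

definition free_gmodule ::
  "('r, 'z) graded_ring_scheme \<Rightarrow> 'b set \<Rightarrow> ('b \<Rightarrow> int) \<Rightarrow> ('r, 'b \<Rightarrow> 'r) gmodule" where
  "free_gmodule A B dg =
    (let C = {\<phi>. (\<forall>b. \<phi> b \<in> carrier A) \<and> (\<forall>b. b \<notin> B \<longrightarrow> \<phi> b = \<zero>\<^bsub>A\<^esub>) \<and>
                 finite {b. \<phi> b \<noteq> \<zero>\<^bsub>A\<^esub>}} in
     \<lparr>carrier = C,
      mult = undefined, one = undefined,
      zero = (\<lambda>b. \<zero>\<^bsub>A\<^esub>),
      add = (\<lambda>\<phi> \<psi> b. \<phi> b \<oplus>\<^bsub>A\<^esub> \<psi> b),
      smult = (\<lambda>a \<phi> b. a \<otimes>\<^bsub>A\<^esub> \<phi> b),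
      hpart = (\<lambda>d. {\<phi> \<in> C. \<forall>b\<in>B. \<phi> b \<in> hom_part A (d - dg b)})\<rparr>)"

definition free_complex_of ::
  "('r, 'z) graded_ring_scheme \<Rightarrow> ('r, 'b) free_data \<Rightarrow> ('r, 'b \<Rightarrow> 'r) gcomplex" where
  "free_complex_of A X =
    \<lparr>Ob = (\<lambda>n. free_gmodule A (Gens X n) (gdeg X n)),
     Df = (\<lambda>n \<phi> c. if c \<in> Gens X (n + 1)
                    then \<Oplus>\<^bsub>A\<^esub>b\<in>{b. \<phi> b \<noteq> \<zero>\<^bsub>A\<^esub>}. \<phi> b \<otimes>\<^bsub>A\<^esub> Mat X n c b
                    else \<zero>\<^bsub>A\<^esub>)\<rparr>"

definition graded_free_data :: "('r, 'z) graded_ring_scheme \<Rightarrow> ('r, 'b) free_data \<Rightarrow> bool" where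
  "graded_free_data A X \<longleftrightarrow>
     (\<forall>n. \<forall>b\<in>Gens X n.
        (\<forall>c\<in>Gens X (n + 1). Mat X n c b \<in> hom_part A (gdeg X n b - gdeg X (n + 1) c)) \<and>
        finite {c \<in> Gens X (n + 1). Mat X n c b \<noteq> \<zero>\<^bsub>A\<^esub>}) \<and>
     graded_complex A (free_complex_of A X)"

definition minimal_free_data :: "('r, 'z) graded_ring_scheme \<Rightarrow> ('r, 'b) free_data \<Rightarrow> bool" where
  "minimal_free_data A X \<longleftrightarrow> graded_free_data A X \<and>
     (\<forall>n. \<forall>b\<in>Gens X n. \<forall>c\<in>Gens X (n + 1). Mat X n c b \<in> hom_max_ideal A)"

definition linear_part ::
  "('r, 'z) graded_ring_scheme \<Rightarrow> ('r, 'b) free_data \<Rightarrow> ('r, 'b) free_data" where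
  "linear_part A X = X\<lparr>Mat := (\<lambda>n c b. erase_above_linear A (Mat X n c b))\<rparr>"

definition minimal_model ::
  "('r, 'z) graded_ring_scheme \<Rightarrow> ('r, 'a) gcomplex \<Rightarrow> ('r, 'b) free_data \<Rightarrow> bool" where
  "minimal_model A F X \<longleftrightarrow>
     minimal_free_data A X \<and> homotopy_equivalent A (free_complex_of A X) F"


section \<open>The symmetric and the exterior algebra\<close>

text \<open>\<open>V = K\<^sup>v\<close> with standard basis \<open>e\<^sub>i\<close> and dual basis \<open>x\<^sub>i\<close> (\<open>i < v\<close>).  \<open>Sym(W)\<close> is the polynomial ring
  in the \<open>x\<^sub>i\<close>, monomials being exponent vectors.\<close>

type_synonym 'k sym = "(nat \<Rightarrow>\<^sub>0 nat) \<Rightarrow>\<^sub>0 'k"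

definition mono_deg :: "(nat \<Rightarrow>\<^sub>0 nat) \<Rightarrow> int" where
  "mono_deg m = (\<Sum>i\<in>Poly_Mapping.keys m. int (Poly_Mapping.lookup m i))"

definition Sym :: "nat \<Rightarrow> ('k::field) sym graded_ring" where
  "Sym v = \<lparr>carrier = {p. \<forall>m\<in>Poly_Mapping.keys p. Poly_Mapping.keys m \<subseteq> {..<v}},
     mult = (*), one = 1, zero = 0, add = (+),
     gcomp = (\<lambda>d p. \<Sum>m\<in>{m \<in> Poly_Mapping.keys p. mono_deg m = d}.
                      Poly_Mapping.single m (Poly_Mapping.lookup p m))\<rparr>"

definition sym_const :: "'k::field \<Rightarrow> 'k sym" where
  "sym_const c = Poly_Mapping.single 0 c"

definition sym_var :: "nat \<Rightarrow> ('k::field) sym" where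
  "sym_var i = Poly_Mapping.single (Poly_Mapping.single i 1) 1"

text \<open>\<open>f :: 'k ext\<close> stands for the sum of all \<open>f I \<cdot> e\<^sub>I\<close>, where \<open>e\<^sub>I\<close> is the product of
  the \<open>e\<^sub>i\<close>, \<open>i \<in> I\<close>, in increasing order.  For disjoint \<open>I\<close>, \<open>J\<close> one has
  \<open>e\<^sub>I \<cdot> e\<^sub>J = ext_sign I J \<cdot> e\<^sub>I\<^sub>\<union>\<^sub>J\<close>.\<close>

type_synonym 'k ext = "nat set \<Rightarrow> 'k"

definition ext_sign :: "nat set \<Rightarrow> nat set \<Rightarrow> 'k::field" where
  "ext_sign I J = (- 1) ^ card {(i, j). i \<in> I \<and> j \<in> J \<and> j < i}"

definition Ext :: "nat \<Rightarrow> ('k::field) ext graded_ring" where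
  "Ext v = \<lparr>carrier = {f. \<forall>I. \<not> I \<subseteq> {..<v} \<longrightarrow> f I = 0},
     mult = (\<lambda>f g J. \<Sum>I\<in>Pow J. ext_sign I (J - I) * f I * g (J - I)),
     one = (\<lambda>I. if I = {} then 1 else 0),
     zero = (\<lambda>I. 0),
     add = (\<lambda>f g I. f I + g I),
     gcomp = (\<lambda>d f I. if - int (card I) = d then f I else 0)\<rparr>"

definition ext_const :: "'k::field \<Rightarrow> 'k ext" where
  "ext_const c = (\<lambda>I. if I = {} then c else 0)"

definition ext_gen :: "nat \<Rightarrow> ('k::field) ext" where
  "ext_gen i = (\<lambda>I. if I = {i} then 1 else 0)"


section \<open>The functor R\<close>

definition alt_sign :: "('r, 'a) gmodule \<Rightarrow> int \<Rightarrow> 'a \<Rightarrow> 'a" where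
  "alt_sign M i x = (if even i then x else \<ominus>\<^bsub>M\<^esub> x)"

text \<open>\<open>Hom\<^sub>K(E, M\<^sub>j)\<close> for a graded \<open>S\<close>-module \<open>M\<close>, as a graded left \<open>E\<close>-module; \<open>M\<^sub>j\<close> sits in degree
  \<open>j\<close>, so maps of degree \<open>t\<close> vanish on \<open>E\<^sub>s\<close> for \<open>s + t \<noteq> j\<close>.\<close>

definition HomE ::
  "nat \<Rightarrow> (('k::field) sym, 'a) gmodule \<Rightarrow> int \<Rightarrow> ('k ext, 'k ext \<Rightarrow> 'a) gmodule" where
  "HomE v M j =
    (let E = Ext v;
         C = {\<alpha> \<in> carrier E \<rightarrow>\<^sub>E hpart M j.
               (\<forall>e\<in>carrier E. \<forall>e'\<in>carrier E. \<alpha> (e \<oplus>\<^bsub>E\<^esub> e') = \<alpha> e \<oplus>\<^bsub>M\<^esub> \<alpha> e') \<and>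
               (\<forall>c. \<forall>e\<in>carrier E. \<alpha> (ext_const c \<otimes>\<^bsub>E\<^esub> e) = sym_const c \<odot>\<^bsub>M\<^esub> \<alpha> e)} in
     \<lparr>carrier = C,
      mult = undefined, one = undefined,
      zero = (\<lambda>e\<in>carrier E. \<zero>\<^bsub>M\<^esub>),
      add = (\<lambda>\<alpha> \<beta>. \<lambda>e\<in>carrier E. \<alpha> e \<oplus>\<^bsub>M\<^esub> \<beta> e),
      smult = (\<lambda>f \<alpha>. \<lambda>e\<in>carrier E. \<alpha> (e \<otimes>\<^bsub>E\<^esub> f)),
      hpart = (\<lambda>t. {\<alpha> \<in> C. \<forall>s. s + t \<noteq> j \<longrightarrow> (\<forall>e\<in>hom_part E s. \<alpha> e = \<zero>\<^bsub>M\<^esub>)})\<rparr>)"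

definition R_diff ::
  "nat \<Rightarrow> (('k::field) sym, 'a) gmodule \<Rightarrow> ('k ext \<Rightarrow> 'a) \<Rightarrow> ('k ext \<Rightarrow> 'a)" where
  "R_diff v M \<alpha> =
     (\<lambda>e\<in>carrier (Ext v). \<Oplus>\<^bsub>M\<^esub>i\<in>{..<v}. sym_var i \<odot>\<^bsub>M\<^esub> \<alpha> (ext_gen i \<otimes>\<^bsub>Ext v\<^esub> e))"

text \<open>An element of the \<open>n\<close>-th term is a family \<open>\<phi>\<close> with \<open>\<phi> i \<in> Hom\<^sub>K(E, (F\<^sup>i)\<^sub>n\<^sub>-\<^sub>i)\<close>.  Sign
  convention of the total complex: on the \<open>i\<close>-th summand the differential is
  \<open>d\<^sub>F + (-1)\<^sup>i d\<^sub>R\<close>.\<close>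

definition bgg_R ::
  "nat \<Rightarrow> (('k::field) sym, 'a) gcomplex \<Rightarrow> ('k ext, int \<Rightarrow> 'k ext \<Rightarrow> 'a) gcomplex" where
  "bgg_R v F =
    \<lparr>Ob = (\<lambda>n. direct_sum (\<lambda>i. HomE v (Ob F i) (n - i))),
     Df = (\<lambda>n \<phi> i. let H = HomE v (Ob F i) (n + 1 - i) in
             (\<lambda>e\<in>carrier (Ext v). Df F (i - 1) (\<phi> (i - 1) e))
             \<oplus>\<^bsub>H\<^esub> alt_sign H i (R_diff v (Ob F i) (\<phi> i)))\<rparr>"


section \<open>The functor L\<close>

text \<open>\<open>S \<otimes>\<^sub>K P\<^sub>j\<close> for a graded \<open>E\<close>-module \<open>P\<close>, as the module of polynomials with coefficients in \<open>P\<^sub>j\<close>: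
  \<open>q m\<close> is the coefficient of the monomial \<open>m\<close>.  \<open>P\<^sub>j\<close> sits in degree \<open>j\<close>.\<close>

definition pure_tensor ::
  "(('k::field) ext, 'a) gmodule \<Rightarrow> 'k sym \<Rightarrow> 'a \<Rightarrow> (nat \<Rightarrow>\<^sub>0 nat) \<Rightarrow> 'a" where
  "pure_tensor P s p = (\<lambda>m. ext_const (Poly_Mapping.lookup s m) \<odot>\<^bsub>P\<^esub> p)"

definition SymTensor ::
  "nat \<Rightarrow> (('k::field) ext, 'a) gmodule \<Rightarrow> int \<Rightarrow> ('k sym, (nat \<Rightarrow>\<^sub>0 nat) \<Rightarrow> 'a) gmodule" where
  "SymTensor v P j =
    (let C = {q. (\<forall>m. q m \<in> hpart P j) \<and> finite {m. q m \<noteq> \<zero>\<^bsub>P\<^esub>} \<and>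
                 (\<forall>m. \<not> Poly_Mapping.keys m \<subseteq> {..<v} \<longrightarrow> q m = \<zero>\<^bsub>P\<^esub>)} in
     \<lparr>carrier = C,
      mult = undefined, one = undefined,
      zero = (\<lambda>m. \<zero>\<^bsub>P\<^esub>),
      add = (\<lambda>q r m. q m \<oplus>\<^bsub>P\<^esub> r m),
      smult = (\<lambda>s q m. \<Oplus>\<^bsub>P\<^esub>a\<in>{a \<in> Poly_Mapping.keys s. \<exists>b. m = a + b}.
                         ext_const (Poly_Mapping.lookup s a) \<odot>\<^bsub>P\<^esub> q (m - a)),
      hpart = (\<lambda>t. {q \<in> C. \<forall>m. mono_deg m + j \<noteq> t \<longrightarrow> q m = \<zero>\<^bsub>P\<^esub>})\<rparr>)"

text \<open>The map \<open>s \<otimes> p \<mapsto> \<Sum>\<^sub>i x\<^sub>i s \<otimes> e\<^sub>i p\<close>, read off on coefficients of monomials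
  (see \<open>L_diff_pure_tensor\<close> below).\<close>

definition L_diff ::
  "nat \<Rightarrow> (('k::field) ext, 'a) gmodule \<Rightarrow> ((nat \<Rightarrow>\<^sub>0 nat) \<Rightarrow> 'a) \<Rightarrow> ((nat \<Rightarrow>\<^sub>0 nat) \<Rightarrow> 'a)" where
  "L_diff v P q =
     (\<lambda>m. \<Oplus>\<^bsub>P\<^esub>i\<in>{i. i < v \<and> 0 < Poly_Mapping.lookup m i}.
            ext_gen i \<odot>\<^bsub>P\<^esub> q (m - Poly_Mapping.single i 1))"

text \<open>An element of the \<open>n\<close>-th term is a family \<open>\<phi>\<close> with \<open>\<phi> i \<in> S \<otimes>\<^sub>K (G\<^sup>i)\<^sub>i\<^sub>-\<^sub>n\<close>; signs as
  for \<open>bgg_R\<close>.\<close>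

definition bgg_L ::
  "nat \<Rightarrow> (('k::field) ext, 'a) gcomplex \<Rightarrow> ('k sym, int \<Rightarrow> (nat \<Rightarrow>\<^sub>0 nat) \<Rightarrow> 'a) gcomplex" where
  "bgg_L v G =
    \<lparr>Ob = (\<lambda>n. direct_sum (\<lambda>i. SymTensor v (Ob G i) (i - n))),
     Df = (\<lambda>n \<phi> i. let T = SymTensor v (Ob G i) (i - (n + 1)) in
             (\<lambda>m. Df G (i - 1) (\<phi> (i - 1) m))
             \<oplus>\<^bsub>T\<^esub> alt_sign T i (L_diff v (Ob G i) (\<phi> i)))\<rparr>"


section \<open>Consistency of the concrete models\<close>

lemma ext_sign_empty [simp]: "ext_sign {} J = 1" "ext_sign I {} = 1"
  by (simp_all add: ext_sign_def)

lemma ext_sign_Un_left: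
  assumes "finite A" "finite B" "finite C" "A \<inter> B = {}"
  shows "ext_sign (A \<union> B) C = ext_sign A C * ext_sign B C"
proof -
  have fin: "finite {(i, j). i \<in> X \<and> j \<in> C \<and> j < i}" if "finite X" for X :: "nat set"
    by (rule finite_subset[of _ "X \<times> C"]) (use that assms in auto)
  have "{(i, j). i \<in> A \<union> B \<and> j \<in> C \<and> j < i} =
      {(i, j). i \<in> A \<and> j \<in> C \<and> j < i} \<union> {(i, j). i \<in> B \<and> j \<in> C \<and> j < i}"
    by auto
  moreover have "{(i, j). i \<in> A \<and> j \<in> C \<and> j < i} \<inter> {(i, j). i \<in> B \<and> j \<in> C \<and> j < i} = {}"
    using assms(4) by auto
  ultimately show ?thesis
    unfolding ext_sign_def using fin[OF assms(1)] fin[OF assms(2)]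
    by (simp add: card_Un_disjoint power_add)
qed

lemma ext_sign_Un_right:
  assumes "finite A" "finite B" "finite C" "B \<inter> C = {}"
  shows "ext_sign A (B \<union> C) = ext_sign A B * ext_sign A C"
proof -
  have fin: "finite {(i, j). i \<in> A \<and> j \<in> X \<and> j < i}" if "finite X" for X :: "nat set"
    by (rule finite_subset[of _ "A \<times> X"]) (use that assms in auto)
  have "{(i, j). i \<in> A \<and> j \<in> B \<union> C \<and> j < i} =
      {(i, j). i \<in> A \<and> j \<in> B \<and> j < i} \<union> {(i, j). i \<in> A \<and> j \<in> C \<and> j < i}"
    by auto
  moreover have "{(i, j). i \<in> A \<and> j \<in> B \<and> j < i} \<inter> {(i, j). i \<in> A \<and> j \<in> C \<and> j < i} = {}"
    using assms(4) by auto
  ultimately show ?thesis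
    unfolding ext_sign_def using fin[OF assms(2)] fin[OF assms(3)]
    by (simp add: card_Un_disjoint power_add)
qed

lemma ext_mult_assoc:
  fixes f g h :: "('k::field) ext"
  shows "mult (Ext v) (mult (Ext v) f g) h = mult (Ext v) f (mult (Ext v) g h)"
proof
  fix J :: "nat set"
  show "mult (Ext v) (mult (Ext v) f g) h J = mult (Ext v) f (mult (Ext v) g h) J"
  proof (cases "finite J")
    case False
    then have "infinite (Pow J)" by simp
    then show ?thesis by (simp add: Ext_def)
  next
    case True
    have "mult (Ext v) (mult (Ext v) f g) h J =
      (\<Sum>I\<in>Pow J. \<Sum>A\<in>Pow I. ext_sign I (J - I) * ext_sign A (I - A) * f A * g (I - A) * h (J - I))"
      by (simp add: Ext_def sum_distrib_left sum_distrib_right mult_ac)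
    also have "\<dots> = (\<Sum>(I, A)\<in>Sigma (Pow J) Pow. ext_sign I (J - I) * ext_sign A (I - A) * f A * g (I - A) * h (J - I))"
      by (rule sum.Sigma) (use True finite_subset in auto)
    also have "\<dots> = (\<Sum>(A, B)\<in>Sigma (Pow J) (\<lambda>A. Pow (J - A)).
        ext_sign A (J - A) * ext_sign B (J - A - B) * f A * g B * h (J - A - B))"
    proof (rule sum.reindex_bij_witness[where i = "\<lambda>(A, B). (A \<union> B, A)" and j = "\<lambda>(I, A). (A, I - A)"], goal_cases)
      case (5 p)
      obtain I A where p: "p = (I, A)" "I \<subseteq> J" "A \<subseteq> I" using 5 by auto
      let ?B = "I - A" and ?C = "J - I"
      have fin: "finite A" "finite ?B" "finite ?C" using p True by (auto intro: finite_subset)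
      have eq: "I = A \<union> ?B" "J - A = ?B \<union> ?C" "J - A - ?B = ?C" using p by auto
      have s1: "ext_sign I ?C = (ext_sign A ?C * ext_sign ?B ?C :: 'k)"
        by (subst eq(1), rule ext_sign_Un_left) (use fin in auto)
      have s2: "ext_sign A (J - A) = (ext_sign A ?B * ext_sign A ?C :: 'k)"
        by (subst eq(2), rule ext_sign_Un_right) (use fin in auto)
      show ?case using s1 s2 by (simp add: p(1) eq(3) mult_ac)
    qed auto
    also have "\<dots> = (\<Sum>A\<in>Pow J. \<Sum>B\<in>Pow (J - A).
        ext_sign A (J - A) * ext_sign B (J - A - B) * f A * g B * h (J - A - B))"
      by (rule sum.Sigma[symmetric]) (use True in auto)
    also have "\<dots> = mult (Ext v) f (mult (Ext v) g h) J"
      by (simp add: Ext_def sum_distrib_left mult_ac)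
    finally show ?thesis .
  qed
qed

lemma ext_const_mult: "e \<in> carrier (Ext v) \<Longrightarrow> mult (Ext v) (ext_const c) e = (\<lambda>J. c * e J)"
proof
  fix J assume e: "e \<in> carrier (Ext v)"
  show "mult (Ext v) (ext_const c) e J = c * e J"
  proof (cases "finite J")
    case False
    then have "\<not> J \<subseteq> {..<v}" "infinite (Pow J)" by (auto dest: finite_subset)
    then show ?thesis using e by (simp add: Ext_def)
  next
    case True
    have "mult (Ext v) (ext_const c) e J = (\<Sum>I\<in>Pow J. if I = {} then c * e J else 0)"
      by (auto simp: Ext_def ext_const_def intro!: sum.cong)
    then show ?thesis using True by (simp add: sum.delta)
  qed
qed

lemma ext_mult_const: "e \<in> carrier (Ext v) \<Longrightarrow> mult (Ext v) e (ext_const c) = (\<lambda>J. c * e J)"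
proof
  fix J assume e: "e \<in> carrier (Ext v)"
  show "mult (Ext v) e (ext_const c) J = c * e J"
  proof (cases "finite J")
    case False
    then have "\<not> J \<subseteq> {..<v}" "infinite (Pow J)" by (auto dest: finite_subset)
    then show ?thesis using e by (simp add: Ext_def)
  next
    case True
    have "mult (Ext v) e (ext_const c) J = (\<Sum>I\<in>Pow J. if I = J then c * e J else 0)"
      by (auto simp: Ext_def ext_const_def intro!: sum.cong)
    then show ?thesis using True by (simp add: sum.delta)
  qed
qed

lemma ext_one_const: "one (Ext v) = ext_const 1"
  by (simp add: Ext_def ext_const_def)

lemma ring_Ext: "ring (Ext v :: ('k::field) ext graded_ring)"
proof (rule ringI)
  show "abelian_group (Ext v :: 'k ext graded_ring)"
  proof (rule abelian_groupI)
    fix x :: "'k ext" assume "x \<in> carrier (Ext v)"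
    then show "\<exists>y\<in>carrier (Ext v). y \<oplus>\<^bsub>Ext v\<^esub> x = \<zero>\<^bsub>Ext v\<^esub>"
      by (intro bexI[of _ "\<lambda>I. - x I"]) (auto simp: Ext_def)
  qed (auto simp: Ext_def fun_eq_iff)
  show "Group.monoid (Ext v :: 'k ext graded_ring)"
  proof (rule monoidI)
    fix x y :: "'k ext" assume xy: "x \<in> carrier (Ext v)" "y \<in> carrier (Ext v)"
    have "x \<otimes>\<^bsub>Ext v\<^esub> y \<in> carrier (Ext v) \<longleftrightarrow> (\<forall>J. \<not> J \<subseteq> {..<v} \<longrightarrow> (\<Sum>I\<in>Pow J. ext_sign I (J - I) * x I * y (J - I)) = 0)"
      by (simp add: Ext_def)
    also have "\<dots>"
    proof (intro allI impI sum.neutral ballI)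
      fix I J assume "\<not> J \<subseteq> {..<v}" "I \<in> Pow J"
      then have "\<not> I \<subseteq> {..<v} \<or> \<not> J - I \<subseteq> {..<v}" by blast
      moreover have "\<forall>I. \<not> I \<subseteq> {..<v} \<longrightarrow> x I = 0" "\<forall>I. \<not> I \<subseteq> {..<v} \<longrightarrow> y I = 0"
        using xy by (simp_all add: Ext_def)
      ultimately have "x I = 0 \<or> y (J - I) = 0" by metis
      then show "ext_sign I (J - I) * x I * y (J - I) = 0" by auto
    qed
    finally show "x \<otimes>\<^bsub>Ext v\<^esub> y \<in> carrier (Ext v)" .
  qed (auto simp: ext_mult_assoc ext_one_const ext_const_mult ext_mult_const, auto simp: Ext_def ext_const_def)
qed (auto simp: Ext_def fun_eq_iff algebra_simps sum.distrib)

lemma ext_gen_square: "ext_gen i \<otimes>\<^bsub>Ext v\<^esub> ext_gen i = \<zero>\<^bsub>Ext v\<^esub>"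
proof
  fix J
  have "(ext_gen i \<otimes>\<^bsub>Ext v\<^esub> ext_gen i) J =
      (\<Sum>I\<in>Pow J. ext_sign I (J - I) * ext_gen i I * ext_gen i (J - I))"
    by (simp add: Ext_def)
  also have "\<dots> = 0"
  proof (rule sum.neutral, rule ballI)
    fix I
    have "I \<noteq> {i} \<or> J - I \<noteq> {i}" by blast
    then show "ext_sign I (J - I) * ext_gen i I * ext_gen i (J - I) = 0"
      by (simp add: ext_gen_def)
  qed
  finally show "(ext_gen i \<otimes>\<^bsub>Ext v\<^esub> ext_gen i) J = \<zero>\<^bsub>Ext v\<^esub> J" by (simp add: Ext_def)
qed

lemma ext_gen_mult:
  assumes "i \<noteq> j"
  shows "ext_gen i \<otimes>\<^bsub>Ext v\<^esub> ext_gen j =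
    (\<lambda>J. if J = {i, j} then (if i < j then 1 else - 1) else (0::'k::field))"
proof
  fix J :: "nat set"
  have sign: "ext_sign {i} {j} = (if i < j then 1 else - 1 :: 'k)"
  proof -
    have "{(a, b). a \<in> {i} \<and> b \<in> {j} \<and> b < a} = (if j < i then {(i, j)} else {})" by auto
    then show ?thesis using assms by (simp add: ext_sign_def)
  qed
  have "(ext_gen i \<otimes>\<^bsub>Ext v\<^esub> ext_gen j) J =
      (\<Sum>I\<in>Pow J. ext_sign I (J - I) * ext_gen i I * ext_gen j (J - I) :: 'k)"
    by (simp add: Ext_def)
  also have "\<dots> = (\<Sum>I\<in>Pow J. if I = {i} then (if J - {i} = {j} then ext_sign {i} {j} else 0) else 0)"
    by (rule sum.cong) (simp_all add: ext_gen_def)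
  also have "\<dots> = (if J = {i, j} then ext_sign {i} {j} else 0)"
  proof (cases "J = {i, j}")
    case True
    moreover have "{i, j} - {i} = {j}" using assms by blast
    ultimately show ?thesis by (simp add: sum.delta)
  next
    case False
    have "(\<Sum>I\<in>Pow J. if I = {i} then if J - {i} = {j} then ext_sign {i} {j} else 0 else 0) = (0::'k)"
    proof (rule sum.neutral, rule ballI)
      fix I assume "I \<in> Pow J"
      then have "\<not> (I = {i} \<and> J - {i} = {j})" using False by blast
      then show "(if I = {i} then if J - {i} = {j} then ext_sign {i} {j} else 0 else 0) = (0::'k)"
        by presburger
    qed
    then show ?thesis using False by presburger
  qed
  finally show "(ext_gen i \<otimes>\<^bsub>Ext v\<^esub> ext_gen j) J =
      (if J = {i, j} then (if i < j then 1 else - 1) else (0::'k))"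
    by (simp only: sign)
qed

lemma sym_times_closed:
  fixes x y :: "('k::field) sym"
  assumes x: "\<forall>m\<in>Poly_Mapping.keys x. Poly_Mapping.keys m \<subseteq> {..<v}"
    and y: "\<forall>m\<in>Poly_Mapping.keys y. Poly_Mapping.keys m \<subseteq> {..<v}"
  shows "\<forall>m\<in>Poly_Mapping.keys (x * y). Poly_Mapping.keys m \<subseteq> {..<v}"
proof
  fix m assume "m \<in> Poly_Mapping.keys (x * y)"
  then obtain a b where "m = a + b" "a \<in> Poly_Mapping.keys x" "b \<in> Poly_Mapping.keys y"
    using keys_mult[of x y] by blast
  then show "Poly_Mapping.keys m \<subseteq> {..<v}"
    using x y Poly_Mapping.keys_add[of a b] by blast
qed

lemma cring_Sym: "cring (Sym v :: ('k::field) sym graded_ring)"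
proof (rule cringI)
  show "abelian_group (Sym v :: 'k sym graded_ring)"
  proof (rule abelian_groupI)
    fix x y :: "'k sym" assume "x \<in> carrier (Sym v)" "y \<in> carrier (Sym v)"
    then show "x \<oplus>\<^bsub>Sym v\<^esub> y \<in> carrier (Sym v)"
      using Poly_Mapping.keys_add[of x y] unfolding Sym_def by simp blast
  next
    fix x :: "'k sym" assume "x \<in> carrier (Sym v)"
    then show "\<exists>y\<in>carrier (Sym v). y \<oplus>\<^bsub>Sym v\<^esub> x = \<zero>\<^bsub>Sym v\<^esub>"
      by (intro bexI[of _ "- x"]) (simp_all add: Sym_def in_keys_iff)
  qed (simp_all add: Sym_def add_ac)
  show "Group.comm_monoid (Sym v :: 'k sym graded_ring)"
    by (rule comm_monoidI) (use sym_times_closed in \<open>simp_all add: Sym_def mult_ac\<close>)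
qed (simp add: Sym_def distrib_right)

lemma lookup_sym_var_mult:
  "Poly_Mapping.lookup (sym_var i * s) m =
    (if 0 < Poly_Mapping.lookup m i then Poly_Mapping.lookup s (m - Poly_Mapping.single i 1) else 0)"
proof -
  let ?x = "Poly_Mapping.single i (1::nat)"
  have eq: "m = ?x + q \<longleftrightarrow> 0 < Poly_Mapping.lookup m i \<and> q = m - ?x" for q
  proof
    assume "0 < Poly_Mapping.lookup m i \<and> q = m - ?x"
    then show "m = ?x + q"
      by (intro poly_mapping_eqI) (auto simp: lookup_add lookup_minus lookup_single when_def)
  qed (auto simp: lookup_add lookup_single)
  have "Poly_Mapping.lookup (sym_var i * s) m =
      (\<Sum>l. (\<Sum>q. Poly_Mapping.lookup s q when m = l + q) when l = ?x)"
    unfolding lookup_mult sym_var_def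
    by (rule Sum_any.cong) (simp add: lookup_single when_def)
  also have "\<dots> = (\<Sum>q. Poly_Mapping.lookup s q when m = ?x + q)"
    by simp
  also have "\<dots> = (\<Sum>q. (Poly_Mapping.lookup s q when 0 < Poly_Mapping.lookup m i) when q = m - ?x)"
    by (rule Sum_any.cong, subst eq) (simp add: when_def)
  also have "\<dots> = (Poly_Mapping.lookup s (m - ?x) when 0 < Poly_Mapping.lookup m i)"
    by simp
  finally show ?thesis by (simp add: when_def)
qed

lemma L_diff_pure_tensor:
  assumes "left_module (Ext v) P" "p \<in> carrier P"
  shows "L_diff v P (pure_tensor P s p) =
    (\<lambda>m. \<Oplus>\<^bsub>P\<^esub>i\<in>{..<v}. pure_tensor P (sym_var i * s) (ext_gen i \<odot>\<^bsub>P\<^esub> p) m)"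
proof
  fix m :: "nat \<Rightarrow>\<^sub>0 nat"
  interpret left_module "Ext v" P by fact
  have cc: "ext_const c \<in> carrier (Ext v)" for c by (auto simp: Ext_def ext_const_def)
  have gc: "ext_gen i \<in> carrier (Ext v)" if "i < v" for i using that by (auto simp: Ext_def ext_gen_def)
  have z: "ext_const 0 \<odot>\<^bsub>P\<^esub> q = \<zero>\<^bsub>P\<^esub>" if "q \<in> carrier P" for q
  proof -
    have "ext_const 0 \<odot>\<^bsub>P\<^esub> q \<oplus>\<^bsub>P\<^esub> ext_const 0 \<odot>\<^bsub>P\<^esub> q = (ext_const 0 \<oplus>\<^bsub>Ext v\<^esub> ext_const 0) \<odot>\<^bsub>P\<^esub> q"
      using smult_l_distr[OF cc cc that] by simp
    also have "ext_const 0 \<oplus>\<^bsub>Ext v\<^esub> ext_const 0 = ext_const 0" by (auto simp: Ext_def ext_const_def)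
    finally show ?thesis using smult_closed[OF cc that]
      by (metis M.add.l_cancel_one)
  qed
  have c: "ext_gen i \<odot>\<^bsub>P\<^esub> (ext_const c \<odot>\<^bsub>P\<^esub> p) = ext_const c \<odot>\<^bsub>P\<^esub> (ext_gen i \<odot>\<^bsub>P\<^esub> p)" if "i < v" for i c
    using smult_assoc[OF gc[OF that] cc assms(2), of c] smult_assoc[OF cc gc[OF that] assms(2), of c]
    by (simp add: ext_const_mult ext_mult_const gc that)
  let ?I = "{i. i < v \<and> 0 < Poly_Mapping.lookup m i}"
  have "L_diff v P (pure_tensor P s p) m =
    (\<Oplus>\<^bsub>P\<^esub>i\<in>?I. pure_tensor P (sym_var i * s) (ext_gen i \<odot>\<^bsub>P\<^esub> p) m)"
    unfolding L_diff_def pure_tensor_def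
    by (rule M.finsum_cong') (auto simp: lookup_sym_var_mult c intro!: smult_closed cc gc assms)
  also have "\<dots> = (\<Oplus>\<^bsub>P\<^esub>i\<in>{..<v}. pure_tensor P (sym_var i * s) (ext_gen i \<odot>\<^bsub>P\<^esub> p) m)"
    by (rule M.add.finprod_mono_neutral_cong_left)
      (auto simp: pure_tensor_def lookup_sym_var_mult intro!: z smult_closed cc gc assms)
  finally show "L_diff v P (pure_tensor P s p) m = \<dots>" .
qed

end

theory Submission
  imports Defs "HOL-Library.Function_Algebras"
begin

text \<open>Both functors produce complexes whose differential is a sum of two anticommuting parts: one induced
  by the differential of the given complex, one given by multiplication with the variables. The idea
  is to choose \<open>K\<close>-bases of the graded pieces of the given complex which are adapted to its
  differential: a complement of the cocycles, harmonic elements representing a basis of the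
  cohomology, and the images of the complement, which form a basis of the coboundaries. In such a
  basis the differential is the constant matrix \<open>dB\<close>, and the terms of the total complex are free
  over the exterior algebra (as \<open>E\<close> is up to a twist its own \<open>K\<close>-dual) or over the symmetric
  algebra. The total differential becomes \<open>dB\<close> plus \<open>del Y\<close>, where \<open>Y k\<close> is the matrix by which the
  \<open>k\<close>-th variable of the dual algebra acts on the given complex; so \<open>del Y\<close> is linear in the
  variables.
  
  A minimal model exists by homological perturbation. The matrix \<open>dB\<close> has an obvious contracting
  homotopy \<open>hB\<close> onto the harmonic elements. Because \<open>del Y\<close> raises the degree of monomials,
  \<open>hp = hB - hB del hB + hB del hB del hB - \<dots>\<close> is well defined, and it contracts the total complex
  onto a complex on the harmonic generators (\<open>perturbation\<close>, \<open>homotopy_equivalent_harm_complex\<close>). The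
  differential transferred to it has no constant terms, so the complex is minimal
  (\<open>minimal_model_exists\<close>). Left-boundedness makes the series finite on every element, so that \<open>hp\<close>
  is a map of graded modules: \<open>hB\<close> lowers the cohomological degree of the given complex while \<open>del Y\<close>
  preserves it.
  
  The linear part of an arbitrary minimal complex \<open>X\<close> homotopy equivalent to the total complex is
  computed by comparing lowest coefficients (\<open>linear_part_minimal_model\<close>). Let \<open>f\<close> be the equivalence from \<open>X\<close>.
  Its constant coefficients, followed by the projection \<open>pB\<close> to the harmonic elements, identify the
  generators of \<open>X\<close> with the harmonic basis, because the differential of \<open>X\<close> vanishes modulo the
  maximal ideal. The coefficient of a variable in the equation saying that \<open>f\<close> is a chain map shows
  that under this identification the linear entries of the matrices of \<open>X\<close> are \<open>pB Y k\<close> restricted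
  to the harmonic elements. This is the action of the variable on cohomology, so the linear part is
  the coordinate form of the direct sum of the complexes attached to the cohomology modules.
  
  The symmetric and the exterior algebra enter the argument in the same way, as algebras with a basis
  of monomials (\<open>monomial_algebra\<close>). The locale \<open>kcomplex_y\<close> couples such an algebra with a complex of
  modules over the dual algebra; \<open>linear_strand_theorem\<close> is the common statement, to which \<open>R_coords\<close>
  and \<open>L_coords\<close> supply the coordinates of the two functors.\<close>

section \<open>Linear maps given on a basis\<close>

definition scal :: "'k::field \<Rightarrow> ('b \<Rightarrow>\<^sub>0 'k) \<Rightarrow> ('b \<Rightarrow>\<^sub>0 'k)" where
  "scal c u = Poly_Mapping.map ((*) c) u"

definition lin_ext :: "('b \<Rightarrow> ('c \<Rightarrow>\<^sub>0 'k)) \<Rightarrow> ('b \<Rightarrow>\<^sub>0 'k::field) \<Rightarrow> ('c \<Rightarrow>\<^sub>0 'k)" where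
  "lin_ext Y u = (\<Sum>b\<in>Poly_Mapping.keys u. scal (Poly_Mapping.lookup u b) (Y b))"

lemma lookup_scal [simp]: "Poly_Mapping.lookup (scal c u) b = c * Poly_Mapping.lookup u b"
  by (simp add: scal_def Poly_Mapping.map.rep_eq when_def)

lemma scal_simps [simp]:
  "scal 0 u = 0" "scal c 0 = 0" "scal 1 u = u" "scal c (scal d u) = scal (c * d) u"
  "scal c (- u) = - scal c u" "scal c (Poly_Mapping.single b d) = Poly_Mapping.single b (c * d)"
  by (rule poly_mapping_eqI; simp add: lookup_single when_def)+

lemma scal_distrib:
  "scal c (u + w) = scal c u + scal c w" "scal (c + d) u = scal c u + scal d u"
  "scal c (u - w) = scal c u - scal c w"
  by (rule poly_mapping_eqI; simp add: lookup_add lookup_minus algebra_simps)+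

lemma scal_sum: "scal c (sum f S) = (\<Sum>x\<in>S. scal c (f x))"
  by (rule poly_mapping_eqI) (simp add: lookup_sum sum_distrib_left)

lemma keys_scal: "Poly_Mapping.keys (scal c u) \<subseteq> Poly_Mapping.keys u"
  by (rule subsetI, simp add: in_keys_iff)

lemma keys_sum_subset: "(\<And>x. x \<in> S \<Longrightarrow> Poly_Mapping.keys (f x) \<subseteq> B) \<Longrightarrow> Poly_Mapping.keys (sum f S) \<subseteq> B"
  using Poly_Mapping.keys_sum[of f S] by blast

lemma keys_add_subset:
  "Poly_Mapping.keys u \<subseteq> B \<Longrightarrow> Poly_Mapping.keys w \<subseteq> B \<Longrightarrow> Poly_Mapping.keys (u + w) \<subseteq> B"
  using Poly_Mapping.keys_add[of u w] by blast

lemma keys_diff_subset: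
  fixes u w :: "'b \<Rightarrow>\<^sub>0 'k::field"
  shows "Poly_Mapping.keys u \<subseteq> B \<Longrightarrow> Poly_Mapping.keys w \<subseteq> B \<Longrightarrow> Poly_Mapping.keys (u - w) \<subseteq> B"
  using Poly_Mapping.keys_add[of u "- w"] by (simp add: subset_iff in_keys_iff lookup_add lookup_minus) blast

lemma lin_ext_superset:
  assumes "finite S" "Poly_Mapping.keys u \<subseteq> S"
  shows "lin_ext Y u = (\<Sum>b\<in>S. scal (Poly_Mapping.lookup u b) (Y b))"
  unfolding lin_ext_def using assms by (intro sum.mono_neutral_left) (simp_all add: in_keys_iff)

lemma lin_ext_add: "lin_ext Y (u + w) = lin_ext Y u + lin_ext Y w"
proof -
  let ?S = "Poly_Mapping.keys u \<union> Poly_Mapping.keys w"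
  have "lin_ext Y (u + w) = (\<Sum>b\<in>?S. scal (Poly_Mapping.lookup (u + w) b) (Y b))"
    by (rule lin_ext_superset) (simp_all add: Poly_Mapping.keys_add)
  also have "\<dots> = lin_ext Y u + lin_ext Y w"
    by (subst (1 2) lin_ext_superset[where S = ?S])
      (auto simp: lookup_add scal_distrib sum.distrib)
  finally show ?thesis .
qed

lemma lin_ext_scal: "lin_ext Y (scal c u) = scal c (lin_ext Y u)"
  by (subst lin_ext_superset[where S = "Poly_Mapping.keys u"])
    (auto simp: keys_scal lin_ext_def scal_sum)

lemma lin_ext_zero [simp]: "lin_ext Y 0 = 0"
  by (simp add: lin_ext_def)

lemma lin_ext_uminus: "lin_ext Y (- u) = - lin_ext Y u"
  using lin_ext_add[of Y u "- u"] by (simp add: add_eq_0_iff)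

lemma lin_ext_diff: "lin_ext Y (u - w) = lin_ext Y u - lin_ext Y w"
  using lin_ext_add[of Y u "- w"] by (simp add: lin_ext_uminus)

lemma lin_ext_sum: "lin_ext Y (sum f S) = (\<Sum>x\<in>S. lin_ext Y (f x))"
  by (induction S rule: infinite_finite_induct) (simp_all add: lin_ext_add)

lemma lin_ext_single [simp]: "lin_ext Y (Poly_Mapping.single b c) = scal c (Y b)"
  by (subst lin_ext_superset[where S = "{b}"]) auto

lemma lin_ext_comp: "lin_ext Y (lin_ext Z u) = lin_ext (\<lambda>b. lin_ext Y (Z b)) u"
  by (simp add: lin_ext_def[of Z u] lin_ext_sum lin_ext_scal lin_ext_def[of _ u])

lemma lin_ext_cong:
  "(\<And>b. b \<in> Poly_Mapping.keys u \<Longrightarrow> Y b = Z b) \<Longrightarrow> lin_ext Y u = lin_ext Z u"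
  by (simp add: lin_ext_def)

lemma lin_ext_zero_fun [simp]: "lin_ext (\<lambda>b. 0) u = 0"
  by (simp add: lin_ext_def)

lemma lin_ext_uminus_fun: "lin_ext (\<lambda>b. - Y b) u = - lin_ext Y u"
  by (simp add: lin_ext_def sum_negf)

lemma lin_ext_scal_fun: "lin_ext (\<lambda>b. scal c (Y b)) u = scal c (lin_ext Y u)"
  by (simp add: lin_ext_def scal_sum mult.commute)

lemma keys_lin_ext:
  "(\<And>b. b \<in> Poly_Mapping.keys u \<Longrightarrow> Poly_Mapping.keys (Y b) \<subseteq> B) \<Longrightarrow> Poly_Mapping.keys (lin_ext Y u) \<subseteq> B"
  unfolding lin_ext_def by (rule keys_sum_subset) (rule subset_trans[OF keys_scal])

lemma lin_ext_basis [simp]: "lin_ext (\<lambda>b. Poly_Mapping.single b 1) u = u"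
proof (rule poly_mapping_eqI)
  fix b
  have "Poly_Mapping.lookup (lin_ext (\<lambda>b. Poly_Mapping.single b 1) u) b
     = (\<Sum>c\<in>Poly_Mapping.keys u. if c = b then Poly_Mapping.lookup u b else 0)"
    by (auto simp: lin_ext_def lookup_sum lookup_single when_def intro!: sum.cong)
  then show "Poly_Mapping.lookup (lin_ext (\<lambda>b. Poly_Mapping.single b 1) u) b = Poly_Mapping.lookup u b"
    by (simp add: in_keys_iff)
qed

lemma lookup_sum_single:
  assumes "finite S"
  shows "Poly_Mapping.lookup (\<Sum>c\<in>S. Poly_Mapping.single c (f c)) b = (if b \<in> S then f b else (0::'k::field))"
proof -
  have "Poly_Mapping.lookup (\<Sum>c\<in>S. Poly_Mapping.single c (f c)) b = (\<Sum>c\<in>S. if c = b then f b else 0)"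
    by (auto simp: lookup_sum lookup_single when_def intro!: sum.cong)
  then show ?thesis using assms by simp
qed

lemma lookup_lin_ext:
  "Poly_Mapping.lookup (lin_ext Y u) c =
    (\<Sum>b\<in>Poly_Mapping.keys u. Poly_Mapping.lookup u b * Poly_Mapping.lookup (Y b) c)"
  by (simp add: lin_ext_def lookup_sum)

lemma linear_on_eq_lin_ext:
  fixes f :: "('b \<Rightarrow>\<^sub>0 'k::field) \<Rightarrow> ('c \<Rightarrow>\<^sub>0 'k)"
  assumes add: "\<And>u w. Poly_Mapping.keys u \<subseteq> B \<Longrightarrow> Poly_Mapping.keys w \<subseteq> B \<Longrightarrow> f (u + w) = f u + f w"
    and scal: "\<And>c u. Poly_Mapping.keys u \<subseteq> B \<Longrightarrow> f (scal c u) = scal c (f u)"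
    and u: "Poly_Mapping.keys u \<subseteq> B"
  shows "f u = lin_ext (\<lambda>b. f (Poly_Mapping.single b 1)) u"
proof -
  have z: "f 0 = 0" using add[of 0 0] by simp
  have *: "f (\<Sum>b\<in>S. scal (c b) (Poly_Mapping.single b 1)) = (\<Sum>b\<in>S. scal (c b) (f (Poly_Mapping.single b 1)))"
    if "finite S" "S \<subseteq> B" for S c
    using that
  proof (induction S rule: finite_induct)
    case (insert x S)
    have 1: "Poly_Mapping.keys (Poly_Mapping.single x (1::'k)) \<subseteq> B" using insert.prems by simp
    have 2: "Poly_Mapping.keys (scal (c x) (Poly_Mapping.single x 1)) \<subseteq> B"
      by (rule subset_trans[OF keys_scal 1])
    have 3: "Poly_Mapping.keys (\<Sum>b\<in>S. scal (c b) (Poly_Mapping.single b 1)) \<subseteq> B"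
      by (rule keys_sum_subset) (use insert.prems in \<open>auto split: if_splits\<close>)
    have "f (\<Sum>b\<in>insert x S. scal (c b) (Poly_Mapping.single b 1)) =
       f (scal (c x) (Poly_Mapping.single x 1) + (\<Sum>b\<in>S. scal (c b) (Poly_Mapping.single b 1)))"
      using insert.hyps by (simp del: scal_simps)
    also have "\<dots> = scal (c x) (f (Poly_Mapping.single x 1)) + (\<Sum>b\<in>S. scal (c b) (f (Poly_Mapping.single b 1)))"
      using insert.IH insert.prems by (simp add: add[OF 2 3] scal[OF 1] del: scal_simps)
    finally show ?case using insert.hyps by simp
  qed (simp add: z)
  have "f u = f (lin_ext (\<lambda>b. Poly_Mapping.single b 1) u)" by simp
  also have "\<dots> = lin_ext (\<lambda>b. f (Poly_Mapping.single b 1)) u"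
    unfolding lin_ext_def by (rule *) (use u in auto)
  finally show ?thesis .
qed

text \<open>Isomorphism with an explicit inverse chain map. Unlike a bijective chain map, such an isomorphism
  has an inverse which respects the grading.\<close>

definition iso_complex ::
  "('r, 'z) graded_ring_scheme \<Rightarrow> ('r, 'a) gcomplex \<Rightarrow> ('r, 'b) gcomplex \<Rightarrow> bool" where
  "iso_complex A C D \<longleftrightarrow> (\<exists>f g. chain_map A C D f \<and> chain_map A D C g \<and>
     (\<forall>n. \<forall>x\<in>carrier (Ob C n). g n (f n x) = x) \<and> (\<forall>n. \<forall>y\<in>carrier (Ob D n). f n (g n y) = y))"

text \<open>The closure properties under which homotopies can be transported along an isomorphism. They are
  also meaningful for a complex whose terms have not been shown to be modules.\<close>

definition op_closed :: "('r, 'z) graded_ring_scheme \<Rightarrow> ('r, 'a) gcomplex \<Rightarrow> bool" where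
  "op_closed A C \<longleftrightarrow> (\<forall>n.
     (\<forall>x\<in>carrier (Ob C n). \<forall>y\<in>carrier (Ob C n). x \<oplus>\<^bsub>Ob C n\<^esub> y \<in> carrier (Ob C n)) \<and>
     (\<forall>a\<in>carrier A. \<forall>x\<in>carrier (Ob C n). a \<odot>\<^bsub>Ob C n\<^esub> x \<in> carrier (Ob C n)) \<and>
     (\<forall>x\<in>carrier (Ob C n). Df C n x \<in> carrier (Ob C (n + 1))) \<and>
     (\<forall>d. hpart (Ob C n) d \<subseteq> carrier (Ob C n)))"

lemma graded_homD:
  assumes "f \<in> graded_hom A M N"
  shows "x \<in> carrier M \<Longrightarrow> f x \<in> carrier N"
    and "x \<in> carrier M \<Longrightarrow> y \<in> carrier M \<Longrightarrow> f (x \<oplus>\<^bsub>M\<^esub> y) = f x \<oplus>\<^bsub>N\<^esub> f y"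
    and "a \<in> carrier A \<Longrightarrow> x \<in> carrier M \<Longrightarrow> f (a \<odot>\<^bsub>M\<^esub> x) = a \<odot>\<^bsub>N\<^esub> f x"
    and "x \<in> hpart M d \<Longrightarrow> f x \<in> hpart N d"
  using assms unfolding graded_hom_def by (auto simp: image_subset_iff)

lemma graded_homI:
  assumes "\<And>x. x \<in> carrier M \<Longrightarrow> f x \<in> carrier N"
    and "\<And>x y. x \<in> carrier M \<Longrightarrow> y \<in> carrier M \<Longrightarrow> f (x \<oplus>\<^bsub>M\<^esub> y) = f x \<oplus>\<^bsub>N\<^esub> f y"
    and "\<And>a x. a \<in> carrier A \<Longrightarrow> x \<in> carrier M \<Longrightarrow> f (a \<odot>\<^bsub>M\<^esub> x) = a \<odot>\<^bsub>N\<^esub> f x"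
    and "\<And>x d. x \<in> hpart M d \<Longrightarrow> f x \<in> hpart N d"
  shows "f \<in> graded_hom A M N"
  using assms unfolding graded_hom_def by auto

lemma graded_hom_comp:
  "f \<in> graded_hom A M N \<Longrightarrow> g \<in> graded_hom A N L \<Longrightarrow> (\<lambda>x. g (f x)) \<in> graded_hom A M L"
  by (rule graded_homI) (simp_all add: graded_homD)

lemma chain_mapD:
  assumes "chain_map A C D f"
  shows "f n \<in> graded_hom A (Ob C n) (Ob D n)"
    and "x \<in> carrier (Ob C n) \<Longrightarrow> f (n + 1) (Df C n x) = Df D n (f n x)"
  using assms unfolding chain_map_def by auto

lemma chain_map_comp:
  "chain_map A C D f \<Longrightarrow> chain_map A D F g \<Longrightarrow> chain_map A C F (\<lambda>n x. g n (f n x))"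
  by (simp add: chain_map_def[of A C F] graded_hom_comp[OF chain_mapD(1) chain_mapD(1)] chain_mapD(2)
      graded_homD(1)[OF chain_mapD(1)])

lemma iso_complex_sym: "iso_complex A C D \<Longrightarrow> iso_complex A D C"
  unfolding iso_complex_def by blast

lemma iso_complex_trans:
  assumes "iso_complex A C D" "iso_complex A D F"
  shows "iso_complex A C F"
proof -
  obtain f g where fg: "chain_map A C D f" "chain_map A D C g"
     "\<forall>n. \<forall>x\<in>carrier (Ob C n). g n (f n x) = x" "\<forall>n. \<forall>y\<in>carrier (Ob D n). f n (g n y) = y"
    using assms(1) unfolding iso_complex_def by blast
  obtain f' g' where fg': "chain_map A D F f'" "chain_map A F D g'"
     "\<forall>n. \<forall>x\<in>carrier (Ob D n). g' n (f' n x) = x" "\<forall>n. \<forall>y\<in>carrier (Ob F n). f' n (g' n y) = y"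
    using assms(2) unfolding iso_complex_def by blast
  show ?thesis unfolding iso_complex_def
    by (rule exI[of _ "\<lambda>n x. f' n (f n x)"], rule exI[of _ "\<lambda>n x. g n (g' n x)"])
      (use chain_map_comp[OF fg(1) fg'(1)] chain_map_comp[OF fg'(2) fg(2)] fg(3,4) fg'(3,4)
        graded_homD(1)[OF chain_mapD(1)[OF fg(1)]] graded_homD(1)[OF chain_mapD(1)[OF fg'(2)]] in simp)
qed

lemma chain_isomorphic_if_iso_complex:
  assumes "iso_complex A C D"
  shows "chain_isomorphic A C D"
proof -
  obtain f g where fg: "chain_map A C D f" "chain_map A D C g"
     "\<forall>n. \<forall>x\<in>carrier (Ob C n). g n (f n x) = x" "\<forall>n. \<forall>y\<in>carrier (Ob D n). f n (g n y) = y"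
    using assms(1) unfolding iso_complex_def by blast
  have "bij_betw (f n) (carrier (Ob C n)) (carrier (Ob D n))" for n
    by (rule bij_betw_byWitness[where f' = "g n"])
      (use fg in \<open>auto dest: chain_mapD(1)[THEN graded_homD(1)]\<close>)
  then show ?thesis unfolding chain_isomorphic_def using fg(1) by blast
qed

text \<open>A bijective map of graded modules need not reflect the grading, hence the condition on \<open>hpart\<close>.\<close>

lemma iso_complexI:
  assumes f: "chain_map A C D f" and cl: "op_closed A C"
    and bij: "\<And>n. bij_betw (f n) (carrier (Ob C n)) (carrier (Ob D n))"
    and hp: "\<And>n x d. x \<in> carrier (Ob C n) \<Longrightarrow> f n x \<in> hpart (Ob D n) d \<Longrightarrow> x \<in> hpart (Ob C n) d"
    and hD: "\<And>n d. hpart (Ob D n) d \<subseteq> carrier (Ob D n)"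
  shows "iso_complex A C D"
proof -
  define g where "g n = inv_into (carrier (Ob C n)) (f n)" for n
  have gf: "g n (f n x) = x" if "x \<in> carrier (Ob C n)" for n x
    using bij[of n] that unfolding g_def bij_betw_def by (simp add: inv_into_f_f)
  have fg: "f n (g n y) = y" if "y \<in> carrier (Ob D n)" for n y
    using bij[of n] that unfolding g_def bij_betw_def by (auto simp: f_inv_into_f)
  have gc: "g n y \<in> carrier (Ob C n)" if "y \<in> carrier (Ob D n)" for n y
    using bij[of n] that unfolding g_def bij_betw_def by (auto simp: inv_into_into)
  note fD = chain_mapD(1)[OF f, THEN graded_homD(1)] chain_mapD(1)[OF f, THEN graded_homD(2)]
    chain_mapD(1)[OF f, THEN graded_homD(3)]
  have *: "g n y = x" if "x \<in> carrier (Ob C n)" "f n x = y" for n x y using gf that by auto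
  note cl' = cl[unfolded op_closed_def, rule_format]
  have "chain_map A D C g" unfolding chain_map_def
  proof (intro allI conjI ballI)
    fix n show "g n \<in> graded_hom A (Ob D n) (Ob C n)"
    proof (rule graded_homI)
      fix y z assume yz: "y \<in> carrier (Ob D n)" "z \<in> carrier (Ob D n)"
      show "g n (y \<oplus>\<^bsub>Ob D n\<^esub> z) = g n y \<oplus>\<^bsub>Ob C n\<^esub> g n z"
        by (rule *) (use yz cl' gc fg in \<open>auto simp: fD\<close>)
    next
      fix a y assume yz: "a \<in> carrier A" "y \<in> carrier (Ob D n)"
      show "g n (a \<odot>\<^bsub>Ob D n\<^esub> y) = a \<odot>\<^bsub>Ob C n\<^esub> g n y"
        by (rule *) (use yz cl' gc fg in \<open>auto simp: fD\<close>)
    next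
      fix y d assume "y \<in> hpart (Ob D n) d"
      moreover from this have "y \<in> carrier (Ob D n)" using hD by blast
      ultimately show "g n y \<in> hpart (Ob C n) d" using hp gc fg by auto
    qed (rule gc)
  next
    fix n y assume y: "y \<in> carrier (Ob D n)"
    show "g (n + 1) (Df D n y) = Df C n (g n y)"
      by (rule *) (use y cl' gc fg chain_mapD(2)[OF f] in auto)
  qed
  then show ?thesis unfolding iso_complex_def using f fg gf by blast
qed

lemma homotopic_to_idE:
  assumes "homotopic_to_id A C f"
  obtains s where "\<And>n. s n \<in> graded_hom A (Ob C n) (Ob C (n - 1))"
    and "\<And>n x. x \<in> carrier (Ob C n) \<Longrightarrow>
      f n x = x \<oplus>\<^bsub>Ob C n\<^esub> (Df C (n - 1) (s n x) \<oplus>\<^bsub>Ob C n\<^esub> s (n + 1) (Df C n x))"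
proof -
  from assms obtain s where s: "\<forall>n. s n \<in> graded_hom A (Ob C n) (Ob C (n - 1)) \<and>
       (\<forall>x\<in>carrier (Ob C n).
          f n x = x \<oplus>\<^bsub>Ob C n\<^esub> (Df C (n - 1) (s n x) \<oplus>\<^bsub>Ob C n\<^esub> s (n + 1) (Df C n x)))"
    unfolding homotopic_to_id_def ..
  show ?thesis by (rule that[of s]) (use s in simp_all)
qed

lemma homotopy_equivalent_sym: "homotopy_equivalent A C D \<Longrightarrow> homotopy_equivalent A D C"
  unfolding homotopy_equivalent_def by blast

lemma homotopy_equivalent_iso_right:
  assumes "homotopy_equivalent A C D" "iso_complex A D F" and D: "op_closed A D"
  shows "homotopy_equivalent A C F"
proof -
  obtain f g where fg: "chain_map A C D f" "chain_map A D C g" "homotopic_to_id A C (\<lambda>n x. g n (f n x))"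
    "homotopic_to_id A D (\<lambda>n y. f n (g n y))"
    using assms(1) unfolding homotopy_equivalent_def by blast
  obtain p q where pq: "chain_map A D F p" "chain_map A F D q"
     "\<forall>n. \<forall>x\<in>carrier (Ob D n). q n (p n x) = x" "\<forall>n. \<forall>y\<in>carrier (Ob F n). p n (q n y) = y"
    using assms(2) unfolding iso_complex_def by blast
  note cl = graded_homD(1)[OF chain_mapD(1)[OF fg(1)]] graded_homD(1)[OF chain_mapD(1)[OF fg(2)]]
     graded_homD(1)[OF chain_mapD(1)[OF pq(1)]] graded_homD(1)[OF chain_mapD(1)[OF pq(2)]]
  obtain s where s: "\<And>n. s n \<in> graded_hom A (Ob D n) (Ob D (n - 1))"
      "\<And>n x. x \<in> carrier (Ob D n) \<Longrightarrow>
          f n (g n x) = x \<oplus>\<^bsub>Ob D n\<^esub> (Df D (n - 1) (s n x) \<oplus>\<^bsub>Ob D n\<^esub> s (n + 1) (Df D n x))"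
    by (rule homotopic_to_idE[OF fg(4)]) blast
  obtain r where r: "\<And>n. r n \<in> graded_hom A (Ob C n) (Ob C (n - 1))"
      "\<And>n x. x \<in> carrier (Ob C n) \<Longrightarrow>
          g n (f n x) = x \<oplus>\<^bsub>Ob C n\<^esub> (Df C (n - 1) (r n x) \<oplus>\<^bsub>Ob C n\<^esub> r (n + 1) (Df C n x))"
    by (rule homotopic_to_idE[OF fg(3)]) blast
  let ?f = "\<lambda>n x. p n (f n x)" and ?g = "\<lambda>n x. g n (q n x)"
  have 1: "homotopic_to_id A C (\<lambda>n x. ?g n (?f n x))"
    unfolding homotopic_to_id_def
  proof (rule exI[of _ r], intro allI conjI ballI)
    fix n x assume x: "x \<in> carrier (Ob C n)"
    show "?g n (?f n x) = x \<oplus>\<^bsub>Ob C n\<^esub> (Df C (n - 1) (r n x) \<oplus>\<^bsub>Ob C n\<^esub> r (n + 1) (Df C n x))"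
      using r(2)[OF x] pq(3) cl(1)[OF x] by simp
  qed (rule r(1))
  have 2: "homotopic_to_id A F (\<lambda>n x. ?f n (?g n x))"
    unfolding homotopic_to_id_def
  proof (rule exI[of _ "\<lambda>n y. p (n - 1) (s n (q n y))"], intro allI conjI ballI)
    fix n
    show "(\<lambda>y. p (n - 1) (s n (q n y))) \<in> graded_hom A (Ob F n) (Ob F (n - 1))"
      by (intro graded_hom_comp[OF _ chain_mapD(1)[OF pq(1)]] graded_hom_comp[OF _ s(1)] chain_mapD(1)[OF pq(2)])
    fix y assume y: "y \<in> carrier (Ob F n)"
    let ?x = "q n y"
    have x: "?x \<in> carrier (Ob D n)" using y cl by auto
    note cD = D[unfolded op_closed_def, rule_format]
    have sc: "s n ?x \<in> carrier (Ob D (n - 1))" using graded_homD(1)[OF s(1)] x by auto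
    have dsc: "Df D (n - 1) (s n ?x) \<in> carrier (Ob D n)"
      using cD[of "n - 1"] sc by auto
    have dx: "Df D n ?x \<in> carrier (Ob D (n + 1))" using cD x by auto
    have sdx: "s (n + 1) (Df D n ?x) \<in> carrier (Ob D n)"
      using graded_homD(1)[OF s(1) dx] by simp
    have q: "q (n + 1) (Df F n y) = Df D n ?x" by (rule chain_mapD(2)[OF pq(2) y])
    have pd: "p n (Df D (n - 1) (s n ?x)) = Df F (n - 1) (p (n - 1) (s n ?x))"
      using chain_mapD(2)[OF pq(1) sc] by simp
    have "?f n (?g n y) = p n (?x \<oplus>\<^bsub>Ob D n\<^esub> (Df D (n - 1) (s n ?x) \<oplus>\<^bsub>Ob D n\<^esub> s (n + 1) (Df D n ?x)))"
      by (simp add: s(2)[OF x])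
    also have "\<dots> = p n ?x \<oplus>\<^bsub>Ob F n\<^esub> (p n (Df D (n - 1) (s n ?x)) \<oplus>\<^bsub>Ob F n\<^esub> p n (s (n + 1) (Df D n ?x)))"
      using graded_homD(2)[OF chain_mapD(1)[OF pq(1)]] x dsc sdx cD by simp
    finally show "?f n (?g n y) = y \<oplus>\<^bsub>Ob F n\<^esub> (Df F (n - 1) (p (n - 1) (s n (q n y))) \<oplus>\<^bsub>Ob F n\<^esub>
         p (n + 1 - 1) (s (n + 1) (q (n + 1) (Df F n y))))" using pq(4) y by (simp add: pd q)
  qed
  show ?thesis unfolding homotopy_equivalent_def
    using 1 2 chain_map_comp[OF fg(1) pq(1)] chain_map_comp[OF pq(2) fg(2)] by blast
qed

section \<open>Algebras with a monomial basis and their free modules\<close>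

text \<open>What the symmetric and the exterior algebra have in common. The coefficient of a monomial \<open>m\<close> in \<open>a\<close>
  is \<open>co a m\<close>; \<open>dv m\<close> consists of the divisors of \<open>m\<close>, \<open>m - l\<close> is the complementary divisor, and the
  product of the monomials \<open>l\<close> and \<open>m - l\<close> is \<open>gam l (m - l)\<close> times \<open>m\<close>. The variables have degree
  \<open>- eta\<close>, so that all monomials other than \<open>e0\<close> (the unit) have degrees of the same sign, and they
  commute up to the sign \<open>tau\<close>.\<close>

locale monomial_algebra =
  fixes A :: "'r graded_ring" and co :: "'r \<Rightarrow> 'm::minus \<Rightarrow> 'k::field"
    and Idx :: "'m set" and dv :: "'m \<Rightarrow> 'm set" and gam :: "'m \<Rightarrow> 'm \<Rightarrow> 'k" and e0 :: 'm
    and var :: "nat \<Rightarrow> 'm" and v :: nat and dgm :: "'m \<Rightarrow> int" and eta :: int and tau :: 'k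
  assumes ring_A: "ring A"
    and co_inj: "\<lbrakk>a \<in> carrier A; b \<in> carrier A; \<And>m. co a m = co b m\<rbrakk> \<Longrightarrow> a = b"
    and co_surj: "\<lbrakk>finite {m. f m \<noteq> 0}; {m. f m \<noteq> 0} \<subseteq> Idx\<rbrakk> \<Longrightarrow> \<exists>a\<in>carrier A. co a = f"
    and co_finite: "a \<in> carrier A \<Longrightarrow> finite {m. co a m \<noteq> 0}"
    and co_Idx: "\<lbrakk>a \<in> carrier A; m \<notin> Idx\<rbrakk> \<Longrightarrow> co a m = 0"
    and co_add: "\<lbrakk>a \<in> carrier A; b \<in> carrier A\<rbrakk> \<Longrightarrow> co (a \<oplus>\<^bsub>A\<^esub> b) m = co a m + co b m"
    and co_mult: "\<lbrakk>a \<in> carrier A; b \<in> carrier A; m \<in> Idx\<rbrakk> \<Longrightarrow>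
        co (a \<otimes>\<^bsub>A\<^esub> b) m = (\<Sum>l\<in>dv m. gam l (m - l) * co a l * co b (m - l))"
    and gcomp_closed: "a \<in> carrier A \<Longrightarrow> gcomp A d a \<in> carrier A"
    and co_gcomp: "a \<in> carrier A \<Longrightarrow> co (gcomp A d a) m = (if dgm m = d then co a m else 0)"
    and e0_Idx: "e0 \<in> Idx"
    and dv_finite: "m \<in> Idx \<Longrightarrow> finite (dv m)"
    and dv_Idx: "\<lbrakk>m \<in> Idx; l \<in> dv m\<rbrakk> \<Longrightarrow> l \<in> Idx"
    and dv_compl: "\<lbrakk>m \<in> Idx; l \<in> dv m\<rbrakk> \<Longrightarrow> m - l \<in> dv m \<and> m - (m - l) = l"
    and e0_dv: "m \<in> Idx \<Longrightarrow> e0 \<in> dv m" and m_e0: "m \<in> Idx \<Longrightarrow> m - e0 = m"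
    and gam_e0: "m \<in> Idx \<Longrightarrow> gam e0 m = 1 \<and> gam m e0 = 1"
    and dv_swap: "\<lbrakk>m \<in> Idx; l \<in> dv m; r \<in> dv (m - l)\<rbrakk> \<Longrightarrow> r \<in> dv m \<and> l \<in> dv (m - r) \<and> m - l - r = m - r - l"
    and dv_inj: "\<lbrakk>m \<in> Idx; m' \<in> Idx; l \<in> dv m; l \<in> dv m'; m - l = m' - l\<rbrakk> \<Longrightarrow> m = m'"
    and gam_cocycle: "\<lbrakk>m \<in> Idx; l \<in> dv m; r \<in> dv (m - l)\<rbrakk> \<Longrightarrow>
        gam (m - r) r * gam l (m - r - l) = gam l (m - l) * gam (m - l - r) r"
    and var_Idx: "k < v \<Longrightarrow> var k \<in> Idx" and var_inj: "\<lbrakk>k < v; j < v; var k = var j\<rbrakk> \<Longrightarrow> k = j"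
    and dgm_var: "k < v \<Longrightarrow> dgm (var k) = - eta" and eta: "eta = 1 \<or> eta = - 1"
    and dgm_dv: "\<lbrakk>m \<in> Idx; l \<in> dv m\<rbrakk> \<Longrightarrow> dgm m = dgm l + dgm (m - l)"
    and dgm_zero: "m \<in> Idx \<Longrightarrow> dgm m = 0 \<longleftrightarrow> m = e0"
    and dgm_one: "\<lbrakk>m \<in> Idx; \<bar>dgm m\<bar> = 1\<rbrakk> \<Longrightarrow> \<exists>k<v. m = var k"
    and dgm_sign: "m \<in> Idx \<Longrightarrow> eta * dgm m \<le> 0"
    and tau: "tau * tau = 1"
    and gam_swap: "\<lbrakk>m \<in> Idx; k < v; j < v; k \<noteq> j; var k \<in> dv m; var j \<in> dv (m - var k)\<rbrakk> \<Longrightarrow>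
        gam (m - var k) (var k) * gam (m - var k - var j) (var j) =
        tau * (gam (m - var j) (var j) * gam (m - var j - var k) (var k))"
begin

definition vr :: "'m \<Rightarrow> nat set" where
  "vr m = (if m \<in> Idx then {k. k < v \<and> var k \<in> dv m} else {})"

definition sg :: "nat \<Rightarrow> 'm \<Rightarrow> 'k" where
  "sg k m = gam (m - var k) (var k)"

text \<open>The number of variables in a monomial, the induction parameter below.\<close>

definition ht :: "'m \<Rightarrow> nat" where
  "ht m = nat (- (eta * dgm m))"

definition mk :: "('m \<Rightarrow> 'k) \<Rightarrow> 'r" where
  "mk f = (SOME a. a \<in> carrier A \<and> co a = f)"

definition act :: "'r \<Rightarrow> ('m \<Rightarrow> ('b \<Rightarrow>\<^sub>0 'k)) \<Rightarrow> ('m \<Rightarrow> ('b \<Rightarrow>\<^sub>0 'k))" where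
  "act a q = (\<lambda>m. if m \<in> Idx then \<Sum>l\<in>dv m. scal (gam l (m - l) * co a l) (q (m - l)) else 0)"

definition supp_in :: "'b set \<Rightarrow> ('m \<Rightarrow> ('b \<Rightarrow>\<^sub>0 'k)) set" where
  "supp_in B = {q. (\<forall>m. Poly_Mapping.keys (q m) \<subseteq> B) \<and> finite {m. q m \<noteq> 0} \<and> (\<forall>m. m \<notin> Idx \<longrightarrow> q m = 0)}"

text \<open>The free module on \<open>B\<close> as functions assigning to every monomial a vector of coefficients.\<close>

definition Tm :: "'b set \<Rightarrow> ('b \<Rightarrow> int) \<Rightarrow> ('r, 'm \<Rightarrow> ('b \<Rightarrow>\<^sub>0 'k)) gmodule" where
  "Tm B dg = \<lparr>carrier = supp_in B, mult = undefined, one = undefined,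
     zero = 0, add = (+), smult = act,
     hpart = (\<lambda>t. {q \<in> supp_in B. \<forall>m. \<forall>b\<in>Poly_Mapping.keys (q m). dgm m + dg b = t})\<rparr>"

definition mono :: "'m \<Rightarrow> 'r" where
  "mono l = mk (\<lambda>m. if m = l then 1 else 0)"

definition tens :: "'m \<Rightarrow> ('b \<Rightarrow>\<^sub>0 'k) \<Rightarrow> 'm \<Rightarrow> ('b \<Rightarrow>\<^sub>0 'k)" where
  "tens l u = (\<lambda>m. if m = l then u else 0)"

lemma mk:
  assumes "finite {m. f m \<noteq> 0}" "{m. f m \<noteq> 0} \<subseteq> Idx"
  shows "mk f \<in> carrier A" "co (mk f) = f"
proof -
  have "mk f \<in> carrier A \<and> co (mk f) = f"
    unfolding mk_def by (rule someI_ex) (use co_surj[OF assms] in blast)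
  then show "mk f \<in> carrier A" "co (mk f) = f" by auto
qed

lemma mono: "l \<in> Idx \<Longrightarrow> mono l \<in> carrier A" "l \<in> Idx \<Longrightarrow> co (mono l) m = (if m = l then 1 else 0)"
  unfolding mono_def by (simp_all add: mk)

lemma zero_closed: "\<zero>\<^bsub>A\<^esub> \<in> carrier A"
  by (simp add: ring.ring_simprules[OF ring_A])

lemma co_zero [simp]: "co \<zero>\<^bsub>A\<^esub> m = 0"
proof -
  have "\<zero>\<^bsub>A\<^esub> \<oplus>\<^bsub>A\<^esub> \<zero>\<^bsub>A\<^esub> = \<zero>\<^bsub>A\<^esub>" by (simp add: ring.ring_simprules[OF ring_A])
  then have "co \<zero>\<^bsub>A\<^esub> m = co \<zero>\<^bsub>A\<^esub> m + co \<zero>\<^bsub>A\<^esub> m"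
    using co_add[OF zero_closed zero_closed, of m] by simp
  then show ?thesis by (rule add_0_iff[THEN iffD1])
qed

lemma m_minus_m: "m \<in> Idx \<Longrightarrow> m \<in> dv m \<and> m - m = e0"
  using dv_compl[OF _ e0_dv, of m] m_e0 by auto

lemma minus_Idx: "m \<in> Idx \<Longrightarrow> l \<in> dv m \<Longrightarrow> m - l \<in> Idx"
  using dv_Idx dv_compl by blast

lemma minus_eq_e0: "m \<in> Idx \<Longrightarrow> l \<in> dv m \<Longrightarrow> m - l = e0 \<longleftrightarrow> l = m"
  using dv_compl[of m l] m_e0 m_minus_m by metis

lemma dv_e0: "dv e0 = {e0}"
proof -
  have "l = e0" if l: "l \<in> dv e0" for l
  proof -
    have "dgm e0 = dgm l + dgm (e0 - l)" by (rule dgm_dv[OF e0_Idx l])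
    moreover have "dgm e0 = 0" using dgm_zero e0_Idx by blast
    moreover have "eta * dgm l \<le> 0" "eta * dgm (e0 - l) \<le> 0"
      using dgm_sign dv_Idx minus_Idx e0_Idx l by auto
    ultimately have "dgm l = 0" using eta by auto
    then show "l = e0" using dgm_zero dv_Idx e0_Idx l by blast
  qed
  then show ?thesis using e0_dv e0_Idx by blast
qed

lemma finite_vr: "finite (vr m)"
  by (simp add: vr_def)

lemma vrD: "k \<in> vr m \<Longrightarrow> m \<in> Idx \<and> k < v \<and> var k \<in> dv m \<and> m - var k \<in> dv m \<and> m - var k \<in> Idx \<and> m - (m - var k) = var k"
  using dv_compl minus_Idx by (auto simp: vr_def split: if_splits)

lemma dgm_minus_var: "k \<in> vr m \<Longrightarrow> dgm (m - var k) = dgm m + eta"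
  using vrD[of k m] dgm_dv[of m "var k"] dgm_var by auto

lemma ht_minus_var: "k \<in> vr m \<Longrightarrow> ht m = Suc (ht (m - var k))"
  using dgm_minus_var[of k m] vrD[of k m] dgm_sign[of "m - var k"] eta unfolding ht_def by auto

lemma vr_e0: "vr e0 = {}"
proof -
  have "dgm e0 = 0" using dgm_zero e0_Idx by blast
  then show ?thesis using ht_minus_var[of _ e0] by (auto simp: ht_def)
qed

lemma supp_inD:
  assumes "q \<in> supp_in B"
  shows "Poly_Mapping.keys (q m) \<subseteq> B" "finite {m. q m \<noteq> 0}" "m \<notin> Idx \<Longrightarrow> q m = 0"
  using assms unfolding supp_in_def by auto

lemma Tm_simps [simp]:
  "carrier (Tm B dg) = supp_in B" "\<zero>\<^bsub>Tm B dg\<^esub> = 0" "x \<oplus>\<^bsub>Tm B dg\<^esub> y = x + y" "a \<odot>\<^bsub>Tm B dg\<^esub> x = act a x"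
  by (simp_all add: Tm_def)

lemma hpart_Tm: "q \<in> hpart (Tm B dg) t \<longleftrightarrow>
    q \<in> supp_in B \<and> (\<forall>m. \<forall>b\<in>Poly_Mapping.keys (q m). dgm m + dg b = t)"
  by (simp add: Tm_def)

lemma supp_in_zero: "0 \<in> supp_in B"
  by (simp add: supp_in_def zero_fun_def)

lemma supp_in_add: "x \<in> supp_in B \<Longrightarrow> y \<in> supp_in B \<Longrightarrow> x + y \<in> supp_in B"
proof -
  assume x: "x \<in> supp_in B" and y: "y \<in> supp_in B"
  have "{m. (x + y) m \<noteq> 0} \<subseteq> {m. x m \<noteq> 0} \<union> {m. y m \<noteq> 0}" by auto
  then have "finite {m. (x + y) m \<noteq> 0}"
    using supp_inD(2)[OF x] supp_inD(2)[OF y] by (meson finite_UnI finite_subset)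
  then show ?thesis
    using supp_inD(1)[OF x] supp_inD(1)[OF y] supp_inD(3)[OF x] supp_inD(3)[OF y]
    by (simp add: supp_in_def keys_add_subset)
qed

lemma supp_in_comp:
  assumes q: "q \<in> supp_in B" and f: "f 0 = 0" "\<And>u. Poly_Mapping.keys u \<subseteq> B \<Longrightarrow> Poly_Mapping.keys (f u) \<subseteq> B'"
  shows "(\<lambda>m. f (q m)) \<in> supp_in B'"
proof -
  have "{m. f (q m) \<noteq> 0} \<subseteq> {m. q m \<noteq> 0}" using f by auto
  then show ?thesis using supp_inD[OF q] f by (auto simp: supp_in_def intro: finite_subset)
qed

lemma supp_in_uminus: "x \<in> supp_in B \<Longrightarrow> - x \<in> supp_in B"
  using supp_in_comp[of x B uminus B] by (simp add: fun_Compl_def)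

lemma supp_in_diff: "x \<in> supp_in B \<Longrightarrow> y \<in> supp_in B \<Longrightarrow> x - y \<in> supp_in B"
  using supp_in_add[of x B "- y"] supp_in_uminus[of y B] by simp

lemma act_nz:
  assumes "act a q m \<noteq> 0"
  shows "m \<in> Idx \<and> (\<exists>l\<in>dv m. co a l \<noteq> 0 \<and> q (m - l) \<noteq> 0)"
proof (rule ccontr)
  assume "\<not> ?thesis"
  then have "act a q m = 0" unfolding act_def by (auto intro!: sum.neutral)
  with assms show False by simp
qed

lemma keys_act: "Poly_Mapping.keys (act a q m) \<subseteq> (\<Union>l\<in>dv m. if co a l \<noteq> 0 then Poly_Mapping.keys (q (m - l)) else {})"
proof (cases "m \<in> Idx")
  case True
  show ?thesis unfolding act_def using True
    by (simp del: Un_iff, intro keys_sum_subset)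
      (use keys_scal in \<open>force simp: in_keys_iff\<close>)
qed (simp add: act_def)

lemma supp_in_act:
  assumes a: "a \<in> carrier A" and q: "q \<in> supp_in B"
  shows "act a q \<in> supp_in B"
proof -
  let ?f = "\<lambda>m. SOME l. l \<in> dv m \<and> co a l \<noteq> 0 \<and> q (m - l) \<noteq> 0"
  let ?N = "{m. act a q m \<noteq> 0}"
  have f: "?f m \<in> dv m \<and> co a (?f m) \<noteq> 0 \<and> q (m - ?f m) \<noteq> 0" if "m \<in> ?N" for m
    by (rule someI_ex) (use act_nz that in blast)
  have "inj_on (\<lambda>m. (?f m, m - ?f m)) ?N"
  proof (rule inj_onI)
    fix m m' assume m: "m \<in> ?N" "m' \<in> ?N" and eq: "(?f m, m - ?f m) = (?f m', m' - ?f m')"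
    have "m \<in> Idx" "m' \<in> Idx" using act_nz m by blast+
    then show "m = m'" using dv_inj[of m m' "?f m"] f[OF m(1)] f[OF m(2)] eq by auto
  qed
  moreover have "(\<lambda>m. (?f m, m - ?f m)) ` ?N \<subseteq> {l. co a l \<noteq> 0} \<times> {m. q m \<noteq> 0}"
    using f by auto
  ultimately have "finite ?N"
    using co_finite[OF a] supp_inD(2)[OF q] by (meson finite_SigmaI inj_on_finite)
  moreover have "Poly_Mapping.keys (act a q m) \<subseteq> B" for m
    using keys_act[of a q m] supp_inD(1)[OF q] by (force split: if_splits)
  ultimately show ?thesis by (auto simp: supp_in_def act_def)
qed

lemma act_add: "act a (x + y) = act a x + act a y"
  by (rule ext) (simp add: act_def scal_distrib sum.distrib)

lemma act_zero: "act a 0 = 0"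
  by (rule ext) (simp add: act_def)

lemma act_uminus: "act a (- x) = - act a x"
  using act_add[of a x "- x"] by (simp add: act_zero add_eq_0_iff)

lemma act_diff: "act a (x - y) = act a x - act a y"
  using act_add[of a x "- y"] by (simp add: act_uminus)

lemma act_lin_ext: "(\<lambda>m. lin_ext Y (act a q m)) = act a (\<lambda>m. lin_ext Y (q m))"
  by (rule ext) (simp add: act_def lin_ext_sum lin_ext_scal)

lemma act_mono_tens:
  assumes "l \<in> Idx"
  shows "act (mono l) q m = (if m \<in> Idx \<and> l \<in> dv m then scal (gam l (m - l)) (q (m - l)) else 0)"
proof (cases "m \<in> Idx")
  case True
  have "act (mono l) q m = (\<Sum>l'\<in>dv m. if l' = l then scal (gam l (m - l)) (q (m - l)) else 0)"
    unfolding act_def using True by (auto simp: mono[OF assms] intro!: sum.cong)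
  then show ?thesis using True dv_finite by simp
qed (simp add: act_def)

lemma act_mono_tens_e0:
  assumes "l \<in> Idx"
  shows "act (mono l) (tens e0 u) = tens l u"
proof
  fix m
  show "act (mono l) (tens e0 u) m = tens l u m"
    unfolding act_mono_tens[OF assms] using assms m_minus_m[of m] minus_eq_e0[of m l] gam_e0[of l]
    by (auto simp: tens_def)
qed

lemma supp_in_tens: "l \<in> Idx \<Longrightarrow> Poly_Mapping.keys u \<subseteq> B \<Longrightarrow> tens l u \<in> supp_in B"
  by (auto simp: supp_in_def tens_def)

lemma tens_zero [simp]: "tens l 0 = 0"
  by (rule ext) (simp add: tens_def)

lemma tens_add: "tens l (u + w) = tens l u + tens l w"
  by (rule ext) (simp add: tens_def)

lemma supp_in_expand:
  assumes "q \<in> supp_in B"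
  shows "q = (\<Sum>l\<in>{l. q l \<noteq> 0}. tens l (q l))"
proof
  fix m
  have "(\<Sum>l\<in>S. tens l (q l)) m = (\<Sum>l\<in>S. tens l (q l) m)" if "finite S" for S
    using that by (induction S rule: finite_induct) auto
  then have "(\<Sum>l\<in>{l. q l \<noteq> 0}. tens l (q l)) m = (\<Sum>l\<in>{l. q l \<noteq> 0}. if l = m then q m else 0)"
    using supp_inD(2)[OF assms] by (auto simp: tens_def intro!: sum.cong)
  then show "q m = (\<Sum>l\<in>{l. q l \<noteq> 0}. tens l (q l)) m" using supp_inD(2)[OF assms] by auto
qed

lemma hom_zero:
  assumes "f \<in> graded_hom A (Tm B dg) (Tm B' dg')"
  shows "f 0 = 0"
  using graded_homD(2)[OF assms, of 0 0] by (simp add: supp_in_zero)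

text \<open>A homomorphism is determined by its values on the generators \<open>tens e0 u\<close>.\<close>

lemma hom_expand:
  assumes f: "f \<in> graded_hom A (Tm B dg) (Tm B' dg')" and q: "q \<in> supp_in B" and m: "m \<in> Idx"
  shows "f q m = (\<Sum>l\<in>dv m. scal (gam l (m - l)) (f (tens e0 (q l)) (m - l)))"
proof -
  let ?S = "{l. q l \<noteq> 0}"
  have S: "finite ?S" "?S \<subseteq> Idx" using supp_inD[OF q] by auto
  have *: "f (\<Sum>l\<in>T. tens l (q l)) m = (\<Sum>l\<in>T. if l \<in> dv m then scal (gam l (m - l)) (f (tens e0 (q l)) (m - l)) else 0)
      \<and> (\<Sum>l\<in>T. tens l (q l)) \<in> supp_in B" if "finite T" "T \<subseteq> Idx" for T
    using that
  proof (induction T rule: finite_induct)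
    case empty show ?case by (simp add: hom_zero[OF f, unfolded zero_fun_def] supp_in_zero[unfolded zero_fun_def])
  next
    case (insert l T)
    have l: "l \<in> Idx" using insert by auto
    have t: "tens l' (q l) \<in> supp_in B" if "l' \<in> Idx" for l'
      by (rule supp_in_tens[OF that supp_inD(1)[OF q]])
    have "f (tens l (q l)) = act (mono l) (f (tens e0 (q l)))"
      using graded_homD(3)[OF f mono(1)[OF l], of "tens e0 (q l)"] t e0_Idx
      by (simp add: act_mono_tens_e0[OF l])
    then have e: "f (tens l (q l)) m = (if l \<in> dv m then scal (gam l (m - l)) (f (tens e0 (q l)) (m - l)) else 0)"
      using m l by (simp add: act_mono_tens)
    let ?x = "\<Sum>l\<in>T. tens l (q l)"
    have IH: "f ?x m = (\<Sum>l\<in>T. if l \<in> dv m then scal (gam l (m - l)) (f (tens e0 (q l)) (m - l)) else 0)"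
      "?x \<in> supp_in B" using insert by auto
    have s: "(\<Sum>l\<in>insert l T. tens l (q l)) = tens l (q l) + ?x"
      by (rule sum.insert[OF insert.hyps])
    have "f (tens l (q l) + ?x) = f (tens l (q l)) + f ?x"
      using graded_homD(2)[OF f, of "tens l (q l)" ?x] t[OF l] IH(2) by simp
    then have "f (tens l (q l) + ?x) m = f (tens l (q l)) m + f ?x m"
      by (simp only: plus_fun_apply)
    then show ?case unfolding s
      using supp_in_add[OF t[OF l] IH(2)] e IH(1) by (simp only: sum.insert[OF insert.hyps] simp_thms)
  qed
  have "f q m = f (\<Sum>l\<in>?S. tens l (q l)) m" using supp_in_expand[OF q] by simp
  also have "\<dots> = (\<Sum>l\<in>?S. if l \<in> dv m then scal (gam l (m - l)) (f (tens e0 (q l)) (m - l)) else 0)"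
    using * S by blast
  also have "\<dots> = (\<Sum>l\<in>?S \<inter> dv m. scal (gam l (m - l)) (f (tens e0 (q l)) (m - l)))"
    by (simp add: sum.inter_restrict[OF S(1)])
  also have "\<dots> = (\<Sum>l\<in>dv m. scal (gam l (m - l)) (f (tens e0 (q l)) (m - l)))"
    using dv_finite[OF m] by (intro sum.mono_neutral_left) (auto simp: hom_zero[OF f])
  finally show ?thesis .
qed

definition cst :: "'k \<Rightarrow> 'r" where
  "cst c = mk (\<lambda>m. if m = e0 then c else 0)"

lemma cst: "cst c \<in> carrier A" "co (cst c) m = (if m = e0 then c else 0)"
proof -
  have "{m. (if m = e0 then c else 0) \<noteq> 0} \<subseteq> {e0}" by auto
  then have "finite {m. (if m = e0 then c else 0) \<noteq> 0}" "{m. (if m = e0 then c else 0) \<noteq> 0} \<subseteq> Idx"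
    using e0_Idx by (auto intro: finite_subset)
  from mk[OF this] show "cst c \<in> carrier A" "co (cst c) m = (if m = e0 then c else 0)"
    unfolding cst_def by auto
qed

lemma act_cst: "act (cst c) q m = (if m \<in> Idx then scal c (q m) else 0)"
proof (cases "m \<in> Idx")
  case True
  have "act (cst c) q m = (\<Sum>l\<in>dv m. if l = e0 then scal c (q m) else 0)"
    unfolding act_def using True gam_e0 m_e0 by (auto simp: cst intro!: sum.cong)
  then show ?thesis using True dv_finite e0_dv by simp
qed (simp add: act_def)

lemma hom_tens_lin:
  fixes u :: "'b \<Rightarrow>\<^sub>0 'k"
  assumes f: "f \<in> graded_hom A (Tm B dg) (Tm B' dg')" and u: "Poly_Mapping.keys u \<subseteq> B" and r: "r \<in> Idx"
  shows "f (tens e0 u) r = lin_ext (\<lambda>b. f (tens e0 (Poly_Mapping.single b 1)) r) u"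
proof (rule linear_on_eq_lin_ext[where B = B and f = "\<lambda>u. f (tens e0 u) r"])
  fix u w :: "'b \<Rightarrow>\<^sub>0 'k" assume "Poly_Mapping.keys u \<subseteq> B" "Poly_Mapping.keys w \<subseteq> B"
  then show "f (tens e0 (u + w)) r = f (tens e0 u) r + f (tens e0 w) r"
    using graded_homD(2)[OF f, of "tens e0 u" "tens e0 w"] by (simp add: supp_in_tens e0_Idx tens_add)
next
  fix c and u :: "'b \<Rightarrow>\<^sub>0 'k" assume "Poly_Mapping.keys u \<subseteq> B"
  then have "tens e0 u \<in> supp_in B" by (simp add: supp_in_tens e0_Idx)
  moreover have "act (cst c) (tens e0 u) = tens e0 (scal c u)"
    by (rule ext) (auto simp: act_cst tens_def e0_Idx)
  ultimately show "f (tens e0 (scal c u)) r = scal c (f (tens e0 u) r)"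
    using graded_homD(3)[OF f cst(1), of "tens e0 u" c] r by (simp add: act_cst)
qed (rule u)

text \<open>The differential sending \<open>a \<otimes> b\<close> to the sum of the \<open>a x\<^sub>k \<otimes> Y k b\<close>. The variable is multiplied to the
  right of \<open>a\<close>, whence the map is linear for the left module structure (\<open>del_act\<close>): in terms of
  structure constants this is the cocycle condition for \<open>gam\<close>.\<close>

definition del :: "(nat \<Rightarrow> 'b \<Rightarrow> ('c \<Rightarrow>\<^sub>0 'k)) \<Rightarrow> ('m \<Rightarrow> ('b \<Rightarrow>\<^sub>0 'k)) \<Rightarrow> 'm \<Rightarrow> ('c \<Rightarrow>\<^sub>0 'k)" where
  "del Y q m = (\<Sum>k\<in>vr m. scal (sg k m) (lin_ext (Y k) (q (m - var k))))"

lemma del_add: "del Y (x + y) = del Y x + del Y y"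
  by (rule ext) (simp add: del_def lin_ext_add scal_distrib sum.distrib)

lemma del_zero: "del Y 0 = 0"
  by (rule ext) (simp add: del_def)

lemma del_act: "del Y (act a q) = act a (del Y q)"
proof
  fix m
  show "del Y (act a q) m = act a (del Y q) m"
  proof (cases "m \<in> Idx")
    case False
    then show ?thesis by (simp add: del_def act_def vr_def)
  next
    case m: True
    let ?g = "\<lambda>k l. scal (sg k m * gam l (m - var k - l) * co a l) (lin_ext (Y k) (q (m - var k - l)))"
    let ?h = "\<lambda>l k. scal (gam l (m - l) * co a l * sg k (m - l)) (lin_ext (Y k) (q (m - l - var k)))"
    have "del Y (act a q) m = (\<Sum>k\<in>vr m. \<Sum>l\<in>dv (m - var k). ?g k l)"
      unfolding del_def by (rule sum.cong[OF refl])
        (use vrD in \<open>simp add: act_def lin_ext_sum lin_ext_scal scal_sum mult.assoc\<close>)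
    also have "\<dots> = (\<Sum>(k, l)\<in>Sigma (vr m) (\<lambda>k. dv (m - var k)). ?g k l)"
      by (rule sum.Sigma) (use vrD dv_finite finite_vr in auto)
    also have "\<dots> = (\<Sum>(l, k)\<in>Sigma (dv m) (\<lambda>l. vr (m - l)). ?h l k)"
    proof (rule sum.reindex_bij_witness[where i = "\<lambda>(l, k). (k, l)" and j = "\<lambda>(k, l). (l, k)"], goal_cases)
      case (2 p)
      then obtain k l where p: "p = (k, l)" "k \<in> vr m" "l \<in> dv (m - var k)" by auto
      then have "l \<in> dv m \<and> var k \<in> dv (m - l)" "k < v" using dv_swap[OF m, of "var k" l] vrD[of k m] by auto
      then show ?case using minus_Idx[OF m] p by (auto simp: vr_def)
    next
      case (4 p)
      then obtain k l where p: "p = (l, k)" "l \<in> dv m" "k \<in> vr (m - l)" by auto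
      then have "l \<in> dv (m - var k) \<and> var k \<in> dv m" "k < v" using dv_swap[OF m, of l "var k"] vrD[of k "m - l"] by auto
      then show ?case using m p by (auto simp: vr_def)
    next
      case (5 p)
      then obtain k l where p: "p = (k, l)" "k \<in> vr m" "l \<in> dv (m - var k)" by auto
      then have l: "l \<in> dv m" "var k \<in> dv (m - l)" "m - var k - l = m - l - var k"
        using dv_swap[OF m, of "var k" l] vrD[of k m] by auto
      show ?case using gam_cocycle[OF m l(1) l(2)] l(3) by (simp add: p(1) sg_def mult_ac)
    qed auto
    also have "\<dots> = (\<Sum>l\<in>dv m. \<Sum>k\<in>vr (m - l). ?h l k)"
      by (rule sum.Sigma[symmetric]) (use m dv_finite finite_vr in auto)
    also have "\<dots> = act a (del Y q) m"
      using m by (simp add: act_def del_def scal_sum)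
    finally show ?thesis .
  qed
qed

text \<open>The terms cancel in pairs, as distinct variables commute up to \<open>tau\<close> and the matrices \<open>Y k\<close> up to
  \<open>- tau\<close>. A diagonal term occurs only if the square of the variable divides a monomial, so for the
  symmetric algebra, and then the matrix has square zero.\<close>

lemma del_del:
  assumes YY: "\<And>k l b. \<lbrakk>k < v; l < v; k \<noteq> l\<rbrakk> \<Longrightarrow> lin_ext (Y k) (Y l b) = - scal tau (lin_ext (Y l) (Y k b))"
    and Ysq: "\<And>k b m. \<lbrakk>k < v; m \<in> Idx; var k \<in> dv m; var k \<in> dv (m - var k)\<rbrakk> \<Longrightarrow> lin_ext (Y k) (Y k b) = 0"
  shows "del Y (del Y q) = 0"
proof
  fix m
  let ?P = "Sigma (vr m) (\<lambda>k. vr (m - var k))"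
  let ?t = "\<lambda>k l. scal (sg k m * sg l (m - var k)) (lin_ext (Y k) (lin_ext (Y l) (q (m - var k - var l))))"
  have fin: "finite ?P" using finite_vr by auto
  have swap: "(l, k) \<in> ?P \<and> ?t l k = - ?t k l" if kl: "(k, l) \<in> ?P" "k \<noteq> l" for k l
  proof -
    have m: "m \<in> Idx" "k < v" "l < v" "var k \<in> dv m" "var l \<in> dv (m - var k)" using kl vrD by auto
    note sw = dv_swap[OF m(1) m(4) m(5)]
    have 1: "(l, k) \<in> ?P" using sw m minus_Idx[OF m(1)] by (auto simp: vr_def)
    have e: "m - var l - var k = m - var k - var l" using sw by simp
    have gs: "sg k m * sg l (m - var k) = tau * (sg l m * sg k (m - var l))"
      unfolding sg_def using gam_swap[OF m(1-3) kl(2) m(4,5)] by simp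
    let ?u = "q (m - var k - var l)"
    have "lin_ext (Y k) (lin_ext (Y l) ?u) = lin_ext (\<lambda>b. - scal tau (lin_ext (Y l) (Y k b))) ?u"
      unfolding lin_ext_comp using YY[OF m(2,3) kl(2)] by presburger
    then have "lin_ext (Y k) (lin_ext (Y l) ?u) = - scal tau (lin_ext (Y l) (lin_ext (Y k) ?u))"
      by (simp add: lin_ext_comp lin_ext_uminus_fun lin_ext_scal_fun)
    then have "?t k l = - scal (sg l m * sg k (m - var l) * (tau * tau)) (lin_ext (Y l) (lin_ext (Y k) ?u))"
      by (simp add: gs mult_ac)
    then show ?thesis using 1 by (simp add: tau e)
  qed
  have diag: "?t k k = 0" if "(k, k) \<in> ?P" for k
  proof -
    have m: "m \<in> Idx" "k < v" "var k \<in> dv m" "var k \<in> dv (m - var k)" using that vrD by auto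
    show ?thesis using Ysq[OF m(2,1,3,4)] by (simp add: lin_ext_comp)
  qed
  let ?L = "{(k, l) \<in> ?P. k < l}" and ?G = "{(k, l) \<in> ?P. l < k}" and ?D = "{(k, l) \<in> ?P. k = l}"
  have "del Y (del Y q) m = (\<Sum>k\<in>vr m. \<Sum>l\<in>vr (m - var k). ?t k l)"
    unfolding del_def by (simp add: lin_ext_sum lin_ext_scal scal_sum)
  also have "\<dots> = (\<Sum>(k, l)\<in>?P. ?t k l)" by (rule sum.Sigma) (use finite_vr in auto)
  also have "?P = (?L \<union> ?G) \<union> ?D" by auto
  also have "(\<Sum>(k, l)\<in>(?L \<union> ?G) \<union> ?D. ?t k l) = (\<Sum>(k, l)\<in>?L. ?t k l) + (\<Sum>(k, l)\<in>?G. ?t k l) + (\<Sum>(k, l)\<in>?D. ?t k l)"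
    by (subst sum.union_disjoint, (auto intro: finite_subset[OF _ fin])[3], subst sum.union_disjoint)
       (auto intro: finite_subset[OF _ fin])
  also have "(\<Sum>(k, l)\<in>?D. ?t k l) = 0" by (rule sum.neutral) (use diag in auto)
  also have "(\<Sum>(k, l)\<in>?G. ?t k l) = (\<Sum>(k, l)\<in>?L. - ?t k l)"
  proof (rule sum.reindex_bij_witness[where i = "\<lambda>(l, k). (k, l)" and j = "\<lambda>(k, l). (l, k)"], goal_cases)
    case (2 p)
    then obtain k l where "p = (k, l)" "(k, l) \<in> ?P" "l < k" by blast
    then show ?case using swap[of k l] by auto
  next
    case (4 p)
    then obtain k l where "p = (k, l)" "(k, l) \<in> ?P" "k < l" by blast
    then show ?case using swap[of k l] by auto
  next
    case (5 p)
    then obtain k l where "p = (k, l)" "(k, l) \<in> ?P" "l < k" by blast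
    then show ?case using swap[of k l] by simp
  qed auto
  also have "\<dots> = - (\<Sum>(k, l)\<in>?L. ?t k l)" by (simp add: sum_negf split_beta)
  finally show "del Y (del Y q) m = 0 m" by simp
qed

lemma del_e0 [simp]: "del Y q e0 = 0"
  by (simp add: del_def vr_e0)

lemma vr_var: "k < v \<Longrightarrow> vr (var k) = {k}"
proof -
  assume k: "k < v"
  have "j = k" if "j \<in> vr (var k)" for j
  proof -
    note j = vrD[OF that]
    have "dgm (var k - var j) = 0" using dgm_minus_var[OF that] dgm_var[OF k] by simp
    then have "var k - var j = e0" using j dgm_zero by blast
    then have "var j = var k" using minus_eq_e0 j by blast
    then show ?thesis using var_inj j k by blast
  qed
  then show ?thesis using k m_minus_m[of "var k"] var_Idx by (auto simp: vr_def)
qed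

lemma del_var: "k < v \<Longrightarrow> del Y q (var k) = lin_ext (Y k) (q e0)"
  using m_minus_m[OF var_Idx] gam_e0[OF var_Idx] by (simp add: del_def vr_var sg_def)

lemma supp_in_del:
  assumes q: "q \<in> supp_in B" and Y: "\<And>k b. k < v \<Longrightarrow> b \<in> B \<Longrightarrow> Poly_Mapping.keys (Y k b) \<subseteq> B'"
  shows "del Y q \<in> supp_in B'"
proof -
  have keys: "Poly_Mapping.keys (del Y q m) \<subseteq> B'" for m
    unfolding del_def
    by (rule keys_sum_subset, rule subset_trans[OF keys_scal], rule keys_lin_ext)
      (use Y vrD supp_inD(1)[OF q] in blast)
  let ?N = "{m. del Y q m \<noteq> 0}"
  have *: "\<exists>k<v. m \<in> Idx \<and> var k \<in> dv m \<and> q (m - var k) \<noteq> 0" if "m \<in> ?N" for m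
  proof (rule ccontr)
    assume "\<not> ?thesis"
    then have "del Y q m = 0" unfolding del_def using vrD by (auto intro!: sum.neutral)
    with that show False by simp
  qed
  have "?N \<subseteq> (\<Union>k\<in>{..<v}. {m \<in> Idx. var k \<in> dv m \<and> q (m - var k) \<noteq> 0})" using * by blast
  moreover have "finite {m \<in> Idx. var k \<in> dv m \<and> q (m - var k) \<noteq> 0}" for k
  proof (rule finite_imageD)
    show "inj_on (\<lambda>m. m - var k) {m \<in> Idx. var k \<in> dv m \<and> q (m - var k) \<noteq> 0}"
      using dv_inj by (intro inj_onI) auto
    show "finite ((\<lambda>m. m - var k) ` {m \<in> Idx. var k \<in> dv m \<and> q (m - var k) \<noteq> 0})"
      by (rule finite_subset[OF _ supp_inD(2)[OF q]]) auto
  qed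
  ultimately have "finite ?N" by (meson finite_UN finite_lessThan finite_subset)
  then show ?thesis using keys by (auto simp: supp_in_def del_def vr_def)
qed

end

section \<open>Graded free complexes in coordinates\<close>

text \<open>Closure is inherited through an isomorphism: operations on the target are transported images of
  operations on the source.\<close>

lemma op_closed_iso:
  assumes "iso_complex A C D" "op_closed A C" "\<And>n d. hpart (Ob D n) d \<subseteq> carrier (Ob D n)"
  shows "op_closed A D"
proof -
  obtain f g where fg: "chain_map A C D f" "chain_map A D C g"
     "\<And>n y. y \<in> carrier (Ob D n) \<Longrightarrow> f n (g n y) = y"
    using assms(1) unfolding iso_complex_def by metis
  note f = chain_mapD(1)[OF fg(1)] and g = chain_mapD(1)[OF fg(2)]
  note C = assms(2)[unfolded op_closed_def, rule_format]
  show ?thesis unfolding op_closed_def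
  proof (intro allI conjI ballI)
    fix n x y assume x: "x \<in> carrier (Ob D n)" and y: "y \<in> carrier (Ob D n)"
    have "f n (g n x \<oplus>\<^bsub>Ob C n\<^esub> g n y) = x \<oplus>\<^bsub>Ob D n\<^esub> y"
      using graded_homD(2)[OF f] graded_homD(1)[OF g] x y fg(3) by simp
    moreover have "f n (g n x \<oplus>\<^bsub>Ob C n\<^esub> g n y) \<in> carrier (Ob D n)"
      by (rule graded_homD(1)[OF f]) (use C graded_homD(1)[OF g] x y in simp)
    ultimately show "x \<oplus>\<^bsub>Ob D n\<^esub> y \<in> carrier (Ob D n)" by simp
  next
    fix n a x assume a: "a \<in> carrier A" and x: "x \<in> carrier (Ob D n)"
    have "f n (a \<odot>\<^bsub>Ob C n\<^esub> g n x) = a \<odot>\<^bsub>Ob D n\<^esub> x"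
      using graded_homD(3)[OF f] graded_homD(1)[OF g] a x fg(3) by simp
    moreover have "f n (a \<odot>\<^bsub>Ob C n\<^esub> g n x) \<in> carrier (Ob D n)"
      by (rule graded_homD(1)[OF f]) (use C graded_homD(1)[OF g] a x in simp)
    ultimately show "a \<odot>\<^bsub>Ob D n\<^esub> x \<in> carrier (Ob D n)" by simp
  next
    fix n x assume x: "x \<in> carrier (Ob D n)"
    have gx: "g n x \<in> carrier (Ob C n)" using graded_homD(1)[OF g] x by simp
    have "f (n + 1) (Df C n (g n x)) = Df D n x"
      using chain_mapD(2)[OF fg(1) gx] fg(3) x by simp
    moreover have "f (n + 1) (Df C n (g n x)) \<in> carrier (Ob D (n + 1))"
      by (rule graded_homD(1)[OF f]) (use C gx in simp)
    ultimately show "Df D n x \<in> carrier (Ob D (n + 1))" by simp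
  next
    fix n d show "hpart (Ob D n) d \<subseteq> carrier (Ob D n)" by (rule assms(3))
  qed
qed

lemma ex_lookup_nonzero: "u \<noteq> 0 \<Longrightarrow> \<exists>b. Poly_Mapping.lookup u b \<noteq> 0"
  by (rule ccontr) (simp add: poly_mapping_eq_iff fun_eq_iff)

lemma hom_partD: "a \<in> hom_part A d \<Longrightarrow> a \<in> carrier A \<and> gcomp A d a = a"
  by (simp add: hom_part_def)

context monomial_algebra
begin

lemma hom_part_iff: "a \<in> hom_part A d \<longleftrightarrow> a \<in> carrier A \<and> (\<forall>m. co a m \<noteq> 0 \<longrightarrow> dgm m = d)"
proof
  assume a: "a \<in> hom_part A d"
  then have "a \<in> carrier A" "gcomp A d a = a" by (auto dest: hom_partD)
  then show "a \<in> carrier A \<and> (\<forall>m. co a m \<noteq> 0 \<longrightarrow> dgm m = d)" using co_gcomp[of a d] by metis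
next
  assume a: "a \<in> carrier A \<and> (\<forall>m. co a m \<noteq> 0 \<longrightarrow> dgm m = d)"
  then have "gcomp A d a = a" using gcomp_closed co_gcomp[of a d] by (intro co_inj) auto
  then show "a \<in> hom_part A d" using a by (simp add: hom_part_def)
qed

lemma co_finsum:
  assumes "finite S" "\<And>x. x \<in> S \<Longrightarrow> f x \<in> carrier A"
  shows "finsum A f S \<in> carrier A \<and> co (finsum A f S) m = (\<Sum>x\<in>S. co (f x) m)"
proof -
  interpret ring A by (rule ring_A)
  show ?thesis using assms
    by (induction S rule: finite_induct) (simp_all add: co_add Pi_def)
qed

lemma free_simps:
  "\<zero>\<^bsub>free_gmodule A B dg\<^esub> = (\<lambda>b. \<zero>\<^bsub>A\<^esub>)"
  "\<phi> \<oplus>\<^bsub>free_gmodule A B dg\<^esub> \<psi> = (\<lambda>b. \<phi> b \<oplus>\<^bsub>A\<^esub> \<psi> b)"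
  "a \<odot>\<^bsub>free_gmodule A B dg\<^esub> \<phi> = (\<lambda>b. a \<otimes>\<^bsub>A\<^esub> \<phi> b)"
  by (simp_all add: free_gmodule_def)

lemma carrier_free: "\<phi> \<in> carrier (free_gmodule A B dg) \<longleftrightarrow> (\<forall>b. \<phi> b \<in> carrier A) \<and>
    (\<forall>b. b \<notin> B \<longrightarrow> \<phi> b = \<zero>\<^bsub>A\<^esub>) \<and> finite {b. \<phi> b \<noteq> \<zero>\<^bsub>A\<^esub>}"
  by (simp add: free_gmodule_def)

lemma hpart_free: "\<phi> \<in> hpart (free_gmodule A B dg) t \<longleftrightarrow> \<phi> \<in> carrier (free_gmodule A B dg) \<and>
    (\<forall>b\<in>B. \<phi> b \<in> hom_part A (t - dg b))"
  by (simp add: free_gmodule_def)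

lemma free_add_closed:
  assumes "\<phi> \<in> carrier (free_gmodule A B dg)" "\<psi> \<in> carrier (free_gmodule A B dg)"
  shows "(\<lambda>b. \<phi> b \<oplus>\<^bsub>A\<^esub> \<psi> b) \<in> carrier (free_gmodule A B dg)"
proof -
  interpret ring A by (rule ring_A)
  have "{b. \<phi> b \<oplus>\<^bsub>A\<^esub> \<psi> b \<noteq> \<zero>\<^bsub>A\<^esub>} \<subseteq> {b. \<phi> b \<noteq> \<zero>\<^bsub>A\<^esub>} \<union> {b. \<psi> b \<noteq> \<zero>\<^bsub>A\<^esub>}" by auto
  then have "finite {b. \<phi> b \<oplus>\<^bsub>A\<^esub> \<psi> b \<noteq> \<zero>\<^bsub>A\<^esub>}"
    by (rule finite_subset) (use assms in \<open>simp add: carrier_free\<close>)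
  then show ?thesis using assms by (simp add: carrier_free)
qed

lemma free_smult_closed:
  assumes "a \<in> carrier A" "\<phi> \<in> carrier (free_gmodule A B dg)"
  shows "(\<lambda>b. a \<otimes>\<^bsub>A\<^esub> \<phi> b) \<in> carrier (free_gmodule A B dg)"
proof -
  interpret ring A by (rule ring_A)
  have "{b. a \<otimes>\<^bsub>A\<^esub> \<phi> b \<noteq> \<zero>\<^bsub>A\<^esub>} \<subseteq> {b. \<phi> b \<noteq> \<zero>\<^bsub>A\<^esub>}" using assms(1) by auto
  then have "finite {b. a \<otimes>\<^bsub>A\<^esub> \<phi> b \<noteq> \<zero>\<^bsub>A\<^esub>}"
    by (rule finite_subset) (use assms in \<open>simp add: carrier_free\<close>)
  then show ?thesis using assms by (simp add: carrier_free)
qed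

text \<open>The passage from \<open>A\<close>-valued functions on the generators to vector-valued functions on monomials;
  \<open>coeff_mat\<close> and \<open>coeff_complex\<close> express the differential of a free complex in these terms.\<close>

definition coeff_fun :: "('b \<Rightarrow> 'r) \<Rightarrow> 'm \<Rightarrow> ('b \<Rightarrow>\<^sub>0 'k)" where
  "coeff_fun \<phi> = (\<lambda>m. \<Sum>b\<in>{b. \<phi> b \<noteq> \<zero>\<^bsub>A\<^esub>}. Poly_Mapping.single b (co (\<phi> b) m))"

definition coeff_mat :: "('r, 'b) free_data \<Rightarrow> int \<Rightarrow> 'm \<Rightarrow> 'b \<Rightarrow> ('b \<Rightarrow>\<^sub>0 'k)" where
  "coeff_mat X n r b = (\<Sum>c\<in>{c \<in> Gens X (n + 1). Mat X n c b \<noteq> \<zero>\<^bsub>A\<^esub>}. Poly_Mapping.single c (co (Mat X n c b) r))"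

definition coeff_complex :: "('r, 'b) free_data \<Rightarrow> ('r, 'm \<Rightarrow> ('b \<Rightarrow>\<^sub>0 'k)) gcomplex" where
  "coeff_complex X = \<lparr>Ob = (\<lambda>n. Tm (Gens X n) (gdeg X n)),
     Df = (\<lambda>n q m. if m \<in> Idx then \<Sum>l\<in>dv m. scal (gam l (m - l)) (lin_ext (coeff_mat X n (m - l)) (q l)) else 0)\<rparr>"

definition col_finite :: "('r, 'b) free_data \<Rightarrow> bool" where
  "col_finite X \<longleftrightarrow> (\<forall>n. \<forall>b\<in>Gens X n. (\<forall>c\<in>Gens X (n + 1). Mat X n c b \<in> carrier A) \<and>
      finite {c \<in> Gens X (n + 1). Mat X n c b \<noteq> \<zero>\<^bsub>A\<^esub>})"

lemma lookup_coeff_fun: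
  "\<phi> \<in> carrier (free_gmodule A B dg) \<Longrightarrow> Poly_Mapping.lookup (coeff_fun \<phi> m) b = co (\<phi> b) m"
  by (auto simp: coeff_fun_def carrier_free lookup_sum_single)

lemma lookup_coeff_mat:
  "col_finite X \<Longrightarrow> b \<in> Gens X n \<Longrightarrow>
    Poly_Mapping.lookup (coeff_mat X n r b) c = (if c \<in> Gens X (n + 1) then co (Mat X n c b) r else 0)"
  by (auto simp: coeff_mat_def col_finite_def lookup_sum_single)

lemma keys_coeff_mat: "Poly_Mapping.keys (coeff_mat X n r b) \<subseteq> Gens X (n + 1)"
  unfolding coeff_mat_def by (rule keys_sum_subset) (auto split: if_splits)

lemma coeff_fun_supp_in:
  assumes "\<phi> \<in> carrier (free_gmodule A B dg)"
  shows "coeff_fun \<phi> \<in> supp_in B"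
proof -
  have f: "finite {b. \<phi> b \<noteq> \<zero>\<^bsub>A\<^esub>}" "\<And>b. \<phi> b \<in> carrier A" "\<And>b. b \<notin> B \<Longrightarrow> \<phi> b = \<zero>\<^bsub>A\<^esub>"
    using assms by (auto simp: carrier_free)
  have "{m. coeff_fun \<phi> m \<noteq> 0} \<subseteq> (\<Union>b\<in>{b. \<phi> b \<noteq> \<zero>\<^bsub>A\<^esub>}. {m. co (\<phi> b) m \<noteq> 0})"
  proof
    fix m assume "m \<in> {m. coeff_fun \<phi> m \<noteq> 0}"
    then obtain b where "Poly_Mapping.lookup (coeff_fun \<phi> m) b \<noteq> 0"
      using ex_lookup_nonzero by blast
    then have "co (\<phi> b) m \<noteq> 0" by (simp add: lookup_coeff_fun[OF assms])
    moreover from this have "\<phi> b \<noteq> \<zero>\<^bsub>A\<^esub>" using co_zero[of m] by metis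
    ultimately show "m \<in> (\<Union>b\<in>{b. \<phi> b \<noteq> \<zero>\<^bsub>A\<^esub>}. {m. co (\<phi> b) m \<noteq> 0})" by blast
  qed
  moreover have "finite (\<Union>b\<in>{b. \<phi> b \<noteq> \<zero>\<^bsub>A\<^esub>}. {m. co (\<phi> b) m \<noteq> 0})" using f co_finite by auto
  ultimately have fin: "finite {m. coeff_fun \<phi> m \<noteq> 0}" by (rule finite_subset)
  have "Poly_Mapping.keys (coeff_fun \<phi> m) \<subseteq> B" for m
  proof
    fix b assume "b \<in> Poly_Mapping.keys (coeff_fun \<phi> m)"
    then have "co (\<phi> b) m \<noteq> 0" by (simp add: in_keys_iff lookup_coeff_fun[OF assms])
    then show "b \<in> B" by (rule contrapos_np) (simp add: f(3))
  qed
  moreover have "coeff_fun \<phi> m = 0" if "m \<notin> Idx" for m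
    by (rule poly_mapping_eqI) (simp add: lookup_coeff_fun[OF assms] co_Idx f that)
  ultimately show ?thesis using fin by (simp add: supp_in_def)
qed

lemma coeff_fun_surj:
  assumes q: "q \<in> supp_in B"
  shows "\<exists>\<phi>\<in>carrier (free_gmodule A B dg). coeff_fun \<phi> = q"
proof
  let ?\<phi> = "\<lambda>b. mk (\<lambda>m. Poly_Mapping.lookup (q m) b)"
  have 1: "finite {m. Poly_Mapping.lookup (q m) b \<noteq> 0}" "{m. Poly_Mapping.lookup (q m) b \<noteq> 0} \<subseteq> Idx" for b
  proof -
    have "{m. Poly_Mapping.lookup (q m) b \<noteq> 0} \<subseteq> {m. q m \<noteq> 0}" by auto
    then show "finite {m. Poly_Mapping.lookup (q m) b \<noteq> 0}" "{m. Poly_Mapping.lookup (q m) b \<noteq> 0} \<subseteq> Idx"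
      using supp_inD(2)[OF q] supp_inD(3)[OF q] by (auto intro: finite_subset)
  qed
  note mk' = mk[OF 1]
  have "{b. ?\<phi> b \<noteq> \<zero>\<^bsub>A\<^esub>} \<subseteq> (\<Union>m\<in>{m. q m \<noteq> 0}. Poly_Mapping.keys (q m))"
  proof
    fix b assume "b \<in> {b. ?\<phi> b \<noteq> \<zero>\<^bsub>A\<^esub>}"
    then have "\<not> (\<forall>m. co (?\<phi> b) m = co \<zero>\<^bsub>A\<^esub> m)" using co_inj[OF mk'(1)[of b] zero_closed] by blast
    then obtain m where "co (?\<phi> b) m \<noteq> 0" by auto
    then have "Poly_Mapping.lookup (q m) b \<noteq> 0" by (simp add: mk'(2))
    then have "b \<in> Poly_Mapping.keys (q m)" "q m \<noteq> 0" by (simp_all add: in_keys_iff) auto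
    then show "b \<in> (\<Union>m\<in>{m. q m \<noteq> 0}. Poly_Mapping.keys (q m))" by blast
  qed
  then have fin: "finite {b. ?\<phi> b \<noteq> \<zero>\<^bsub>A\<^esub>}" using supp_inD(2)[OF q] by (auto intro: finite_subset)
  have z: "?\<phi> b = \<zero>\<^bsub>A\<^esub>" if "b \<notin> B" for b
  proof (rule co_inj[OF mk'(1) zero_closed])
    fix m have "b \<notin> Poly_Mapping.keys (q m)" using supp_inD(1)[OF q, of m] that by blast
    then show "co (?\<phi> b) m = co \<zero>\<^bsub>A\<^esub> m" by (simp add: mk'(2) in_keys_iff)
  qed
  show c: "?\<phi> \<in> carrier (free_gmodule A B dg)" using fin z mk'(1) by (simp add: carrier_free)
  show "coeff_fun ?\<phi> = q"
    by (rule ext, rule poly_mapping_eqI) (simp add: lookup_coeff_fun[OF c] mk'(2))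
qed

lemma coeff_fun_inj:
  assumes "\<phi> \<in> carrier (free_gmodule A B dg)" "\<psi> \<in> carrier (free_gmodule A B dg)" "coeff_fun \<phi> = coeff_fun \<psi>"
  shows "\<phi> = \<psi>"
proof
  fix b show "\<phi> b = \<psi> b"
    by (rule co_inj) (use assms in \<open>auto simp: carrier_free lookup_coeff_fun[OF assms(1), symmetric] lookup_coeff_fun[OF assms(2), symmetric]\<close>)
qed

lemma coeff_fun_add:
  assumes "\<phi> \<in> carrier (free_gmodule A B dg)" "\<psi> \<in> carrier (free_gmodule A B dg)"
  shows "coeff_fun (\<lambda>b. \<phi> b \<oplus>\<^bsub>A\<^esub> \<psi> b) = coeff_fun \<phi> + coeff_fun \<psi>"
proof (rule ext, rule poly_mapping_eqI)
  fix m b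
  have "\<phi> b \<in> carrier A" "\<psi> b \<in> carrier A" using assms by (auto simp: carrier_free)
  then show "Poly_Mapping.lookup (coeff_fun (\<lambda>b. \<phi> b \<oplus>\<^bsub>A\<^esub> \<psi> b) m) b = Poly_Mapping.lookup ((coeff_fun \<phi> + coeff_fun \<psi>) m) b"
    by (simp add: lookup_coeff_fun[OF free_add_closed[OF assms]] lookup_coeff_fun[OF assms(1)] lookup_coeff_fun[OF assms(2)] lookup_add co_add)
qed

lemma coeff_fun_act:
  assumes "a \<in> carrier A" "\<phi> \<in> carrier (free_gmodule A B dg)"
  shows "coeff_fun (\<lambda>b. a \<otimes>\<^bsub>A\<^esub> \<phi> b) = act a (coeff_fun \<phi>)"
proof (rule ext, rule poly_mapping_eqI)
  fix m b
  interpret ring A by (rule ring_A)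
  have p: "\<phi> b \<in> carrier A" using assms by (auto simp: carrier_free)
  show "Poly_Mapping.lookup (coeff_fun (\<lambda>b. a \<otimes>\<^bsub>A\<^esub> \<phi> b) m) b = Poly_Mapping.lookup (act a (coeff_fun \<phi>) m) b"
    by (simp add: lookup_coeff_fun[OF free_smult_closed[OF assms]] act_def lookup_sum lookup_coeff_fun[OF assms(2)]
        co_mult co_Idx assms(1) p)
qed

lemma coeff_fun_hpart:
  assumes "\<phi> \<in> carrier (free_gmodule A B dg)"
  shows "\<phi> \<in> hpart (free_gmodule A B dg) t \<longleftrightarrow> coeff_fun \<phi> \<in> hpart (Tm B dg) t"
proof -
  have p: "\<phi> b \<in> carrier A" for b using assms by (auto simp: carrier_free)
  have "\<phi> \<in> hpart (free_gmodule A B dg) t \<longleftrightarrow> (\<forall>b\<in>B. \<forall>m. co (\<phi> b) m \<noteq> 0 \<longrightarrow> dgm m = t - dg b)"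
    using assms p by (auto simp: hpart_free hom_part_iff)
  also have "\<dots> \<longleftrightarrow> (\<forall>m. \<forall>b. co (\<phi> b) m \<noteq> 0 \<longrightarrow> dgm m + dg b = t)"
  proof -
    have "co (\<phi> b) m = 0" if "b \<notin> B" for b m using assms that by (auto simp: carrier_free)
    then have "(\<forall>b\<in>B. \<forall>m. co (\<phi> b) m \<noteq> 0 \<longrightarrow> dgm m = t - dg b) \<longleftrightarrow> (\<forall>b. \<forall>m. co (\<phi> b) m \<noteq> 0 \<longrightarrow> dgm m = t - dg b)"
      by metis
    then show ?thesis by (auto simp: algebra_simps)
  qed
  also have "\<dots> \<longleftrightarrow> coeff_fun \<phi> \<in> hpart (Tm B dg) t"
    by (simp add: hpart_Tm coeff_fun_supp_in[OF assms] in_keys_iff Ball_def lookup_coeff_fun[OF assms])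
  finally show ?thesis .
qed

lemma coeff_fun_hpartD: "\<phi> \<in> hpart (free_gmodule A B dg) t \<Longrightarrow> coeff_fun \<phi> \<in> hpart (Tm B dg) t"
  using coeff_fun_hpart hpart_free by blast

lemma free_complex_simps:
  "Ob (free_complex_of A X) n = free_gmodule A (Gens X n) (gdeg X n)"
  "Df (free_complex_of A X) n \<phi> = (\<lambda>c. if c \<in> Gens X (n + 1)
                    then \<Oplus>\<^bsub>A\<^esub>b\<in>{b. \<phi> b \<noteq> \<zero>\<^bsub>A\<^esub>}. \<phi> b \<otimes>\<^bsub>A\<^esub> Mat X n c b
                    else \<zero>\<^bsub>A\<^esub>)"
  by (simp_all add: free_complex_of_def)

lemma free_Df_closed:
  assumes X: "col_finite X" and p: "\<phi> \<in> carrier (free_gmodule A (Gens X n) (gdeg X n))"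
  shows "Df (free_complex_of A X) n \<phi> \<in> carrier (free_gmodule A (Gens X (n + 1)) (gdeg X (n + 1)))"
proof -
  interpret ring A by (rule ring_A)
  let ?S = "{b. \<phi> b \<noteq> \<zero>\<^bsub>A\<^esub>}"
  have S: "finite ?S" "\<And>b. \<phi> b \<in> carrier A" "?S \<subseteq> Gens X n" using p by (auto simp: carrier_free)
  have M: "\<And>b c. b \<in> ?S \<Longrightarrow> c \<in> Gens X (n + 1) \<Longrightarrow> Mat X n c b \<in> carrier A"
     "\<And>b. b \<in> ?S \<Longrightarrow> finite {c \<in> Gens X (n + 1). Mat X n c b \<noteq> \<zero>\<^bsub>A\<^esub>}"
    using X S(3) by (auto simp: col_finite_def)
  have "{c. Df (free_complex_of A X) n \<phi> c \<noteq> \<zero>\<^bsub>A\<^esub>} \<subseteq> (\<Union>b\<in>?S. {c \<in> Gens X (n + 1). Mat X n c b \<noteq> \<zero>\<^bsub>A\<^esub>})"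
  proof (rule subsetI, rule ccontr)
    fix c assume c: "c \<in> {c. Df (free_complex_of A X) n \<phi> c \<noteq> \<zero>\<^bsub>A\<^esub>}"
      and n: "c \<notin> (\<Union>b\<in>?S. {c \<in> Gens X (n + 1). Mat X n c b \<noteq> \<zero>\<^bsub>A\<^esub>})"
    then have cG: "c \<in> Gens X (n + 1)" by (auto simp: free_complex_simps split: if_splits)
    have "(\<Oplus>\<^bsub>A\<^esub>b\<in>?S. \<phi> b \<otimes>\<^bsub>A\<^esub> Mat X n c b) = \<zero>\<^bsub>A\<^esub>"
      by (rule add.finprod_one_eqI) (use n cG S in auto)
    then show False using c cG by (auto simp: free_complex_simps)
  qed
  moreover have "finite (\<Union>b\<in>?S. {c \<in> Gens X (n + 1). Mat X n c b \<noteq> \<zero>\<^bsub>A\<^esub>})" using S M by auto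
  ultimately have "finite {c. Df (free_complex_of A X) n \<phi> c \<noteq> \<zero>\<^bsub>A\<^esub>}" by (rule finite_subset)
  then show ?thesis using S M by (auto simp: carrier_free free_complex_simps intro!: finsum_closed)
qed

lemma coeff_fun_Df:
  assumes X: "col_finite X" and p: "\<phi> \<in> carrier (free_gmodule A (Gens X n) (gdeg X n))"
  shows "coeff_fun (Df (free_complex_of A X) n \<phi>) = Df (coeff_complex X) n (coeff_fun \<phi>)"
proof (rule ext, rule poly_mapping_eqI)
  fix m c
  interpret ring A by (rule ring_A)
  let ?S = "{b. \<phi> b \<noteq> \<zero>\<^bsub>A\<^esub>}"
  have S: "finite ?S" "\<And>b. \<phi> b \<in> carrier A" "?S \<subseteq> Gens X n" using p by (auto simp: carrier_free)
  have M: "\<And>b c. b \<in> ?S \<Longrightarrow> c \<in> Gens X (n + 1) \<Longrightarrow> Mat X n c b \<in> carrier A"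
    using X S(3) by (auto simp: col_finite_def)
  have L: "Poly_Mapping.lookup (coeff_fun (Df (free_complex_of A X) n \<phi>) m) c = co (Df (free_complex_of A X) n \<phi> c) m"
    by (rule lookup_coeff_fun[OF free_Df_closed[OF X p]])
  have K: "Poly_Mapping.keys (coeff_fun \<phi> l) \<subseteq> ?S" for l
  proof
    fix b assume "b \<in> Poly_Mapping.keys (coeff_fun \<phi> l)"
    then have "co (\<phi> b) l \<noteq> 0" by (simp add: in_keys_iff lookup_coeff_fun[OF p])
    then show "b \<in> ?S" by auto
  qed
  have R: "Poly_Mapping.lookup (lin_ext (coeff_mat X n r) (coeff_fun \<phi> l)) c =
      (if c \<in> Gens X (n + 1) then \<Sum>b\<in>?S. co (\<phi> b) l * co (Mat X n c b) r else 0)" for l r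
  proof -
    have "Poly_Mapping.lookup (lin_ext (coeff_mat X n r) (coeff_fun \<phi> l)) c =
      (\<Sum>b\<in>?S. co (\<phi> b) l * Poly_Mapping.lookup (coeff_mat X n r b) c)"
      by (simp add: lin_ext_superset[OF S(1) K] lookup_sum lookup_coeff_fun[OF p])
    also have "\<dots> = (if c \<in> Gens X (n + 1) then \<Sum>b\<in>?S. co (\<phi> b) l * co (Mat X n c b) r else 0)"
      using S(3) by (auto simp: lookup_coeff_mat[OF X] intro!: sum.cong sum.neutral)
    finally show ?thesis .
  qed
  show "Poly_Mapping.lookup (coeff_fun (Df (free_complex_of A X) n \<phi>) m) c = Poly_Mapping.lookup (Df (coeff_complex X) n (coeff_fun \<phi>) m) c"
  proof (cases "m \<in> Idx \<and> c \<in> Gens X (n + 1)")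
    case True
    have "co (Df (free_complex_of A X) n \<phi> c) m = (\<Sum>b\<in>?S. co (\<phi> b \<otimes>\<^bsub>A\<^esub> Mat X n c b) m)"
      unfolding free_complex_simps using True M S
      by (simp del: not_not, intro co_finsum[THEN conjunct2]) auto
    also have "\<dots> = (\<Sum>b\<in>?S. \<Sum>l\<in>dv m. gam l (m - l) * co (\<phi> b) l * co (Mat X n c b) (m - l))"
      using True M S by (intro sum.cong) (auto simp: co_mult)
    also have "\<dots> = (\<Sum>l\<in>dv m. \<Sum>b\<in>?S. gam l (m - l) * co (\<phi> b) l * co (Mat X n c b) (m - l))"
      by (rule sum.swap)
    also have "\<dots> = Poly_Mapping.lookup (Df (coeff_complex X) n (coeff_fun \<phi>) m) c"
      using True by (simp add: coeff_complex_def lookup_sum R sum_distrib_left mult.assoc)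
    finally show ?thesis using L by simp
  next
    case False
    have cc: "Df (free_complex_of A X) n \<phi> c \<in> carrier A"
      using free_Df_closed[OF X p] by (simp add: carrier_free)
    have "co (Df (free_complex_of A X) n \<phi> c) m = 0"
    proof (cases "m \<in> Idx")
      case True
      then show ?thesis using False by (simp add: free_complex_simps)
    qed (simp add: co_Idx[OF cc])
    moreover have "Poly_Mapping.lookup (Df (coeff_complex X) n (coeff_fun \<phi>) m) c = 0"
      using False by (auto simp: coeff_complex_def lookup_sum R)
    ultimately show ?thesis using L by simp
  qed
qed

lemma op_closed_free: "col_finite X \<Longrightarrow> op_closed A (free_complex_of A X)"
  unfolding op_closed_def
  by (auto simp: free_complex_simps(1) free_simps free_add_closed free_smult_closed free_Df_closed hpart_free)

lemma chain_map_coeff_fun: "col_finite X \<Longrightarrow> chain_map A (free_complex_of A X) (coeff_complex X) (\<lambda>n. coeff_fun)"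
  unfolding chain_map_def
proof (intro allI conjI ballI)
  fix n assume X: "col_finite X"
  show "coeff_fun \<in> graded_hom A (Ob (free_complex_of A X) n) (Ob (coeff_complex X) n)"
    by (rule graded_homI)
      (simp_all add: coeff_complex_def free_complex_simps(1) free_simps coeff_fun_supp_in coeff_fun_add coeff_fun_act coeff_fun_hpartD)
qed (simp add: coeff_fun_Df free_complex_simps(1))

lemma free_iso:
  assumes X: "col_finite X"
  shows "iso_complex A (free_complex_of A X) (coeff_complex X)"
proof (rule iso_complexI[OF chain_map_coeff_fun[OF X] op_closed_free[OF X]])
  fix n
  show "bij_betw coeff_fun (carrier (Ob (free_complex_of A X) n)) (carrier (Ob (coeff_complex X) n))"
    unfolding bij_betw_def
    using coeff_fun_surj[of _ "Gens X n" "gdeg X n"]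
    by (auto simp: coeff_complex_def free_complex_simps(1) coeff_fun_supp_in image_iff intro!: inj_onI coeff_fun_inj)
qed (auto simp: coeff_complex_def free_complex_simps(1) coeff_fun_hpart hpart_Tm)

lemma op_closed_coeff_complex: "col_finite X \<Longrightarrow> op_closed A (coeff_complex X)"
  by (rule op_closed_iso[OF free_iso op_closed_free]) (auto simp: coeff_complex_def hpart_Tm)

lemma coeff_complex_Df_e0:
  "Df (coeff_complex X) n q e0 = lin_ext (coeff_mat X n e0) (q e0)"
  using e0_Idx gam_e0 m_e0[OF e0_Idx] by (simp add: coeff_complex_def dv_e0)

end

section \<open>The perturbation lemma\<close>

text \<open>The perturbation argument takes place among additive maps of an abelian group.\<close>

definition additive_fun :: "('f::ab_group_add \<Rightarrow> 'g::ab_group_add) \<Rightarrow> bool" where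
  "additive_fun f \<longleftrightarrow> (\<forall>x y. f (x + y) = f x + f y)"

lemma additive_funD:
  assumes "additive_fun f"
  shows "f (x + y) = f x + f y" "f 0 = 0" "f (- x) = - f x" "f (x - y) = f x - f y"
proof -
  show 1: "f (x + y) = f x + f y" for x y using assms by (simp add: additive_fun_def)
  show 2: "f 0 = 0" using 1[of 0 0] by simp
  show 3: "f (- x) = - f x" for x using 1[of x "- x"] 2 by (simp add: add_eq_0_iff)
  show "f (x - y) = f x - f y" using 1[of x "- y"] 3 by simp
qed

text \<open>The homological perturbation lemma as algebra. A differential \<open>d\<close> with homotopy \<open>h\<close> is perturbed by
  \<open>p\<close>; instead of a convergent series the perturbed homotopy \<open>h'\<close> is a common solution of the two
  equations which the series \<open>h - h p h + \<dots>\<close> satisfies. The map \<open>q\<close> is the projection homotopic to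
  the identity which belongs to \<open>h'\<close>.\<close>

locale perturbation =
  fixes d p h h' :: "'f::ab_group_add \<Rightarrow> 'f"
  assumes add: "additive_fun d" "additive_fun p" "additive_fun h" "additive_fun h'"
    and dd: "\<And>x. d (d x) = 0" and dp: "\<And>x. d (p x) + p (d x) = 0" and pp: "\<And>x. p (p x) = 0"
    and hh: "\<And>x. h (h x) = 0" and hdh: "\<And>x. h (d (h x)) = h x"
    and left: "\<And>x. h' x = h x - h (p (h' x))" and right: "\<And>x. h' x = h x - h' (p (h x))"
begin

lemmas ad = additive_funD[OF add(1)] additive_funD[OF add(2)] additive_funD[OF add(3)] additive_funD[OF add(4)]

definition D where "D x = d x + p x"
definition q where "q x = x - D (h' x) - h' (D x)"

lemma D_ad: "D (x + y) = D x + D y" "D 0 = 0" "D (- x) = - D x" "D (x - y) = D x - D y"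
  by (simp_all add: D_def ad)

lemma q_ad: "q (x + y) = q x + q y" "q 0 = 0" "q (- x) = - q x" "q (x - y) = q x - q y"
  by (simp_all add: q_def D_ad ad)

lemma DD: "D (D x) = 0"
  using dd[of x] dp[of x] pp[of x] by (simp add: D_def ad add.assoc)

lemma hh'1: "h (h' x) = 0"
  by (subst left) (simp add: ad hh)

lemma h'h': "h' (h' x) = 0"
  by (subst right) (simp add: hh'1 ad)

lemma hph': "h (p (h' x)) = h x - h' x" using left[of x] by (simp add: algebra_simps)

lemma h'ph: "h' (p (h x)) = h x - h' x" using right[of x] by (simp add: algebra_simps)

lemma hDh': "h (d (h' x)) = h' x"
proof -
  have "h (d (h' x)) = h (d (h x)) - h (d (h (p (h' x))))"
    by (subst left) (simp add: ad)
  then show ?thesis using left[of x] by (simp add: hdh)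
qed

lemma h'Dh': "h' (D (h' x)) = h' x"
proof -
  have "h' (d (h' x)) = h (d (h' x)) - h' (p (h (d (h' x))))"
    by (rule right)
  then have "h' (d (h' x)) = h' x - h' (p (h' x))" by (simp add: hDh')
  then show ?thesis by (simp add: D_def ad)
qed

lemma qh': "q (h' x) = 0" and h'q: "h' (q x) = 0"
  by (simp_all add: q_def ad D_ad h'h' h'Dh')

lemma qD: "q (D x) = D (q x)"
  by (simp add: q_def ad D_ad DD)

lemma qh: "q (h x) = 0"
proof -
  have "h x = h' (x + p (h x))" by (simp add: ad h'ph)
  then show ?thesis using qh' by metis
qed

lemma hq: "h (q x) = 0"
proof -
  have "h (q x) = h' (q x) + h (p (h' (q x)))" by (simp add: hph')
  then show ?thesis by (simp add: h'q ad)
qed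

lemma qq: "q (q x) = q x"
proof -
  have "q (q x) = q x - D (h' (q x)) - h' (D (q x))" by (simp add: q_def[of "q x"])
  also have "h' (D (q x)) = h' (q (D x))" by (simp add: qD)
  finally show ?thesis by (simp add: h'q D_ad)
qed

text \<open>The unperturbed projection \<open>1 - d h - h d\<close> may be inserted between two copies of \<open>q\<close>. This is why
  the images of the two projections are isomorphic.\<close>

lemma q_proj_q: "q (q x - d (h (q x)) - h (d (q x))) = q x"
  by (simp add: q_ad qq hq ad qh)

end

context monomial_algebra
begin

lemma hpart_Tm_subset: "q \<in> hpart (Tm B dg) t \<longleftrightarrow>
    q \<in> supp_in B \<and> (\<forall>m. Poly_Mapping.keys (q m) \<subseteq> {b. dgm m + dg b = t})"
  by (auto simp: hpart_Tm)

lemma hom_minus: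
  assumes f: "f \<in> graded_hom A (Tm B dg) (Tm B' dg')" and g: "g \<in> graded_hom A (Tm B dg) (Tm B' dg')"
  shows "(\<lambda>x. f x - g x) \<in> graded_hom A (Tm B dg) (Tm B' dg')"
proof (rule graded_homI)
  fix x d assume x: "x \<in> hpart (Tm B dg) d"
  then have "f x \<in> hpart (Tm B' dg') d" "g x \<in> hpart (Tm B' dg') d" using graded_homD(4)[OF f] graded_homD(4)[OF g] by auto
  then show "f x - g x \<in> hpart (Tm B' dg') d"
    unfolding hpart_Tm_subset by (simp add: supp_in_diff keys_diff_subset)
qed (use graded_homD[OF f] graded_homD[OF g] in \<open>simp_all add: supp_in_diff act_diff\<close>)

lemma hom_plus:
  assumes f: "f \<in> graded_hom A (Tm B dg) (Tm B' dg')" and g: "g \<in> graded_hom A (Tm B dg) (Tm B' dg')"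
  shows "(\<lambda>x. f x + g x) \<in> graded_hom A (Tm B dg) (Tm B' dg')"
proof (rule graded_homI)
  fix x d assume x: "x \<in> hpart (Tm B dg) d"
  then have "f x \<in> hpart (Tm B' dg') d" "g x \<in> hpart (Tm B' dg') d" using graded_homD(4)[OF f] graded_homD(4)[OF g] by auto
  then show "f x + g x \<in> hpart (Tm B' dg') d"
    unfolding hpart_Tm_subset by (simp add: supp_in_add keys_add_subset)
qed (use graded_homD[OF f] graded_homD[OF g] in \<open>simp_all add: supp_in_add act_add\<close>)

lemma hom_id: "(\<lambda>x. x) \<in> graded_hom A (Tm B dg) (Tm B dg)"
  by (rule graded_homI) simp_all

definition pw :: "('b \<Rightarrow> ('c \<Rightarrow>\<^sub>0 'k)) \<Rightarrow> ('m \<Rightarrow> ('b \<Rightarrow>\<^sub>0 'k)) \<Rightarrow> 'm \<Rightarrow> ('c \<Rightarrow>\<^sub>0 'k)" where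
  "pw Y q = (\<lambda>m. lin_ext Y (q m))"

lemma pw_add: "pw Y (x + y) = pw Y x + pw Y y" by (rule ext) (simp add: pw_def lin_ext_add)
lemma pw_zero: "pw Y 0 = 0" by (rule ext) (simp add: pw_def)
lemma pw_act: "pw Y (act a q) = act a (pw Y q)" unfolding pw_def by (rule act_lin_ext)
lemma pw_pw: "pw Y (pw Z q) = pw (\<lambda>b. lin_ext Y (Z b)) q" by (simp add: pw_def lin_ext_comp)

lemma pw_hom:
  assumes "\<And>b. b \<in> B \<Longrightarrow> Poly_Mapping.keys (Y b) \<subseteq> {c \<in> B'. dg' c = dg b}"
  shows "pw Y \<in> graded_hom A (Tm B dg) (Tm B' dg')"
proof -
  have supp: "pw Y q \<in> supp_in B'" if q: "q \<in> supp_in B" for q unfolding pw_def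
    by (rule supp_in_comp[OF q]) (simp, rule keys_lin_ext, use assms in blast)
  show ?thesis
  proof (rule graded_homI)
    fix q t assume q: "q \<in> hpart (Tm B dg) t"
    have "Poly_Mapping.keys (pw Y q m) \<subseteq> {c. dgm m + dg' c = t}" for m unfolding pw_def
    proof (rule keys_lin_ext)
      fix b assume b: "b \<in> Poly_Mapping.keys (q m)"
      then have "b \<in> B" "dgm m + dg b = t" using q by (auto simp: hpart_Tm dest: supp_inD(1))
      then show "Poly_Mapping.keys (Y b) \<subseteq> {c. dgm m + dg' c = t}" using assms[of b] by auto
    qed
    then show "pw Y q \<in> hpart (Tm B' dg') t" using supp[of q] q by (auto simp: hpart_Tm)
  qed (simp_all add: supp pw_add pw_act)
qed

lemma del_hom:
  assumes "\<And>k b. k < v \<Longrightarrow> b \<in> B \<Longrightarrow> Poly_Mapping.keys (Y k b) \<subseteq> {c \<in> B'. dg' c = dg b + eta}"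
  shows "del Y \<in> graded_hom A (Tm B dg) (Tm B' dg')"
proof -
  have supp: "del Y q \<in> supp_in B'" if q: "q \<in> supp_in B" for q
    by (rule supp_in_del[OF q]) (use assms in blast)
  show ?thesis
  proof (rule graded_homI)
    fix q t assume q: "q \<in> hpart (Tm B dg) t"
    have "Poly_Mapping.keys (del Y q m) \<subseteq> {c. dgm m + dg' c = t}" for m unfolding del_def
    proof (rule keys_sum_subset, rule subset_trans[OF keys_scal], rule keys_lin_ext)
      fix k b assume k: "k \<in> vr m" and b: "b \<in> Poly_Mapping.keys (q (m - var k))"
      then have "b \<in> B" "dgm (m - var k) + dg b = t" using q by (auto simp: hpart_Tm dest: supp_inD(1))
      then show "Poly_Mapping.keys (Y k b) \<subseteq> {c. dgm m + dg' c = t}"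
        using assms[of k b] vrD[OF k] dgm_minus_var[OF k] by auto
    qed
    then show "del Y q \<in> hpart (Tm B' dg') t" using supp[of q] q by (auto simp: hpart_Tm)
  qed (simp_all add: supp del_add del_act)
qed

end

text \<open>Indices of an adapted basis: \<open>Co\<close> marks the basis of a complement of the cocycles, \<open>Harm\<close> the
  representatives of cohomology and \<open>Bd\<close> the coboundaries. An index \<open>(t, i, j, a)\<close> belongs to
  cohomological degree \<open>i\<close> and internal degree \<open>j\<close>. A coboundary carries the label of its preimage,
  so \<open>dB\<close> sends \<open>(Co, i, j, a)\<close> to \<open>(Bd, i + 1, j, a)\<close>, \<open>hB\<close> goes back, and \<open>pB\<close> projects to the
  harmonic part.\<close>

datatype tag = Co | Harm | Bd

type_synonym 'a idx = "tag \<times> int \<times> int \<times> 'a"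

definition dB :: "'a idx \<Rightarrow> ('a idx \<Rightarrow>\<^sub>0 'k::field)" where
  "dB = (\<lambda>(t, i, j, a). if t = Co then Poly_Mapping.single (Bd, i + 1, j, a) 1 else 0)"

definition hB :: "'a idx \<Rightarrow> ('a idx \<Rightarrow>\<^sub>0 'k::field)" where
  "hB = (\<lambda>(t, i, j, a). if t = Bd then Poly_Mapping.single (Co, i - 1, j, a) 1 else 0)"

definition pB :: "'a idx \<Rightarrow> ('a idx \<Rightarrow>\<^sub>0 'k::field)" where
  "pB = (\<lambda>(t, i, j, a). if t = Harm then Poly_Mapping.single (t, i, j, a) 1 else 0)"

lemma dhp:
  "lin_ext dB (dB b) = 0" "lin_ext hB (hB b) = 0" "lin_ext hB (lin_ext dB (hB b)) = hB b"
  "lin_ext pB (dB b) = 0" "lin_ext pB (hB b) = 0" "lin_ext dB (pB b) = 0" "lin_ext hB (pB b) = 0"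
  "lin_ext pB (pB b) = pB b"
  "pB b = Poly_Mapping.single b 1 - lin_ext dB (hB b) - lin_ext hB (dB b)"
  by (cases b rule: prod_cases4; cases "fst b"; simp add: dB_def hB_def pB_def)+

lemma pB_id: "lin_ext pB u = u - lin_ext dB (lin_ext hB u) - lin_ext hB (lin_ext dB u)"
proof -
  have "u - lin_ext dB (lin_ext hB u) - lin_ext hB (lin_ext dB u) =
     (\<Sum>b\<in>Poly_Mapping.keys u. scal (Poly_Mapping.lookup u b) (Poly_Mapping.single b 1 - lin_ext dB (hB b) - lin_ext hB (dB b)))"
    unfolding scal_distrib(3) sum_subtractf lin_ext_comp
    by (subst (1) lin_ext_basis[symmetric], subst (1) lin_ext_def) (simp add: lin_ext_def del: scal_simps(6))
  then show ?thesis by (simp add: lin_ext_def[of pB] dhp(9)[symmetric])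
qed

section \<open>Transfer of the total complex to its harmonic part\<close>

text \<open>The constant \<open>c\<close> is the twist by which the generators are shifted: dualising the exterior algebra
  moves them by \<open>v\<close>.\<close>

definition dgu :: "int \<Rightarrow> 'a idx \<Rightarrow> int" where
  "dgu c = (\<lambda>(t, i, j, a). j + c)"

context monomial_algebra
begin

text \<open>The total degree of an index is \<open>i + j\<close> over the exterior and \<open>i - j\<close> over the symmetric algebra;
  both are \<open>i + eta * j\<close>.\<close>

definition basis_at :: "'a idx set \<Rightarrow> int \<Rightarrow> 'a idx set" where
  "basis_at bs n = {b \<in> bs. case b of (t, i, j, a) \<Rightarrow> i + eta * j = n}"

definition total_complex :: "'a idx set \<Rightarrow> int \<Rightarrow> (nat \<Rightarrow> 'a idx \<Rightarrow> ('a idx \<Rightarrow>\<^sub>0 'k)) \<Rightarrow> ('r, 'm \<Rightarrow> ('a idx \<Rightarrow>\<^sub>0 'k)) gcomplex" where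
  "total_complex bs c Y = \<lparr>Ob = (\<lambda>n. Tm (basis_at bs n) (dgu c)), Df = (\<lambda>n q. pw dB q + del Y q)\<rparr>"

text \<open>The partial sums of the series for the perturbed homotopy. Each factor \<open>del Y\<close> raises the monomial
  degree by one, so the coefficient at \<open>m\<close> is constant from step \<open>ht m + 1\<close> on, and \<open>hp\<close> is the limit.\<close>

primrec hp_iter :: "(nat \<Rightarrow> 'a idx \<Rightarrow> ('a idx \<Rightarrow>\<^sub>0 'k)) \<Rightarrow> nat \<Rightarrow> ('m \<Rightarrow> ('a idx \<Rightarrow>\<^sub>0 'k)) \<Rightarrow> 'm \<Rightarrow> ('a idx \<Rightarrow>\<^sub>0 'k)" where
  "hp_iter Y 0 q = 0"
| "hp_iter Y (Suc n) q = pw hB q - pw hB (del Y (hp_iter Y n q))"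

definition hp where
  "hp Y q = (\<lambda>m. hp_iter Y (Suc (ht m)) q m)"

lemma del_cong: "(\<And>k. k \<in> vr m \<Longrightarrow> x (m - var k) = y (m - var k)) \<Longrightarrow> del Y x m = del Y y m"
  unfolding del_def by (rule sum.cong) auto

lemma hp_iter_stable: "ht m < n \<Longrightarrow> ht m < n' \<Longrightarrow> hp_iter Y n q m = hp_iter Y n' q m"
proof (induction n arbitrary: n' m)
  case (Suc n)
  then obtain l where l: "n' = Suc l" by (cases n') auto
  have "del Y (hp_iter Y n q) m = del Y (hp_iter Y l q) m"
    by (rule del_cong, rule Suc.IH) (use Suc.prems ht_minus_var l in force)+
  then show ?case by (simp add: l pw_def)
qed simp

lemma hp_left: "hp Y q = pw hB q - pw hB (del Y (hp Y q))"
proof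
  fix m
  have "del Y (hp Y q) m = del Y (hp_iter Y (ht m) q) m"
    by (rule del_cong) (use ht_minus_var in \<open>force simp: hp_def intro!: hp_iter_stable\<close>)
  then show "hp Y q m = (pw hB q - pw hB (del Y (hp Y q))) m"
    by (simp add: hp_def pw_def)
qed

text \<open>The equation determines the coefficients by induction on the degree of the monomial. Additivity and
  the second form \<open>hp_right\<close> of the equation follow from this uniqueness.\<close>

lemma hp_unique:
  assumes "w = pw hB q - pw hB (del Y w)"
  shows "w = hp Y q"
proof
  fix m
  show "w m = hp Y q m"
  proof (induction "ht m" arbitrary: m rule: less_induct)
    case less
    have "del Y w m = del Y (hp Y q) m"
      by (rule del_cong, rule less) (use ht_minus_var in force)
    then have "(pw hB q - pw hB (del Y w)) m = (pw hB q - pw hB (del Y (hp Y q))) m" by (simp add: pw_def)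
    then show ?case using assms hp_left[of Y q] by metis
  qed
qed

lemma del_additive: "additive_fun (del Y)" by (simp add: additive_fun_def del_add)
lemma pw_additive: "additive_fun (pw Y)" by (simp add: additive_fun_def pw_add)

lemmas lins = additive_funD[OF del_additive] additive_funD[OF pw_additive]

lemma hp_add: "hp Y (x + y) = hp Y x + hp Y y"
proof (rule hp_unique[symmetric])
  show "hp Y x + hp Y y = pw hB (x + y) - pw hB (del Y (hp Y x + hp Y y))"
    by (subst (1) hp_left, subst (2) hp_left) (simp add: lins)
qed

lemma hp_additive: "additive_fun (hp Y)" by (simp add: additive_fun_def hp_add)

lemma hp_right: "hp Y q = pw hB q - hp Y (del Y (pw hB q))"
proof (rule hp_unique[symmetric])
  let ?z = "del Y (pw hB q)"
  have "pw hB (del Y (hp Y ?z)) = pw hB ?z - hp Y ?z"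
    using hp_left[of Y ?z] by (simp add: algebra_simps)
  then show "pw hB q - hp Y ?z = pw hB q - pw hB (del Y (pw hB q - hp Y ?z))"
    by (simp add: lins)
qed

end

text \<open>The coordinate form of the total complex. The matrices \<open>Y k\<close> preserve the cohomological degree,
  raise the internal degree by \<open>eta\<close>, anticommute with \<open>dB\<close> by the signs of the total complex, and
  satisfy the relations of the dual algebra.\<close>

locale ladder = monomial_algebra A co Idx dv gam e0 var v dgm eta tau
  for A :: "'r graded_ring" and co :: "'r \<Rightarrow> 'm::minus \<Rightarrow> 'k::field"
    and Idx dv gam e0 var v dgm eta tau +
  fixes bs :: "'a idx set" and Y :: "nat \<Rightarrow> 'a idx \<Rightarrow> ('a idx \<Rightarrow>\<^sub>0 'k)" and c :: int
  assumes Y_keys: "k < v \<Longrightarrow> Poly_Mapping.keys (Y k (t, i, j, a)) \<subseteq> {(t', i', j', a'). (t', i', j', a') \<in> bs \<and> i' = i \<and> j' = j + eta}"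
    and dY: "k < v \<Longrightarrow> lin_ext (Y k) (dB b) = - lin_ext dB (Y k b)"
    and bs_dB: "(Co, i, j, a) \<in> bs \<longleftrightarrow> (Bd, i + 1, j, a) \<in> bs"
    and YY: "\<lbrakk>k < v; l < v; k \<noteq> l\<rbrakk> \<Longrightarrow> lin_ext (Y k) (Y l b) = - scal tau (lin_ext (Y l) (Y k b))"
    and Ysq: "\<lbrakk>k < v; m \<in> Idx; var k \<in> dv m; var k \<in> dv (m - var k)\<rbrakk> \<Longrightarrow> lin_ext (Y k) (Y k b) = 0"
begin

abbreviation Th where "Th n \<equiv> Tm (basis_at bs n) (dgu c)"

lemma eta2: "eta * eta = 1" using eta by auto

lemma anticomm: "pw dB (del Y x) + del Y (pw dB x) = 0"
proof
  fix m
  have "del Y (pw dB x) m = (\<Sum>k\<in>vr m. scal (sg k m) (lin_ext (\<lambda>b. - lin_ext dB (Y k b)) (x (m - var k))))"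
    unfolding del_def pw_def using vrD dY by (auto simp: lin_ext_comp intro!: sum.cong)
  also have "\<dots> = - pw dB (del Y x) m"
    by (simp add: del_def pw_def lin_ext_uminus_fun lin_ext_comp[symmetric] sum_negf lin_ext_sum lin_ext_scal)
  finally show "(pw dB (del Y x) + del Y (pw dB x)) m = 0 m" by simp
qed

lemma pw_zero_fun: "pw (\<lambda>b. 0) q = 0" by (rule ext) (simp add: pw_def)

sublocale P: perturbation "pw dB" "del Y" "pw hB" "hp Y"
proof
  show "pw dB (pw dB x) = 0" for x by (simp add: pw_pw dhp pw_zero_fun)
  show "pw hB (pw hB x) = 0" for x by (simp add: pw_pw dhp pw_zero_fun)
  show "pw hB (pw dB (pw hB x)) = pw hB x" for x by (simp add: pw_pw dhp)
  show "del Y (del Y x) = 0" for x by (rule del_del[OF YY Ysq])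
qed (rule del_additive pw_additive hp_additive anticomm hp_left hp_right)+

lemma d_hom: "pw dB \<in> graded_hom A (Th n) (Th (n + 1))"
  by (rule pw_hom) (auto simp: dB_def basis_at_def dgu_def bs_dB[symmetric] split: if_splits)

lemma h_hom: "pw hB \<in> graded_hom A (Th n) (Th (n - 1))"
  by (rule pw_hom) (auto simp: hB_def basis_at_def dgu_def bs_dB split: if_splits)

lemma Y_keys_basis_at: "k < v \<Longrightarrow> b \<in> basis_at bs n \<Longrightarrow> Poly_Mapping.keys (Y k b) \<subseteq> {x \<in> basis_at bs (n + 1). dgu c x = dgu c b + eta}"
proof -
  assume k: "k < v" and b: "b \<in> basis_at bs n"
  obtain t i j a where e: "b = (t, i, j, a)" by (cases b rule: prod_cases4)
  show ?thesis using Y_keys[OF k, of t i j a] b eta2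
    unfolding e by (auto simp: basis_at_def dgu_def algebra_simps dest!: subsetD)
qed

lemma del_hom': "del Y \<in> graded_hom A (Th n) (Th (n + 1))"
  by (rule del_hom[OF Y_keys_basis_at])

lemma D_hom: "P.D \<in> graded_hom A (Th n) (Th (n + 1))"
  unfolding P.D_def[abs_def] by (rule hom_plus[OF d_hom del_hom'])

lemma zero_hom: "(\<lambda>x. 0) \<in> graded_hom A (Tm B dg) (Tm B' dg')"
  by (rule graded_homI)
    (simp_all add: supp_in_zero act_zero hpart_Tm)

lemma hp_iter_hom: "hp_iter Y N \<in> graded_hom A (Th n) (Th (n - 1))"
proof (induction N)
  case 0
  have "hp_iter Y 0 = (\<lambda>x. 0)" by (rule ext) (rule hp_iter.simps(1))
  then show ?case by (simp only: zero_hom)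
next
  case (Suc N)
  have "(\<lambda>q. pw hB (del Y (hp_iter Y N q))) \<in> graded_hom A (Th n) (Th (n - 1))"
    using graded_hom_comp[OF graded_hom_comp[OF Suc del_hom'] h_hom] by simp
  from hom_minus[OF h_hom this]
  have "(\<lambda>x. pw hB x - pw hB (del Y (hp_iter Y N x))) \<in> graded_hom A (Th n) (Th (n - 1))" .
  moreover have "hp_iter Y (Suc N) = (\<lambda>x. pw hB x - pw hB (del Y (hp_iter Y N x)))"
    by (rule ext) (rule hp_iter.simps(2))
  ultimately show ?case by (simp only:)
qed

text \<open>On a single element the series is a finite sum: the difference of consecutive partial sums involves
  only basis elements of ever smaller cohomological degree, since \<open>hB\<close> lowers this degree and \<open>del Y\<close>
  preserves it, and the basis is bounded below.\<close>

lemma hp_eq_hp_iter: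
  assumes lb: "\<forall>t i j a. (t, i, j, a) \<in> bs \<longrightarrow> m0 \<le> i" and x: "x \<in> supp_in (basis_at bs n)"
  shows "\<exists>N. hp Y x = hp_iter Y N x"
proof -
  let ?K = "\<Union>m\<in>{m. x m \<noteq> 0}. Poly_Mapping.keys (x m)"
  let ?B = "\<lambda>I. {b. (case b of (t, i, j, a) \<Rightarrow> b \<in> bs \<and> i \<le> I)}"
  have fin: "finite ?K" using supp_inD(2)[OF x] by auto
  define I where "I = Max (insert 0 ((\<lambda>(t, i, j, a). i) ` ?K))"
  have I: "i \<le> I" if "(t, i, j, a) \<in> ?K" for t i j a
    unfolding I_def using fin that by (intro Max_ge) (auto intro!: image_eqI[of _ _ "(t, i, j, a)"])
  have xk: "Poly_Mapping.keys (x m) \<subseteq> ?B I" for m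
  proof (cases "x m = 0")
    case False
    show ?thesis
    proof
      fix b assume b: "b \<in> Poly_Mapping.keys (x m)"
      obtain t i j a where bb: "b = (t, i, j, a)" by (cases b rule: prod_cases4)
      have "(t, i, j, a) \<in> ?K" using b False bb by blast
      then have "i \<le> I" by (rule I)
      moreover have "b \<in> bs" using supp_inD(1)[OF x, of m] b by (auto simp: basis_at_def)
      ultimately show "b \<in> ?B I" by (simp add: bb)
    qed
  qed simp
  \<comment> \<open>The support of the \<open>N\<close>-th difference lies in cohomological degrees below \<open>I - N\<close>.\<close>
  define e where "e N = hp_iter Y (Suc N) x - hp_iter Y N x" for N
  have eS: "e (Suc N) = - pw hB (del Y (e N))" for N
    by (simp add: e_def lins)
  have hk: "Poly_Mapping.keys (pw hB w m) \<subseteq> ?B (J - 1)" if "Poly_Mapping.keys (w m) \<subseteq> ?B J" for w m J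
    unfolding pw_def by (rule keys_lin_ext) (use that in \<open>auto simp: hB_def bs_dB split: if_splits\<close>)
  have ek: "Poly_Mapping.keys (e N m) \<subseteq> ?B (I - 1 - int N)" for N m
  proof (induction N arbitrary: m)
    case 0
    show ?case using hk[OF xk] by (simp add: e_def lins)
  next
    case (Suc N)
    have "Poly_Mapping.keys (del Y (e N) m) \<subseteq> ?B (I - 1 - int N)"
      unfolding del_def
    proof (rule keys_sum_subset, rule subset_trans[OF keys_scal], rule keys_lin_ext)
      fix k b assume k: "k \<in> vr m" and b: "b \<in> Poly_Mapping.keys (e N (m - var k))"
      obtain t i j a where bb: "b = (t, i, j, a)" by (cases b rule: prod_cases4)
      have "i \<le> I - 1 - int N" using Suc b bb by fastforce
      then show "Poly_Mapping.keys (Y k b) \<subseteq> ?B (I - 1 - int N)"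
        using Y_keys[of k t i j a] vrD[OF k] unfolding bb by auto
    qed
    from hk[of "del Y (e N)" m, OF this] show ?case unfolding eS by (simp add: algebra_simps)
  qed
  define N where "N = nat (I - m0)"
  have "e N m = 0" for m
  proof -
    have "\<not> i \<le> I - 1 - int N" if "(t, i, j, a) \<in> bs" for t i j a
      using lb[rule_format, OF that] unfolding N_def by linarith
    then have "?B (I - 1 - int N) = {}" by auto
    then have "Poly_Mapping.keys (e N m) = {}" using ek by blast
    then show ?thesis by simp
  qed
  then have "e N = 0" by (simp add: fun_eq_iff)
  then have "hp_iter Y N x = pw hB x - pw hB (del Y (hp_iter Y N x))" by (simp add: e_def)
  then have "hp_iter Y N x = hp Y x" by (rule hp_unique)
  then show ?thesis by metis
qed

lemma hp_act: "hp Y (act a x) = act a (hp Y x)"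
proof (rule hp_unique[symmetric])
  show "act a (hp Y x) = pw hB (act a x) - pw hB (del Y (act a (hp Y x)))"
    by (subst hp_left) (simp add: pw_act del_act act_diff)
qed

lemma hp_hom:
  assumes lb: "\<forall>t i j a. (t, i, j, a) \<in> bs \<longrightarrow> m0 \<le> i"
  shows "hp Y \<in> graded_hom A (Th n) (Th (n - 1))"
proof (rule graded_homI)
  fix x assume "x \<in> carrier (Th n)"
  then have x: "x \<in> supp_in (basis_at bs n)" by simp
  obtain N where "hp Y x = hp_iter Y N x" using hp_eq_hp_iter[OF lb x] by blast
  then show "hp Y x \<in> carrier (Th (n - 1))" using graded_homD(1)[OF hp_iter_hom[of N n], of x] x by simp
next
  fix x d assume x: "x \<in> hpart (Th n) d"
  then have "x \<in> supp_in (basis_at bs n)" by (simp add: hpart_Tm)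
  then obtain N where "hp Y x = hp_iter Y N x" using hp_eq_hp_iter[OF lb] by blast
  then show "hp Y x \<in> hpart (Th (n - 1)) d" using graded_homD(4)[OF hp_iter_hom[of N n] x] by simp
qed (simp_all add: hp_add hp_act)

lemma q_hom:
  assumes lb: "\<forall>t i j a. (t, i, j, a) \<in> bs \<longrightarrow> m0 \<le> i"
  shows "P.q \<in> graded_hom A (Th n) (Th n)"
proof -
  have 1: "(\<lambda>x. P.D (hp Y x)) \<in> graded_hom A (Th n) (Th n)"
    using graded_hom_comp[OF hp_hom[OF lb, of n] D_hom] by simp
  have 2: "(\<lambda>x. hp Y (P.D x)) \<in> graded_hom A (Th n) (Th n)"
    using graded_hom_comp[OF D_hom[of n] hp_hom[OF lb]] by simp
  show ?thesis unfolding P.q_def[abs_def] by (rule hom_minus[OF hom_minus[OF hom_id 1] 2])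
qed

text \<open>The harmonic indices of total degree \<open>n\<close> are named by pairs \<open>(i, z)\<close>; the internal degree is
  determined by \<open>n\<close> and \<open>i\<close>.\<close>

definition harm_incl :: "int \<Rightarrow> int \<times> 'a \<Rightarrow> ('a idx \<Rightarrow>\<^sub>0 'k)" where
  "harm_incl n = (\<lambda>(i, z). Poly_Mapping.single (Harm, i, eta * (n - i), z) 1)"

definition harm_proj :: "'a idx \<Rightarrow> (int \<times> 'a \<Rightarrow>\<^sub>0 'k)" where
  "harm_proj = (\<lambda>(t, i, j, a). if t = Harm then Poly_Mapping.single (i, a) 1 else 0)"

definition harm_gens :: "int \<Rightarrow> (int \<times> 'a) set" where
  "harm_gens n = {(i, z). (Harm, i, eta * (n - i), z) \<in> bs}"

definition harm_deg :: "int \<Rightarrow> int \<times> 'a \<Rightarrow> int" where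
  "harm_deg n = (\<lambda>(i, z). eta * (n - i) + c)"

abbreviation Tg where "Tg n \<equiv> Tm (harm_gens n) (harm_deg n)"

lemma eta_solve: "i + eta * j = n \<longleftrightarrow> j = eta * (n - i)"
  using eta by auto

lemma j_hom: "pw (harm_incl n) \<in> graded_hom A (Tg n) (Th n)"
  by (rule pw_hom) (auto simp: harm_incl_def harm_gens_def basis_at_def harm_deg_def dgu_def eta_solve split: if_splits)

lemma r_hom: "pw harm_proj \<in> graded_hom A (Th n) (Tg n)"
  by (rule pw_hom) (auto simp: harm_proj_def harm_gens_def basis_at_def harm_deg_def dgu_def eta_solve split: if_splits)

lemma rj:
  "pw harm_proj (pw (harm_incl n) x) = x" "pw harm_proj (pw hB y) = 0" "pw harm_proj (pw dB y) = 0" "pw hB (pw (harm_incl n) x) = 0" "pw dB (pw (harm_incl n) x) = 0"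
proof -
  have "lin_ext harm_proj (harm_incl n b) = Poly_Mapping.single b 1" "lin_ext hB (harm_incl n b) = 0" "lin_ext dB (harm_incl n b) = 0" for b
    by (cases b; simp add: harm_proj_def harm_incl_def hB_def dB_def)+
  moreover have "lin_ext harm_proj (hB b) = 0" "lin_ext harm_proj (dB b) = 0" for b
    by (cases b rule: prod_cases4; simp add: harm_proj_def hB_def dB_def)+
  ultimately show "pw harm_proj (pw (harm_incl n) x) = x" "pw harm_proj (pw hB y) = 0" "pw harm_proj (pw dB y) = 0" "pw hB (pw (harm_incl n) x) = 0" "pw dB (pw (harm_incl n) x) = 0"
    unfolding pw_pw by (simp_all add: pw_zero_fun) (simp add: pw_def)
qed

lemma jr:
  assumes "x \<in> supp_in (basis_at bs n)"
  shows "pw (harm_incl n) (pw harm_proj x) = x - pw dB (pw hB x) - pw hB (pw dB x)"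
proof
  fix m
  have "lin_ext (harm_incl n) (lin_ext harm_proj (x m)) = lin_ext pB (x m)"
    unfolding lin_ext_comp
  proof (rule lin_ext_cong)
    fix b assume "b \<in> Poly_Mapping.keys (x m)"
    then have "b \<in> basis_at bs n" using supp_inD(1)[OF assms] by blast
    then show "lin_ext (harm_incl n) (harm_proj b) = pB b"
      by (cases b rule: prod_cases4) (auto simp: harm_proj_def harm_incl_def pB_def basis_at_def eta_solve)
  qed
  then show "pw (harm_incl n) (pw harm_proj x) m = (x - pw dB (pw hB x) - pw hB (pw dB x)) m"
    by (simp add: pw_def pB_id)
qed

lemma hp_j: "hp Y (pw (harm_incl n) x) = 0"
  by (subst hp_right) (simp add: rj lins additive_funD[OF hp_additive])

lemma r_hp: "pw harm_proj (hp Y x) = 0"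
  by (subst hp_left) (simp add: rj lins)

definition harm_diff :: "int \<Rightarrow> ('m \<Rightarrow> (int \<times> 'a \<Rightarrow>\<^sub>0 'k)) \<Rightarrow> 'm \<Rightarrow> (int \<times> 'a \<Rightarrow>\<^sub>0 'k)" where
  "harm_diff n x = pw harm_proj (P.q (P.D (pw (harm_incl n) x)))"

definition harm_complex :: "('r, 'm \<Rightarrow> (int \<times> 'a \<Rightarrow>\<^sub>0 'k)) gcomplex" where
  "harm_complex = \<lparr>Ob = (\<lambda>n. Tg n), Df = harm_diff\<rparr>"

lemma total_complex_simps [simp]: "Ob (total_complex bs c Y) n = Th n" "Df (total_complex bs c Y) n = P.D"
  by (auto simp: total_complex_def P.D_def[abs_def])

lemma harm_complex_simps [simp]: "Ob harm_complex n = Tg n" "Df harm_complex n = harm_diff n"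
  by (auto simp: harm_complex_def)

text \<open>The projection \<open>q\<close> changes harmonic elements only by non-harmonic ones.\<close>

lemma r_q_j: "pw harm_proj (P.q (pw (harm_incl n) x)) = x"
  by (simp add: P.q_def lins rj hp_j r_hp P.D_ad)

lemma q_jr_q:
  assumes lb: "\<forall>t i j a. (t, i, j, a) \<in> bs \<longrightarrow> m0 \<le> i" and y: "y \<in> supp_in (basis_at bs n)"
  shows "P.q (pw (harm_incl n) (pw harm_proj (P.q y))) = P.q y"
proof -
  have "P.q y \<in> supp_in (basis_at bs n)" using graded_homD(1)[OF q_hom[OF lb], of y n] y by simp
  then show ?thesis by (simp add: jr P.q_proj_q)
qed

lemma harm_diff_hom:
  assumes lb: "\<forall>t i j a. (t, i, j, a) \<in> bs \<longrightarrow> m0 \<le> i"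
  shows "harm_diff n \<in> graded_hom A (Tg n) (Tg (n + 1))"
  unfolding harm_diff_def[abs_def]
  by (rule graded_hom_comp[OF _ r_hom], rule graded_hom_comp[OF _ q_hom[OF lb]],
      rule graded_hom_comp[OF j_hom D_hom])

text \<open>The equivalences are \<open>q\<close> after the inclusion and the harmonic projection after \<open>q\<close>. One composite is
  the identity by \<open>r_q_j\<close>, the other is \<open>q\<close> by \<open>q_proj_q\<close>, and \<open>q\<close> is homotopic to the identity
  through \<open>hp\<close>.\<close>

lemma homotopy_equivalent_harm_complex:
  assumes lb: "\<forall>t i j a. (t, i, j, a) \<in> bs \<longrightarrow> m0 \<le> i"
  shows "homotopy_equivalent A harm_complex (total_complex bs c Y)"
proof -
  let ?f = "\<lambda>n x. P.q (pw (harm_incl n) x)" and ?g = "\<lambda>n y. pw harm_proj (P.q y)"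
  have Djr: "P.D (pw (harm_incl n) x) \<in> supp_in (basis_at bs (n + 1))" if "x \<in> supp_in (harm_gens n)" for x n
    using graded_homD(1)[OF graded_hom_comp[OF j_hom D_hom], of x n] that by simp
  have f: "chain_map A harm_complex (total_complex bs c Y) ?f" unfolding chain_map_def
  proof (intro allI conjI ballI)
    fix n show "?f n \<in> graded_hom A (Ob harm_complex n) (Ob (total_complex bs c Y) n)"
      using graded_hom_comp[OF j_hom q_hom[OF lb]] by simp
    fix x assume x: "x \<in> carrier (Ob harm_complex n)"
    show "?f (n + 1) (Df harm_complex n x) = Df (total_complex bs c Y) n (?f n x)"
      using q_jr_q[OF lb Djr, of x n] x by (simp add: harm_diff_def P.qD)
  qed
  have g: "chain_map A (total_complex bs c Y) harm_complex ?g" unfolding chain_map_def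
  proof (intro allI conjI ballI)
    fix n show "?g n \<in> graded_hom A (Ob (total_complex bs c Y) n) (Ob harm_complex n)"
      using graded_hom_comp[OF q_hom[OF lb] r_hom] by simp
    fix x assume x: "x \<in> carrier (Ob (total_complex bs c Y) n)"
    show "?g (n + 1) (Df (total_complex bs c Y) n x) = Df harm_complex n (?g n x)"
      using q_jr_q[OF lb, of x n] x by (simp add: harm_diff_def P.qD)
  qed
  have 1: "homotopic_to_id A harm_complex (\<lambda>n x. ?g n (?f n x))"
    unfolding homotopic_to_id_def
  proof (rule exI[of _ "\<lambda>n x. 0"], intro allI conjI ballI)
    fix n show "(\<lambda>x. 0) \<in> graded_hom A (Ob harm_complex n) (Ob harm_complex (n - 1))"
      unfolding harm_complex_simps by (rule zero_hom)
    fix x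
    show "?g n (?f n x) = x \<oplus>\<^bsub>Ob harm_complex n\<^esub> (Df harm_complex (n - 1) 0 \<oplus>\<^bsub>Ob harm_complex n\<^esub> 0)"
      by (simp add: P.qq r_q_j harm_diff_def lins P.q_ad P.D_ad)
  qed
  have 2: "homotopic_to_id A (total_complex bs c Y) (\<lambda>n y. ?f n (?g n y))"
    unfolding homotopic_to_id_def
  proof (rule exI[of _ "\<lambda>n x. 0 - hp Y x"], intro allI conjI ballI)
    fix n
    have "(\<lambda>x. 0) \<in> graded_hom A (Th n) (Th (n - 1))"
      by (rule zero_hom)
    from hom_minus[OF this hp_hom[OF lb]]
    show "(\<lambda>x. 0 - hp Y x) \<in> graded_hom A (Ob (total_complex bs c Y) n) (Ob (total_complex bs c Y) (n - 1))" by simp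
    fix x assume x: "x \<in> carrier (Ob (total_complex bs c Y) n)"
    have "P.q (pw (harm_incl n) (pw harm_proj (P.q x))) = x + (P.D (0 - hp Y x) + (0 - hp Y (P.D x)))"
      using q_jr_q[OF lb, of x n] x by (simp add: P.q_def[of x] P.D_ad)
    then show "?f n (?g n x) = x \<oplus>\<^bsub>Ob (total_complex bs c Y) n\<^esub> (Df (total_complex bs c Y) (n - 1) (0 - hp Y x) \<oplus>\<^bsub>Ob (total_complex bs c Y) n\<^esub>
         (0 - hp Y (Df (total_complex bs c Y) n x)))" by simp
  qed
  show ?thesis unfolding homotopy_equivalent_def using f g 1 2 by blast
qed

text \<open>Minimality: harmonic elements are killed by \<open>dB\<close>, and everything else in the transferred
  differential passes through \<open>del Y\<close>, which has no constant coefficient, or through \<open>dB\<close> or \<open>hB\<close>,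
  which have no harmonic part.\<close>

lemma harm_diff_e0:
  "harm_diff n x e0 = 0"
proof -
  let ?y = "del Y (pw (harm_incl n) x)"
  have D: "P.D (pw (harm_incl n) x) = ?y" by (simp add: P.D_def rj)
  have hp0: "hp Y w e0 = lin_ext hB (w e0)" for w
    by (subst hp_left) (simp add: pw_def)
  have "P.q ?y e0 = 0"
    by (simp add: P.q_def P.D_def pw_def hp0)
  moreover have "harm_diff n x e0 = lin_ext harm_proj (P.q ?y e0)"
    unfolding harm_diff_def D by (rule pw_def[THEN fun_cong])
  ultimately show ?thesis by simp
qed

end

section \<open>Free modules are graded modules\<close>

context monomial_algebra
begin

lemma finsum_free:
  assumes M: "abelian_monoid (free_gmodule A B dg)"
    and "finite S" "\<And>x. x \<in> S \<Longrightarrow> f x \<in> carrier (free_gmodule A B dg)"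
  shows "finsum (free_gmodule A B dg) f S \<in> carrier (free_gmodule A B dg) \<and>
    (\<forall>b. finsum (free_gmodule A B dg) f S b = finsum A (\<lambda>x. f x b) S)"
proof -
  interpret ring A by (rule ring_A)
  interpret M: abelian_monoid "free_gmodule A B dg" by (rule M)
  show ?thesis using assms(2,3)
  proof (induction S rule: finite_induct)
    case (insert x S)
    have fA: "f y b \<in> carrier A" if "y \<in> insert x S" for y b using insert.prems[OF that] by (simp add: carrier_free)
    have fx: "f x \<in> carrier (free_gmodule A B dg)" using insert.prems by simp
    have IH: "finsum (free_gmodule A B dg) f S \<in> carrier (free_gmodule A B dg)"
      "\<forall>b. finsum (free_gmodule A B dg) f S b = finsum A (\<lambda>x. f x b) S" using insert by auto
    have e: "finsum (free_gmodule A B dg) f (insert x S) =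
        f x \<oplus>\<^bsub>free_gmodule A B dg\<^esub> finsum (free_gmodule A B dg) f S"
      by (rule M.finsum_insert) (use insert in auto)
    show ?case unfolding e
    proof (rule conjI[OF M.a_closed[OF fx IH(1)]], intro allI)
      fix b
      have "finsum A (\<lambda>x. f x b) (insert x S) = f x b \<oplus>\<^bsub>A\<^esub> finsum A (\<lambda>x. f x b) S"
        by (rule finsum_insert) (use insert.hyps fA in auto)
      then show "(f x \<oplus>\<^bsub>free_gmodule A B dg\<^esub> finsum (free_gmodule A B dg) f S) b = finsum A (\<lambda>x. f x b) (insert x S)"
        using IH(2) by (simp add: free_simps(2))
    qed
  qed (simp add: free_simps(1) carrier_free zero_closed)
qed

lemma abelian_group_free: "abelian_group (free_gmodule A B dg)"
proof -
  interpret ring A by (rule ring_A)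
  show ?thesis
  proof (rule abelian_groupI)
    fix x assume x: "x \<in> carrier (free_gmodule A B dg)"
    have xc: "x b \<in> carrier A" for b using x by (simp add: carrier_free)
    have "{b. \<ominus>\<^bsub>A\<^esub> x b \<noteq> \<zero>\<^bsub>A\<^esub>} \<subseteq> {b. x b \<noteq> \<zero>\<^bsub>A\<^esub>}" by auto
    then have "finite {b. \<ominus>\<^bsub>A\<^esub> x b \<noteq> \<zero>\<^bsub>A\<^esub>}"
      by (rule finite_subset) (use x in \<open>simp add: carrier_free\<close>)
    then have "(\<lambda>b. \<ominus>\<^bsub>A\<^esub> x b) \<in> carrier (free_gmodule A B dg)" using x by (simp add: carrier_free)
    then show "\<exists>y\<in>carrier (free_gmodule A B dg). y \<oplus>\<^bsub>free_gmodule A B dg\<^esub> x = \<zero>\<^bsub>free_gmodule A B dg\<^esub>"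
      by (rule bexI[rotated]) (simp add: free_simps l_neg xc)
  qed (auto simp: free_simps free_add_closed, auto simp: carrier_free fun_eq_iff a_ac)
qed

lemma hpart_free_co:
  "\<phi> \<in> hpart (free_gmodule A B dg) t \<longleftrightarrow> \<phi> \<in> carrier (free_gmodule A B dg) \<and>
     (\<forall>b m. co (\<phi> b) m \<noteq> 0 \<longrightarrow> dgm m + dg b = t)"
proof -
  have 1: "co (\<phi> b) m = 0" if "\<phi> \<in> carrier (free_gmodule A B dg)" "b \<notin> B" for b m
    using that by (simp add: carrier_free)
  have 2: "\<phi> b \<in> carrier A" if "\<phi> \<in> carrier (free_gmodule A B dg)" for b
    using that by (simp add: carrier_free)
  show ?thesis
  proof
    assume h: "\<phi> \<in> hpart (free_gmodule A B dg) t"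
    then have c: "\<phi> \<in> carrier (free_gmodule A B dg)" by (simp add: hpart_free)
    have "dgm m + dg b = t" if nz: "co (\<phi> b) m \<noteq> 0" for b m
    proof -
      have "b \<in> B" using 1[OF c] nz by blast
      then have "dgm m = t - dg b" using h nz by (simp add: hpart_free hom_part_iff)
      then show ?thesis by simp
    qed
    then show "\<phi> \<in> carrier (free_gmodule A B dg) \<and> (\<forall>b m. co (\<phi> b) m \<noteq> 0 \<longrightarrow> dgm m + dg b = t)"
      using c by simp
  next
    assume h: "\<phi> \<in> carrier (free_gmodule A B dg) \<and> (\<forall>b m. co (\<phi> b) m \<noteq> 0 \<longrightarrow> dgm m + dg b = t)"
    have "dgm m = t - dg b" if "co (\<phi> b) m \<noteq> 0" for b m
      using h that by (simp add: eq_diff_eq)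
    then show "\<phi> \<in> hpart (free_gmodule A B dg) t"
      using h 2 by (simp add: hpart_free hom_part_iff)
  qed
qed

lemma hpart_free_coD: "\<phi> \<in> hpart (free_gmodule A B dg) t \<Longrightarrow> co (\<phi> b) m \<noteq> 0 \<Longrightarrow> dgm m + dg b = t"
  unfolding hpart_free_co by blast

lemma hpart_free_coI: "\<phi> \<in> carrier (free_gmodule A B dg) \<Longrightarrow>
    (\<And>b m. co (\<phi> b) m \<noteq> 0 \<Longrightarrow> dgm m + dg b = t) \<Longrightarrow> \<phi> \<in> hpart (free_gmodule A B dg) t"
  unfolding hpart_free_co by blast

text \<open>The homogeneous components of an element are found coefficient by coefficient: in degree \<open>d\<close> the
  component at the generator \<open>b\<close> is the part of degree \<open>d - dg b\<close> of its coefficient.\<close>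

lemma graded_module_free: "graded_module A (free_gmodule A B dg)"
proof -
  let ?M = "free_gmodule A B dg"
  interpret ring A by (rule ring_A)
  interpret M: abelian_group ?M by (rule abelian_group_free)
  have cA: "x b \<in> carrier A" if "x \<in> carrier ?M" for x b using that by (simp add: carrier_free)
  have "left_module A ?M"
    by (intro left_module.intro left_module_axioms.intro ring_A M.abelian_group_axioms)
      (simp_all add: free_simps free_smult_closed cA fun_eq_iff l_distr r_distr m_assoc)
  moreover have "graded_module_axioms A ?M"
  proof (rule graded_module_axioms.intro)
    fix d
    show "additive_subgroup (hpart ?M d) ?M"
    proof (rule additive_subgroup.intro, rule group.subgroupI[OF M.a_group])
      show "hpart ?M d \<subseteq> carrier (add_monoid ?M)" by (auto simp: hpart_free)
      have "\<zero>\<^bsub>?M\<^esub> \<in> hpart ?M d" by (rule hpart_free_coI[OF M.zero_closed]) (simp add: free_simps)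
      then show "hpart ?M d \<noteq> {}" by blast
    next
      fix x assume x: "x \<in> hpart ?M d"
      then have xc: "x \<in> carrier ?M" by (simp add: hpart_free)
      have n: "\<ominus>\<^bsub>?M\<^esub> x \<in> carrier ?M" using xc by simp
      have "co ((\<ominus>\<^bsub>?M\<^esub> x) b) m + co (x b) m = 0" for b m
      proof -
        have "(\<ominus>\<^bsub>?M\<^esub> x) b \<oplus>\<^bsub>A\<^esub> x b = \<zero>\<^bsub>A\<^esub>"
          using M.l_neg[OF xc] by (simp add: free_simps fun_eq_iff)
        then show ?thesis using co_add[OF cA[OF n] cA[OF xc], of b b m] by simp
      qed
      then have "co ((\<ominus>\<^bsub>?M\<^esub> x) b) m = - co (x b) m" for b m by (simp add: eq_neg_iff_add_eq_0)
      then have "\<ominus>\<^bsub>?M\<^esub> x \<in> hpart ?M d" using hpart_free_coD[OF x] by (intro hpart_free_coI[OF n]) simp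
      then show "inv\<^bsub>add_monoid ?M\<^esub> x \<in> hpart ?M d" by (simp add: a_inv_def)
    next
      fix x y assume x: "x \<in> hpart ?M d" and y: "y \<in> hpart ?M d"
      then have "x \<in> carrier ?M" "y \<in> carrier ?M" by (simp_all add: hpart_free)
      note xyc = this
      have "dgm m + dg b = d" if nz: "co (x b \<oplus>\<^bsub>A\<^esub> y b) m \<noteq> 0" for b m
      proof -
        have "co (x b) m \<noteq> 0 \<or> co (y b) m \<noteq> 0" using nz by (auto simp: co_add cA xyc)
        then show ?thesis using x y unfolding hpart_free_co by blast
      qed
      then have "x \<oplus>\<^bsub>?M\<^esub> y \<in> hpart ?M d"
        by (intro hpart_free_coI) (simp_all add: xyc free_simps(2) free_add_closed)
      then show "x \<otimes>\<^bsub>add_monoid ?M\<^esub> y \<in> hpart ?M d" by simp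
    qed
  next
    fix a i x d assume a: "a \<in> hom_part A i" and x: "x \<in> hpart ?M d"
    then have xc: "x \<in> carrier ?M" and ac: "a \<in> carrier A" by (simp_all add: hpart_free hom_part_iff)
    have "dgm m + dg b = i + d" if nz: "co (a \<otimes>\<^bsub>A\<^esub> x b) m \<noteq> 0" for b m
    proof -
      have m: "m \<in> Idx" using nz co_Idx[of "a \<otimes>\<^bsub>A\<^esub> x b"] ac cA[OF xc] by auto
      have "(\<Sum>l\<in>dv m. gam l (m - l) * co a l * co (x b) (m - l)) \<noteq> 0"
        using nz by (simp add: co_mult ac cA[OF xc] m)
      then obtain l where l: "l \<in> dv m" "co a l \<noteq> 0" "co (x b) (m - l) \<noteq> 0"
        by (rule sum.not_neutral_contains_not_neutral) auto
      have "dgm l = i" "dgm (m - l) + dg b = d" using a x l unfolding hom_part_iff hpart_free_co by blast+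
      then show ?thesis using dgm_dv[OF m l(1)] by simp
    qed
    then show "a \<odot>\<^bsub>?M\<^esub> x \<in> hpart ?M (i + d)"
      by (intro hpart_free_coI) (simp_all add: free_simps(3) free_smult_closed[OF ac xc])
  next
    fix x assume x: "x \<in> carrier ?M"
    note xc = cA[OF x]
    let ?c = "\<lambda>d b. gcomp A (d - dg b) (x b)"
    have coc: "co (?c d b) m = (if dgm m + dg b = d then co (x b) m else 0)" for d b m
      using co_gcomp[OF xc, of "d - dg b" b m] by (auto simp: algebra_simps)
    have gz: "gcomp A d \<zero>\<^bsub>A\<^esub> = \<zero>\<^bsub>A\<^esub>" for d
      by (rule co_inj) (simp_all add: gcomp_closed co_gcomp)
    have cc: "?c d \<in> carrier ?M" for d
    proof -
      have "{b. ?c d b \<noteq> \<zero>\<^bsub>A\<^esub>} \<subseteq> {b. x b \<noteq> \<zero>\<^bsub>A\<^esub>}" using gz by auto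
      then have "finite {b. ?c d b \<noteq> \<zero>\<^bsub>A\<^esub>}" by (rule finite_subset) (use x in \<open>simp add: carrier_free\<close>)
      then show ?thesis using x gz by (simp add: carrier_free gcomp_closed)
    qed
    have ch: "?c d \<in> hpart ?M d" for d
      by (rule hpart_free_coI[OF cc]) (simp add: coc split: if_splits)
    have fin: "finite {d. ?c d \<noteq> \<zero>\<^bsub>?M\<^esub>}"
    proof (rule finite_subset)
      show "{d. ?c d \<noteq> \<zero>\<^bsub>?M\<^esub>} \<subseteq> (\<Union>b\<in>{b. x b \<noteq> \<zero>\<^bsub>A\<^esub>}. (\<lambda>m. dgm m + dg b) ` {m. co (x b) m \<noteq> 0})"
      proof
        fix d assume "d \<in> {d. ?c d \<noteq> \<zero>\<^bsub>?M\<^esub>}"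
        then obtain b where b: "?c d b \<noteq> \<zero>\<^bsub>A\<^esub>" by (auto simp: free_simps fun_eq_iff)
        then have "\<not> (\<forall>m. co (?c d b) m = co \<zero>\<^bsub>A\<^esub> m)" using co_inj[OF gcomp_closed[OF xc] zero_closed] by blast
        then obtain m where "dgm m + dg b = d" "co (x b) m \<noteq> 0" by (auto simp: coc split: if_splits)
        moreover have "x b \<noteq> \<zero>\<^bsub>A\<^esub>" using b gz by metis
        ultimately show "d \<in> (\<Union>b\<in>{b. x b \<noteq> \<zero>\<^bsub>A\<^esub>}. (\<lambda>m. dgm m + dg b) ` {m. co (x b) m \<noteq> 0})" by blast
      qed
      show "finite (\<Union>b\<in>{b. x b \<noteq> \<zero>\<^bsub>A\<^esub>}. (\<lambda>m. dgm m + dg b) ` {m. co (x b) m \<noteq> 0})"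
        using x xc co_finite by (auto simp: carrier_free)
    qed
    have key: "co (finsum ?M c {d. c d \<noteq> \<zero>\<^bsub>?M\<^esub>} b) m = co (c (dgm m + dg b) b) m"
      if c: "\<forall>d. c d \<in> hpart ?M d" "finite {d. c d \<noteq> \<zero>\<^bsub>?M\<^esub>}" for c b m
    proof -
      let ?S = "{d. c d \<noteq> \<zero>\<^bsub>?M\<^esub>}"
      have ccM: "c d \<in> carrier ?M" for d using c by (simp add: hpart_free)
      have "co (finsum ?M c ?S b) m = (\<Sum>d\<in>?S. co (c d b) m)"
        using finsum_free[OF M.abelian_monoid_axioms c(2), of c] ccM co_finsum[OF c(2)] cA by simp
      also have "\<dots> = (\<Sum>d\<in>?S. if d = dgm m + dg b then co (c (dgm m + dg b) b) m else 0)"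
      proof (rule sum.cong[OF refl])
        fix d
        show "co (c d b) m = (if d = dgm m + dg b then co (c (dgm m + dg b) b) m else 0)"
          using hpart_free_coD[OF c(1)[rule_format, of d], of b m] by (cases "co (c d b) m = 0") auto
      qed
      also have "\<dots> = co (c (dgm m + dg b) b) m"
        using c(2) by (auto simp: free_simps)
      finally show ?thesis .
    qed
    show "\<exists>!c. (\<forall>d. c d \<in> hpart ?M d) \<and> finite {d. c d \<noteq> \<zero>\<^bsub>?M\<^esub>} \<and>
           x = (\<Oplus>\<^bsub>?M\<^esub>d\<in>{d. c d \<noteq> \<zero>\<^bsub>?M\<^esub>}. c d)"
    proof (rule ex1I[of _ ?c], intro conjI allI)
      show "x = (\<Oplus>\<^bsub>?M\<^esub>d\<in>{d. ?c d \<noteq> \<zero>\<^bsub>?M\<^esub>}. ?c d)"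
      proof
        fix b
        have "(\<Oplus>\<^bsub>?M\<^esub>d\<in>{d. ?c d \<noteq> \<zero>\<^bsub>?M\<^esub>}. ?c d) \<in> carrier ?M" by (rule M.finsum_closed) (use cc in auto)
        then show "x b = (\<Oplus>\<^bsub>?M\<^esub>d\<in>{d. ?c d \<noteq> \<zero>\<^bsub>?M\<^esub>}. ?c d) b"
          using key[of ?c b, OF _ fin] ch by (intro co_inj[OF xc cA]) (simp_all add: coc co_gcomp xc)
      qed
    next
      fix c' assume c': "(\<forall>d. c' d \<in> hpart ?M d) \<and> finite {d. c' d \<noteq> \<zero>\<^bsub>?M\<^esub>} \<and>
           x = (\<Oplus>\<^bsub>?M\<^esub>d\<in>{d. c' d \<noteq> \<zero>\<^bsub>?M\<^esub>}. c' d)"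
      have c'c: "c' d \<in> carrier ?M" for d using c' by (simp add: hpart_free)
      show "c' = ?c"
      proof (intro ext)
        fix d b show "c' d b = ?c d b"
        proof (rule co_inj)
          fix m
          have 1: "co (x b) m = co (c' (dgm m + dg b) b) m" using key[of c' b m] c' by simp
          show "co (c' d b) m = co (?c d b) m"
          proof (cases "dgm m + dg b = d")
            case False
            then have "co (c' d b) m = 0" using hpart_free_coD[OF c'[THEN conjunct1, rule_format, of d], of b m] by blast
            then show ?thesis using False by (simp add: coc)
          qed (simp add: coc 1)
        qed (use c'c cA gcomp_closed xc in auto)
      qed
    qed (use ch fin in auto)
  qed
  ultimately show ?thesis by (rule graded_module.intro)
qed

end

section \<open>The minimal model on harmonic generators\<close>

context monomial_algebra begin
lemma graded_complex_free:
  assumes X: "col_finite X"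
    and hom: "\<And>n. Df (coeff_complex X) n \<in> graded_hom A (Tm (Gens X n) (gdeg X n)) (Tm (Gens X (n + 1)) (gdeg X (n + 1)))"
    and sq: "\<And>n q. q \<in> supp_in (Gens X n) \<Longrightarrow> Df (coeff_complex X) (n + 1) (Df (coeff_complex X) n q) = 0"
  shows "graded_complex A (free_complex_of A X)"
proof -
  let ?F = "free_complex_of A X"
  have tz: "coeff_fun (\<lambda>b. \<zero>\<^bsub>A\<^esub>) = 0" by (rule ext) (simp add: coeff_fun_def)
  have zc: "(\<lambda>b. \<zero>\<^bsub>A\<^esub>) \<in> carrier (free_gmodule A B dg)" for B and dg :: "'b \<Rightarrow> int"
    by (simp add: carrier_free zero_closed)
  note cl = free_Df_closed[OF X] and td = coeff_fun_Df[OF X]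
  show ?thesis unfolding graded_complex_def
  proof (intro allI conjI ballI)
    fix n
    show "graded_module A (Ob ?F n)" unfolding free_complex_simps(1) by (rule graded_module_free)
    show "Df ?F n \<in> graded_hom A (Ob ?F n) (Ob ?F (n + 1))"
      unfolding free_complex_simps(1)
    proof (rule graded_homI)
      fix x y assume x: "x \<in> carrier (free_gmodule A (Gens X n) (gdeg X n))" and y: "y \<in> carrier (free_gmodule A (Gens X n) (gdeg X n))"
      have "coeff_fun (Df ?F n (\<lambda>b. x b \<oplus>\<^bsub>A\<^esub> y b)) = coeff_fun (\<lambda>c. Df ?F n x c \<oplus>\<^bsub>A\<^esub> Df ?F n y c)"
        using graded_homD(2)[OF hom, of "coeff_fun x" n "coeff_fun y"]
        by (simp add: td free_add_closed x y coeff_fun_add[OF cl[OF x] cl[OF y]] coeff_fun_add[OF x y] coeff_fun_supp_in[OF x] coeff_fun_supp_in[OF y])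
      from coeff_fun_inj[OF cl[OF free_add_closed[OF x y]] free_add_closed[OF cl[OF x] cl[OF y]] this]
      show "Df ?F n (x \<oplus>\<^bsub>free_gmodule A (Gens X n) (gdeg X n)\<^esub> y) =
           Df ?F n x \<oplus>\<^bsub>free_gmodule A (Gens X (n + 1)) (gdeg X (n + 1))\<^esub> Df ?F n y"
        by (simp add: free_simps)
    next
      fix a x assume a: "a \<in> carrier A" and x: "x \<in> carrier (free_gmodule A (Gens X n) (gdeg X n))"
      have "coeff_fun (Df ?F n (\<lambda>b. a \<otimes>\<^bsub>A\<^esub> x b)) = coeff_fun (\<lambda>c. a \<otimes>\<^bsub>A\<^esub> Df ?F n x c)"
        using graded_homD(3)[OF hom a, of "coeff_fun x" n]
        by (simp add: td free_smult_closed[OF a x] coeff_fun_act[OF a cl[OF x]] coeff_fun_act[OF a x] coeff_fun_supp_in[OF x] x)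
      from coeff_fun_inj[OF cl[OF free_smult_closed[OF a x]] free_smult_closed[OF a cl[OF x]] this]
      show "Df ?F n (a \<odot>\<^bsub>free_gmodule A (Gens X n) (gdeg X n)\<^esub> x) =
           a \<odot>\<^bsub>free_gmodule A (Gens X (n + 1)) (gdeg X (n + 1))\<^esub> Df ?F n x"
        by (simp add: free_simps)
    next
      fix x d assume x: "x \<in> hpart (free_gmodule A (Gens X n) (gdeg X n)) d"
      then have xc: "x \<in> carrier (free_gmodule A (Gens X n) (gdeg X n))" by (simp add: hpart_free)
      show "Df ?F n x \<in> hpart (free_gmodule A (Gens X (n + 1)) (gdeg X (n + 1))) d"
        using graded_homD(4)[OF hom coeff_fun_hpartD[OF x]] coeff_fun_hpart[OF cl[OF xc]] by (simp add: td xc)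
    qed (rule cl)
    fix x assume "x \<in> carrier (Ob ?F n)"
    then have x: "x \<in> carrier (free_gmodule A (Gens X n) (gdeg X n))" by (simp add: free_complex_simps)
    have "coeff_fun (Df ?F (n + 1) (Df ?F n x)) = coeff_fun (\<lambda>b. \<zero>\<^bsub>A\<^esub>)"
      using sq[OF coeff_fun_supp_in[OF x]] by (simp add: td cl[OF x] x tz)
    from coeff_fun_inj[OF cl[OF cl[OF x]] zc this]
    show "Df ?F (n + 1) (Df ?F n x) = \<zero>\<^bsub>Ob ?F (n + 2)\<^esub>" by (simp add: free_complex_simps(1) free_simps)
  qed
qed

end

context ladder
begin

text \<open>The matrix of the transferred differential, read off from its values on the generators.\<close>

definition Xmin :: "('r, int \<times> 'a) free_data" where
  "Xmin = \<lparr>Gens = harm_gens, gdeg = harm_deg,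
     Mat = (\<lambda>n c b. mk (\<lambda>m. Poly_Mapping.lookup (harm_diff n (tens e0 (Poly_Mapping.single b 1)) m) c))\<rparr>"

lemma Xmin_simps [simp]: "Gens Xmin = harm_gens" "gdeg Xmin = harm_deg"
  by (simp_all add: Xmin_def)

context
  fixes m0 :: int
  assumes lb: "\<forall>t i j a. (t, i, j, a) \<in> bs \<longrightarrow> m0 \<le> i"
begin

lemma harm_diff_col:
  assumes b: "b \<in> harm_gens n"
  shows "harm_diff n (tens e0 (Poly_Mapping.single b 1)) \<in> hpart (Tg (n + 1)) (harm_deg n b)"
proof (rule graded_homD(4)[OF harm_diff_hom[OF lb]])
  have "dgm e0 = 0" using dgm_zero e0_Idx by blast
  then show "tens e0 (Poly_Mapping.single b 1) \<in> hpart (Tg n) (harm_deg n b)"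
    using b by (auto simp: hpart_Tm supp_in_tens e0_Idx) (auto simp: tens_def split: if_splits)
qed

lemma harm_diff_col_supp: "b \<in> harm_gens n \<Longrightarrow> harm_diff n (tens e0 (Poly_Mapping.single b 1)) \<in> supp_in (harm_gens (n + 1))"
  using harm_diff_col hpart_Tm by blast

lemma Mat_Xmin:
  assumes b: "b \<in> harm_gens n"
  shows "Mat Xmin n y b \<in> carrier A"
    "co (Mat Xmin n y b) m = Poly_Mapping.lookup (harm_diff n (tens e0 (Poly_Mapping.single b 1)) m) y"
proof -
  let ?w = "harm_diff n (tens e0 (Poly_Mapping.single b 1))"
  note w = harm_diff_col_supp[OF b]
  have "{m. Poly_Mapping.lookup (?w m) y \<noteq> 0} \<subseteq> {m. ?w m \<noteq> 0}" by auto
  then have "finite {m. Poly_Mapping.lookup (?w m) y \<noteq> 0}" "{m. Poly_Mapping.lookup (?w m) y \<noteq> 0} \<subseteq> Idx"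
    using supp_inD(2)[OF w] supp_inD(3)[OF w] by (auto intro: finite_subset)
  from mk[OF this] show "Mat Xmin n y b \<in> carrier A" "co (Mat Xmin n y b) m = Poly_Mapping.lookup (?w m) y"
    by (simp_all add: Xmin_def)
qed

lemma col_finite_Xmin: "col_finite Xmin"
  unfolding col_finite_def
proof (intro allI ballI conjI)
  fix n b assume "b \<in> Gens Xmin n"
  then have b: "b \<in> harm_gens n" by simp
  let ?w = "harm_diff n (tens e0 (Poly_Mapping.single b 1))"
  show "Mat Xmin n c b \<in> carrier A" for c by (rule Mat_Xmin(1)[OF b])
  have "{c \<in> Gens Xmin (n + 1). Mat Xmin n c b \<noteq> \<zero>\<^bsub>A\<^esub>} \<subseteq> (\<Union>m\<in>{m. ?w m \<noteq> 0}. Poly_Mapping.keys (?w m))"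
  proof
    fix c assume "c \<in> {c \<in> Gens Xmin (n + 1). Mat Xmin n c b \<noteq> \<zero>\<^bsub>A\<^esub>}"
    then have "\<not> (\<forall>m. co (Mat Xmin n c b) m = co \<zero>\<^bsub>A\<^esub> m)"
      using co_inj[OF Mat_Xmin(1)[OF b] zero_closed] by blast
    then obtain m where "Poly_Mapping.lookup (?w m) c \<noteq> 0" by (auto simp: Mat_Xmin(2)[OF b])
    then have "c \<in> Poly_Mapping.keys (?w m)" "?w m \<noteq> 0" by (simp_all add: in_keys_iff) auto
    then show "c \<in> (\<Union>m\<in>{m. ?w m \<noteq> 0}. Poly_Mapping.keys (?w m))" by blast
  qed
  moreover have "finite (\<Union>m\<in>{m. ?w m \<noteq> 0}. Poly_Mapping.keys (?w m))"
    using supp_inD(2)[OF harm_diff_col_supp[OF b]] by auto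
  ultimately show "finite {c \<in> Gens Xmin (n + 1). Mat Xmin n c b \<noteq> \<zero>\<^bsub>A\<^esub>}" by (rule finite_subset)
qed

lemma coeff_complex_Xmin: 
  assumes x: "x \<in> supp_in (harm_gens n)"
  shows "Df (coeff_complex Xmin) n x = harm_diff n x"
proof
  fix m
  have tm: "coeff_mat Xmin n r b = harm_diff n (tens e0 (Poly_Mapping.single b 1)) r" if b: "b \<in> harm_gens n" for r b
  proof (rule poly_mapping_eqI)
    fix c
    have "Poly_Mapping.lookup (harm_diff n (tens e0 (Poly_Mapping.single b 1)) r) c = 0" if "c \<notin> harm_gens (n + 1)"
    proof -
      have "c \<notin> Poly_Mapping.keys (harm_diff n (tens e0 (Poly_Mapping.single b 1)) r)"
        using supp_inD(1)[OF harm_diff_col_supp[OF b], of r] that by blast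
      then show ?thesis by (simp add: in_keys_iff)
    qed
    then show "Poly_Mapping.lookup (coeff_mat Xmin n r b) c = Poly_Mapping.lookup (harm_diff n (tens e0 (Poly_Mapping.single b 1)) r) c"
      using lookup_coeff_mat[OF col_finite_Xmin, of b n r c] b by (simp add: Mat_Xmin(2)[OF b])
  qed
  show "Df (coeff_complex Xmin) n x m = harm_diff n x m"
  proof (cases "m \<in> Idx")
    case True
    have "harm_diff n x m = (\<Sum>l\<in>dv m. scal (gam l (m - l)) (harm_diff n (tens e0 (x l)) (m - l)))"
      by (rule hom_expand[OF harm_diff_hom[OF lb] x True])
    also have "\<dots> = (\<Sum>l\<in>dv m. scal (gam l (m - l)) (lin_ext (coeff_mat Xmin n (m - l)) (x l)))"
    proof (rule sum.cong[OF refl])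
      fix l assume l: "l \<in> dv m"
      have "harm_diff n (tens e0 (x l)) (m - l) = lin_ext (\<lambda>b. harm_diff n (tens e0 (Poly_Mapping.single b 1)) (m - l)) (x l)"
        by (rule hom_tens_lin[OF harm_diff_hom[OF lb] supp_inD(1)[OF x] minus_Idx[OF True l]])
      also have "\<dots> = lin_ext (coeff_mat Xmin n (m - l)) (x l)"
      proof (rule lin_ext_cong)
        fix b assume "b \<in> Poly_Mapping.keys (x l)"
        then have "b \<in> harm_gens n" using supp_inD(1)[OF x, of l] by blast
        then show "harm_diff n (tens e0 (Poly_Mapping.single b 1)) (m - l) = coeff_mat Xmin n (m - l) b"
          by (rule tm[symmetric])
      qed
      finally show "scal (gam l (m - l)) (harm_diff n (tens e0 (x l)) (m - l)) = scal (gam l (m - l)) (lin_ext (coeff_mat Xmin n (m - l)) (x l))"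
        by simp
    qed
    finally show ?thesis using True by (simp add: coeff_complex_def)
  next
    case False
    have "harm_diff n x \<in> supp_in (harm_gens (n + 1))" using graded_homD(1)[OF harm_diff_hom[OF lb], of x n] x by simp
    then have "harm_diff n x m = 0" by (rule supp_inD(3)[OF _ False])
    then show ?thesis by (simp add: coeff_complex_def False)
  qed
qed

lemma coeff_complex_Xmin_hom: "Df (coeff_complex Xmin) n \<in> graded_hom A (Tg n) (Tg (n + 1))"
proof (rule graded_homI)
  fix x d assume x: "x \<in> hpart (Tg n) d"
  then have "x \<in> supp_in (harm_gens n)" by (simp add: hpart_Tm)
  then show "Df (coeff_complex Xmin) n x \<in> hpart (Tg (n + 1)) d" using graded_homD(4)[OF harm_diff_hom[OF lb] x] by (simp add: coeff_complex_Xmin)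
qed (use graded_homD[OF harm_diff_hom[OF lb]] in \<open>simp_all add: coeff_complex_Xmin supp_in_add supp_in_act\<close>)

lemma harm_diff_harm_diff: 
  assumes x: "x \<in> supp_in (harm_gens n)" shows "harm_diff (n + 1) (harm_diff n x) = 0"
proof -
  have "P.D (pw (harm_incl n) x) \<in> supp_in (basis_at bs (n + 1))"
    using graded_homD(1)[OF graded_hom_comp[OF j_hom D_hom], of x n] x by simp
  from q_jr_q[OF lb this]
  have "P.q (P.D (pw (harm_incl (n + 1)) (harm_diff n x))) = P.D (P.q (P.D (pw (harm_incl n) x)))"
    unfolding P.qD harm_diff_def by (simp add: P.qD)
  also have "\<dots> = 0" by (simp add: P.qD[symmetric] P.DD P.q_ad)
  finally show ?thesis by (simp add: harm_diff_def[of "n + 1"] lins)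
qed

lemma minimal_Xmin: "minimal_free_data A Xmin"
proof -
  have gc: "graded_complex A (free_complex_of A Xmin)"
  proof (rule graded_complex_free[OF col_finite_Xmin])
    fix n q assume q: "q \<in> supp_in (Gens Xmin n)"
    have "harm_diff n q \<in> supp_in (harm_gens (n + 1))" using graded_homD(1)[OF harm_diff_hom[OF lb], of q n] q by simp
    then show "Df (coeff_complex Xmin) (n + 1) (Df (coeff_complex Xmin) n q) = 0" using q by (simp add: coeff_complex_Xmin harm_diff_harm_diff)
  qed (simp add: coeff_complex_Xmin_hom)
  have hp: "Mat Xmin n c b \<in> hom_part A (harm_deg n b - harm_deg (n + 1) c)" if b: "b \<in> harm_gens n" for n b c
    unfolding hom_part_iff
  proof (intro conjI allI impI)
    fix m assume "co (Mat Xmin n c b) m \<noteq> 0"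
    then have "c \<in> Poly_Mapping.keys (harm_diff n (tens e0 (Poly_Mapping.single b 1)) m)"
      by (simp add: Mat_Xmin(2)[OF b] in_keys_iff)
    then have "dgm m + harm_deg (n + 1) c = harm_deg n b" using harm_diff_col[OF b] by (simp add: hpart_Tm)
    then show "dgm m = harm_deg n b - harm_deg (n + 1) c" by simp
  qed (rule Mat_Xmin(1)[OF b])
  have mx: "Mat Xmin n c b \<in> hom_max_ideal A" if b: "b \<in> harm_gens n" for n b c
  proof -
    have "co (gcomp A 0 (Mat Xmin n c b)) m = co \<zero>\<^bsub>A\<^esub> m" for m
    proof (cases "m \<in> Idx \<and> dgm m = 0")
      case True
      then have "m = e0" using dgm_zero by blast
      then show ?thesis by (simp add: co_gcomp Mat_Xmin[OF b] harm_diff_e0)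
    next
      case False
      then show ?thesis using co_Idx[OF Mat_Xmin(1)[OF b, of c], of m] by (auto simp: co_gcomp Mat_Xmin(1)[OF b])
    qed
    then have "gcomp A 0 (Mat Xmin n c b) = \<zero>\<^bsub>A\<^esub>"
      using Mat_Xmin(1)[OF b] gcomp_closed zero_closed by (intro co_inj) auto
    then show ?thesis using Mat_Xmin(1)[OF b] by (simp add: hom_max_ideal_def)
  qed
  show ?thesis unfolding minimal_free_data_def graded_free_data_def
    using gc hp mx col_finite_Xmin by (auto simp: col_finite_def)
qed

theorem minimal_model_exists:
  "minimal_free_data A Xmin \<and> homotopy_equivalent A (free_complex_of A Xmin) (total_complex bs c Y)"
proof
  have iso: "iso_complex A (coeff_complex Xmin) harm_complex"
    unfolding iso_complex_def
  proof (rule exI[of _ "\<lambda>n x. x"], rule exI[of _ "\<lambda>n x. x"], intro conjI)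
    have O: "Ob (coeff_complex Xmin) n = Tg n" for n by (simp add: coeff_complex_def)
    show "chain_map A (coeff_complex Xmin) harm_complex (\<lambda>n x. x)" "chain_map A harm_complex (coeff_complex Xmin) (\<lambda>n x. x)"
      by (auto simp: chain_map_def O hom_id coeff_complex_Xmin)
  qed auto
  have cl: "op_closed A harm_complex"
    by (rule op_closed_iso[OF iso op_closed_coeff_complex[OF col_finite_Xmin]]) (auto simp: hpart_Tm)
  have "homotopy_equivalent A (total_complex bs c Y) (coeff_complex Xmin)"
    by (rule homotopy_equivalent_iso_right[OF homotopy_equivalent_sym[OF homotopy_equivalent_harm_complex[OF lb]] iso_complex_sym[OF iso] cl])
  then have "homotopy_equivalent A (total_complex bs c Y) (free_complex_of A Xmin)"
    by (rule homotopy_equivalent_iso_right[OF _ iso_complex_sym[OF free_iso[OF col_finite_Xmin]] op_closed_coeff_complex[OF col_finite_Xmin]])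
  then show "homotopy_equivalent A (free_complex_of A Xmin) (total_complex bs c Y)" by (rule homotopy_equivalent_sym)
qed (rule minimal_Xmin)

end

end

section \<open>The linear part of a minimal model\<close>

context monomial_algebra
begin

lemma tens_self [simp]: "tens l u l = u"
  by (simp add: tens_def)

lemma dv_var: "k < v \<Longrightarrow> dv (var k) = {e0, var k}"
proof -
  assume k: "k < v"
  note K = var_Idx[OF k]
  have "l = e0 \<or> l = var k" if l: "l \<in> dv (var k)" for l
  proof -
    have "- eta = dgm l + dgm (var k - l)" using dgm_dv[OF K l] dgm_var[OF k] by simp
    moreover have "eta * dgm l \<le> 0" "eta * dgm (var k - l) \<le> 0"
      using dgm_sign dv_Idx[OF K l] minus_Idx[OF K l] by auto
    ultimately have "dgm l = 0 \<or> dgm (var k - l) = 0" using eta by auto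
    then show ?thesis using dgm_zero dv_Idx[OF K l] minus_Idx[OF K l] minus_eq_e0[OF K l] by auto
  qed
  then show ?thesis using e0_dv[OF K] m_minus_m[OF K] by blast
qed

lemma var_ne_e0: "k < v \<Longrightarrow> var k \<noteq> e0"
  using dgm_var[of k] dgm_zero[OF e0_Idx] eta by auto

text \<open>Constant coefficients of a homomorphism depend only on constant coefficients of the argument; for
  the coefficient of a variable (\<open>hom_var\<close>) exactly two terms of the expansion remain.\<close>

lemma hom_e0:
  assumes f: "f \<in> graded_hom A (Tm B dg) (Tm B' dg')" and q: "q \<in> supp_in B"
  shows "f q e0 = f (tens e0 (q e0)) e0"
  using hom_expand[OF f q e0_Idx] gam_e0[OF e0_Idx] m_e0[OF e0_Idx] by (simp add: dv_e0)

lemma hom_var: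
  assumes f: "f \<in> graded_hom A (Tm B dg) (Tm B' dg')" and q: "q \<in> supp_in B" and k: "k < v"
  shows "f q (var k) = f (tens e0 (q e0)) (var k) + f (tens e0 (q (var k))) e0"
  using hom_expand[OF f q var_Idx[OF k]] gam_e0[OF var_Idx[OF k]] m_e0[OF var_Idx[OF k]] m_minus_m[OF var_Idx[OF k]] var_ne_e0[OF k]
  by (simp add: dv_var[OF k])

lemma co_erase:
  assumes a: "a \<in> carrier A"
  shows "erase_above_linear A a \<in> carrier A"
    "co (erase_above_linear A a) m = (if \<bar>dgm m\<bar> \<le> 1 then co a m else 0)"
proof -
  interpret ring A by (rule ring_A)
  show "erase_above_linear A a \<in> carrier A"
    unfolding erase_above_linear_def using gcomp_closed[OF a] by simp
  show "co (erase_above_linear A a) m = (if \<bar>dgm m\<bar> \<le> 1 then co a m else 0)"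
    unfolding erase_above_linear_def using gcomp_closed[OF a] by (auto simp: co_add co_gcomp a)
qed

lemma erase_zero: "erase_above_linear A \<zero>\<^bsub>A\<^esub> = \<zero>\<^bsub>A\<^esub>"
  by (rule co_inj) (simp_all add: co_erase zero_closed)

lemma linear_part_simps [simp]:
  "Gens (linear_part A X) = Gens X" "gdeg (linear_part A X) = gdeg X"
  "Mat (linear_part A X) n c b = erase_above_linear A (Mat X n c b)"
  by (simp_all add: linear_part_def)

lemma col_finite_linear_part:
  assumes "col_finite X"
  shows "col_finite (linear_part A X)"
  unfolding col_finite_def
proof (intro allI ballI conjI)
  fix n b assume "b \<in> Gens (linear_part A X) n"
  then have b: "b \<in> Gens X n" by simp
  have X: "\<And>c. c \<in> Gens X (n + 1) \<Longrightarrow> Mat X n c b \<in> carrier A" "finite {c \<in> Gens X (n + 1). Mat X n c b \<noteq> \<zero>\<^bsub>A\<^esub>}"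
    using assms b by (auto simp: col_finite_def)
  show "Mat (linear_part A X) n c b \<in> carrier A" if "c \<in> Gens (linear_part A X) (n + 1)" for c
    using X(1) that by (simp add: co_erase)
  show "finite {c \<in> Gens (linear_part A X) (n + 1). Mat (linear_part A X) n c b \<noteq> \<zero>\<^bsub>A\<^esub>}"
    by (rule finite_subset[OF _ X(2)]) (auto simp: erase_zero)
qed

lemma minimal_col_finite: "minimal_free_data A X \<Longrightarrow> col_finite X"
  by (auto simp: minimal_free_data_def graded_free_data_def col_finite_def hom_part_def)

lemma coeff_mat_e0:
  assumes X: "minimal_free_data A X" and b: "b \<in> Gens X n"
  shows "coeff_mat X n e0 b = 0"
proof (rule poly_mapping_eqI)
  fix c
  have "co (Mat X n c b) e0 = 0" if c: "c \<in> Gens X (n + 1)"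
  proof -
    have "Mat X n c b \<in> hom_max_ideal A" using X b c by (simp add: minimal_free_data_def)
    then have "Mat X n c b \<in> carrier A" "gcomp A 0 (Mat X n c b) = \<zero>\<^bsub>A\<^esub>" by (auto simp: hom_max_ideal_def)
    moreover have "dgm e0 = 0" using dgm_zero e0_Idx by blast
    ultimately show ?thesis using co_gcomp[of "Mat X n c b" 0 e0] by simp
  qed
  then show "Poly_Mapping.lookup (coeff_mat X n e0 b) c = Poly_Mapping.lookup 0 c"
    by (simp add: lookup_coeff_mat[OF minimal_col_finite[OF X] b])
qed

lemma coeff_complex_min_e0:
  assumes X: "minimal_free_data A X" and q: "q \<in> supp_in (Gens X n)"
  shows "Df (coeff_complex X) n q e0 = 0"
proof -
  have "lin_ext (coeff_mat X n e0) (q e0) = lin_ext (\<lambda>b. 0) (q e0)"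
    by (rule lin_ext_cong) (rule coeff_mat_e0[OF X], rule subsetD[OF supp_inD(1)[OF q]])
  then show ?thesis by (simp add: coeff_complex_Df_e0)
qed

lemma coeff_complex_tens_var:
  assumes k: "k < v"
  shows "Df (coeff_complex X) n (tens e0 u) (var k) = lin_ext (coeff_mat X n (var k)) u"
proof -
  have "Df (coeff_complex X) n (tens e0 u) (var k) =
      (\<Sum>l\<in>{e0, var k}. scal (gam l (var k - l)) (lin_ext (coeff_mat X n (var k - l)) (tens e0 u l)))"
    using var_Idx[OF k] by (simp add: coeff_complex_def dv_var[OF k])
  then show ?thesis
    using gam_e0[OF var_Idx[OF k]] m_e0[OF var_Idx[OF k]] var_ne_e0[OF k] by (simp add: tens_def)
qed

text \<open>For a minimal complex the erased matrices only contain variables, and the differential takes the form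
  \<open>del\<close> for the matrices of coefficients of the variables.\<close>

lemma coeff_complex_linear_part:
  assumes X: "minimal_free_data A X" and q: "q \<in> supp_in (Gens X n)"
  shows "Df (coeff_complex (linear_part A X)) n q = del (\<lambda>k. coeff_mat X n (var k)) q"
proof
  fix m
  note cX = minimal_col_finite[OF X]
  show "Df (coeff_complex (linear_part A X)) n q m = del (\<lambda>k. coeff_mat X n (var k)) q m"
  proof (cases "m \<in> Idx")
    case False
    then show ?thesis by (simp add: coeff_complex_def del_def vr_def)
  next
    case m: True
    have tl: "coeff_mat (linear_part A X) n r b = (if \<bar>dgm r\<bar> \<le> 1 then coeff_mat X n r b else 0)" if b: "b \<in> Gens X n" for r b
    proof (rule poly_mapping_eqI)
      fix c
      have "c \<in> Gens X (n + 1) \<Longrightarrow> Mat X n c b \<in> carrier A" using cX b by (simp add: col_finite_def)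
      then show "Poly_Mapping.lookup (coeff_mat (linear_part A X) n r b) c = Poly_Mapping.lookup (if \<bar>dgm r\<bar> \<le> 1 then coeff_mat X n r b else 0) c"
        using lookup_coeff_mat[OF col_finite_linear_part[OF cX], of b n r c] lookup_coeff_mat[OF cX, of b n r c] b by (simp add: co_erase)
    qed
    \<comment> \<open>Only variables contribute as complementary factors: the unit has coefficient zero by minimality, and
      all other monomials are erased.\<close>
    have lz: "lin_ext (coeff_mat (linear_part A X) n (m - l)) (q l) = 0"
      if l: "l \<in> dv m" "l \<notin> (\<lambda>k. m - var k) ` vr m" for l
    proof -
      have "coeff_mat (linear_part A X) n (m - l) b = 0" if b: "b \<in> Gens X n" for b
      proof (cases "\<bar>dgm (m - l)\<bar> \<le> 1")
        case True
        have "\<bar>dgm (m - l)\<bar> \<noteq> 1"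
        proof
          assume "\<bar>dgm (m - l)\<bar> = 1"
          then obtain k where k: "k < v" "m - l = var k" using dgm_one[OF minus_Idx[OF m l(1)]] by blast
          then have "k \<in> vr m" "l = m - var k" using dv_compl[OF m l(1)] m by (auto simp: vr_def)
          then show False using l by blast
        qed
        then have "m - l = e0" using True dgm_zero[OF minus_Idx[OF m l(1)]] by linarith
        then show ?thesis using tl[OF b] coeff_mat_e0[OF X b] by simp
      qed (simp add: tl[OF b])
      then have "lin_ext (coeff_mat (linear_part A X) n (m - l)) (q l) = lin_ext (\<lambda>b. 0) (q l)"
        using supp_inD(1)[OF q] by (intro lin_ext_cong) blast
      then show ?thesis by simp
    qed
    have "Df (coeff_complex (linear_part A X)) n q m =
        (\<Sum>l\<in>dv m. scal (gam l (m - l)) (lin_ext (coeff_mat (linear_part A X) n (m - l)) (q l)))"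
      using m by (simp add: coeff_complex_def)
    also have "\<dots> = (\<Sum>l\<in>(\<lambda>k. m - var k) ` vr m. scal (gam l (m - l)) (lin_ext (coeff_mat (linear_part A X) n (m - l)) (q l)))"
      by (rule sum.mono_neutral_right) (use m dv_finite vrD lz in auto)
    also have "\<dots> = (\<Sum>k\<in>vr m. scal (gam (m - var k) (m - (m - var k))) (lin_ext (coeff_mat (linear_part A X) n (m - (m - var k))) (q (m - var k))))"
    proof (rule sum.reindex[unfolded o_def], rule inj_onI)
      fix k l assume kl: "k \<in> vr m" "l \<in> vr m" "m - var k = m - var l"
      then have "var k = var l" using vrD[of k m] vrD[of l m] by metis
      then show "k = l" using var_inj vrD kl by blast
    qed
    also have "\<dots> = del (\<lambda>k. coeff_mat X n (var k)) q m"
      unfolding del_def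
    proof (rule sum.cong[OF refl])
      fix k assume k: "k \<in> vr m"
      have "lin_ext (coeff_mat (linear_part A X) n (var k)) (q (m - var k)) = lin_ext (coeff_mat X n (var k)) (q (m - var k))"
      proof (rule lin_ext_cong)
        fix b assume "b \<in> Poly_Mapping.keys (q (m - var k))"
        then have b: "b \<in> Gens X n" using supp_inD(1)[OF q] by blast
        have "\<bar>dgm (var k)\<bar> \<le> 1" using dgm_var[of k] vrD[OF k] eta by auto
        then show "coeff_mat (linear_part A X) n (var k) b = coeff_mat X n (var k) b" by (simp add: tl[OF b])
      qed
      then show "scal (gam (m - var k) (m - (m - var k))) (lin_ext (coeff_mat (linear_part A X) n (m - (m - var k))) (q (m - var k)))
          = scal (sg k m) (lin_ext (coeff_mat X n (var k)) (q (m - var k)))"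
        using vrD[OF k] by (simp add: sg_def)
    qed
    finally show ?thesis .
  qed
qed

end

context ladder
begin

definition bsH :: "'a idx set" where "bsH = {b \<in> bs. fst b = Harm}"
definition YH :: "nat \<Rightarrow> 'a idx \<Rightarrow> ('a idx \<Rightarrow>\<^sub>0 'k)" where "YH k b = lin_ext pB (Y k b)"

lemma pB_harm: "b \<in> bsH \<Longrightarrow> pB b = Poly_Mapping.single b 1" "b \<in> bsH \<Longrightarrow> dB b = 0"
  by (cases b rule: prod_cases4; simp add: bsH_def pB_def dB_def)+

lemma keys_pB: "Poly_Mapping.keys u \<subseteq> basis_at bs n \<Longrightarrow> Poly_Mapping.keys (lin_ext pB u) \<subseteq> basis_at bsH n"
  by (rule keys_lin_ext) (auto simp: pB_def basis_at_def bsH_def split: if_splits)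

text \<open>The constant coefficients \<open>F0\<close> and \<open>G0\<close> of the two equivalences are nearly inverse to each other:
  \<open>G0 F0\<close> is the identity since all differentials of the minimal complex vanish modulo the maximal
  ideal, while \<open>F0 G0\<close> differs from the identity on harmonic elements by a coboundary, which \<open>pB\<close>
  kills. Hence \<open>pB F0\<close> and \<open>G0\<close> are inverse bijections between the generators and the harmonic basis,
  and comparing the coefficients of the variables in the chain map equation for \<open>f\<close> shows that they
  match the linear parts of the differentials.\<close>

theorem linear_part_minimal_model:
  fixes X :: "('r, 'b) free_data"
  assumes X: "minimal_free_data A X" and he: "homotopy_equivalent A (free_complex_of A X) (total_complex bs c Y)"
  shows "iso_complex A (free_complex_of A (linear_part A X)) (total_complex bsH c YH)"
proof -
  note cX = minimal_col_finite[OF X]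
  have "homotopy_equivalent A (total_complex bs c Y) (coeff_complex X)"
    by (rule homotopy_equivalent_iso_right[OF homotopy_equivalent_sym[OF he] free_iso[OF cX] op_closed_free[OF cX]])
  then obtain g f where gf: "chain_map A (total_complex bs c Y) (coeff_complex X) g" "chain_map A (coeff_complex X) (total_complex bs c Y) f"
      "homotopic_to_id A (total_complex bs c Y) (\<lambda>n x. f n (g n x))" "homotopic_to_id A (coeff_complex X) (\<lambda>n y. g n (f n y))"
    unfolding homotopy_equivalent_def by blast
  have OX: "Ob (coeff_complex X) n = Tm (Gens X n) (gdeg X n)" for n by (simp add: coeff_complex_def)
  note [simp] = OX
  have f: "f n \<in> graded_hom A (Tm (Gens X n) (gdeg X n)) (Th n)" for n using chain_mapD(1)[OF gf(2), of n] by simp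
  have g: "g n \<in> graded_hom A (Th n) (Tm (Gens X n) (gdeg X n))" for n using chain_mapD(1)[OF gf(1), of n] by simp
  obtain s where s: "\<And>n. s n \<in> graded_hom A (Ob (total_complex bs c Y) n) (Ob (total_complex bs c Y) (n - 1))"
    and fg: "\<And>n x. x \<in> carrier (Ob (total_complex bs c Y) n) \<Longrightarrow> f n (g n x) = x \<oplus>\<^bsub>Ob (total_complex bs c Y) n\<^esub>
        (Df (total_complex bs c Y) (n - 1) (s n x) \<oplus>\<^bsub>Ob (total_complex bs c Y) n\<^esub> s (n + 1) (Df (total_complex bs c Y) n x))"
    by (rule homotopic_to_idE[OF gf(3)]) blast
  obtain r where r: "\<And>n. r n \<in> graded_hom A (Ob (coeff_complex X) n) (Ob (coeff_complex X) (n - 1))"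
    and gfr: "\<And>n x. x \<in> carrier (Ob (coeff_complex X) n) \<Longrightarrow> g n (f n x) = x \<oplus>\<^bsub>Ob (coeff_complex X) n\<^esub>
        (Df (coeff_complex X) (n - 1) (r n x) \<oplus>\<^bsub>Ob (coeff_complex X) n\<^esub> r (n + 1) (Df (coeff_complex X) n x))"
    by (rule homotopic_to_idE[OF gf(4)]) blast
  have s': "s n \<in> graded_hom A (Th n) (Th (n - 1))" and r': "r n \<in> graded_hom A (Tm (Gens X n) (gdeg X n)) (Tm (Gens X (n - 1)) (gdeg X (n - 1)))" for n
    using s[of n] r[of n] by simp_all
  let ?harm_gens = "Gens X"
  have tX: "tens e0 u \<in> supp_in (?harm_gens n)" if "Poly_Mapping.keys u \<subseteq> ?harm_gens n" for u n
    by (rule supp_in_tens[OF e0_Idx that])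
  have tC: "tens e0 u \<in> supp_in (basis_at bs n)" if "Poly_Mapping.keys u \<subseteq> basis_at bs n" for u n
    by (rule supp_in_tens[OF e0_Idx that])
  have dXs: "Df (coeff_complex X) n q \<in> supp_in (?harm_gens (n + 1))" if "q \<in> supp_in (?harm_gens n)" for n q
    using op_closed_coeff_complex[OF cX] that unfolding op_closed_def by simp
  define F0 where "F0 n u = f n (tens e0 u) e0" for n u
  define G0 where "G0 n u = g n (tens e0 u) e0" for n u
  have F0k: "Poly_Mapping.keys (F0 n u) \<subseteq> basis_at bs n" if "Poly_Mapping.keys u \<subseteq> ?harm_gens n" for n u
    unfolding F0_def using graded_homD(1)[OF f, of "tens e0 u" n] tX[OF that] supp_inD(1) by simp
  have G0k: "Poly_Mapping.keys (G0 n u) \<subseteq> ?harm_gens n" if "Poly_Mapping.keys u \<subseteq> basis_at bs n" for n u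
    unfolding G0_def using graded_homD(1)[OF g, of "tens e0 u" n] tC[OF that] supp_inD(1) by simp
  have F0lin: "F0 n u = lin_ext (\<lambda>b. F0 n (Poly_Mapping.single b 1)) u" if "Poly_Mapping.keys u \<subseteq> ?harm_gens n" for n u
    unfolding F0_def by (rule hom_tens_lin[OF f that e0_Idx])
  have G0lin: "G0 n u = lin_ext (\<lambda>b. G0 n (Poly_Mapping.single b 1)) u" if "Poly_Mapping.keys u \<subseteq> basis_at bs n" for n u
    unfolding G0_def by (rule hom_tens_lin[OF g that e0_Idx])
  have De0: "P.D x e0 = lin_ext dB (x e0)" for x by (simp add: P.D_def pw_def)
  have Dvar: "P.D x (var k) = lin_ext dB (x (var k)) + lin_ext (Y k) (x e0)" if "k < v" for x k
    using del_var[OF that] by (simp add: P.D_def pw_def)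
  have chf: "f (n + 1) (Df (coeff_complex X) n q) = P.D (f n q)" if "q \<in> supp_in (?harm_gens n)" for n q
    using chain_mapD(2)[OF gf(2), of q n] that by simp
  have chg: "g (n + 1) (P.D q) = Df (coeff_complex X) n (g n q)" if "q \<in> supp_in (basis_at bs n)" for n q
    using chain_mapD(2)[OF gf(1), of q n] that by simp
  have f0: "f n 0 = 0" and s0: "s n 0 = 0" and r0: "r n 0 = 0" for n
    by (simp_all add: hom_zero[OF f] hom_zero[OF s'] hom_zero[OF r'])
  \<comment> \<open>The constant coefficient of the chain map equation for \<open>f\<close>.\<close>
  have i: "lin_ext dB (F0 n u) = 0" if u: "Poly_Mapping.keys u \<subseteq> ?harm_gens n" for n u
  proof -
    have "P.D (f n (tens e0 u)) e0 = f (n + 1) (Df (coeff_complex X) n (tens e0 u)) e0" using chf[OF tX[OF u]] by simp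
    also have "\<dots> = 0" using hom_e0[OF f dXs[OF tX[OF u]]] coeff_complex_min_e0[OF X tX[OF u]] by (simp add: f0)
    finally show ?thesis by (simp add: De0 F0_def)
  qed
  \<comment> \<open>The constant coefficient of the chain map equation for \<open>g\<close>.\<close>
  have ii: "G0 (n + 1) (lin_ext dB w) = 0" if w: "Poly_Mapping.keys w \<subseteq> basis_at bs n" for n w
  proof -
    have Dt: "P.D (tens e0 w) \<in> supp_in (basis_at bs (n + 1))" using graded_homD(1)[OF D_hom, of "tens e0 w" n] tC[OF w] by simp
    have gt: "g n (tens e0 w) \<in> supp_in (?harm_gens n)" using graded_homD(1)[OF g, of "tens e0 w" n] tC[OF w] by simp
    have "g (n + 1) (P.D (tens e0 w)) e0 = 0" using chg[OF tC[OF w]] coeff_complex_min_e0[OF X gt] by simp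
    moreover have "P.D (tens e0 w) e0 = lin_ext dB w" by (simp add: De0)
    ultimately show ?thesis using hom_e0[OF g Dt] by (simp add: G0_def)
  qed
  \<comment> \<open>Both homotopy terms contain a differential of the minimal complex, whose constant coefficient
    vanishes.\<close>
  have iii: "G0 n (F0 n u) = u" if u: "Poly_Mapping.keys u \<subseteq> ?harm_gens n" for n u
  proof -
    have ft: "f n (tens e0 u) \<in> supp_in (basis_at bs n)" using graded_homD(1)[OF f, of "tens e0 u" n] tX[OF u] by simp
    have "G0 n (F0 n u) = g n (f n (tens e0 u)) e0" using hom_e0[OF g ft] by (simp add: G0_def F0_def)
    also have "\<dots> = u + (Df (coeff_complex X) (n - 1) (r n (tens e0 u)) e0 + r (n + 1) (Df (coeff_complex X) n (tens e0 u)) e0)"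
      using gfr[of "tens e0 u" n] tX[OF u] by simp
    also have "Df (coeff_complex X) (n - 1) (r n (tens e0 u)) e0 = 0"
      by (rule coeff_complex_min_e0[OF X]) (use graded_homD(1)[OF r', of "tens e0 u" n] tX[OF u] in simp)
    also have "r (n + 1) (Df (coeff_complex X) n (tens e0 u)) e0 = 0"
      using hom_e0[OF r' dXs[OF tX[OF u]]] coeff_complex_min_e0[OF X tX[OF u]] by (simp add: r0)
    finally show ?thesis by simp
  qed
  \<comment> \<open>For a harmonic argument one homotopy term vanishes and the other is a coboundary.\<close>
  have iv: "lin_ext pB (F0 n (G0 n (Poly_Mapping.single b 1))) = Poly_Mapping.single b 1" if b: "b \<in> basis_at bsH n" for n b
  proof -
    let ?z = "Poly_Mapping.single b (1::'k)"
    have bb: "b \<in> bsH" "b \<in> basis_at bs n" using b by (auto simp: basis_at_def bsH_def)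
    have z: "tens e0 ?z \<in> supp_in (basis_at bs n)" by (rule tC) (simp add: bb)
    have gz: "g n (tens e0 ?z) \<in> supp_in (?harm_gens n)" using graded_homD(1)[OF g, of "tens e0 ?z" n] z by simp
    have Dz: "P.D (tens e0 ?z) \<in> supp_in (basis_at bs (n + 1))" using graded_homD(1)[OF D_hom, of "tens e0 ?z" n] z by simp
    have "F0 n (G0 n ?z) = f n (g n (tens e0 ?z)) e0" using hom_e0[OF f gz] by (simp add: G0_def F0_def)
    also have "\<dots> = ?z + (P.D (s n (tens e0 ?z)) e0 + s (n + 1) (P.D (tens e0 ?z)) e0)"
      using fg[of "tens e0 ?z" n] z by simp
    also have "s (n + 1) (P.D (tens e0 ?z)) e0 = 0"
      using hom_e0[OF s' Dz] by (simp add: De0 pB_harm(2)[OF bb(1)] s0)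
    finally have "F0 n (G0 n ?z) = ?z + lin_ext dB (s n (tens e0 ?z) e0)" by (simp add: De0)
    then show ?thesis by (simp add: lin_ext_add lin_ext_comp dhp(4) pB_harm(1)[OF bb(1)])
  qed
  define PB where "PB n b = lin_ext pB (F0 n (Poly_Mapping.single b 1))" for n b
  define GB where "GB n b = G0 n (Poly_Mapping.single b 1)" for n b
  have PBlin: "lin_ext (PB n) u = lin_ext pB (F0 n u)" if "Poly_Mapping.keys u \<subseteq> ?harm_gens n" for n u
    unfolding PB_def F0lin[OF that] lin_ext_comp by simp
  have hBk: "Poly_Mapping.keys (lin_ext hB w) \<subseteq> basis_at bs (n - 1)" if "Poly_Mapping.keys w \<subseteq> basis_at bs n" for w n
    by (rule keys_lin_ext) (use that in \<open>auto simp: hB_def basis_at_def bs_dB split: if_splits\<close>)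
  have inv1: "lin_ext (GB n) (PB n b) = Poly_Mapping.single b 1" if b: "b \<in> ?harm_gens n" for n b
  proof -
    let ?z = "Poly_Mapping.single b (1::'k)"
    have z: "Poly_Mapping.keys ?z \<subseteq> ?harm_gens n" using b by simp
    have k: "Poly_Mapping.keys (PB n b) \<subseteq> basis_at bs n"
      unfolding PB_def using keys_pB[OF F0k[OF z]] by (auto simp: basis_at_def bsH_def)
    let ?w = "lin_ext hB (F0 n ?z)"
    have wk: "Poly_Mapping.keys ?w \<subseteq> basis_at bs (n - 1)" by (rule hBk[OF F0k[OF z]])
    have e: "F0 n ?z = PB n b + lin_ext dB ?w"
      unfolding PB_def pB_id by (simp add: i[OF z])
    have dk: "Poly_Mapping.keys (lin_ext dB ?w) \<subseteq> basis_at bs n"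
    proof -
      have "F0 n ?z - PB n b = lin_ext dB ?w"
        using arg_cong[OF e, of "\<lambda>x. x - PB n b"] by (simp only: add_diff_cancel_left')
      then show ?thesis using keys_diff_subset[OF F0k[OF z] k] by (simp only:)
    qed
    have "?z = G0 n (PB n b + lin_ext dB ?w)" using iii[OF z] e by simp
    also have "\<dots> = lin_ext (GB n) (PB n b) + lin_ext (GB n) (lin_ext dB ?w)"
      unfolding G0lin[OF keys_add_subset[OF k dk]] GB_def by (rule lin_ext_add)
    also have "lin_ext (GB n) (lin_ext dB ?w) = G0 n (lin_ext dB ?w)" unfolding GB_def by (rule G0lin[OF dk, symmetric])
    also have "\<dots> = 0" using ii[OF wk] by simp
    finally show ?thesis by simp
  qed
  have inv2: "lin_ext (PB n) (GB n b) = Poly_Mapping.single b 1" if b: "b \<in> basis_at bsH n" for n b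
  proof -
    have "Poly_Mapping.keys (GB n b) \<subseteq> ?harm_gens n" unfolding GB_def by (rule G0k) (use b in \<open>auto simp: basis_at_def bsH_def\<close>)
    then show ?thesis using iv[OF b] by (simp add: PBlin GB_def)
  qed
  \<comment> \<open>The coefficient of the \<open>k\<close>-th variable in the chain map equation for \<open>f\<close>. The value of \<open>f\<close> at the
    variable enters only through \<open>dB\<close> and disappears under \<open>pB\<close>.\<close>
  have comm: "lin_ext (PB (n + 1)) (coeff_mat X n (var k) b) = lin_ext (YH k) (PB n b)" if b: "b \<in> ?harm_gens n" and k: "k < v" for n k b
  proof -
    let ?z = "Poly_Mapping.single b (1::'k)"
    have z: "Poly_Mapping.keys ?z \<subseteq> ?harm_gens n" using b by simp
    have "P.D (f n (tens e0 ?z)) (var k) = f (n + 1) (Df (coeff_complex X) n (tens e0 ?z)) (var k)" using chf[OF tX[OF z]] by simp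
    also have "\<dots> = F0 (n + 1) (coeff_mat X n (var k) b)"
      using hom_var[OF f dXs[OF tX[OF z]] k] coeff_complex_min_e0[OF X tX[OF z]] coeff_complex_tens_var[OF k, of X n ?z] by (simp add: f0 F0_def)
    finally have e: "F0 (n + 1) (coeff_mat X n (var k) b) = lin_ext dB (f n (tens e0 ?z) (var k)) + lin_ext (Y k) (F0 n ?z)"
      using Dvar[OF k] by (simp add: F0_def)
    have 1: "lin_ext (PB (n + 1)) (coeff_mat X n (var k) b) = lin_ext pB (lin_ext (Y k) (F0 n ?z))"
      unfolding PBlin[OF keys_coeff_mat] e by (simp add: lin_ext_add lin_ext_comp[of pB dB] dhp(4))
    have Yd: "lin_ext pB (lin_ext (Y k) (lin_ext dB w)) = 0" for w
    proof -
      have "lin_ext (Y k) (lin_ext dB w) = lin_ext (\<lambda>b. - lin_ext dB (Y k b)) w"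
        unfolding lin_ext_comp by (rule lin_ext_cong) (rule dY[OF k])
      also have "\<dots> = - lin_ext dB (lin_ext (Y k) w)" by (simp add: lin_ext_uminus_fun lin_ext_comp)
      finally show ?thesis by (simp add: lin_ext_uminus lin_ext_comp[of pB dB] dhp(4))
    qed
    have "F0 n ?z = PB n b + lin_ext dB (lin_ext hB (F0 n ?z))"
      unfolding PB_def pB_id by (simp add: i[OF z])
    then have "lin_ext pB (lin_ext (Y k) (F0 n ?z)) = lin_ext pB (lin_ext (Y k) (PB n b + lin_ext dB (lin_ext hB (F0 n ?z))))"
      by simp
    also have "\<dots> = lin_ext pB (lin_ext (Y k) (PB n b))" by (simp add: lin_ext_add Yd)
    also have "\<dots> = lin_ext (YH k) (PB n b)" unfolding YH_def[abs_def] by (rule lin_ext_comp)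
    finally show ?thesis using 1 by simp
  qed
  note cL = col_finite_linear_part[OF cX]
  let ?TL = "coeff_complex (linear_part A X)" and ?H = "total_complex bsH c YH"
  have OL: "Ob ?TL n = Tm (Gens X n) (gdeg X n)" "Ob ?H n = Tm (basis_at bsH n) (dgu c)" for n by (simp_all add: coeff_complex_def total_complex_def)
  have d0: "dgm e0 = 0" using dgm_zero e0_Idx by blast
  have PBh: "pw (PB n) \<in> graded_hom A (Tm (Gens X n) (gdeg X n)) (Tm (basis_at bsH n) (dgu c))" for n
  proof (rule pw_hom)
    fix b assume b: "b \<in> ?harm_gens n"
    let ?z = "Poly_Mapping.single b (1::'k)"
    have z: "Poly_Mapping.keys ?z \<subseteq> ?harm_gens n" using b by simp
    have "tens e0 ?z \<in> hpart (Tm (?harm_gens n) (gdeg X n)) (gdeg X n b)"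
      using tX[OF z] by (auto simp: hpart_Tm) (auto simp: tens_def d0 split: if_splits)
    from graded_homD(4)[OF f this]
    have "\<forall>m. Poly_Mapping.keys (f n (tens e0 ?z) m) \<subseteq> {x. dgm m + dgu c x = gdeg X n b}" by (simp add: hpart_Tm_subset)
    from spec[OF this, of e0] have "Poly_Mapping.keys (F0 n ?z) \<subseteq> {x. dgu c x = gdeg X n b}" by (simp add: F0_def d0)
    then have "Poly_Mapping.keys (PB n b) \<subseteq> {x. dgu c x = gdeg X n b}"
      unfolding PB_def by (intro keys_lin_ext) (auto simp: pB_def split: if_splits)
    then show "Poly_Mapping.keys (PB n b) \<subseteq> {x \<in> basis_at bsH n. dgu c x = gdeg X n b}"
      using keys_pB[OF F0k[OF z]] unfolding PB_def by blast
  qed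
  have GBh: "pw (GB n) \<in> graded_hom A (Tm (basis_at bsH n) (dgu c)) (Tm (Gens X n) (gdeg X n))" for n
  proof (rule pw_hom)
    fix b assume b: "b \<in> basis_at bsH n"
    let ?z = "Poly_Mapping.single b (1::'k)"
    have z: "Poly_Mapping.keys ?z \<subseteq> basis_at bs n" using b by (auto simp: basis_at_def bsH_def)
    have "tens e0 ?z \<in> hpart (Th n) (dgu c b)"
      using tC[OF z] by (auto simp: hpart_Tm) (auto simp: tens_def d0 split: if_splits)
    from graded_homD(4)[OF g this]
    have "\<forall>m. Poly_Mapping.keys (g n (tens e0 ?z) m) \<subseteq> {x. dgm m + gdeg X n x = dgu c b}" by (simp add: hpart_Tm_subset)
    from spec[OF this, of e0] have "Poly_Mapping.keys (GB n b) \<subseteq> {x. gdeg X n x = dgu c b}" by (simp add: GB_def G0_def d0)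
    then show "Poly_Mapping.keys (GB n b) \<subseteq> {x \<in> ?harm_gens n. gdeg X n x = dgu c b}"
      using G0k[OF z] unfolding GB_def by blast
  qed
  have i1: "pw (GB n) (pw (PB n) x) = x" if x: "x \<in> supp_in (?harm_gens n)" for n x
  proof
    fix m
    have "pw (GB n) (pw (PB n) x) m = lin_ext (\<lambda>b. lin_ext (GB n) (PB n b)) (x m)" by (simp add: pw_pw) (simp add: pw_def)
    also have "\<dots> = lin_ext (\<lambda>b. Poly_Mapping.single b 1) (x m)"
      by (rule lin_ext_cong) (rule inv1, rule subsetD[OF supp_inD(1)[OF x]])
    finally show "pw (GB n) (pw (PB n) x) m = x m" by simp
  qed
  have i2: "pw (PB n) (pw (GB n) x) = x" if x: "x \<in> supp_in (basis_at bsH n)" for n x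
  proof
    fix m
    have "pw (PB n) (pw (GB n) x) m = lin_ext (\<lambda>b. lin_ext (PB n) (GB n b)) (x m)" by (simp add: pw_pw) (simp add: pw_def)
    also have "\<dots> = lin_ext (\<lambda>b. Poly_Mapping.single b 1) (x m)"
      by (rule lin_ext_cong) (rule inv2, rule subsetD[OF supp_inD(1)[OF x]])
    finally show "pw (PB n) (pw (GB n) x) m = x m" by simp
  qed
  have ch: "pw (PB (n + 1)) (Df ?TL n x) = Df ?H n (pw (PB n) x)" if x: "x \<in> supp_in (?harm_gens n)" for n x
  proof
    fix m
    have y: "pw (PB n) x \<in> supp_in (basis_at bsH n)" using graded_homD(1)[OF PBh, of x n] x by simp
    have "lin_ext dB (pw (PB n) x m) = lin_ext (\<lambda>b. 0) (pw (PB n) x m)"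
      by (rule lin_ext_cong, rule pB_harm(2)) (use supp_inD(1)[OF y, of m] in \<open>auto simp: basis_at_def\<close>)
    then have dz: "pw dB (pw (PB n) x) m = 0" by (simp add: pw_def)
    have "pw (PB (n + 1)) (Df ?TL n x) m = (\<Sum>k\<in>vr m. scal (sg k m) (lin_ext (\<lambda>b. lin_ext (PB (n + 1)) (coeff_mat X n (var k) b)) (x (m - var k))))"
      by (simp add: coeff_complex_linear_part[OF X x] pw_def del_def lin_ext_sum lin_ext_scal lin_ext_comp)
    also have "\<dots> = (\<Sum>k\<in>vr m. scal (sg k m) (lin_ext (\<lambda>b. lin_ext (YH k) (PB n b)) (x (m - var k))))"
    proof (rule sum.cong[OF refl])
      fix k assume k: "k \<in> vr m"
      have "lin_ext (\<lambda>b. lin_ext (PB (n + 1)) (coeff_mat X n (var k) b)) (x (m - var k)) =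
         lin_ext (\<lambda>b. lin_ext (YH k) (PB n b)) (x (m - var k))"
        by (rule lin_ext_cong, rule comm, rule subsetD[OF supp_inD(1)[OF x]]) (use vrD[OF k] in auto)
      then show "scal (sg k m) (lin_ext (\<lambda>b. lin_ext (PB (n + 1)) (coeff_mat X n (var k) b)) (x (m - var k))) =
         scal (sg k m) (lin_ext (\<lambda>b. lin_ext (YH k) (PB n b)) (x (m - var k)))" by simp
    qed
    also have "\<dots> = Df ?H n (pw (PB n) x) m" using dz
      by (simp add: total_complex_def del_def) (simp add: pw_def lin_ext_comp)
    finally show "pw (PB (n + 1)) (Df ?TL n x) m = Df ?H n (pw (PB n) x) m" .
  qed
  have "iso_complex A ?TL ?H"
  proof (rule iso_complexI[where f = "\<lambda>n. pw (PB n)"])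
    show "chain_map A ?TL ?H (\<lambda>n. pw (PB n))" unfolding chain_map_def by (auto simp: OL PBh ch)
    show "op_closed A ?TL" by (rule op_closed_coeff_complex[OF cL])
    show "bij_betw (pw (PB n)) (carrier (Ob ?TL n)) (carrier (Ob ?H n))" for n
      by (rule bij_betw_byWitness[where f' = "pw (GB n)"])
        (use graded_homD(1)[OF PBh] graded_homD(1)[OF GBh] in \<open>auto simp: OL i1 i2\<close>)
    fix n x d assume x: "x \<in> carrier (Ob ?TL n)" and h: "pw (PB n) x \<in> hpart (Ob ?H n) d"
    have "pw (GB n) (pw (PB n) x) \<in> hpart (Ob ?TL n) d" using graded_homD(4)[OF GBh, of "pw (PB n) x" n d] h by (simp add: OL)
    then show "x \<in> hpart (Ob ?TL n) d" using x i1 by (simp add: OL)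
  qed (auto simp: OL hpart_Tm)
  then show ?thesis using iso_complex_trans[OF free_iso[OF cL]] by blast
qed

end

section \<open>The symmetric and the exterior algebra as monomial algebras\<close>

definition mono_divisors :: "(nat \<Rightarrow>\<^sub>0 nat) \<Rightarrow> (nat \<Rightarrow>\<^sub>0 nat) set" where
  "mono_divisors m = {l. \<exists>b. m = l + b}"

lemma finite_mono_divisors: "finite (mono_divisors m)"
proof (rule finite_imageD)
  let ?f = "\<lambda>l. restrict (Poly_Mapping.lookup l) (Poly_Mapping.keys m)"
  show "inj_on ?f (mono_divisors m)"
  proof (rule inj_onI, rule poly_mapping_eqI)
    fix l l' i assume l: "l \<in> mono_divisors m" "l' \<in> mono_divisors m" and eq: "?f l = ?f l'"
    show "Poly_Mapping.lookup l i = Poly_Mapping.lookup l' i"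
    proof (cases "i \<in> Poly_Mapping.keys m")
      case True
      then show ?thesis using fun_cong[OF eq, of i] by simp
    next
      case False
      then have "Poly_Mapping.lookup m i = 0" by (simp add: in_keys_iff)
      moreover have "\<exists>b. m = l + b" "\<exists>b'. m = l' + b'" using l by (simp_all add: mono_divisors_def)
      then obtain b b' where "m = l + b" "m = l' + b'" by blast
      then have "Poly_Mapping.lookup m i = Poly_Mapping.lookup l i + Poly_Mapping.lookup b i"
        "Poly_Mapping.lookup m i = Poly_Mapping.lookup l' i + Poly_Mapping.lookup b' i"
        by (metis lookup_add)+
      ultimately show ?thesis by simp
    qed
  qed
  have "?f ` mono_divisors m \<subseteq> PiE (Poly_Mapping.keys m) (\<lambda>i. {..Poly_Mapping.lookup m i})"
    by (auto simp: mono_divisors_def lookup_add)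
  then show "finite (?f ` mono_divisors m)" by (rule finite_subset) (auto intro: finite_PiE)
qed

lemma mono_divisors_minus: "l \<in> mono_divisors m \<Longrightarrow> m = l + (m - l)"
  by (auto simp: mono_divisors_def)

lemma lookup_mult_mono_divisors:
  fixes a b :: "('k::field) sym"
  shows "Poly_Mapping.lookup (a * b) m = (\<Sum>l\<in>mono_divisors m. Poly_Mapping.lookup a l * Poly_Mapping.lookup b (m - l))"
proof -
  have inner: "(\<Sum>q. Poly_Mapping.lookup b q when m = l + q) = (if l \<in> mono_divisors m then Poly_Mapping.lookup b (m - l) else 0)" for l
  proof (cases "l \<in> mono_divisors m")
    case True
    have eq: "m = l + q \<longleftrightarrow> q = m - l" for q
      using mono_divisors_minus[OF True] by (metis add_diff_cancel_left')
    have "(\<Sum>q. Poly_Mapping.lookup b q when m = l + q) = (\<Sum>q. Poly_Mapping.lookup b q when q = m - l)"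
      by (simp only: eq)
    then show ?thesis using True by simp
  next
    case False
    then have "\<not> m = l + q" for q by (auto simp: mono_divisors_def)
    then show ?thesis using False by simp
  qed
  have "Poly_Mapping.lookup (a * b) m = (\<Sum>l. Poly_Mapping.lookup a l * (if l \<in> mono_divisors m then Poly_Mapping.lookup b (m - l) else 0))"
    unfolding lookup_mult inner ..
  also have "\<dots> = (\<Sum>l\<in>mono_divisors m. Poly_Mapping.lookup a l * (if l \<in> mono_divisors m then Poly_Mapping.lookup b (m - l) else 0))"
    by (rule Sum_any.expand_superset[OF finite_mono_divisors]) auto
  finally show ?thesis by simp
qed

lemma mono_deg_superset: "finite S \<Longrightarrow> Poly_Mapping.keys m \<subseteq> S \<Longrightarrow> mono_deg m = (\<Sum>i\<in>S. int (Poly_Mapping.lookup m i))"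
  unfolding mono_deg_def by (rule sum.mono_neutral_left) (simp_all add: in_keys_iff)

lemma mono_deg_add: "mono_deg (a + b) = mono_deg a + mono_deg b"
proof -
  let ?S = "Poly_Mapping.keys a \<union> Poly_Mapping.keys b"
  have "mono_deg (a + b) = (\<Sum>i\<in>?S. int (Poly_Mapping.lookup (a + b) i))"
    by (rule mono_deg_superset) (simp_all add: Poly_Mapping.keys_add)
  also have "\<dots> = (\<Sum>i\<in>?S. int (Poly_Mapping.lookup a i)) + (\<Sum>i\<in>?S. int (Poly_Mapping.lookup b i))"
    by (simp add: lookup_add sum.distrib)
  also have "\<dots> = mono_deg a + mono_deg b" by (simp add: mono_deg_superset[symmetric])
  finally show ?thesis .
qed

lemma mono_deg_nonneg: "mono_deg m \<ge> 0"
  by (simp add: mono_deg_def sum_nonneg)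

lemma mono_deg_zero_iff: "mono_deg m = 0 \<longleftrightarrow> m = 0"
proof
  assume "mono_deg m = 0"
  then have "\<forall>i\<in>Poly_Mapping.keys m. int (Poly_Mapping.lookup m i) = 0"
    unfolding mono_deg_def by (subst (asm) sum_nonneg_eq_0_iff) auto
  then have "Poly_Mapping.lookup m i = 0" for i by (cases "i \<in> Poly_Mapping.keys m") (simp_all add: in_keys_iff)
  then show "m = 0" by (intro poly_mapping_eqI) simp
qed (simp add: mono_deg_def)

lemma mono_deg_single: "mono_deg (Poly_Mapping.single k n) = int n"
  by (simp add: mono_deg_def)

lemma mono_deg_one: "mono_deg m = 1 \<Longrightarrow> \<exists>k\<in>Poly_Mapping.keys m. m = Poly_Mapping.single k 1"
proof -
  assume d: "mono_deg m = 1"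
  then have "m \<noteq> 0" using mono_deg_zero_iff[of m] by auto
  then obtain k where k: "k \<in> Poly_Mapping.keys m" by fastforce
  have "m = Poly_Mapping.single k 1 + (m - Poly_Mapping.single k 1)"
  proof (rule poly_mapping_eqI)
    fix i
    have "Poly_Mapping.lookup m k \<noteq> 0" using k by (simp add: in_keys_iff)
    then show "Poly_Mapping.lookup m i = Poly_Mapping.lookup (Poly_Mapping.single k 1 + (m - Poly_Mapping.single k 1)) i"
      by (auto simp: lookup_add lookup_minus lookup_single when_def)
  qed
  then have "mono_deg m = 1 + mono_deg (m - Poly_Mapping.single k 1)"
    by (metis mono_deg_add mono_deg_single of_nat_1)
  then have "m - Poly_Mapping.single k 1 = 0" using d mono_deg_zero_iff by auto
  with \<open>m = Poly_Mapping.single k 1 + (m - Poly_Mapping.single k 1)\<close> k show ?thesis by auto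
qed

lemma lookup_gcomp_Sym:
  "Poly_Mapping.lookup (gcomp (Sym v) d p) m = (if mono_deg m = d then Poly_Mapping.lookup p m else 0)"
proof -
  have "finite {m \<in> Poly_Mapping.keys p. mono_deg m = d}" by simp
  from lookup_sum_single[OF this, of "Poly_Mapping.lookup p" m] show ?thesis by (simp add: Sym_def in_keys_iff)
qed

lemma carrier_Sym: "p \<in> carrier (Sym v) \<longleftrightarrow> (\<forall>m. Poly_Mapping.lookup p m \<noteq> 0 \<longrightarrow> Poly_Mapping.keys m \<subseteq> {..<v})"
  by (simp add: Sym_def Ball_def in_keys_iff)

lemma mono_divisors_keys: "l \<in> mono_divisors m \<Longrightarrow> Poly_Mapping.keys l \<subseteq> Poly_Mapping.keys m"
  by (auto simp: mono_divisors_def in_keys_iff lookup_add simp del: lookup_not_eq_zero_eq_in_keys)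

lemma monomial_algebra_Sym:
  "monomial_algebra (Sym v :: ('k::field) sym graded_ring) Poly_Mapping.lookup {m. Poly_Mapping.keys m \<subseteq> {..<v}} mono_divisors
     (\<lambda>_ _. 1) 0 (\<lambda>k. Poly_Mapping.single k 1) v mono_deg (- 1) 1"
proof (rule monomial_algebra.intro)
  show "ring (Sym v :: 'k sym graded_ring)" using cring_Sym by (rule cring.axioms(1))
  fix a b :: "'k sym" and m d
  show "finite {m. Poly_Mapping.lookup a m \<noteq> 0}" by simp
  show "Poly_Mapping.lookup (a \<oplus>\<^bsub>Sym v\<^esub> b) m = Poly_Mapping.lookup a m + Poly_Mapping.lookup b m"
    by (simp add: Sym_def lookup_add)
  show "Poly_Mapping.lookup (a \<otimes>\<^bsub>Sym v\<^esub> b) m = (\<Sum>l\<in>mono_divisors m. 1 * Poly_Mapping.lookup a l * Poly_Mapping.lookup b (m - l))"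
    by (simp add: Sym_def lookup_mult_mono_divisors)
  show "gcomp (Sym v) d a \<in> carrier (Sym v)" if "a \<in> carrier (Sym v)"
    using that unfolding carrier_Sym lookup_gcomp_Sym by simp
  show "Poly_Mapping.lookup (gcomp (Sym v) d a) m = (if mono_deg m = d then Poly_Mapping.lookup a m else 0)"
    by (rule lookup_gcomp_Sym)
  show "Poly_Mapping.lookup a m = 0" if "a \<in> carrier (Sym v)" "m \<notin> {m. Poly_Mapping.keys m \<subseteq> {..<v}}"
    using that unfolding carrier_Sym by blast
next
  fix a b :: "'k sym" assume "\<And>m. Poly_Mapping.lookup a m = Poly_Mapping.lookup b m"
  then show "a = b" by (rule poly_mapping_eqI)
next
  fix f :: "(nat \<Rightarrow>\<^sub>0 nat) \<Rightarrow> 'k"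
  assume f: "finite {m. f m \<noteq> 0}" "{m. f m \<noteq> 0} \<subseteq> {m. Poly_Mapping.keys m \<subseteq> {..<v}}"
  show "\<exists>a\<in>carrier (Sym v). Poly_Mapping.lookup a = f"
    by (rule bexI[of _ "Abs_poly_mapping f"]) (use f in \<open>auto simp: carrier_Sym\<close>)
next
  fix m l r assume l: "l \<in> mono_divisors m" and r: "r \<in> mono_divisors (m - l)"
  obtain b where b: "m = l + b" using l by (auto simp: mono_divisors_def)
  obtain b' where b': "b = r + b'" using r b by (auto simp: mono_divisors_def)
  have m: "m = r + (l + b')" "m = l + (r + b')" unfolding b b' by (simp_all add: ac_simps)
  have "m - r = l + b'" "m - l = r + b'" using m by (metis add_diff_cancel_left')+
  then show "r \<in> mono_divisors m \<and> l \<in> mono_divisors (m - r) \<and> m - l - r = m - r - l"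
    using m(1) by (auto simp: mono_divisors_def)
next
  fix m l assume m: "m \<in> {m. Poly_Mapping.keys m \<subseteq> {..<v}}" and l: "l \<in> mono_divisors m"
  show "l \<in> {m. Poly_Mapping.keys m \<subseteq> {..<v}}" using mono_divisors_keys[OF l] m by blast
  show "m - l \<in> mono_divisors m \<and> m - (m - l) = l"
  proof -
    obtain b where b: "m = l + b" using l by (auto simp: mono_divisors_def)
    have "m = b + l" using b by (simp add: add.commute)
    then show ?thesis using b by (metis (mono_tags, lifting) add_diff_cancel_left' mono_divisors_def mem_Collect_eq)
  qed
  show "mono_deg m = mono_deg l + mono_deg (m - l)" using mono_divisors_minus[OF l] mono_deg_add by metis
next
  fix m m' l :: "nat \<Rightarrow>\<^sub>0 nat" assume "l \<in> mono_divisors m" "l \<in> mono_divisors m'" "m - l = m' - l"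
  then show "m = m'" using mono_divisors_minus by metis
next
  fix m :: "nat \<Rightarrow>\<^sub>0 nat" show "0 \<in> mono_divisors m" by (simp add: mono_divisors_def)
next
  fix m :: "nat \<Rightarrow>\<^sub>0 nat" assume m: "m \<in> {m. Poly_Mapping.keys m \<subseteq> {..<v}}" "\<bar>mono_deg m\<bar> = 1"
  then have "mono_deg m = 1" using mono_deg_nonneg[of m] by linarith
  from mono_deg_one[OF this] show "\<exists>k<v. m = Poly_Mapping.single k 1" using m by blast
next
  fix k j :: nat assume "Poly_Mapping.single k (1::nat) = Poly_Mapping.single j 1"
  from arg_cong[OF this, of Poly_Mapping.keys] show "k = j" by simp
qed (auto simp: finite_mono_divisors mono_deg_single mono_deg_nonneg mono_deg_zero_iff)

lemma ext_sign_swap: "i \<noteq> j \<Longrightarrow> ext_sign {i} {j} = - (ext_sign {j} {i} :: 'k::field)"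
proof -
  assume ij: "i \<noteq> j"
  have "{(a, b). a \<in> {i} \<and> b \<in> {j} \<and> b < a} = (if j < i then {(i, j)} else {})" for i j :: nat by auto
  then show ?thesis using ij by (simp add: ext_sign_def)
qed

text \<open>The structure constants are the signs of shuffles; the cocycle condition expresses that they are
  multiplicative in both arguments.\<close>

lemma monomial_algebra_Ext:
  "monomial_algebra (Ext v :: ('k::field) ext graded_ring) (\<lambda>f. f) (Pow {..<v}) Pow ext_sign {} (\<lambda>k. {k}) v
     (\<lambda>I. - int (card I)) 1 (- 1)"
proof (rule monomial_algebra.intro)
  show "ring (Ext v :: 'k ext graded_ring)" by (rule ring_Ext)
  fix a b :: "'k ext" and m d
  show "finite {m. a m \<noteq> 0}" if "a \<in> carrier (Ext v)"
    by (rule finite_subset[of _ "Pow {..<v}"]) (use that in \<open>auto simp: Ext_def\<close>)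
next
  fix a b :: "'k ext" assume "\<And>m. a m = b m"
  then show "a = b" by (rule ext)
next
  fix f :: "'k ext" assume f: "{m. f m \<noteq> 0} \<subseteq> Pow {..<v}"
  show "\<exists>a\<in>carrier (Ext v). a = f"
    by (rule bexI[of _ f]) (use f in \<open>auto simp: Ext_def\<close>)
next
  fix m l r :: "nat set" assume m: "m \<in> Pow {..<v}" and l: "l \<in> Pow m" and r: "r \<in> Pow (m - l)"
  have fin: "finite l" "finite r" "finite (m - r - l)" "finite (m - l - r)"
    using m l r by (auto intro: finite_subset)
  have e: "m - r = l \<union> (m - r - l)" "m - l = (m - l - r) \<union> r" "m - r - l = m - l - r" using l r by auto
  have 1: "ext_sign (m - r) r = (ext_sign l r * ext_sign (m - r - l) r :: 'k)"
    by (subst e(1), rule ext_sign_Un_left) (use fin in auto)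
  have 2: "ext_sign l (m - l) = (ext_sign l (m - l - r) * ext_sign l r :: 'k)"
    by (subst e(2), rule ext_sign_Un_right) (use fin in auto)
  show "ext_sign (m - r) r * ext_sign l (m - r - l) = (ext_sign l (m - l) * ext_sign (m - l - r) r :: 'k)"
    unfolding 1 2 e(3) by (simp add: mult_ac)
next
  fix m :: "nat set" and k j assume m: "m \<in> Pow {..<v}" and kj: "k \<noteq> j" "{k} \<in> Pow m" "{j} \<in> Pow (m - {k})"
  let ?n = "m - {k} - {j}"
  have e: "m - {k} = ?n \<union> {j}" "m - {j} = ?n \<union> {k}" "m - {j} - {k} = ?n" using kj by auto
  have fin: "finite ?n" using m by (auto intro: finite_subset)
  have 1: "ext_sign (m - {k}) {k} = (ext_sign ?n {k} * ext_sign {j} {k} :: 'k)"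
    by (subst e(1), rule ext_sign_Un_left) (use fin in auto)
  have 2: "ext_sign (m - {j}) {j} = (ext_sign ?n {j} * ext_sign {k} {j} :: 'k)"
    by (subst e(2), rule ext_sign_Un_left) (use fin in auto)
  show "ext_sign (m - {k}) {k} * ext_sign (m - {k} - {j}) {j} =
        - 1 * (ext_sign (m - {j}) {j} * ext_sign (m - {j} - {k}) {k} :: 'k)"
    unfolding 1 2 e(3) ext_sign_swap[OF kj(1), where 'k = 'k] by simp
next
  fix m l :: "nat set" assume m: "m \<in> Pow {..<v}" and l: "l \<in> Pow m"
  have "finite m" using m by (auto intro: finite_subset)
  then show "- int (card m) = - int (card l) + - int (card (m - l))"
    using l card_Un_disjoint[of l "m - l"] by (simp add: Un_absorb1 finite_subset card_Diff_subset card_mono)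
next
  fix m :: "nat set" assume m: "m \<in> Pow {..<v}" "\<bar>- int (card m)\<bar> = 1"
  then obtain k where "m = {k}" by (auto simp: card_1_singleton_iff)
  then show "\<exists>k<v. m = {k}" using m by auto
next
  fix m :: "nat set" assume m: "m \<in> Pow {..<v}"
  then have "finite m" by (auto intro: finite_subset)
  then show "- int (card m) = 0 \<longleftrightarrow> m = {}" by simp
  show "finite (Pow m)" using \<open>finite m\<close> by simp
qed (auto simp: Ext_def)

section \<open>Vector spaces on carrier sets\<close>

text \<open>Vector spaces on the carrier of an abelian group, as the graded pieces of modules are.\<close>

locale kspace = M?: abelian_group M for M (structure) +
  fixes sm :: "'k::field \<Rightarrow> 'a \<Rightarrow> 'a"
  assumes sm_closed: "x \<in> carrier M \<Longrightarrow> sm c x \<in> carrier M"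
    and sm_add: "x \<in> carrier M \<Longrightarrow> y \<in> carrier M \<Longrightarrow> sm c (x \<oplus> y) = sm c x \<oplus> sm c y"
    and sm_dist: "x \<in> carrier M \<Longrightarrow> sm (c + d) x = sm c x \<oplus> sm d x"
    and sm_mult: "x \<in> carrier M \<Longrightarrow> sm c (sm d x) = sm (c * d) x"
    and sm_one: "x \<in> carrier M \<Longrightarrow> sm 1 x = x"
begin

lemma self_cancel: "x \<in> carrier M \<Longrightarrow> x \<oplus> x = x \<Longrightarrow> x = \<zero>"
  using M.add.l_cancel_one by blast

lemma sm_zero_left: "x \<in> carrier M \<Longrightarrow> sm 0 x = \<zero>"
  using sm_dist[of x 0 0] sm_closed[of x 0] by (intro self_cancel) auto

lemma sm_zero_right: "sm c \<zero> = \<zero>"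
  using sm_add[of \<zero> \<zero> c] sm_closed[of \<zero> c] by (intro self_cancel) auto

lemma sm_finsum:
  "finite S \<Longrightarrow> (\<And>x. x \<in> S \<Longrightarrow> f x \<in> carrier M) \<Longrightarrow> sm c (finsum M f S) = finsum M (\<lambda>x. sm c (f x)) S"
proof (induction S rule: finite_induct)
  case (insert x S)
  have 1: "f \<in> S \<rightarrow> carrier M" "f x \<in> carrier M" using insert by auto
  have 2: "(\<lambda>x. sm c (f x)) \<in> S \<rightarrow> carrier M" "sm c (f x) \<in> carrier M" using 1 sm_closed by auto
  show ?case using insert 1 2 by (simp add: sm_add)
qed (simp add: sm_zero_right)

definition subspace :: "'a set \<Rightarrow> bool" where
  "subspace N \<longleftrightarrow> N \<subseteq> carrier M \<and> \<zero> \<in> N \<and> (\<forall>x\<in>N. \<forall>y\<in>N. x \<oplus> y \<in> N) \<and> (\<forall>c. \<forall>x\<in>N. sm c x \<in> N)"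

lemma sm_neg: "x \<in> carrier M \<Longrightarrow> sm (- 1) x = \<ominus> x"
proof -
  assume x: "x \<in> carrier M"
  have "sm (- 1) x \<oplus> x = \<zero>" using sm_dist[OF x, of "- 1" 1] sm_one[OF x] sm_zero_left[OF x] by simp
  then show ?thesis using x sm_closed M.minus_equality by metis
qed

lemma subspace_minus: "subspace N \<Longrightarrow> x \<in> N \<Longrightarrow> \<ominus> x \<in> N"
  using sm_neg unfolding subspace_def by (metis subsetD)

lemma minus_zero_eq:
  assumes x: "x \<in> carrier M" and y: "y \<in> carrier M" and e: "x \<ominus> y = \<zero>"
  shows "x = y"
proof -
  have "x \<oplus> \<ominus> y = \<ominus> y \<oplus> y" using e x y by (simp add: M.minus_eq M.l_neg)
  then have "\<ominus> y \<oplus> x = \<ominus> y \<oplus> y" using x y by (simp add: M.a_comm)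
  then show ?thesis using x y by simp
qed

definition comb :: "('a \<Rightarrow>\<^sub>0 'k) \<Rightarrow> 'a" where
  "comb u = finsum M (\<lambda>b. sm (Poly_Mapping.lookup u b) b) (Poly_Mapping.keys u)"

lemma comb_superset:
  assumes "finite S" "Poly_Mapping.keys u \<subseteq> S" "S \<subseteq> carrier M"
  shows "comb u = finsum M (\<lambda>b. sm (Poly_Mapping.lookup u b) b) S"
  unfolding comb_def
proof (rule M.add.finprod_mono_neutral_cong_left)
  fix i assume i: "i \<in> S - Poly_Mapping.keys u"
  then have "Poly_Mapping.lookup u i = 0" by (simp add: in_keys_iff)
  then show "sm (Poly_Mapping.lookup u i) i = \<zero>" using i assms(3) sm_zero_left by auto
qed (use assms sm_closed in auto)

lemma comb_add:
  assumes "Poly_Mapping.keys u \<subseteq> carrier M" "Poly_Mapping.keys w \<subseteq> carrier M"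
  shows "comb (u + w) = comb u \<oplus> comb w"
proof -
  let ?S = "Poly_Mapping.keys u \<union> Poly_Mapping.keys w"
  have S: "finite ?S" "?S \<subseteq> carrier M" using assms by auto
  have "comb (u + w) = finsum M (\<lambda>b. sm (Poly_Mapping.lookup (u + w) b) b) ?S"
    by (rule comb_superset[OF S(1) Poly_Mapping.keys_add S(2)])
  also have "\<dots> = finsum M (\<lambda>b. sm (Poly_Mapping.lookup u b) b \<oplus> sm (Poly_Mapping.lookup w b) b) ?S"
    by (rule M.add.finprod_cong') (use S sm_closed sm_dist in \<open>auto simp: lookup_add\<close>)
  also have "\<dots> = comb u \<oplus> comb w"
    by (subst (1 2) comb_superset[OF S(1) _ S(2)]) (use S sm_closed in \<open>auto intro!: M.finsum_addf\<close>)
  finally show ?thesis .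
qed

lemma comb_closed: "Poly_Mapping.keys u \<subseteq> carrier M \<Longrightarrow> comb u \<in> carrier M"
  unfolding comb_def using sm_closed by (intro M.finsum_closed) auto

lemma comb_scal:
  assumes "Poly_Mapping.keys u \<subseteq> carrier M"
  shows "comb (scal c u) = sm c (comb u)"
proof -
  have "comb (scal c u) = finsum M (\<lambda>b. sm (Poly_Mapping.lookup (scal c u) b) b) (Poly_Mapping.keys u)"
    by (rule comb_superset[OF finite_keys keys_scal assms])
  also have "\<dots> = finsum M (\<lambda>b. sm c (sm (Poly_Mapping.lookup u b) b)) (Poly_Mapping.keys u)"
    by (rule M.add.finprod_cong') (use assms sm_closed sm_mult in auto)
  also have "\<dots> = sm c (comb u)"
    unfolding comb_def by (rule sm_finsum[symmetric]) (use assms sm_closed in auto)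
  finally show ?thesis .
qed

lemma comb_zero [simp]: "comb 0 = \<zero>"
  by (simp add: comb_def)

lemma comb_single: "b \<in> carrier M \<Longrightarrow> comb (Poly_Mapping.single b c) = sm c b"
  by (subst comb_superset[where S = "{b}"]) (auto simp: sm_closed)

lemma comb_subspace:
  assumes N: "subspace N" and u: "Poly_Mapping.keys u \<subseteq> N"
  shows "comb u \<in> N"
proof -
  have "finsum M (\<lambda>b. sm (c b) b) S \<in> N" if "finite S" "S \<subseteq> N" for S c
    using that
  proof (induction S rule: finite_induct)
    case empty then show ?case using N by (simp add: subspace_def)
  next
    case (insert x S)
    then have 1: "S \<subseteq> carrier M" "x \<in> carrier M" using N by (auto simp: subspace_def)
    then have "finsum M (\<lambda>b. sm (c b) b) (insert x S) = sm (c x) x \<oplus> finsum M (\<lambda>b. sm (c b) b) S"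
      using insert.hyps sm_closed by (intro M.finsum_insert) auto
    then show ?case using insert N by (auto simp: subspace_def)
  qed
  then show ?thesis using u unfolding comb_def by simp
qed

text \<open>A basis of \<open>Z\<close> modulo \<open>N\<close>, found as a maximal subset of \<open>Z\<close> which is independent modulo \<open>N\<close>.
  An element outside the span could be added to it: in a relation involving it one divides by its
  coefficient.\<close>

lemma relative_basis:
  assumes N: "subspace N" and Z: "subspace Z"
  shows "\<exists>B\<subseteq>Z. (\<forall>u. Poly_Mapping.keys u \<subseteq> B \<longrightarrow> comb u \<in> N \<longrightarrow> u = 0) \<and>
     (\<forall>z\<in>Z. \<exists>u. Poly_Mapping.keys u \<subseteq> B \<and> z \<ominus> comb u \<in> N)"
proof -
  let ?ind = "\<lambda>B. \<forall>u. Poly_Mapping.keys u \<subseteq> B \<longrightarrow> comb u \<in> N \<longrightarrow> u = 0"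
  let ?S = "{B. B \<subseteq> Z \<and> ?ind B}"
  have "\<exists>B\<in>?S. \<forall>X\<in>?S. B \<subseteq> X \<longrightarrow> X = B"
  proof (rule subset_Zorn')
    fix C assume C: "subset.chain ?S C"
    then have CS: "C \<subseteq> ?S" by (auto simp: subset.chain_def)
    have "?ind (\<Union>C)"
    proof (intro allI impI)
      fix u :: "'a \<Rightarrow>\<^sub>0 'k" assume u: "Poly_Mapping.keys u \<subseteq> \<Union>C" "comb u \<in> N"
      show "u = 0"
      proof (cases "C = {}")
        case True
        then show ?thesis using u by simp
      next
        case False
        obtain X where "X \<in> C" "Poly_Mapping.keys u \<subseteq> X"
          by (rule finite_subset_Union_chain[OF finite_keys u(1) False C])
        moreover from this have "?ind X" using CS by blast
        ultimately show ?thesis using u(2) by metis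
      qed
    qed
    moreover have "\<Union>C \<subseteq> Z" using CS by blast
    ultimately show "\<Union>C \<in> ?S" by (simp only: mem_Collect_eq simp_thms)
  qed
  then obtain B where BS: "B \<in> ?S" and max: "\<And>X. X \<in> ?S \<Longrightarrow> B \<subseteq> X \<Longrightarrow> X = B" by (elim bexE) simp
  from BS have B: "B \<subseteq> Z" "?ind B" unfolding mem_Collect_eq by (rule conjunct1, rule conjunct2)
  have ZM: "Z \<subseteq> carrier M" and NM: "N \<subseteq> carrier M" using Z N by (auto simp: subspace_def)
  have "\<exists>u. Poly_Mapping.keys u \<subseteq> B \<and> z \<ominus> comb u \<in> N" if z: "z \<in> Z" for z
  proof (rule ccontr)
    assume no: "\<not> ?thesis"
    have zM: "z \<in> carrier M" using z ZM by blast
    have zB: "z \<notin> B"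
    proof
      assume "z \<in> B"
      moreover have "z \<ominus> comb (Poly_Mapping.single z 1) = \<zero>" using zM by (simp add: comb_single sm_one M.minus_eq M.r_neg)
      moreover have "\<zero> \<in> N" using N by (simp add: subspace_def)
      moreover have "Poly_Mapping.keys (Poly_Mapping.single z (1::'k)) = {z}" by simp
      ultimately have "Poly_Mapping.keys (Poly_Mapping.single z (1::'k)) \<subseteq> B \<and> z \<ominus> comb (Poly_Mapping.single z 1) \<in> N" by simp
      then show False using no by blast
    qed
    \<comment> \<open>If \<open>z\<close> were outside the span, then \<open>B\<close> would not be maximal.\<close>
    have "?ind (insert z B)"
    proof (intro allI impI)
      fix u :: "'a \<Rightarrow>\<^sub>0 'k" assume u: "Poly_Mapping.keys u \<subseteq> insert z B" "comb u \<in> N"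
      let ?c = "Poly_Mapping.lookup u z"
      let ?w = "u - Poly_Mapping.single z ?c"
      have wz: "Poly_Mapping.lookup ?w z = 0" by (simp add: lookup_minus)
      have wB: "Poly_Mapping.keys ?w \<subseteq> B"
      proof
        fix b assume b: "b \<in> Poly_Mapping.keys ?w"
        then have "Poly_Mapping.lookup ?w b \<noteq> 0" by (simp add: in_keys_iff)
        then have "b \<noteq> z" using wz by (intro notI) (simp only: simp_thms)
        moreover have "b \<in> insert z B"
          by (rule subsetD[OF keys_diff_subset[OF u(1)] b]) (simp split: if_splits)
        ultimately show "b \<in> B" by simp
      qed
      have uw: "u = ?w + Poly_Mapping.single z ?c" by simp
      have wM: "Poly_Mapping.keys ?w \<subseteq> carrier M" "Poly_Mapping.keys (Poly_Mapping.single z ?c) \<subseteq> carrier M"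
        using wB B(1) ZM zM by (blast, simp)
      have cu: "comb u = comb ?w \<oplus> sm ?c z"
        by (subst uw, subst comb_add[OF wM]) (simp add: comb_single zM)
      show "u = 0"
      proof (cases "?c = 0")
        case True
        then have "u = ?w" by simp
        then show ?thesis using wB B(2) u(2) by metis
      next
        case False
        let ?d = "- inverse ?c"
        have "sm (inverse ?c) (comb u) = sm (inverse ?c) (comb ?w) \<oplus> z"
          unfolding cu using comb_closed[OF wM(1)] zM False by (simp add: sm_add sm_closed sm_mult sm_one)
        moreover have "sm (inverse ?c) (comb ?w) = \<ominus> comb (scal ?d ?w)"
        proof -
          have "comb (scal ?d ?w) = sm (- 1) (sm (inverse ?c) (comb ?w))"
            using comb_closed[OF wM(1)] by (simp add: comb_scal[OF wM(1)] sm_mult)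
          then show ?thesis using comb_closed[OF wM(1)] sm_closed by (simp add: sm_neg)
        qed
        moreover have "sm (inverse ?c) (comb u) \<in> N" using N u(2) by (auto simp: subspace_def)
        moreover have dk: "Poly_Mapping.keys (scal ?d ?w) \<subseteq> B" by (rule subset_trans[OF keys_scal wB])
        moreover have "comb (scal ?d ?w) \<in> carrier M" by (rule comb_closed) (use dk B ZM in blast)
        ultimately have "z \<ominus> comb (scal ?d ?w) \<in> N" using zM by (simp add: M.minus_eq M.a_comm)
        then show ?thesis using no dk by blast
      qed
    qed
    moreover have "insert z B \<subseteq> Z" using z B(1) by simp
    ultimately have "insert z B \<in> ?S" by (simp only: mem_Collect_eq simp_thms)
    then have "insert z B = B" by (rule max) blast
    then show False using zB by blast
  qed
  with B show ?thesis by (intro exI[of _ B] conjI) simp_all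
qed

end

text \<open>A graded module without the decomposition into homogeneous parts. Coordinates refer to the
  homogeneous parts only, and quotient modules have this weaker structure by construction.\<close>

definition pre_graded :: "('s, 'z) graded_ring_scheme \<Rightarrow> ('s, 'a) gmodule \<Rightarrow> bool" where
  "pre_graded B M \<longleftrightarrow> left_module B M \<and> (\<forall>d. additive_subgroup (hpart M d) M) \<and>
     (\<forall>a i x d. a \<in> hom_part B i \<longrightarrow> x \<in> hpart M d \<longrightarrow> a \<odot>\<^bsub>M\<^esub> x \<in> hpart M (i + d))"

lemma pre_graded_if_graded_module: "graded_module B M \<Longrightarrow> pre_graded B M"
  unfolding pre_graded_def
  by (simp add: graded_module.axioms(1) graded_module.hpart_subgroup graded_module.hpart_smult)

text \<open>An embedding of the field into the degree zero part of a ring; it makes modules over the ring vector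
  spaces.\<close>

locale scalars =
  fixes B :: "'s graded_ring" and kc :: "'k::field \<Rightarrow> 's"
  assumes ring_B: "ring B" and kc_part: "kc c \<in> hom_part B 0"
    and kc_add: "kc (c + d) = kc c \<oplus>\<^bsub>B\<^esub> kc d" and kc_mult: "kc (c * d) = kc c \<otimes>\<^bsub>B\<^esub> kc d"
    and kc_one: "kc 1 = \<one>\<^bsub>B\<^esub>"
begin

lemma kc_closed: "kc c \<in> carrier B" using kc_part[of c] by (simp add: hom_part_def)

lemma kspaceI:
  assumes "pre_graded B M" shows "kspace M (\<lambda>c x. kc c \<odot>\<^bsub>M\<^esub> x)"
proof -
  interpret left_module B M using assms by (simp add: pre_graded_def)
  show ?thesis
    by (intro kspace.intro kspace_axioms.intro M.abelian_group_axioms)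
      (simp_all add: smult_closed smult_r_distr smult_l_distr smult_assoc[symmetric] smult_one kc_closed kc_add kc_mult kc_one)
qed

lemma hpart_closed: "pre_graded B M \<Longrightarrow> x \<in> hpart M d \<Longrightarrow> x \<in> carrier M"
  using additive_subgroup.a_subset[of "hpart M d" M] by (auto simp: pre_graded_def)

lemma hpart_subspace:
  assumes M: "pre_graded B M" shows "kspace.subspace M (\<lambda>c x. kc c \<odot>\<^bsub>M\<^esub> x) (hpart M d)"
proof -
  interpret kspace M "\<lambda>c x. kc c \<odot>\<^bsub>M\<^esub> x" by (rule kspaceI[OF M])
  interpret A: additive_subgroup "hpart M d" M using M by (simp add: pre_graded_def)
  have "kc c \<odot>\<^bsub>M\<^esub> x \<in> hpart M d" if "x \<in> hpart M d" for c x
    using M kc_part[of c] that unfolding pre_graded_def by fastforce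
  then show ?thesis by (simp add: subspace_def A.a_subset)
qed

end

section \<open>Adapted bases of complexes\<close>

text \<open>Linear coordinates on the degree \<open>j\<close> part of a module, with values in the vectors on \<open>S\<close>.\<close>

definition kcoord :: "('k::field \<Rightarrow> 's) \<Rightarrow> ('s, 'a) gmodule \<Rightarrow> int \<Rightarrow> 'b set \<Rightarrow> ('a \<Rightarrow> ('b \<Rightarrow>\<^sub>0 'k)) \<Rightarrow> bool" where
  "kcoord kc M j S \<kappa> \<longleftrightarrow> bij_betw \<kappa> (hpart M j) {u. Poly_Mapping.keys u \<subseteq> S} \<and>
     (\<forall>x\<in>hpart M j. \<forall>y\<in>hpart M j. \<kappa> (x \<oplus>\<^bsub>M\<^esub> y) = \<kappa> x + \<kappa> y) \<and>
     (\<forall>c. \<forall>x\<in>hpart M j. \<kappa> (kc c \<odot>\<^bsub>M\<^esub> x) = scal c (\<kappa> x))"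

locale kcomplex = scalars B kc for B :: "'s graded_ring" and kc :: "'k::field \<Rightarrow> 's" +
  fixes G :: "('s, 'a) gcomplex"
  assumes G: "graded_complex B G"
begin

lemma gm: "graded_module B (Ob G i)" and d_hom: "Df G i \<in> graded_hom B (Ob G i) (Ob G (i + 1))"
  and dd: "x \<in> carrier (Ob G i) \<Longrightarrow> Df G (i + 1) (Df G i x) = \<zero>\<^bsub>Ob G (i + 2)\<^esub>"
  using G by (auto simp: graded_complex_def)

lemma pg: "pre_graded B (Ob G i)" by (rule pre_graded_if_graded_module[OF gm])

sublocale K: kspace "Ob G i" "\<lambda>c x. kc c \<odot>\<^bsub>Ob G i\<^esub> x" for i by (rule kspaceI[OF pg])

lemmas hcl = hpart_closed[OF pg]
lemmas hsub = hpart_subspace[OF pg]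

lemma hadd: "x \<in> hpart (Ob G i) j \<Longrightarrow> y \<in> hpart (Ob G i) j \<Longrightarrow> x \<oplus>\<^bsub>Ob G i\<^esub> y \<in> hpart (Ob G i) j"
  and hscal: "x \<in> hpart (Ob G i) j \<Longrightarrow> kc c \<odot>\<^bsub>Ob G i\<^esub> x \<in> hpart (Ob G i) j"
  and hzero: "\<zero>\<^bsub>Ob G i\<^esub> \<in> hpart (Ob G i) j"
  using hsub[of i j] by (auto simp: K.subspace_def)

lemma hminus: "x \<in> hpart (Ob G i) j \<Longrightarrow> y \<in> hpart (Ob G i) j \<Longrightarrow> x \<ominus>\<^bsub>Ob G i\<^esub> y \<in> hpart (Ob G i) j"
  using hadd[of x i j "\<ominus>\<^bsub>Ob G i\<^esub> y"] K.subspace_minus[OF hsub, of y i j] by (simp add: K.M.minus_eq)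

lemma d_zero: "Df G i \<zero>\<^bsub>Ob G i\<^esub> = \<zero>\<^bsub>Ob G (i + 1)\<^esub>"
  using graded_homD(2)[OF d_hom, of "\<zero>\<^bsub>Ob G i\<^esub>" i "\<zero>\<^bsub>Ob G i\<^esub>"] graded_homD(1)[OF d_hom, of "\<zero>\<^bsub>Ob G i\<^esub>" i]
  by (intro K.self_cancel) simp_all

lemmas d_closed = graded_homD(1)[OF d_hom] and d_add = graded_homD(2)[OF d_hom] and d_hpart = graded_homD(4)[OF d_hom]

lemma d_scal: "x \<in> carrier (Ob G i) \<Longrightarrow> Df G i (kc c \<odot>\<^bsub>Ob G i\<^esub> x) = kc c \<odot>\<^bsub>Ob G (i + 1)\<^esub> Df G i x"
  by (rule graded_homD(3)[OF d_hom kc_closed])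

lemma d_uminus: "x \<in> carrier (Ob G i) \<Longrightarrow> Df G i (\<ominus>\<^bsub>Ob G i\<^esub> x) = \<ominus>\<^bsub>Ob G (i + 1)\<^esub> Df G i x"
  using d_scal[of x i "- 1"] d_closed[of x i] by (simp add: K.sm_neg)

lemma d_minus: "x \<in> carrier (Ob G i) \<Longrightarrow> y \<in> carrier (Ob G i) \<Longrightarrow>
    Df G i (x \<ominus>\<^bsub>Ob G i\<^esub> y) = Df G i x \<ominus>\<^bsub>Ob G (i + 1)\<^esub> Df G i y"
  by (simp add: K.M.minus_eq d_add d_uminus)

abbreviation d' where "d' i \<equiv> Df G (i - 1)"

lemma d'_closed: "x \<in> carrier (Ob G (i - 1)) \<Longrightarrow> d' i x \<in> carrier (Ob G i)"
  and d'_add: "x \<in> carrier (Ob G (i - 1)) \<Longrightarrow> y \<in> carrier (Ob G (i - 1)) \<Longrightarrow> d' i (x \<oplus>\<^bsub>Ob G (i - 1)\<^esub> y) = d' i x \<oplus>\<^bsub>Ob G i\<^esub> d' i y"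
  and d'_hpart: "x \<in> hpart (Ob G (i - 1)) j \<Longrightarrow> d' i x \<in> hpart (Ob G i) j"
  and d'_scal: "x \<in> carrier (Ob G (i - 1)) \<Longrightarrow> d' i (kc c \<odot>\<^bsub>Ob G (i - 1)\<^esub> x) = kc c \<odot>\<^bsub>Ob G i\<^esub> d' i x"
  and d'_zero: "d' i \<zero>\<^bsub>Ob G (i - 1)\<^esub> = \<zero>\<^bsub>Ob G i\<^esub>"
  and dd': "x \<in> carrier (Ob G (i - 1)) \<Longrightarrow> Df G i (d' i x) = \<zero>\<^bsub>Ob G (i + 1)\<^esub>"
  and d'_minus: "x \<in> carrier (Ob G (i - 1)) \<Longrightarrow> y \<in> carrier (Ob G (i - 1)) \<Longrightarrow> d' i (x \<ominus>\<^bsub>Ob G (i - 1)\<^esub> y) = d' i x \<ominus>\<^bsub>Ob G i\<^esub> d' i y"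
  using d_closed[of x "i - 1"] d_add[of x "i - 1" y] d_hpart[of x "i - 1" j] d_scal[of x "i - 1" c]
     d_zero[of "i - 1"] dd[of x "i - 1"] d_minus[of x "i - 1" y] by (simp_all add: add.commute)

definition Zs :: "int \<Rightarrow> int \<Rightarrow> 'a set" where
  "Zs i j = {x \<in> hpart (Ob G i) j. Df G i x = \<zero>\<^bsub>Ob G (i + 1)\<^esub>}"

definition Bs :: "int \<Rightarrow> int \<Rightarrow> 'a set" where
  "Bs i j = d' i ` hpart (Ob G (i - 1)) j"

lemma Zs_subspace: "K.subspace i (Zs i j)"
  unfolding K.subspace_def Zs_def
  by (auto simp: hcl hadd hscal hzero d_zero d_add d_scal K.sm_zero_right)

lemma Bs_subspace: "K.subspace i (Bs i j)"
  unfolding K.subspace_def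
proof (intro conjI ballI allI)
  show "Bs i j \<subseteq> carrier (Ob G i)" by (auto simp: Bs_def intro: hcl d'_hpart)
  show "\<zero>\<^bsub>Ob G i\<^esub> \<in> Bs i j" unfolding Bs_def
    by (rule image_eqI[of _ _ "\<zero>\<^bsub>Ob G (i - 1)\<^esub>"]) (simp_all add: d'_zero hzero)
next
  fix x y assume "x \<in> Bs i j" "y \<in> Bs i j"
  then obtain x' y' where x: "x = d' i x'" "x' \<in> hpart (Ob G (i - 1)) j" and y: "y = d' i y'" "y' \<in> hpart (Ob G (i - 1)) j"
    by (auto simp: Bs_def)
  have "x \<oplus>\<^bsub>Ob G i\<^esub> y = d' i (x' \<oplus>\<^bsub>Ob G (i - 1)\<^esub> y')" using x y by (simp add: d'_add hcl)
  then show "x \<oplus>\<^bsub>Ob G i\<^esub> y \<in> Bs i j" unfolding Bs_def by (rule image_eqI) (rule hadd[OF x(2) y(2)])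
next
  fix c x assume "x \<in> Bs i j"
  then obtain x' where x: "x = d' i x'" "x' \<in> hpart (Ob G (i - 1)) j" by (auto simp: Bs_def)
  have "kc c \<odot>\<^bsub>Ob G i\<^esub> x = d' i (kc c \<odot>\<^bsub>Ob G (i - 1)\<^esub> x')" using x by (simp add: d'_scal hcl)
  then show "kc c \<odot>\<^bsub>Ob G i\<^esub> x \<in> Bs i j" unfolding Bs_def by (rule image_eqI) (rule hscal[OF x(2)])
qed

text \<open>The conclusion of \<open>K.relative_basis\<close>. It is applied twice in every degree: to the cocycles inside all
  elements and to the coboundaries inside the cocycles.\<close>

definition rel_basis :: "int \<Rightarrow> 'a set \<Rightarrow> 'a set \<Rightarrow> 'a set \<Rightarrow> bool" where
  "rel_basis i N Z C \<longleftrightarrow> C \<subseteq> Z \<and> (\<forall>u. Poly_Mapping.keys u \<subseteq> C \<longrightarrow> K.comb i u \<in> N \<longrightarrow> u = 0) \<and>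
     (\<forall>z\<in>Z. \<exists>u. Poly_Mapping.keys u \<subseteq> C \<and> z \<ominus>\<^bsub>Ob G i\<^esub> K.comb i u \<in> N)"

definition Cb :: "int \<Rightarrow> int \<Rightarrow> 'a set" where "Cb i j = (SOME C. rel_basis i (Zs i j) (hpart (Ob G i) j) C)"
definition Hb :: "int \<Rightarrow> int \<Rightarrow> 'a set" where "Hb i j = (SOME C. rel_basis i (Bs i j) (Zs i j) C)"

lemma Cb: "rel_basis i (Zs i j) (hpart (Ob G i) j) (Cb i j)"
  unfolding Cb_def by (rule someI_ex) (use K.relative_basis[OF Zs_subspace hsub] in \<open>simp add: rel_basis_def\<close>)

lemma Hb: "rel_basis i (Bs i j) (Zs i j) (Hb i j)"
  unfolding Hb_def by (rule someI_ex) (use K.relative_basis[OF Bs_subspace Zs_subspace] in \<open>simp add: rel_basis_def\<close>)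

lemma Cb_sub: "Cb i j \<subseteq> hpart (Ob G i) j" and Hb_sub: "Hb i j \<subseteq> Zs i j" "Hb i j \<subseteq> hpart (Ob G i) j"
  using Cb[of i j] Hb[of i j] by (auto simp: rel_basis_def Zs_def)

definition bs :: "'a idx set" where
  "bs = {(t, i, j, a). (t = Co \<and> a \<in> Cb i j) \<or> (t = Harm \<and> a \<in> Hb i j) \<or> (t = Bd \<and> a \<in> Cb (i - 1) j)}"

definition bsb :: "int \<Rightarrow> int \<Rightarrow> 'a idx set" where
  "bsb i j = {(t, i', j', a). (t, i', j', a) \<in> bs \<and> i' = i \<and> j' = j}"

definition tag_part :: "tag \<Rightarrow> int \<Rightarrow> int \<Rightarrow> ('a idx \<Rightarrow>\<^sub>0 'k) \<Rightarrow> ('a \<Rightarrow>\<^sub>0 'k)" where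
  "tag_part t i j = lin_ext (\<lambda>(t', i', j', a). if t' = t \<and> i' = i \<and> j' = j then Poly_Mapping.single a 1 else 0)"

lemma tag_part_add: "tag_part t i j (u + w) = tag_part t i j u + tag_part t i j w"
  and tag_part_scal: "tag_part t i j (scal c u) = scal c (tag_part t i j u)"
  and tag_part_zero [simp]: "tag_part t i j 0 = 0"
  by (simp_all add: tag_part_def lin_ext_add lin_ext_scal)

lemma tag_part_keys: "Poly_Mapping.keys u \<subseteq> bsb i j \<Longrightarrow>
    Poly_Mapping.keys (tag_part t i j u) \<subseteq> (case t of Co \<Rightarrow> Cb i j | Harm \<Rightarrow> Hb i j | Bd \<Rightarrow> Cb (i - 1) j)"
  unfolding tag_part_def by (rule keys_lin_ext) (auto simp: bsb_def bs_def split: if_splits)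

lemma tag_part_keys':
  assumes "Poly_Mapping.keys u \<subseteq> bsb i j"
  shows "Poly_Mapping.keys (tag_part Co i j u) \<subseteq> Cb i j" "Poly_Mapping.keys (tag_part Harm i j u) \<subseteq> Hb i j"
    "Poly_Mapping.keys (tag_part Bd i j u) \<subseteq> Cb (i - 1) j"
  using tag_part_keys[OF assms, of Co] tag_part_keys[OF assms, of Harm] tag_part_keys[OF assms, of Bd] by simp_all

lemma lookup_tag_part: "Poly_Mapping.lookup (tag_part t i j u) a = Poly_Mapping.lookup u (t, i, j, a)"
proof -
  have "Poly_Mapping.lookup (tag_part t i j u) a = (\<Sum>b\<in>Poly_Mapping.keys u. if b = (t, i, j, a) then Poly_Mapping.lookup u b else 0)"
    unfolding tag_part_def lookup_lin_ext by (rule sum.cong) (auto simp: lookup_single when_def split: if_splits)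
  then show ?thesis by (simp add: in_keys_iff)
qed

text \<open>The element with given coordinates. Coordinates at \<open>Bd\<close> refer to the images of the complement one
  degree below, so that \<open>rho\<close> turns \<open>dB\<close> into the differential without any choice of coboundaries.\<close>

definition rho :: "int \<Rightarrow> int \<Rightarrow> ('a idx \<Rightarrow>\<^sub>0 'k) \<Rightarrow> 'a" where
  "rho i j u = K.comb i (tag_part Co i j u) \<oplus>\<^bsub>Ob G i\<^esub> (K.comb i (tag_part Harm i j u) \<oplus>\<^bsub>Ob G i\<^esub> d' i (K.comb (i - 1) (tag_part Bd i j u)))"

lemma combC:
  assumes "Poly_Mapping.keys u \<subseteq> bsb i j"
  shows "K.comb i (tag_part Co i j u) \<in> hpart (Ob G i) j" "K.comb i (tag_part Harm i j u) \<in> Zs i j"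
    "K.comb i (tag_part Harm i j u) \<in> hpart (Ob G i) j" "K.comb (i - 1) (tag_part Bd i j u) \<in> hpart (Ob G (i - 1)) j"
proof -
  show "K.comb i (tag_part Co i j u) \<in> hpart (Ob G i) j"
    by (rule K.comb_subspace[OF hsub]) (use tag_part_keys'(1)[OF assms] Cb_sub in blast)
  show "K.comb i (tag_part Harm i j u) \<in> Zs i j"
    by (rule K.comb_subspace[OF Zs_subspace]) (use tag_part_keys'(2)[OF assms] Hb_sub in blast)
  then show "K.comb i (tag_part Harm i j u) \<in> hpart (Ob G i) j" by (simp add: Zs_def)
  show "K.comb (i - 1) (tag_part Bd i j u) \<in> hpart (Ob G (i - 1)) j"
    by (rule K.comb_subspace[OF hsub]) (use tag_part_keys'(3)[OF assms] Cb_sub in blast)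
qed

lemma rho_hpart: "Poly_Mapping.keys u \<subseteq> bsb i j \<Longrightarrow> rho i j u \<in> hpart (Ob G i) j"
  unfolding rho_def by (intro hadd combC d'_hpart)

lemma keysM:
  assumes "Poly_Mapping.keys u \<subseteq> bsb i j"
  shows "Poly_Mapping.keys (tag_part Co i j u) \<subseteq> carrier (Ob G i)" "Poly_Mapping.keys (tag_part Harm i j u) \<subseteq> carrier (Ob G i)"
    "Poly_Mapping.keys (tag_part Bd i j u) \<subseteq> carrier (Ob G (i - 1))"
proof -
  show "Poly_Mapping.keys (tag_part Co i j u) \<subseteq> carrier (Ob G i)" using tag_part_keys'(1)[OF assms] Cb_sub[of i j] hcl by blast
  show "Poly_Mapping.keys (tag_part Harm i j u) \<subseteq> carrier (Ob G i)" using tag_part_keys'(2)[OF assms] Hb_sub(2)[of i j] hcl by blast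
  show "Poly_Mapping.keys (tag_part Bd i j u) \<subseteq> carrier (Ob G (i - 1))" using tag_part_keys'(3)[OF assms] Cb_sub[of "i - 1" j] hcl by blast
qed

lemma rho_add:
  assumes u: "Poly_Mapping.keys u \<subseteq> bsb i j" and w: "Poly_Mapping.keys w \<subseteq> bsb i j"
  shows "rho i j (u + w) = rho i j u \<oplus>\<^bsub>Ob G i\<^esub> rho i j w"
  unfolding rho_def tag_part_add
  using combC[OF u] combC[OF w]
  by (simp add: K.comb_add keysM[OF u] keysM[OF w] d'_add hcl d'_closed K.M.a_ac)

lemma rho_scal:
  assumes u: "Poly_Mapping.keys u \<subseteq> bsb i j"
  shows "rho i j (scal c u) = kc c \<odot>\<^bsub>Ob G i\<^esub> rho i j u"
  unfolding rho_def tag_part_scal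
  using combC[OF u]
  by (simp add: K.comb_scal keysM[OF u] d'_scal hcl d'_closed K.sm_add)

lemma d_rho:
  assumes u: "Poly_Mapping.keys u \<subseteq> bsb i j"
  shows "Df G i (rho i j u) = Df G i (K.comb i (tag_part Co i j u))"
proof -
  have h: "Df G i (K.comb i (tag_part Harm i j u)) = \<zero>\<^bsub>Ob G (i + 1)\<^esub>" using combC(2)[OF u] by (simp add: Zs_def)
  show ?thesis unfolding rho_def using combC[OF u] by (simp add: d_add hcl d'_closed h dd' d_closed)
qed

lemma rho_dB:
  assumes u: "Poly_Mapping.keys u \<subseteq> bsb i j"
  shows "rho (i + 1) j (lin_ext dB u) = Df G i (rho i j u)"
proof -
  have "tag_part Co (i + 1) j (lin_ext dB u) = 0" "tag_part Harm (i + 1) j (lin_ext dB u) = 0"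
    unfolding tag_part_def lin_ext_comp by (rule trans[OF lin_ext_cong lin_ext_zero_fun]; auto simp: dB_def)+
  moreover have "tag_part Bd (i + 1) j (lin_ext dB u) = tag_part Co i j u"
    unfolding tag_part_def lin_ext_comp by (rule lin_ext_cong) (auto simp: dB_def)
  ultimately show ?thesis
    unfolding d_rho[OF u] using combC(1)[OF u] by (simp add: rho_def d_closed hcl)
qed

text \<open>The three parts of the basis are separated by passing to the quotients: first modulo cocycles, then
  modulo coboundaries, and finally the differential is injective on the complement.\<close>

lemma rho_inj:
  assumes u: "Poly_Mapping.keys u \<subseteq> bsb i j" and z: "rho i j u = \<zero>\<^bsub>Ob G i\<^esub>"
  shows "u = 0"
proof -
  have "K.comb i (tag_part Co i j u) \<in> Zs i j" using combC(1)[OF u] d_rho[OF u] z d_zero by (simp add: Zs_def)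
  then have 1: "tag_part Co i j u = 0" using Cb[of i j] tag_part_keys'(1)[OF u] by (simp add: rel_basis_def)
  then have "K.comb i (tag_part Harm i j u) \<oplus>\<^bsub>Ob G i\<^esub> d' i (K.comb (i - 1) (tag_part Bd i j u)) = \<zero>\<^bsub>Ob G i\<^esub>"
    using z combC[OF u] by (simp add: rho_def hcl d'_closed)
  then have e: "K.comb i (tag_part Harm i j u) = \<ominus>\<^bsub>Ob G i\<^esub> d' i (K.comb (i - 1) (tag_part Bd i j u))"
    using combC[OF u] by (metis K.M.minus_equality hcl d'_closed)
  have "d' i (K.comb (i - 1) (tag_part Bd i j u)) \<in> Bs i j" using combC(4)[OF u] by (simp add: Bs_def)
  then have "K.comb i (tag_part Harm i j u) \<in> Bs i j" using e K.subspace_minus[OF Bs_subspace] by simp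
  then have 2: "tag_part Harm i j u = 0" using Hb[of i j] tag_part_keys'(2)[OF u] by (simp add: rel_basis_def)
  then have "d' i (K.comb (i - 1) (tag_part Bd i j u)) = \<zero>\<^bsub>Ob G i\<^esub>"
    using z 1 combC(4)[OF u] by (simp add: rho_def hcl d'_closed)
  then have "K.comb (i - 1) (tag_part Bd i j u) \<in> Zs (i - 1) j" using combC(4)[OF u] by (simp add: Zs_def)
  then have 3: "tag_part Bd i j u = 0" using Cb[of "i - 1" j] tag_part_keys'(3)[OF u] by (simp add: rel_basis_def)
  show ?thesis
  proof (rule poly_mapping_eqI)
    fix b :: "'a idx"
    obtain t i' j' a where b: "b = (t, i', j', a)" by (cases b rule: prod_cases4)
    show "Poly_Mapping.lookup u b = Poly_Mapping.lookup 0 b"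
    proof (cases "i' = i \<and> j' = j")
      case True
      have "tag_part t i j u = 0" using 1 2 3 by (cases t) simp_all
      then show ?thesis using lookup_tag_part[of t i j u a] True b by simp
    next
      case False
      then have "b \<notin> bsb i j" by (auto simp: b bsb_def)
      then have "b \<notin> Poly_Mapping.keys u" using u by blast
      then show ?thesis by (simp add: in_keys_iff)
    qed
  qed
qed

definition emb :: "tag \<Rightarrow> int \<Rightarrow> int \<Rightarrow> ('a \<Rightarrow>\<^sub>0 'k) \<Rightarrow> ('a idx \<Rightarrow>\<^sub>0 'k)" where
  "emb t i j = lin_ext (\<lambda>a. Poly_Mapping.single (t, i, j, a) 1)"

lemma tag_part_emb: "tag_part t i j (emb t' i j w) = (if t = t' then w else 0)"
  unfolding tag_part_def emb_def lin_ext_comp by simp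

lemma emb_keys:
  "Poly_Mapping.keys w \<subseteq> (case t of Co \<Rightarrow> Cb i j | Harm \<Rightarrow> Hb i j | Bd \<Rightarrow> Cb (i - 1) j) \<Longrightarrow>
    Poly_Mapping.keys (emb t i j w) \<subseteq> bsb i j"
  unfolding emb_def by (rule keys_lin_ext) (auto simp: bsb_def bs_def split: tag.splits)

lemma rho_surj:
  assumes x: "x \<in> hpart (Ob G i) j"
  shows "\<exists>u. Poly_Mapping.keys u \<subseteq> bsb i j \<and> rho i j u = x"
proof -
  note CB = Cb[unfolded rel_basis_def] and HB = Hb[unfolded rel_basis_def]
  obtain u1 where u1: "Poly_Mapping.keys u1 \<subseteq> Cb i j" "x \<ominus>\<^bsub>Ob G i\<^esub> K.comb i u1 \<in> Zs i j"
    using CB[of i j] x by blast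
  obtain u2 where u2: "Poly_Mapping.keys u2 \<subseteq> Hb i j" "x \<ominus>\<^bsub>Ob G i\<^esub> K.comb i u1 \<ominus>\<^bsub>Ob G i\<^esub> K.comb i u2 \<in> Bs i j"
    using HB[of i j] u1(2) by blast
  obtain w where w: "w \<in> hpart (Ob G (i - 1)) j" "x \<ominus>\<^bsub>Ob G i\<^esub> K.comb i u1 \<ominus>\<^bsub>Ob G i\<^esub> K.comb i u2 = d' i w"
    using u2(2) by (auto simp: Bs_def)
  obtain u3 where u3: "Poly_Mapping.keys u3 \<subseteq> Cb (i - 1) j" "w \<ominus>\<^bsub>Ob G (i - 1)\<^esub> K.comb (i - 1) u3 \<in> Zs (i - 1) j"
    using CB[of "i - 1" j] w(1) by blast
  have c3: "K.comb (i - 1) u3 \<in> carrier (Ob G (i - 1))" by (rule K.comb_closed) (use u3(1) Cb_sub hcl in blast)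
  have c1: "K.comb i u1 \<in> carrier (Ob G i)" by (rule K.comb_closed) (use u1(1) Cb_sub hcl in blast)
  have c2: "K.comb i u2 \<in> carrier (Ob G i)" by (rule K.comb_closed) (use u2(1) Hb_sub hcl in blast)
  have xc: "x \<in> carrier (Ob G i)" and wc: "w \<in> carrier (Ob G (i - 1))" using x w(1) hcl by blast+
  have "d' i w \<ominus>\<^bsub>Ob G i\<^esub> d' i (K.comb (i - 1) u3) = \<zero>\<^bsub>Ob G i\<^esub>"
    using u3(2) d'_minus[OF wc c3] by (simp add: Zs_def)
  then have dw: "d' i w = d' i (K.comb (i - 1) u3)" by (rule K.minus_zero_eq[OF d'_closed[OF wc] d'_closed[OF c3]])
  let ?u = "emb Co i j u1 + (emb Harm i j u2 + emb Bd i j u3)"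
  have k: "Poly_Mapping.keys ?u \<subseteq> bsb i j"
    by (intro keys_add_subset emb_keys) (simp_all add: u1 u2 u3)
  have p: "tag_part Co i j ?u = u1" "tag_part Harm i j ?u = u2" "tag_part Bd i j ?u = u3" by (simp_all add: tag_part_add tag_part_emb)
  have "rho i j ?u = K.comb i u1 \<oplus>\<^bsub>Ob G i\<^esub> (K.comb i u2 \<oplus>\<^bsub>Ob G i\<^esub> (x \<ominus>\<^bsub>Ob G i\<^esub> K.comb i u1 \<ominus>\<^bsub>Ob G i\<^esub> K.comb i u2))"
    by (simp add: rho_def p dw[symmetric] w(2))
  also have "\<dots> = x"
  proof -
    have "K.comb i u1 \<oplus>\<^bsub>Ob G i\<^esub> (K.comb i u2 \<oplus>\<^bsub>Ob G i\<^esub> (x \<ominus>\<^bsub>Ob G i\<^esub> K.comb i u1 \<ominus>\<^bsub>Ob G i\<^esub> K.comb i u2)) =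
       x \<oplus>\<^bsub>Ob G i\<^esub> ((K.comb i u1 \<oplus>\<^bsub>Ob G i\<^esub> \<ominus>\<^bsub>Ob G i\<^esub> K.comb i u1) \<oplus>\<^bsub>Ob G i\<^esub> (K.comb i u2 \<oplus>\<^bsub>Ob G i\<^esub> \<ominus>\<^bsub>Ob G i\<^esub> K.comb i u2))"
      using c1 c2 xc by (simp add: K.M.minus_eq K.M.a_ac)
    then show ?thesis using c1 c2 xc by (simp add: K.M.r_neg)
  qed
  finally show ?thesis using k by blast
qed

lemma rho_bij: "bij_betw (rho i j) {u. Poly_Mapping.keys u \<subseteq> bsb i j} (hpart (Ob G i) j)"
  unfolding bij_betw_def
proof
  show "inj_on (rho i j) {u. Poly_Mapping.keys u \<subseteq> bsb i j}"
  proof (rule inj_onI)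
    fix u w assume "u \<in> {u. Poly_Mapping.keys u \<subseteq> bsb i j}" "w \<in> {u. Poly_Mapping.keys u \<subseteq> bsb i j}"
      and e: "rho i j u = rho i j w"
    then have u: "Poly_Mapping.keys u \<subseteq> bsb i j" and w: "Poly_Mapping.keys w \<subseteq> bsb i j" by auto
    have w': "Poly_Mapping.keys (scal (- 1) w) \<subseteq> bsb i j" by (rule subset_trans[OF keys_scal w])
    have "rho i j (u + scal (- 1) w) = \<zero>\<^bsub>Ob G i\<^esub>"
      using hcl[OF rho_hpart[OF w]] by (simp add: rho_add[OF u w'] rho_scal[OF w] e K.sm_neg K.M.r_neg)
    then have "u + scal (- 1) w = 0" by (rule rho_inj[OF keys_add_subset[OF u w']])
    moreover have "scal (- 1) w = - w" by (rule poly_mapping_eqI) simp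
    ultimately show "u = w" by simp
  qed
  show "rho i j ` {u. Poly_Mapping.keys u \<subseteq> bsb i j} = hpart (Ob G i) j"
    using rho_hpart rho_surj by blast
qed

definition kap :: "int \<Rightarrow> int \<Rightarrow> 'a \<Rightarrow> ('a idx \<Rightarrow>\<^sub>0 'k)" where
  "kap i j = inv_into {u. Poly_Mapping.keys u \<subseteq> bsb i j} (rho i j)"

lemma kap_rho: "Poly_Mapping.keys u \<subseteq> bsb i j \<Longrightarrow> kap i j (rho i j u) = u"
  using bij_betw_inv_into_left[OF rho_bij, of u i j] by (simp add: kap_def)

lemma rho_kap: "x \<in> hpart (Ob G i) j \<Longrightarrow> rho i j (kap i j x) = x"
  using bij_betw_inv_into_right[OF rho_bij, of x i j] by (simp add: kap_def)

lemma kap_bij: "bij_betw (kap i j) (hpart (Ob G i) j) {u. Poly_Mapping.keys u \<subseteq> bsb i j}"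
  unfolding kap_def by (rule bij_betw_inv_into[OF rho_bij])

lemma kap_keys: "x \<in> hpart (Ob G i) j \<Longrightarrow> Poly_Mapping.keys (kap i j x) \<subseteq> bsb i j"
  using bij_betw_apply[OF kap_bij] by blast

lemma kap_unique: "Poly_Mapping.keys u \<subseteq> bsb i j \<Longrightarrow> rho i j u = x \<Longrightarrow> kap i j x = u"
  using kap_rho by blast

lemma kap_add: "x \<in> hpart (Ob G i) j \<Longrightarrow> y \<in> hpart (Ob G i) j \<Longrightarrow> kap i j (x \<oplus>\<^bsub>Ob G i\<^esub> y) = kap i j x + kap i j y"
  by (rule kap_unique) (simp_all add: keys_add_subset kap_keys rho_add rho_kap)

lemma kap_scal: "x \<in> hpart (Ob G i) j \<Longrightarrow> kap i j (kc c \<odot>\<^bsub>Ob G i\<^esub> x) = scal c (kap i j x)"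
  by (rule kap_unique) (simp_all add: subset_trans[OF keys_scal] kap_keys rho_scal rho_kap)

lemma kcoord_kap: "kcoord kc (Ob G i) j (bsb i j) (kap i j)"
  unfolding kcoord_def using kap_bij kap_add kap_scal by blast

lemma keys_dB: "Poly_Mapping.keys u \<subseteq> bsb i j \<Longrightarrow> Poly_Mapping.keys (lin_ext dB u) \<subseteq> bsb (i + 1) j"
  by (rule keys_lin_ext) (auto simp: bsb_def bs_def dB_def split: if_splits)

lemma keys_hB: "Poly_Mapping.keys u \<subseteq> bsb i j \<Longrightarrow> Poly_Mapping.keys (lin_ext hB u) \<subseteq> bsb (i - 1) j"
  by (rule keys_lin_ext) (auto simp: bsb_def bs_def hB_def split: if_splits)

lemma kap_d: "x \<in> hpart (Ob G i) j \<Longrightarrow> kap (i + 1) j (Df G i x) = lin_ext dB (kap i j x)"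
  by (rule kap_unique) (simp_all add: keys_dB kap_keys rho_dB rho_kap)

end

section \<open>The action of the variables in an adapted basis\<close>

text \<open>A monomial algebra coupled with a complex over a dual algebra: the elements \<open>yv k\<close> of the latter
  correspond to the variables of the former and commute with the opposite sign. The sign \<open>eps\<close>
  normalises the matrices of the \<open>yv k\<close>; for the functor \<open>R\<close> it absorbs a sign depending on \<open>v\<close>.\<close>

locale kcomplex_y = monomial_algebra A co Idx dv gam e0 var v dgm eta tau + kcomplex B kc G
  for A :: "'r graded_ring" and co :: "'r \<Rightarrow> 'm::minus \<Rightarrow> 'k::field"
    and Idx dv gam e0 var v dgm eta tau
    and B :: "'s graded_ring" and kc :: "'k \<Rightarrow> 's" and G :: "('s, 'a) gcomplex" +
  fixes yv :: "nat \<Rightarrow> 's" and eps :: 'k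
  assumes yv_part: "k < v \<Longrightarrow> yv k \<in> hom_part B eta"
    and yv_kc: "k < v \<Longrightarrow> kc x \<otimes>\<^bsub>B\<^esub> yv k = yv k \<otimes>\<^bsub>B\<^esub> kc x"
    and yv_yv: "\<lbrakk>k < v; l < v; k \<noteq> l\<rbrakk> \<Longrightarrow> yv k \<otimes>\<^bsub>B\<^esub> yv l = kc (- tau) \<otimes>\<^bsub>B\<^esub> (yv l \<otimes>\<^bsub>B\<^esub> yv k)"
    and yv_sq: "\<lbrakk>k < v; m \<in> Idx; var k \<in> dv m; var k \<in> dv (m - var k)\<rbrakk> \<Longrightarrow> yv k \<otimes>\<^bsub>B\<^esub> yv k = \<zero>\<^bsub>B\<^esub>"
    and eps: "eps * eps = 1"
begin

definition alt_eps :: "int \<Rightarrow> 'k" where "alt_eps i = (if even i then eps else - eps)"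

lemma ee2: "alt_eps i * alt_eps i = 1" and alt_eps_Suc: "alt_eps (i + 1) = - alt_eps i"
  using eps by (auto simp: alt_eps_def)

text \<open>The matrix of \<open>yv k\<close> in the adapted basis, including the alternating sign of the total complex.\<close>

definition Yc :: "nat \<Rightarrow> 'a idx \<Rightarrow> ('a idx \<Rightarrow>\<^sub>0 'k)" where
  "Yc k b = (case b of (t, i, j, a) \<Rightarrow>
     if b \<in> bs then scal (alt_eps i) (kap i (j + eta) (yv k \<odot>\<^bsub>Ob G i\<^esub> rho i j (Poly_Mapping.single b 1))) else 0)"

lemma lm: "left_module B (Ob G i)" using pg by (simp add: pre_graded_def)

lemma yv_closed: "k < v \<Longrightarrow> yv k \<in> carrier B" using yv_part by (simp add: hom_part_def)

lemma yv_hpart: "k < v \<Longrightarrow> x \<in> hpart (Ob G i) j \<Longrightarrow> yv k \<odot>\<^bsub>Ob G i\<^esub> x \<in> hpart (Ob G i) (j + eta)"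
  using pg[of i] yv_part unfolding pre_graded_def by (metis add.commute)

lemma yv_add: "k < v \<Longrightarrow> x \<in> carrier (Ob G i) \<Longrightarrow> y \<in> carrier (Ob G i) \<Longrightarrow>
    yv k \<odot>\<^bsub>Ob G i\<^esub> (x \<oplus>\<^bsub>Ob G i\<^esub> y) = yv k \<odot>\<^bsub>Ob G i\<^esub> x \<oplus>\<^bsub>Ob G i\<^esub> yv k \<odot>\<^bsub>Ob G i\<^esub> y"
  using left_module.smult_r_distr[OF lm] yv_closed by blast

lemma yv_scal: "k < v \<Longrightarrow> x \<in> carrier (Ob G i) \<Longrightarrow>
    yv k \<odot>\<^bsub>Ob G i\<^esub> (kc c \<odot>\<^bsub>Ob G i\<^esub> x) = kc c \<odot>\<^bsub>Ob G i\<^esub> (yv k \<odot>\<^bsub>Ob G i\<^esub> x)"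
  using left_module.smult_assoc[OF lm, of "yv k" "kc c" x] left_module.smult_assoc[OF lm, of "kc c" "yv k" x]
    yv_closed kc_closed yv_kc by metis

lemma Yc_lin:
  assumes k: "k < v" and u: "Poly_Mapping.keys u \<subseteq> bsb i j"
  shows "lin_ext (Yc k) u = scal (alt_eps i) (kap i (j + eta) (yv k \<odot>\<^bsub>Ob G i\<^esub> rho i j u))"
proof -
  let ?f = "\<lambda>u. scal (alt_eps i) (kap i (j + eta) (yv k \<odot>\<^bsub>Ob G i\<^esub> rho i j u))"
  have "?f u = lin_ext (\<lambda>b. ?f (Poly_Mapping.single b 1)) u"
  proof (rule linear_on_eq_lin_ext[where B = "bsb i j"])
    fix u w :: "'a idx \<Rightarrow>\<^sub>0 'k" assume u: "Poly_Mapping.keys u \<subseteq> bsb i j" and w: "Poly_Mapping.keys w \<subseteq> bsb i j"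
    note uw = rho_hpart[OF u] rho_hpart[OF w]
    show "?f (u + w) = ?f u + ?f w"
      by (simp add: rho_add[OF u w] yv_add[OF k hcl[OF uw(1)] hcl[OF uw(2)]] kap_add yv_hpart k uw scal_distrib)
  next
    fix c and u :: "'a idx \<Rightarrow>\<^sub>0 'k" assume u: "Poly_Mapping.keys u \<subseteq> bsb i j"
    show "?f (scal c u) = scal c (?f u)"
      by (simp add: rho_scal[OF u] yv_scal[OF k hcl[OF rho_hpart[OF u]]] kap_scal yv_hpart k rho_hpart[OF u] mult.commute)
  qed (rule u)
  also have "\<dots> = lin_ext (Yc k) u"
    by (rule lin_ext_cong) (use u in \<open>auto simp: Yc_def bsb_def\<close>)
  finally show ?thesis by simp
qed

lemma Yc_kap:
  assumes "k < v" "x \<in> hpart (Ob G i) j"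
  shows "lin_ext (Yc k) (kap i j x) = scal (alt_eps i) (kap i (j + eta) (yv k \<odot>\<^bsub>Ob G i\<^esub> x))"
  using Yc_lin[OF assms(1) kap_keys[OF assms(2)]] rho_kap[OF assms(2)] by simp

lemma basis_in_kap:
  assumes "b \<in> bs"
  obtains i j t a x where "b = (t, i, j, a)" "x \<in> hpart (Ob G i) j" "Poly_Mapping.single b 1 = kap i j x"
proof -
  obtain t i j a where b: "b = (t, i, j, a)" by (cases b rule: prod_cases4)
  have k: "Poly_Mapping.keys (Poly_Mapping.single b (1::'k)) \<subseteq> bsb i j" using assms b by (simp add: bsb_def)
  show ?thesis by (rule that[OF b rho_hpart[OF k]]) (simp add: kap_rho[OF k])
qed

text \<open>The matrices inherit the relations of the dual algebra; the alternating signs make them anticommute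
  with the differential.\<close>

sublocale ladder A co Idx dv gam e0 var v dgm eta tau bs Yc cc for cc :: int
proof
  fix k :: nat and t i j a assume k: "k < v"
  show "Poly_Mapping.keys (Yc k (t, i, j, a)) \<subseteq> {(t', i', j', a'). (t', i', j', a') \<in> bs \<and> i' = i \<and> j' = j + eta}"
  proof (cases "(t, i, j, a) \<in> bs")
    case True
    then have "Poly_Mapping.keys (Poly_Mapping.single (t, i, j, a) (1::'k)) \<subseteq> bsb i j" by (simp add: bsb_def)
    from kap_keys[OF yv_hpart[OF k rho_hpart[OF this]]]
    have "Poly_Mapping.keys (Yc k (t, i, j, a)) \<subseteq> bsb i (j + eta)"
      unfolding Yc_def using True by (simp add: subset_trans[OF keys_scal])
    then show ?thesis unfolding bsb_def .
  qed (simp add: Yc_def)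
next
  fix k :: nat and b assume k: "k < v"
  show "lin_ext (Yc k) (dB b) = - lin_ext dB (Yc k b)"
  proof (cases "b \<in> bs")
    case True
    then obtain t i j a x where b: "b = (t, i, j, a)" and x: "x \<in> hpart (Ob G i) j" and s: "Poly_Mapping.single b (1::'k) = kap i j x"
      by (rule basis_in_kap)
    have Y: "Yc k b = scal (alt_eps i) (kap i (j + eta) (yv k \<odot>\<^bsub>Ob G i\<^esub> x))"
      using Yc_kap[OF k x] s[symmetric] by simp
    have "dB b = kap (i + 1) j (Df G i x)" using kap_d[OF x] s[symmetric] by simp
    then have "lin_ext (Yc k) (dB b) = scal (alt_eps (i + 1)) (kap (i + 1) (j + eta) (yv k \<odot>\<^bsub>Ob G (i + 1)\<^esub> Df G i x))"
      using Yc_kap[OF k d_hpart[OF x]] by simp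
    also have "yv k \<odot>\<^bsub>Ob G (i + 1)\<^esub> Df G i x = Df G i (yv k \<odot>\<^bsub>Ob G i\<^esub> x)"
      using graded_homD(3)[OF d_hom yv_closed[OF k] hcl[OF x]] by simp
    also have "kap (i + 1) (j + eta) \<dots> = lin_ext dB (kap i (j + eta) (yv k \<odot>\<^bsub>Ob G i\<^esub> x))"
      by (rule kap_d[OF yv_hpart[OF k x]])
    finally have "lin_ext (Yc k) (dB b) = scal (- alt_eps i) (lin_ext dB (kap i (j + eta) (yv k \<odot>\<^bsub>Ob G i\<^esub> x)))"
      by (simp add: alt_eps_Suc)
    also have "\<dots> = - lin_ext dB (Yc k b)" unfolding Y lin_ext_scal by (rule poly_mapping_eqI) simp
    finally show ?thesis .
  next
    case False
    have "lin_ext (Yc k) (dB b) = 0"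
      using False by (cases b rule: prod_cases4) (auto simp: dB_def Yc_def bs_def)
    moreover have "Yc k b = 0" using False by (cases b rule: prod_cases4) (simp add: Yc_def)
    ultimately show ?thesis by simp
  qed
next
  fix i j a show "(Co, i, j, a) \<in> bs \<longleftrightarrow> (Bd, i + 1, j, a) \<in> bs" by (simp add: bs_def)
next
  fix k l :: nat and b assume kl: "k < v" "l < v" "k \<noteq> l"
  show "lin_ext (Yc k) (Yc l b) = - scal tau (lin_ext (Yc l) (Yc k b))"
  proof (cases "b \<in> bs")
    case True
    then obtain t i j a x where b: "b = (t, i, j, a)" and x: "x \<in> hpart (Ob G i) j" and s: "Poly_Mapping.single b (1::'k) = kap i j x"
      by (rule basis_in_kap)
    have Y: "Yc k b = scal (alt_eps i) (kap i (j + eta) (yv k \<odot>\<^bsub>Ob G i\<^esub> x))" if "k < v" for k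
      using Yc_kap[OF that x] s[symmetric] by simp
    have YY: "lin_ext (Yc k) (Yc l b) = kap i (j + eta + eta) (yv k \<odot>\<^bsub>Ob G i\<^esub> (yv l \<odot>\<^bsub>Ob G i\<^esub> x))" if "k < v" "l < v" for k l
      using Yc_kap[OF that(1) yv_hpart[OF that(2) x]] by (simp add: Y that lin_ext_scal ee2)
    have "yv k \<odot>\<^bsub>Ob G i\<^esub> (yv l \<odot>\<^bsub>Ob G i\<^esub> x) = kc (- tau) \<odot>\<^bsub>Ob G i\<^esub> (yv l \<odot>\<^bsub>Ob G i\<^esub> (yv k \<odot>\<^bsub>Ob G i\<^esub> x))"
    proof -
      note sa = left_module.smult_assoc[OF lm] and xc = hcl[OF x]
      note cl = ring.ring_simprules(5)[OF ring_B]
      have "yv k \<odot>\<^bsub>Ob G i\<^esub> (yv l \<odot>\<^bsub>Ob G i\<^esub> x) = (yv k \<otimes>\<^bsub>B\<^esub> yv l) \<odot>\<^bsub>Ob G i\<^esub> x"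
        by (rule sa[OF yv_closed[OF kl(1)] yv_closed[OF kl(2)] xc, symmetric])
      also have "\<dots> = kc (- tau) \<odot>\<^bsub>Ob G i\<^esub> ((yv l \<otimes>\<^bsub>B\<^esub> yv k) \<odot>\<^bsub>Ob G i\<^esub> x)"
        unfolding yv_yv[OF kl] by (rule sa[OF kc_closed cl[OF yv_closed[OF kl(2)] yv_closed[OF kl(1)]] xc])
      finally show ?thesis unfolding sa[OF yv_closed[OF kl(2)] yv_closed[OF kl(1)] xc] .
    qed
    then have "lin_ext (Yc k) (Yc l b) = scal (- tau) (lin_ext (Yc l) (Yc k b))"
      by (simp only: YY[OF kl(1,2)] YY[OF kl(2,1)] kap_scal[OF yv_hpart[OF kl(2) yv_hpart[OF kl(1) x]]])
    moreover have "scal (- tau) w = - scal tau w" for w :: "'a idx \<Rightarrow>\<^sub>0 'k" by (rule poly_mapping_eqI) simp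
    ultimately show ?thesis by simp
  next
    case False
    then have "Yc k b = 0" for k by (cases b rule: prod_cases4) (simp add: Yc_def)
    then show ?thesis by simp
  qed
next
  fix k :: nat and b m assume k: "k < v" and m: "m \<in> Idx" "var k \<in> dv m" "var k \<in> dv (m - var k)"
  show "lin_ext (Yc k) (Yc k b) = 0"
  proof (cases "b \<in> bs")
    case True
    then obtain t i j a x where b: "b = (t, i, j, a)" and x: "x \<in> hpart (Ob G i) j" and s: "Poly_Mapping.single b (1::'k) = kap i j x"
      by (rule basis_in_kap)
    have Y: "Yc k b = scal (alt_eps i) (kap i (j + eta) (yv k \<odot>\<^bsub>Ob G i\<^esub> x))"
      using Yc_kap[OF k x] s[symmetric] by simp
    have z: "\<zero>\<^bsub>B\<^esub> \<odot>\<^bsub>Ob G i\<^esub> x = \<zero>\<^bsub>Ob G i\<^esub>"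
    proof (rule K.self_cancel)
      interpret R: ring B by (rule ring_B)
      show "\<zero>\<^bsub>B\<^esub> \<odot>\<^bsub>Ob G i\<^esub> x \<in> carrier (Ob G i)" using left_module.smult_closed[OF lm] hcl[OF x] by simp
      show "\<zero>\<^bsub>B\<^esub> \<odot>\<^bsub>Ob G i\<^esub> x \<oplus>\<^bsub>Ob G i\<^esub> \<zero>\<^bsub>B\<^esub> \<odot>\<^bsub>Ob G i\<^esub> x = \<zero>\<^bsub>B\<^esub> \<odot>\<^bsub>Ob G i\<^esub> x"
        using left_module.smult_l_distr[OF lm R.zero_closed R.zero_closed hcl[OF x]] by simp
    qed
    have "yv k \<odot>\<^bsub>Ob G i\<^esub> (yv k \<odot>\<^bsub>Ob G i\<^esub> x) = \<zero>\<^bsub>Ob G i\<^esub>"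
      using left_module.smult_assoc[OF lm yv_closed[OF k] yv_closed[OF k] hcl[OF x]] yv_sq[OF k m] z by simp
    moreover have "kap i (j + eta + eta) \<zero>\<^bsub>Ob G i\<^esub> = 0"
      by (rule kap_unique) (simp_all add: rho_def d'_zero)
    ultimately show ?thesis using Yc_kap[OF k yv_hpart[OF k x]] by (simp add: Y lin_ext_scal)
  next
    case False
    then have "Yc k b = 0" by (cases b rule: prod_cases4) (simp add: Yc_def)
    then show ?thesis by simp
  qed
qed

end

context kcomplex
begin

text \<open>All coboundaries and all cocycles, of any degree; \<open>ccl i z\<close> is the cohomology class of \<open>z\<close>.\<close>

definition bdry where "bdry i = d' i ` carrier (Ob G (i - 1))"
definition cocyc where "cocyc i = {x \<in> carrier (Ob G i). Df G i x = \<zero>\<^bsub>Ob G (i + 1)\<^esub>}"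
definition ccl :: "int \<Rightarrow> 'a \<Rightarrow> 'a set" where "ccl i z = (\<lambda>h. h \<oplus>\<^bsub>Ob G i\<^esub> z) ` bdry i"

lemma bdry_subspace: "K.subspace i (bdry i)"
  unfolding K.subspace_def
proof (intro conjI ballI allI)
  show "bdry i \<subseteq> carrier (Ob G i)" by (auto simp: bdry_def d'_closed)
  show "\<zero>\<^bsub>Ob G i\<^esub> \<in> bdry i" unfolding bdry_def
    by (rule image_eqI[of _ _ "\<zero>\<^bsub>Ob G (i - 1)\<^esub>"]) (simp_all add: d'_zero)
next
  fix x y assume "x \<in> bdry i" "y \<in> bdry i"
  then obtain x' y' where x: "x = d' i x'" "x' \<in> carrier (Ob G (i - 1))" and y: "y = d' i y'" "y' \<in> carrier (Ob G (i - 1))"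
    by (auto simp: bdry_def)
  show "x \<oplus>\<^bsub>Ob G i\<^esub> y \<in> bdry i" unfolding bdry_def
    by (rule image_eqI[of _ _ "x' \<oplus>\<^bsub>Ob G (i - 1)\<^esub> y'"]) (use x y in \<open>simp_all add: d'_add\<close>)
next
  fix c x assume "x \<in> bdry i"
  then obtain x' where x: "x = d' i x'" "x' \<in> carrier (Ob G (i - 1))" by (auto simp: bdry_def)
  show "kc c \<odot>\<^bsub>Ob G i\<^esub> x \<in> bdry i" unfolding bdry_def
    by (rule image_eqI[of _ _ "kc c \<odot>\<^bsub>Ob G (i - 1)\<^esub> x'"]) (use x in \<open>simp_all add: d'_scal K.sm_closed\<close>)
qed

lemma lmG: "left_module B (Ob G i)" using pg by (simp add: pre_graded_def)

lemma bdry_smult: "a \<in> carrier B \<Longrightarrow> x \<in> bdry i \<Longrightarrow> a \<odot>\<^bsub>Ob G i\<^esub> x \<in> bdry i"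
proof -
  assume a: "a \<in> carrier B" and "x \<in> bdry i"
  then obtain x' where x: "x = d' i x'" "x' \<in> carrier (Ob G (i - 1))" by (auto simp: bdry_def)
  show ?thesis unfolding bdry_def
    by (rule image_eqI[of _ _ "a \<odot>\<^bsub>Ob G (i - 1)\<^esub> x'"])
      (use x a graded_homD(3)[OF d_hom a x(2)] left_module.smult_closed[OF lmG] in simp_all)
qed

lemma cocyc_sub: "x \<in> cocyc i \<Longrightarrow> x \<in> carrier (Ob G i)" by (simp add: cocyc_def)

lemma cocyc_add: "x \<in> cocyc i \<Longrightarrow> y \<in> cocyc i \<Longrightarrow> x \<oplus>\<^bsub>Ob G i\<^esub> y \<in> cocyc i"
  by (simp add: cocyc_def d_add)

lemma cocyc_smult: "a \<in> carrier B \<Longrightarrow> x \<in> cocyc i \<Longrightarrow> a \<odot>\<^bsub>Ob G i\<^esub> x \<in> cocyc i"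
proof -
  assume a: "a \<in> carrier B" and x: "x \<in> cocyc i"
  have "Df G i (a \<odot>\<^bsub>Ob G i\<^esub> x) = a \<odot>\<^bsub>Ob G (i + 1)\<^esub> \<zero>\<^bsub>Ob G (i + 1)\<^esub>"
    using graded_homD(3)[OF d_hom a] x by (simp add: cocyc_def)
  also have "\<dots> = \<zero>\<^bsub>Ob G (i + 1)\<^esub>"
    using left_module.smult_r_distr[OF lmG a K.M.zero_closed K.M.zero_closed] left_module.smult_closed[OF lmG a K.M.zero_closed]
    by (intro K.self_cancel) simp_all
  finally show ?thesis using x left_module.smult_closed[OF lmG a] by (simp add: cocyc_def)
qed

lemma cocyc_uminus: "x \<in> cocyc i \<Longrightarrow> \<ominus>\<^bsub>Ob G i\<^esub> x \<in> cocyc i"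
  using d_uminus[of x i] by (simp add: cocyc_def)

lemma NcD: "h \<in> bdry i \<Longrightarrow> h \<in> carrier (Ob G i)" "h \<in> bdry i \<Longrightarrow> h' \<in> bdry i \<Longrightarrow> h \<oplus>\<^bsub>Ob G i\<^esub> h' \<in> bdry i"
  "\<zero>\<^bsub>Ob G i\<^esub> \<in> bdry i" "h \<in> bdry i \<Longrightarrow> \<ominus>\<^bsub>Ob G i\<^esub> h \<in> bdry i"
  using bdry_subspace[of i] K.subspace_minus[OF bdry_subspace, of h i] unfolding K.subspace_def by auto

lemma ccl_eq_iff:
  assumes z: "z \<in> carrier (Ob G i)" and w: "w \<in> carrier (Ob G i)"
  shows "ccl i z = ccl i w \<longleftrightarrow> z \<ominus>\<^bsub>Ob G i\<^esub> w \<in> bdry i"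
proof
  assume "ccl i z = ccl i w"
  moreover have "z \<in> ccl i z" unfolding ccl_def by (rule image_eqI[of _ _ "\<zero>\<^bsub>Ob G i\<^esub>"]) (simp_all add: NcD z)
  ultimately obtain h where h: "h \<in> bdry i" "z = h \<oplus>\<^bsub>Ob G i\<^esub> w" unfolding ccl_def by blast
  then have "z \<ominus>\<^bsub>Ob G i\<^esub> w = h" using w NcD(1)[OF h(1)] by (simp add: K.M.minus_eq K.M.a_assoc K.M.r_neg)
  then show "z \<ominus>\<^bsub>Ob G i\<^esub> w \<in> bdry i" using h by simp
next
  assume n: "z \<ominus>\<^bsub>Ob G i\<^esub> w \<in> bdry i"
  have sub: "ccl i z \<subseteq> ccl i w" if z: "z \<in> carrier (Ob G i)" and w: "w \<in> carrier (Ob G i)" and n: "z \<ominus>\<^bsub>Ob G i\<^esub> w \<in> bdry i" for z w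
  proof
    fix x assume "x \<in> ccl i z"
    then obtain h where h: "h \<in> bdry i" "x = h \<oplus>\<^bsub>Ob G i\<^esub> z" by (auto simp: ccl_def)
    have "x = (h \<oplus>\<^bsub>Ob G i\<^esub> (z \<ominus>\<^bsub>Ob G i\<^esub> w)) \<oplus>\<^bsub>Ob G i\<^esub> w"
      using h z w NcD(1)[OF h(1)] by (simp add: K.M.minus_eq K.M.a_assoc K.M.l_neg)
    then show "x \<in> ccl i w" unfolding ccl_def by (rule image_eqI) (rule NcD(2)[OF h(1) n])
  qed
  have "\<ominus>\<^bsub>Ob G i\<^esub> (z \<ominus>\<^bsub>Ob G i\<^esub> w) = w \<ominus>\<^bsub>Ob G i\<^esub> z"
    using z w by (simp add: K.M.minus_eq K.M.minus_add K.M.a_comm)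
  then have "w \<ominus>\<^bsub>Ob G i\<^esub> z \<in> bdry i" using NcD(4)[OF n] by simp
  then show "ccl i z = ccl i w" using sub[OF z w n] sub[OF w z] by blast
qed

abbreviation H where "H i \<equiv> cohomology G i"

lemma H_simps:
  "carrier (H i) = ccl i ` cocyc i" "\<zero>\<^bsub>H i\<^esub> = bdry i"
  "X \<oplus>\<^bsub>H i\<^esub> Y = {x \<oplus>\<^bsub>Ob G i\<^esub> y | x y. x \<in> X \<and> y \<in> Y}"
  "a \<odot>\<^bsub>H i\<^esub> X = (\<Union>x\<in>X. ccl i (a \<odot>\<^bsub>Ob G i\<^esub> x))"
  "hpart (H i) j = ccl i ` Zs i j"
proof -
  have r: "bdry i +>\<^bsub>(Ob G i)\<lparr>carrier := cocyc i, hpart := hh\<rparr>\<^esub> z = ccl i z" for z hh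
    by (auto simp: a_r_coset_def' ccl_def)
  have "hpart (Ob G i) j \<inter> cocyc i = Zs i j" using hcl by (auto simp: Zs_def cocyc_def)
  then show "carrier (H i) = ccl i ` cocyc i" "\<zero>\<^bsub>H i\<^esub> = bdry i"
    "X \<oplus>\<^bsub>H i\<^esub> Y = {x \<oplus>\<^bsub>Ob G i\<^esub> y | x y. x \<in> X \<and> y \<in> Y}"
    "a \<odot>\<^bsub>H i\<^esub> X = (\<Union>x\<in>X. ccl i (a \<odot>\<^bsub>Ob G i\<^esub> x))"
    "hpart (H i) j = ccl i ` Zs i j"
    unfolding cohomology_def Let_def quotient_gmodule_def bdry_def[symmetric] cocyc_def[symmetric]
    by (auto simp: r A_RCOSETS_def' set_add_def')
qed

lemma ccl_add: "z \<in> cocyc i \<Longrightarrow> w \<in> cocyc i \<Longrightarrow> ccl i z \<oplus>\<^bsub>H i\<^esub> ccl i w = ccl i (z \<oplus>\<^bsub>Ob G i\<^esub> w)"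
proof -
  assume z: "z \<in> cocyc i" and w: "w \<in> cocyc i"
  note c = cocyc_sub[OF z] cocyc_sub[OF w]
  show ?thesis
  proof (intro subset_antisym subsetI)
    fix x assume "x \<in> ccl i z \<oplus>\<^bsub>H i\<^esub> ccl i w"
    then obtain h h' where h: "h \<in> bdry i" "h' \<in> bdry i" "x = (h \<oplus>\<^bsub>Ob G i\<^esub> z) \<oplus>\<^bsub>Ob G i\<^esub> (h' \<oplus>\<^bsub>Ob G i\<^esub> w)"
      by (auto simp: H_simps ccl_def)
    then have "x = (h \<oplus>\<^bsub>Ob G i\<^esub> h') \<oplus>\<^bsub>Ob G i\<^esub> (z \<oplus>\<^bsub>Ob G i\<^esub> w)" using c NcD(1) by (simp add: K.M.a_ac)
    then show "x \<in> ccl i (z \<oplus>\<^bsub>Ob G i\<^esub> w)" unfolding ccl_def by (rule image_eqI) (rule NcD(2)[OF h(1,2)])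
  next
    fix x assume "x \<in> ccl i (z \<oplus>\<^bsub>Ob G i\<^esub> w)"
    then obtain h where h: "h \<in> bdry i" "x = h \<oplus>\<^bsub>Ob G i\<^esub> (z \<oplus>\<^bsub>Ob G i\<^esub> w)" by (auto simp: ccl_def)
    have "x = (h \<oplus>\<^bsub>Ob G i\<^esub> z) \<oplus>\<^bsub>Ob G i\<^esub> (\<zero>\<^bsub>Ob G i\<^esub> \<oplus>\<^bsub>Ob G i\<^esub> w)" using h c NcD(1)[OF h(1)] by (simp add: K.M.a_assoc)
    moreover have "h \<oplus>\<^bsub>Ob G i\<^esub> z \<in> ccl i z" "\<zero>\<^bsub>Ob G i\<^esub> \<oplus>\<^bsub>Ob G i\<^esub> w \<in> ccl i w" using h NcD(3) by (auto simp only: ccl_def)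
    ultimately show "x \<in> ccl i z \<oplus>\<^bsub>H i\<^esub> ccl i w" unfolding H_simps by blast
  qed
qed

lemma ccl_smult: "a \<in> carrier B \<Longrightarrow> z \<in> cocyc i \<Longrightarrow> a \<odot>\<^bsub>H i\<^esub> ccl i z = ccl i (a \<odot>\<^bsub>Ob G i\<^esub> z)"
proof -
  assume a: "a \<in> carrier B" and z: "z \<in> cocyc i"
  note sc = left_module.smult_closed[OF lmG a]
  have "ccl i (a \<odot>\<^bsub>Ob G i\<^esub> (h \<oplus>\<^bsub>Ob G i\<^esub> z)) = ccl i (a \<odot>\<^bsub>Ob G i\<^esub> z)" if h: "h \<in> bdry i" for h
  proof -
    have c: "a \<odot>\<^bsub>Ob G i\<^esub> h \<in> carrier (Ob G i)" "a \<odot>\<^bsub>Ob G i\<^esub> z \<in> carrier (Ob G i)" using sc NcD(1)[OF h] cocyc_sub[OF z] by auto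
    have "a \<odot>\<^bsub>Ob G i\<^esub> (h \<oplus>\<^bsub>Ob G i\<^esub> z) = a \<odot>\<^bsub>Ob G i\<^esub> h \<oplus>\<^bsub>Ob G i\<^esub> a \<odot>\<^bsub>Ob G i\<^esub> z"
      by (rule left_module.smult_r_distr[OF lmG a NcD(1)[OF h] cocyc_sub[OF z]])
    moreover have "(a \<odot>\<^bsub>Ob G i\<^esub> h \<oplus>\<^bsub>Ob G i\<^esub> a \<odot>\<^bsub>Ob G i\<^esub> z) \<ominus>\<^bsub>Ob G i\<^esub> a \<odot>\<^bsub>Ob G i\<^esub> z = a \<odot>\<^bsub>Ob G i\<^esub> h"
      using c by (simp add: K.M.minus_eq K.M.a_assoc K.M.r_neg)
    ultimately show ?thesis using c bdry_smult[OF a h] by (simp add: ccl_eq_iff)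
  qed
  moreover have "bdry i \<noteq> {}" using NcD(3) by blast
  ultimately show ?thesis by (simp add: H_simps(4)) (simp add: ccl_def[of i z])
qed

lemma ccl_zero: "\<zero>\<^bsub>H i\<^esub> = ccl i \<zero>\<^bsub>Ob G i\<^esub>"
proof -
  have "ccl i \<zero>\<^bsub>Ob G i\<^esub> = (\<lambda>h. h) ` bdry i" unfolding ccl_def by (rule image_cong) (simp_all add: NcD(1))
  then show ?thesis by (simp add: H_simps)
qed

lemma cocyc_zero: "\<zero>\<^bsub>Ob G i\<^esub> \<in> cocyc i" by (simp add: cocyc_def d_zero)

lemma left_module_H: "left_module B (H i)"
proof -
  note ad = ccl_add and sm = ccl_smult
  have "abelian_group (H i)"
  proof (rule abelian_groupI)
    fix x assume "x \<in> carrier (H i)"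
    then obtain z where z: "z \<in> cocyc i" "x = ccl i z" by (auto simp: H_simps)
    have "ccl i (\<ominus>\<^bsub>Ob G i\<^esub> z) \<oplus>\<^bsub>H i\<^esub> x = \<zero>\<^bsub>H i\<^esub>"
      using z cocyc_sub[OF z(1)] by (simp add: ad cocyc_uminus ccl_zero K.M.l_neg)
    then show "\<exists>y\<in>carrier (H i). y \<oplus>\<^bsub>H i\<^esub> x = \<zero>\<^bsub>H i\<^esub>" using z cocyc_uminus by (auto simp: H_simps(1))
  qed (auto simp: H_simps(1) ccl_zero ad cocyc_add cocyc_zero K.M.a_ac cocyc_sub)
  then show ?thesis
    by (intro left_module.intro left_module_axioms.intro ring_B)
      (auto simp: H_simps(1) ad sm cocyc_add cocyc_smult cocyc_sub left_module.smult_l_distr[OF lmG] left_module.smult_r_distr[OF lmG]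
        left_module.smult_assoc[OF lmG] left_module.smult_one[OF lmG] ring.ring_simprules[OF ring_B])
qed

lemma Zs_cocyc: "z \<in> Zs i j \<Longrightarrow> z \<in> cocyc i" using hcl by (auto simp: Zs_def cocyc_def)

lemma Zs_smult: "a \<in> hom_part B i' \<Longrightarrow> z \<in> Zs i j \<Longrightarrow> a \<odot>\<^bsub>Ob G i\<^esub> z \<in> Zs i (i' + j)"
proof -
  assume a: "a \<in> hom_part B i'" and z: "z \<in> Zs i j"
  have "a \<odot>\<^bsub>Ob G i\<^esub> z \<in> hpart (Ob G i) (i' + j)" using pg[of i] a z by (simp add: pre_graded_def Zs_def)
  moreover have "a \<in> carrier B" using a by (simp add: hom_part_def)
  then have "a \<odot>\<^bsub>Ob G i\<^esub> z \<in> cocyc i" by (rule cocyc_smult[OF _ Zs_cocyc[OF z]])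
  ultimately show ?thesis by (simp add: Zs_def cocyc_def)
qed

lemma pre_graded_H: "pre_graded B (H i)"
  unfolding pre_graded_def
proof (intro conjI allI impI left_module_H)
  interpret L: left_module B "H i" by (rule left_module_H)
  note S = Zs_subspace[of i, unfolded K.subspace_def]
  fix d
  show "additive_subgroup (hpart (H i) d) (H i)"
  proof (rule additive_subgroup.intro, rule group.subgroupI[OF L.M.a_group])
    show "hpart (H i) d \<subseteq> carrier (add_monoid (H i))" using Zs_cocyc by (auto simp: H_simps)
    have "\<zero>\<^bsub>Ob G i\<^esub> \<in> Zs i d" using S[of d] by blast
    then show "hpart (H i) d \<noteq> {}" by (auto simp: H_simps)
  next
    fix x assume "x \<in> hpart (H i) d"
    then obtain z where z: "z \<in> Zs i d" "x = ccl i z" by (auto simp: H_simps)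
    have n: "\<ominus>\<^bsub>Ob G i\<^esub> z \<in> Zs i d" by (rule K.subspace_minus[OF Zs_subspace z(1)])
    have "ccl i (\<ominus>\<^bsub>Ob G i\<^esub> z) \<oplus>\<^bsub>H i\<^esub> x = \<zero>\<^bsub>H i\<^esub>"
      using z cocyc_sub[OF Zs_cocyc[OF z(1)]] Zs_cocyc by (simp add: ccl_add cocyc_uminus ccl_zero K.M.l_neg)
    moreover have "x \<in> carrier (H i)" "ccl i (\<ominus>\<^bsub>Ob G i\<^esub> z) \<in> carrier (H i)" using n z Zs_cocyc by (auto simp: H_simps(1))
    ultimately have "\<ominus>\<^bsub>H i\<^esub> x = ccl i (\<ominus>\<^bsub>Ob G i\<^esub> z)" by (rule L.M.minus_equality)
    then show "inv\<^bsub>add_monoid (H i)\<^esub> x \<in> hpart (H i) d" unfolding a_inv_def[symmetric] using n by (simp add: H_simps(5))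
  next
    fix x y assume "x \<in> hpart (H i) d" "y \<in> hpart (H i) d"
    then obtain z w where z: "z \<in> Zs i d" "x = ccl i z" "w \<in> Zs i d" "y = ccl i w" by (auto simp: H_simps)
    have "x \<oplus>\<^bsub>H i\<^esub> y = ccl i (z \<oplus>\<^bsub>Ob G i\<^esub> w)" using z Zs_cocyc by (simp add: ccl_add)
    moreover have "z \<oplus>\<^bsub>Ob G i\<^esub> w \<in> Zs i d" using S[of d] z by blast
    ultimately show "x \<otimes>\<^bsub>add_monoid (H i)\<^esub> y \<in> hpart (H i) d" by (simp add: H_simps(5))
  qed
next
  fix a i' x d assume a: "a \<in> hom_part B i'" and "x \<in> hpart (H i) d"
  then obtain z where z: "z \<in> Zs i d" "x = ccl i z" by (auto simp: H_simps)
  have "a \<in> carrier B" using a by (simp add: hom_part_def)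
  then have "a \<odot>\<^bsub>H i\<^esub> x = ccl i (a \<odot>\<^bsub>Ob G i\<^esub> z)" using z Zs_cocyc by (simp add: ccl_smult)
  then show "a \<odot>\<^bsub>H i\<^esub> x \<in> hpart (H i) (i' + d)" using Zs_smult[OF a z(1)] by (simp add: H_simps(5))
qed

text \<open>A homogeneous coboundary is the image of the component of the same degree of any preimage, by
  uniqueness of the homogeneous decomposition.\<close>

lemma bdry_hpart:
  assumes y: "y \<in> bdry i" "y \<in> hpart (Ob G i) j"
  shows "y \<in> Bs i j"
proof -
  obtain x where x: "x \<in> carrier (Ob G (i - 1))" "y = d' i x" using y(1) by (auto simp: bdry_def)
  obtain c where c: "\<forall>d. c d \<in> hpart (Ob G (i - 1)) d" "finite {d. c d \<noteq> \<zero>\<^bsub>Ob G (i - 1)\<^esub>}"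
      "x = (\<Oplus>\<^bsub>Ob G (i - 1)\<^esub>d\<in>{d. c d \<noteq> \<zero>\<^bsub>Ob G (i - 1)\<^esub>}. c d)"
    using graded_module.hpart_direct_sum[OF gm x(1)] by blast
  let ?S = "{d. c d \<noteq> \<zero>\<^bsub>Ob G (i - 1)\<^esub>}"
  have cc: "c d \<in> carrier (Ob G (i - 1))" for d using c(1) hcl by blast
  have fs: "d' i (finsum (Ob G (i - 1)) c T) = finsum (Ob G i) (\<lambda>d. d' i (c d)) T" if "finite T" for T
    using that
  proof (induction T rule: finite_induct)
    case (insert t T)
    then show ?case using cc d'_closed by (simp add: d'_add Pi_def)
  qed (simp add: d'_zero)
  let ?c = "\<lambda>d. d' i (c d)" and ?e = "\<lambda>d. if d = j then y else \<zero>\<^bsub>Ob G i\<^esub>"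
  \<comment> \<open>\<open>P f\<close> says that \<open>f\<close> is a homogeneous decomposition of \<open>y\<close>. It holds for the images of the components of
    \<open>x\<close> and for \<open>y\<close> placed in degree \<open>j\<close>.\<close>
  define P where "P f \<longleftrightarrow> (\<forall>d. f d \<in> hpart (Ob G i) d) \<and> finite {d. f d \<noteq> \<zero>\<^bsub>Ob G i\<^esub>} \<and>
           y = (\<Oplus>\<^bsub>Ob G i\<^esub>d\<in>{d. f d \<noteq> \<zero>\<^bsub>Ob G i\<^esub>}. f d)" for f
  have sub: "{d. ?c d \<noteq> \<zero>\<^bsub>Ob G i\<^esub>} \<subseteq> ?S" using d'_zero by auto
  have yS: "y = finsum (Ob G i) ?c ?S" using fs[OF c(2)] c(3) x(2) by simp
  have "finsum (Ob G i) ?c {d. ?c d \<noteq> \<zero>\<^bsub>Ob G i\<^esub>} = finsum (Ob G i) ?c ?S"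
    by (rule K.M.add.finprod_mono_neutral_cong_left) (use sub c(2) cc d'_closed in auto)
  then have P1: "P ?c" unfolding P_def using yS c(1) d'_hpart finite_subset[OF sub c(2)] by simp
  have yc: "y \<in> carrier (Ob G i)" using y(2) hcl by blast
  have "finsum (Ob G i) ?e {d. ?e d \<noteq> \<zero>\<^bsub>Ob G i\<^esub>} = finsum (Ob G i) ?e {j}"
    by (rule K.M.add.finprod_mono_neutral_cong_left) (use yc in auto)
  also have "\<dots> = y" using yc by simp
  finally have "finsum (Ob G i) ?e {d. ?e d \<noteq> \<zero>\<^bsub>Ob G i\<^esub>} = y" .
  moreover have "finite {d. ?e d \<noteq> \<zero>\<^bsub>Ob G i\<^esub>}" by (rule finite_subset[of _ "{j}"]) auto
  ultimately have P2: "P ?e" unfolding P_def using y(2) hzero by auto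
  have "\<exists>!f. P f" unfolding P_def by (rule graded_module.hpart_direct_sum[OF gm yc])
  then obtain f where "\<And>g. P g \<Longrightarrow> g = f" by (elim ex1E) blast
  from this[OF P1] this[OF P2] have "?c = ?e" by (rule trans[OF _ sym])
  from fun_cong[OF this, of j] have "y = d' i (c j)" by simp
  then show ?thesis using c(1) by (auto simp: Bs_def)
qed

definition bsHb :: "int \<Rightarrow> int \<Rightarrow> 'a idx set" where "bsHb i j = {b \<in> bsb i j. fst b = Harm}"

text \<open>The harmonic coordinates of a representing cocycle; they do not depend on its choice by \<open>ccl_eq_Zs\<close>.\<close>

definition kapH :: "int \<Rightarrow> int \<Rightarrow> 'a set \<Rightarrow> ('a idx \<Rightarrow>\<^sub>0 'k)" where
  "kapH i j X = lin_ext pB (kap i j (SOME z. z \<in> Zs i j \<and> X = ccl i z))"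

lemma Zs_hpart: "z \<in> Zs i j \<Longrightarrow> z \<in> hpart (Ob G i) j" by (simp add: Zs_def)

lemma kap_minus: "x \<in> hpart (Ob G i) j \<Longrightarrow> y \<in> hpart (Ob G i) j \<Longrightarrow> kap i j (x \<ominus>\<^bsub>Ob G i\<^esub> y) = kap i j x - kap i j y"
proof -
  assume x: "x \<in> hpart (Ob G i) j" and y: "y \<in> hpart (Ob G i) j"
  have "(x \<ominus>\<^bsub>Ob G i\<^esub> y) \<oplus>\<^bsub>Ob G i\<^esub> y = x" using hcl[OF x] hcl[OF y] by (simp add: K.M.minus_eq K.M.a_assoc K.M.l_neg)
  then have "kap i j x = kap i j (x \<ominus>\<^bsub>Ob G i\<^esub> y) + kap i j y" using kap_add[OF hminus[OF x y] y] by simp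
  then show ?thesis by simp
qed

lemma kap_zero: "kap i j \<zero>\<^bsub>Ob G i\<^esub> = 0"
  by (rule kap_unique) (simp_all add: rho_def d'_zero)

text \<open>A cocycle has no coordinates at \<open>Co\<close>. If its harmonic coordinates vanish too, it is a combination of
  coboundaries.\<close>

lemma pB_kap_iff:
  assumes z: "z \<in> Zs i j"
  shows "lin_ext pB (kap i j z) = 0 \<longleftrightarrow> z \<in> Bs i j"
proof
  assume "z \<in> Bs i j"
  then obtain w where w: "w \<in> hpart (Ob G (i - 1)) j" "z = d' i w" by (auto simp: Bs_def)
  have "kap i j z = lin_ext dB (kap (i - 1) j w)" using kap_d[OF w(1)] w(2) by simp
  then show "lin_ext pB (kap i j z) = 0" by (simp add: lin_ext_comp dhp(4))
next
  assume p: "lin_ext pB (kap i j z) = 0"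
  let ?u = "kap i j z"
  have "lin_ext dB ?u = 0" using kap_d[OF Zs_hpart[OF z]] z kap_zero by (simp add: Zs_def)
  then have u: "?u = lin_ext dB (lin_ext hB ?u)" using p pB_id[of ?u] by simp
  have k: "Poly_Mapping.keys (lin_ext hB ?u) \<subseteq> bsb (i - 1) j" by (rule keys_hB[OF kap_keys[OF Zs_hpart[OF z]]])
  have "z = rho i j ?u" using rho_kap[OF Zs_hpart[OF z]] by simp
  also have "\<dots> = rho i j (lin_ext dB (lin_ext hB ?u))" using u by metis
  also have "\<dots> = d' i (rho (i - 1) j (lin_ext hB ?u))" using rho_dB[OF k] by simp
  finally show "z \<in> Bs i j" using rho_hpart[OF k] by (auto simp: Bs_def)
qed

lemma ccl_eq_Zs:
  assumes z: "z \<in> Zs i j" and w: "w \<in> Zs i j"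
  shows "ccl i z = ccl i w \<longleftrightarrow> lin_ext pB (kap i j z) = lin_ext pB (kap i j w)"
proof -
  have d: "z \<ominus>\<^bsub>Ob G i\<^esub> w \<in> Zs i j"
    using Zs_subspace[of i j] K.subspace_minus[OF Zs_subspace w] z unfolding K.subspace_def by (simp add: K.M.minus_eq)
  have "ccl i z = ccl i w \<longleftrightarrow> z \<ominus>\<^bsub>Ob G i\<^esub> w \<in> bdry i"
    by (rule ccl_eq_iff) (use z w Zs_hpart hcl in blast)+
  also have "\<dots> \<longleftrightarrow> z \<ominus>\<^bsub>Ob G i\<^esub> w \<in> Bs i j"
    using bdry_hpart Zs_hpart[OF d] hcl by (auto simp: Bs_def bdry_def)
  also have "\<dots> \<longleftrightarrow> lin_ext pB (kap i j (z \<ominus>\<^bsub>Ob G i\<^esub> w)) = 0" by (rule pB_kap_iff[OF d, symmetric])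
  also have "\<dots> \<longleftrightarrow> lin_ext pB (kap i j z) = lin_ext pB (kap i j w)"
    by (simp add: kap_minus[OF Zs_hpart[OF z] Zs_hpart[OF w]] lin_ext_diff)
  finally show ?thesis .
qed

lemma kapH_ccl:
  assumes z: "z \<in> Zs i j"
  shows "kapH i j (ccl i z) = lin_ext pB (kap i j z)"
proof -
  let ?w = "SOME w. w \<in> Zs i j \<and> ccl i z = ccl i w"
  have w: "?w \<in> Zs i j \<and> ccl i z = ccl i ?w" by (rule someI[of _ z]) (simp add: z)
  then show ?thesis unfolding kapH_def using ccl_eq_Zs[OF z, of ?w] by simp
qed

lemma kcoord_kapH: "kcoord kc (H i) j (bsHb i j) (kapH i j)"
  unfolding kcoord_def
proof (intro conjI ballI allI)
  have inj: "inj_on (kapH i j) (hpart (H i) j)"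
  proof (rule inj_onI)
    fix X Y assume XY: "X \<in> hpart (H i) j" "Y \<in> hpart (H i) j" and e: "kapH i j X = kapH i j Y"
    from XY obtain z w where z: "z \<in> Zs i j" "X = ccl i z" "w \<in> Zs i j" "Y = ccl i w" by (auto simp: H_simps(5))
    then show "X = Y" using e ccl_eq_Zs[OF z(1,3)] by (simp add: kapH_ccl)
  qed
  show "bij_betw (kapH i j) (hpart (H i) j) {u. Poly_Mapping.keys u \<subseteq> bsHb i j}"
    unfolding bij_betw_def
  proof (intro conjI inj subset_antisym subsetI)
    fix u assume "u \<in> kapH i j ` hpart (H i) j"
    then obtain z where z: "z \<in> Zs i j" "u = lin_ext pB (kap i j z)" by (auto simp: H_simps(5) kapH_ccl)
    have "Poly_Mapping.keys u \<subseteq> bsHb i j" unfolding z(2)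
      by (rule keys_lin_ext) (use kap_keys[OF Zs_hpart[OF z(1)]] in \<open>auto simp: pB_def bsHb_def split: if_splits\<close>)
    then show "u \<in> {u. Poly_Mapping.keys u \<subseteq> bsHb i j}" by simp
  next
    fix u :: "'a idx \<Rightarrow>\<^sub>0 'k" assume "u \<in> {u. Poly_Mapping.keys u \<subseteq> bsHb i j}"
    then have u: "Poly_Mapping.keys u \<subseteq> bsHb i j" by simp
    then have k: "Poly_Mapping.keys u \<subseteq> bsb i j" by (auto simp: bsHb_def)
    have "lin_ext dB u = lin_ext (\<lambda>b. 0) u" by (rule lin_ext_cong) (use u in \<open>auto simp: bsHb_def dB_def\<close>)
    then have "Df G i (rho i j u) = \<zero>\<^bsub>Ob G (i + 1)\<^esub>" using rho_dB[OF k] by (simp add: rho_def d'_zero d_zero)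
    then have z: "rho i j u \<in> Zs i j" using rho_hpart[OF k] by (simp add: Zs_def)
    have "lin_ext pB u = lin_ext (\<lambda>b. Poly_Mapping.single b 1) u"
      by (rule lin_ext_cong) (use u in \<open>auto simp: bsHb_def pB_def\<close>)
    then have "kapH i j (ccl i (rho i j u)) = u" by (simp add: kapH_ccl[OF z] kap_rho[OF k])
    then show "u \<in> kapH i j ` hpart (H i) j" using z by (metis H_simps(5) image_eqI)
  qed
next
  fix X Y assume "X \<in> hpart (H i) j" "Y \<in> hpart (H i) j"
  then obtain z w where z: "z \<in> Zs i j" "X = ccl i z" "w \<in> Zs i j" "Y = ccl i w" by (auto simp: H_simps)
  have a: "z \<oplus>\<^bsub>Ob G i\<^esub> w \<in> Zs i j" using Zs_subspace[of i j] z unfolding K.subspace_def by blast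
  have "X \<oplus>\<^bsub>H i\<^esub> Y = ccl i (z \<oplus>\<^bsub>Ob G i\<^esub> w)" using z Zs_cocyc by (simp add: ccl_add)
  then show "kapH i j (X \<oplus>\<^bsub>H i\<^esub> Y) = kapH i j X + kapH i j Y"
    using z a by (simp add: kapH_ccl kap_add Zs_hpart lin_ext_add)
next
  fix c X assume "X \<in> hpart (H i) j"
  then obtain z where z: "z \<in> Zs i j" "X = ccl i z" by (auto simp: H_simps)
  have a: "kc c \<odot>\<^bsub>Ob G i\<^esub> z \<in> Zs i j" using Zs_smult[OF kc_part z(1)] by simp
  have "kc c \<odot>\<^bsub>H i\<^esub> X = ccl i (kc c \<odot>\<^bsub>Ob G i\<^esub> z)" using z Zs_cocyc kc_closed by (simp add: ccl_smult)
  then show "kapH i j (kc c \<odot>\<^bsub>H i\<^esub> X) = scal c (kapH i j X)"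
    using z a by (simp add: kapH_ccl kap_scal Zs_hpart lin_ext_scal)
qed

end

context kcomplex_y
begin

text \<open>The harmonic part of multiplication by a variable computes its action on cohomology: a cocycle
  differs from its harmonic part by a coboundary, on which the variable acts through coboundaries.\<close>

lemma Yc_kapH:
  assumes k: "k < v" and X: "X \<in> hpart (H i) j"
  shows "lin_ext (YH k) (kapH i j X) = scal (alt_eps i) (kapH i (j + eta) (yv k \<odot>\<^bsub>H i\<^esub> X))"
proof -
  obtain z where z: "z \<in> Zs i j" "X = ccl i z" using X by (auto simp: H_simps)
  have a: "yv k \<odot>\<^bsub>Ob G i\<^esub> z \<in> Zs i (j + eta)" using Zs_smult[OF yv_part[OF k] z(1)] by (simp add: add.commute)
  have "yv k \<odot>\<^bsub>H i\<^esub> X = ccl i (yv k \<odot>\<^bsub>Ob G i\<^esub> z)" using z Zs_cocyc yv_closed[OF k] by (simp add: ccl_smult)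
  then have r: "kapH i (j + eta) (yv k \<odot>\<^bsub>H i\<^esub> X) = lin_ext pB (kap i (j + eta) (yv k \<odot>\<^bsub>Ob G i\<^esub> z))" by (simp add: kapH_ccl[OF a])
  let ?u = "kap i j z"
  have du: "lin_ext dB ?u = 0" using kap_d[OF Zs_hpart[OF z(1)]] z kap_zero by (simp add: Zs_def)
  have "lin_ext (Yc k) (lin_ext dB w) = lin_ext (\<lambda>b. - lin_ext dB (Yc k b)) w" for w
    unfolding lin_ext_comp by (rule lin_ext_cong) (rule dY[OF k])
  then have Yd: "lin_ext pB (lin_ext (Yc k) (lin_ext dB w)) = 0" for w
    by (simp add: lin_ext_uminus_fun lin_ext_uminus lin_ext_comp[symmetric]) (simp add: lin_ext_comp dhp(4))
  have "lin_ext (YH k) (kapH i j X) = lin_ext pB (lin_ext (Yc k) (lin_ext pB ?u))"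
    unfolding YH_def[abs_def] z(2) kapH_ccl[OF z(1)] by (rule lin_ext_comp[symmetric])
  also have "\<dots> = lin_ext pB (lin_ext (Yc k) ?u)"
    unfolding pB_id[of ?u] by (simp add: du lin_ext_diff Yd)
  also have "\<dots> = scal (alt_eps i) (kapH i (j + eta) (yv k \<odot>\<^bsub>H i\<^esub> X))"
    by (simp add: Yc_kap[OF k Zs_hpart[OF z(1)]] lin_ext_scal r)
  finally show ?thesis .
qed

end

section \<open>Complexes in coordinates\<close>

text \<open>The part of the basis in given cohomological and internal degree.\<close>

definition bsi :: "'a idx set \<Rightarrow> int \<Rightarrow> int \<Rightarrow> 'a idx set" where
  "bsi S i j = {(t, i', j', a). (t, i', j', a) \<in> S \<and> i' = i \<and> j' = j}"

context monomial_algebra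
begin

text \<open>An identification of a graded module with the free module \<open>Tm S dg\<close>. It concerns the operations of the
  record alone, and the module axioms of \<open>T\<close> are consequences.\<close>

definition coords :: "('r, 'x) gmodule \<Rightarrow> 'b set \<Rightarrow> ('b \<Rightarrow> int) \<Rightarrow> ('x \<Rightarrow> 'm \<Rightarrow> ('b \<Rightarrow>\<^sub>0 'k)) \<Rightarrow> bool" where
  "coords T S dg ev \<longleftrightarrow> bij_betw ev (carrier T) (supp_in S) \<and> \<zero>\<^bsub>T\<^esub> \<in> carrier T \<and> ev \<zero>\<^bsub>T\<^esub> = 0 \<and>
     (\<forall>x\<in>carrier T. \<forall>y\<in>carrier T. x \<oplus>\<^bsub>T\<^esub> y \<in> carrier T \<and> ev (x \<oplus>\<^bsub>T\<^esub> y) = ev x + ev y) \<and>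
     (\<forall>a\<in>carrier A. \<forall>x\<in>carrier T. a \<odot>\<^bsub>T\<^esub> x \<in> carrier T \<and> ev (a \<odot>\<^bsub>T\<^esub> x) = act a (ev x)) \<and>
     (\<forall>d. hpart T d = {x \<in> carrier T. \<forall>m. \<forall>b\<in>Poly_Mapping.keys (ev x m). dgm m + dg b = d})"

lemma coordsD:
  assumes "coords T S dg ev"
  shows "bij_betw ev (carrier T) (supp_in S)" "\<zero>\<^bsub>T\<^esub> \<in> carrier T" "ev \<zero>\<^bsub>T\<^esub> = 0"
    "x \<in> carrier T \<Longrightarrow> y \<in> carrier T \<Longrightarrow> x \<oplus>\<^bsub>T\<^esub> y \<in> carrier T"
    "x \<in> carrier T \<Longrightarrow> y \<in> carrier T \<Longrightarrow> ev (x \<oplus>\<^bsub>T\<^esub> y) = ev x + ev y"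
    "a \<in> carrier A \<Longrightarrow> x \<in> carrier T \<Longrightarrow> a \<odot>\<^bsub>T\<^esub> x \<in> carrier T"
    "a \<in> carrier A \<Longrightarrow> x \<in> carrier T \<Longrightarrow> ev (a \<odot>\<^bsub>T\<^esub> x) = act a (ev x)"
    "hpart T d = {x \<in> carrier T. \<forall>m. \<forall>b\<in>Poly_Mapping.keys (ev x m). dgm m + dg b = d}"
    "x \<in> carrier T \<Longrightarrow> ev x \<in> supp_in S"
    "x \<in> carrier T \<Longrightarrow> ev x = 0 \<longleftrightarrow> x = \<zero>\<^bsub>T\<^esub>"
proof -
  show 1: "bij_betw ev (carrier T) (supp_in S)" and 2: "\<zero>\<^bsub>T\<^esub> \<in> carrier T" and 3: "ev \<zero>\<^bsub>T\<^esub> = 0"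
    and "x \<in> carrier T \<Longrightarrow> y \<in> carrier T \<Longrightarrow> x \<oplus>\<^bsub>T\<^esub> y \<in> carrier T"
    and "x \<in> carrier T \<Longrightarrow> y \<in> carrier T \<Longrightarrow> ev (x \<oplus>\<^bsub>T\<^esub> y) = ev x + ev y"
    and "a \<in> carrier A \<Longrightarrow> x \<in> carrier T \<Longrightarrow> a \<odot>\<^bsub>T\<^esub> x \<in> carrier T"
    and "a \<in> carrier A \<Longrightarrow> x \<in> carrier T \<Longrightarrow> ev (a \<odot>\<^bsub>T\<^esub> x) = act a (ev x)"
    and "hpart T d = {x \<in> carrier T. \<forall>m. \<forall>b\<in>Poly_Mapping.keys (ev x m). dgm m + dg b = d}"
    using assms by (simp_all add: coords_def)
  show "x \<in> carrier T \<Longrightarrow> ev x \<in> supp_in S" using bij_betw_apply[OF 1] by blast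
  show "x \<in> carrier T \<Longrightarrow> ev x = 0 \<longleftrightarrow> x = \<zero>\<^bsub>T\<^esub>"
    using 1 2 3 unfolding bij_betw_def inj_on_def by metis
qed

definition coords_complex where
  "coords_complex C S c Y F \<longleftrightarrow> (\<forall>n. coords (Ob C n) (basis_at S n) (dgu c) (F n) \<and>
     (\<forall>x\<in>carrier (Ob C n). Df C n x \<in> carrier (Ob C (n + 1)) \<and>
        F (n + 1) (Df C n x) = pw dB (F n x) + del Y (F n x)))"

lemma coords_complex_iso:
  assumes "coords_complex C S c Y F"
  shows "iso_complex A C (total_complex S c Y)" "op_closed A C"
proof -
  have cs: "coords (Ob C n) (basis_at S n) (dgu c) (F n)"
    and dc: "x \<in> carrier (Ob C n) \<Longrightarrow> Df C n x \<in> carrier (Ob C (n + 1))"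
    and df: "x \<in> carrier (Ob C n) \<Longrightarrow> F (n + 1) (Df C n x) = pw dB (F n x) + del Y (F n x)" for n x
    using assms by (simp_all add: coords_complex_def)
  note E = coordsD[OF cs]
  show oc: "op_closed A C" unfolding op_closed_def by (simp add: E(4,6) dc) (simp add: E(8))
  have OTC: "Ob (total_complex S c Y) n = Tm (basis_at S n) (dgu c)" "Df (total_complex S c Y) n q = pw dB q + del Y q" for n q
    by (simp_all add: total_complex_def)
  show "iso_complex A C (total_complex S c Y)"
  proof (rule iso_complexI[where f = F, OF _ oc])
    show "chain_map A C (total_complex S c Y) F" unfolding chain_map_def
    proof (intro allI conjI ballI)
      fix n show "F n \<in> graded_hom A (Ob C n) (Ob (total_complex S c Y) n)" unfolding OTC
        by (rule graded_homI) (simp_all add: E(5,7,8,9) hpart_Tm)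
    qed (simp add: OTC df)
    fix n show "bij_betw (F n) (carrier (Ob C n)) (carrier (Ob (total_complex S c Y) n))" using E(1) by (simp add: OTC)
    fix x d assume "x \<in> carrier (Ob C n)" "F n x \<in> hpart (Ob (total_complex S c Y) n) d"
    then show "x \<in> hpart (Ob C n) d" by (simp add: OTC hpart_Tm E(8))
  qed (auto simp: OTC hpart_Tm)
qed

lemma coords_abelian_group:
  assumes "coords T S dg ev"
  shows "abelian_group T" "x \<in> carrier T \<Longrightarrow> ev (\<ominus>\<^bsub>T\<^esub> x) = - ev x"
proof -
  note E = coordsD[OF assms]
  have inj: "x = y" if "x \<in> carrier T" "y \<in> carrier T" "ev x = ev y" for x y
    using E(1) that unfolding bij_betw_def inj_on_def by blast
  show ag: "abelian_group T"
  proof (rule abelian_groupI)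
    fix x assume x: "x \<in> carrier T"
    have "- ev x \<in> ev ` carrier T" using E(1) supp_in_uminus[OF E(9)[OF x]] unfolding bij_betw_def by simp
    then obtain y where y: "y \<in> carrier T" "ev y = - ev x" by force
    have "y \<oplus>\<^bsub>T\<^esub> x = \<zero>\<^bsub>T\<^esub>" by (rule inj) (simp_all add: E(2,3,4,5) x y)
    then show "\<exists>y\<in>carrier T. y \<oplus>\<^bsub>T\<^esub> x = \<zero>\<^bsub>T\<^esub>" using y by blast
  qed (auto intro!: inj simp: E(2-5) ac_simps)
  interpret abelian_group T by (rule ag)
  assume x: "x \<in> carrier T"
  have "ev (\<ominus>\<^bsub>T\<^esub> x) + ev x = 0" using E(5)[of "\<ominus>\<^bsub>T\<^esub> x" x] x by (simp add: l_neg E(3))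
  then show "ev (\<ominus>\<^bsub>T\<^esub> x) = - ev x" by (simp add: eq_neg_iff_add_eq_0)
qed

text \<open>Coordinates of a direct sum are assembled from coordinates of the summands. Every index of the basis
  determines its summand, namely by its second component, which makes the sum of the coordinate
  vectors injective; finiteness of supports on both sides corresponds.\<close>

lemma assembly:
  fixes S :: "'c idx set"
  assumes T: "\<And>n. Ob C n = direct_sum (T n)"
    and ev: "\<And>n i. coords (T n i) (bsi S i (eta * (n - i))) (dgu c) (ev n i)"
    and Dc: "\<And>n \<phi> i. \<phi> \<in> carrier (Ob C n) \<Longrightarrow> Df C n \<phi> i \<in> carrier (T (n + 1) i)"
    and De: "\<And>n \<phi> i. \<phi> \<in> carrier (Ob C n) \<Longrightarrow>
        ev (n + 1) i (Df C n \<phi> i) = pw dB (ev n (i - 1) (\<phi> (i - 1))) + del Y (ev n i (\<phi> i))"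
    and Yk: "\<And>k t i j a. k < v \<Longrightarrow> Poly_Mapping.keys (Y k (t, i, j, a)) \<subseteq> {(t', i', j', a'). i' = i}"
  shows "\<exists>F. coords_complex C S c Y F"
proof -
  note E = coordsD[OF ev]
  have cO: "\<phi> \<in> carrier (Ob C n) \<longleftrightarrow> (\<forall>i. \<phi> i \<in> carrier (T n i)) \<and> finite {i. \<phi> i \<noteq> \<zero>\<^bsub>T n i\<^esub>}" for \<phi> n
    by (simp add: T direct_sum_def)
  have zO: "\<zero>\<^bsub>Ob C n\<^esub> = (\<lambda>i. \<zero>\<^bsub>T n i\<^esub>)" for n by (simp add: T direct_sum_def)
  have aO: "\<phi> \<oplus>\<^bsub>Ob C n\<^esub> \<psi> = (\<lambda>i. \<phi> i \<oplus>\<^bsub>T n i\<^esub> \<psi> i)" for n \<phi> \<psi> by (simp add: T direct_sum_def)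
  have sO: "a \<odot>\<^bsub>Ob C n\<^esub> \<phi> = (\<lambda>i. a \<odot>\<^bsub>T n i\<^esub> \<phi> i)" for n a \<phi> by (simp add: T direct_sum_def)
  have hO: "\<phi> \<in> hpart (Ob C n) d \<longleftrightarrow> \<phi> \<in> carrier (Ob C n) \<and> (\<forall>i. \<phi> i \<in> hpart (T n i) d)" for n d \<phi>
    by (simp add: T direct_sum_def)
  \<comment> \<open>The coordinate vectors of the summands have disjoint supports, so they can be recovered from their sum.\<close>
  define F where "F n \<phi> = (\<lambda>m. \<Sum>i\<in>{i. \<phi> i \<noteq> \<zero>\<^bsub>T n i\<^esub>}. ev n i (\<phi> i) m)" for n \<phi>
  have evk: "Poly_Mapping.keys (ev n i x m) \<subseteq> bsi S i (eta * (n - i))" if "x \<in> carrier (T n i)" for n i x m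
    by (rule supp_inD(1)[OF E(9)[OF that]])
  have look: "Poly_Mapping.lookup (F n \<phi> m) (t, i, j, a) = Poly_Mapping.lookup (ev n i (\<phi> i) m) (t, i, j, a)"
    if p: "\<phi> \<in> carrier (Ob C n)" for n \<phi> m t i j a
  proof -
    have fin: "finite {i. \<phi> i \<noteq> \<zero>\<^bsub>T n i\<^esub>}" and cc: "\<And>i. \<phi> i \<in> carrier (T n i)" using p by (auto simp: cO)
    have "Poly_Mapping.lookup (F n \<phi> m) (t, i, j, a) = (\<Sum>i'\<in>{i. \<phi> i \<noteq> \<zero>\<^bsub>T n i\<^esub>}. if i' = i then Poly_Mapping.lookup (ev n i (\<phi> i) m) (t, i, j, a) else 0)"
      unfolding F_def lookup_sum
    proof (rule sum.cong[OF refl])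
      fix i'
      have "(t, i, j, a) \<notin> Poly_Mapping.keys (ev n i' (\<phi> i') m)" if "i' \<noteq> i"
        using evk[OF cc, of i' m] that by (auto simp: bsi_def)
      then show "Poly_Mapping.lookup (ev n i' (\<phi> i') m) (t, i, j, a) = (if i' = i then Poly_Mapping.lookup (ev n i (\<phi> i) m) (t, i, j, a) else 0)"
        by (simp add: in_keys_iff)
    qed
    also have "\<dots> = (if \<phi> i \<noteq> \<zero>\<^bsub>T n i\<^esub> then Poly_Mapping.lookup (ev n i (\<phi> i) m) (t, i, j, a) else 0)" using fin by simp
    also have "\<dots> = Poly_Mapping.lookup (ev n i (\<phi> i) m) (t, i, j, a)" by (simp add: E(3))
    finally show ?thesis .
  qed
  have lkF: "Poly_Mapping.lookup (F n \<phi> m) b = Poly_Mapping.lookup (ev n (fst (snd b)) (\<phi> (fst (snd b))) m) b"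
    if "\<phi> \<in> carrier (Ob C n)" for n \<phi> m b
    using look[OF that] by (cases b rule: prod_cases4) simp
  have Fsupp: "F n \<phi> \<in> supp_in (basis_at S n)" if p: "\<phi> \<in> carrier (Ob C n)" for n \<phi>
  proof -
    have fin: "finite {i. \<phi> i \<noteq> \<zero>\<^bsub>T n i\<^esub>}" and cc: "\<And>i. \<phi> i \<in> carrier (T n i)" using p by (auto simp: cO)
    have "Poly_Mapping.keys (F n \<phi> m) \<subseteq> basis_at S n" for m
      unfolding F_def
    proof (rule keys_sum_subset)
      fix i
      have "bsi S i (eta * (n - i)) \<subseteq> basis_at S n" using eta by (auto simp: bsi_def basis_at_def)
      then show "Poly_Mapping.keys (ev n i (\<phi> i) m) \<subseteq> basis_at S n" using evk[OF cc] by blast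
    qed
    moreover have "finite {m. F n \<phi> m \<noteq> 0}"
    proof (rule finite_subset)
      show "{m. F n \<phi> m \<noteq> 0} \<subseteq> (\<Union>i\<in>{i. \<phi> i \<noteq> \<zero>\<^bsub>T n i\<^esub>}. {m. ev n i (\<phi> i) m \<noteq> 0})"
        unfolding F_def by (rule subsetI, drule CollectD) (auto dest: sum.not_neutral_contains_not_neutral)
      show "finite (\<Union>i\<in>{i. \<phi> i \<noteq> \<zero>\<^bsub>T n i\<^esub>}. {m. ev n i (\<phi> i) m \<noteq> 0})"
        using fin supp_inD(2)[OF E(9)[OF cc]] by auto
    qed
    moreover have "F n \<phi> m = 0" if "m \<notin> Idx" for m
      unfolding F_def by (rule sum.neutral) (use supp_inD(3)[OF E(9)[OF cc] that] in auto)
    ultimately show ?thesis by (simp add: supp_in_def)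
  qed
  have finsub: "finite {i. f i \<noteq> \<zero>\<^bsub>T n i\<^esub>}" if "finite X" "\<And>i. i \<notin> X \<Longrightarrow> f i = \<zero>\<^bsub>T n i\<^esub>" for f n X
    by (rule finite_subset[OF _ that(1)]) (use that(2) in blast)
  have zz: "\<zero>\<^bsub>T n i\<^esub> \<oplus>\<^bsub>T n i\<^esub> \<zero>\<^bsub>T n i\<^esub> = \<zero>\<^bsub>T n i\<^esub>" for n i
    by (rule E(10)[OF E(4)[OF E(2) E(2)], THEN iffD1]) (simp add: E(5)[OF E(2) E(2)] E(3))
  have az: "a \<odot>\<^bsub>T n i\<^esub> \<zero>\<^bsub>T n i\<^esub> = \<zero>\<^bsub>T n i\<^esub>" if "a \<in> carrier A" for a n i
    by (rule E(10)[OF E(6)[OF that E(2)], THEN iffD1]) (simp add: E(7)[OF that E(2)] E(3) act_zero)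
  have addc: "(\<lambda>i. \<phi> i \<oplus>\<^bsub>T n i\<^esub> \<psi> i) \<in> carrier (Ob C n)" if p: "\<phi> \<in> carrier (Ob C n)" "\<psi> \<in> carrier (Ob C n)" for n \<phi> \<psi>
    unfolding cO
  proof
    show "finite {i. \<phi> i \<oplus>\<^bsub>T n i\<^esub> \<psi> i \<noteq> \<zero>\<^bsub>T n i\<^esub>}"
      by (rule finsub[of "{i. \<phi> i \<noteq> \<zero>\<^bsub>T n i\<^esub>} \<union> {i. \<psi> i \<noteq> \<zero>\<^bsub>T n i\<^esub>}"]) (use p zz in \<open>auto simp: cO\<close>)
  qed (use p E(4) in \<open>auto simp: cO\<close>)
  have smc: "(\<lambda>i. a \<odot>\<^bsub>T n i\<^esub> \<phi> i) \<in> carrier (Ob C n)" if p: "a \<in> carrier A" "\<phi> \<in> carrier (Ob C n)" for n \<phi> a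
    unfolding cO
  proof
    show "finite {i. a \<odot>\<^bsub>T n i\<^esub> \<phi> i \<noteq> \<zero>\<^bsub>T n i\<^esub>}"
      by (rule finsub[of "{i. \<phi> i \<noteq> \<zero>\<^bsub>T n i\<^esub>}"]) (use p az in \<open>auto simp: cO\<close>)
  qed (use p E(6) in \<open>auto simp: cO\<close>)
  have dfc: "Df C n \<phi> \<in> carrier (Ob C (n + 1))" if p: "\<phi> \<in> carrier (Ob C n)" for n \<phi>
    unfolding cO
  proof (intro conjI allI)
    show "Df C n \<phi> i \<in> carrier (T (n + 1) i)" for i by (rule Dc[OF p])
    let ?X = "{i. \<phi> i \<noteq> \<zero>\<^bsub>T n i\<^esub>}"
    have fX: "finite ?X" using p by (simp add: cO)
    show "finite {i. Df C n \<phi> i \<noteq> \<zero>\<^bsub>T (n + 1) i\<^esub>}"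
    proof (rule finsub[of "?X \<union> (\<lambda>i. i + 1) ` ?X"])
      fix i assume i: "i \<notin> ?X \<union> (\<lambda>i. i + 1) ` ?X"
      have "\<phi> i = \<zero>\<^bsub>T n i\<^esub>" using i by blast
      moreover have "\<phi> (i - 1) = \<zero>\<^bsub>T n (i - 1)\<^esub>"
      proof (rule ccontr)
        assume "\<phi> (i - 1) \<noteq> \<zero>\<^bsub>T n (i - 1)\<^esub>"
        then have "i - 1 + 1 \<in> (\<lambda>i. i + 1) ` ?X" by blast
        then show False using i by simp
      qed
      ultimately have "ev (n + 1) i (Df C n \<phi> i) = 0" using De[OF p, of i] by (simp add: E(3) pw_zero del_zero)
      then show "Df C n \<phi> i = \<zero>\<^bsub>T (n + 1) i\<^esub>" using E(10)[OF Dc[OF p]] by blast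
    qed (use fX in simp)
  qed
  have Fadd: "F n (\<lambda>i. \<phi> i \<oplus>\<^bsub>T n i\<^esub> \<psi> i) = F n \<phi> + F n \<psi>" if p: "\<phi> \<in> carrier (Ob C n)" "\<psi> \<in> carrier (Ob C n)" for n \<phi> \<psi>
  proof (rule ext, rule poly_mapping_eqI)
    fix m b
    have "\<phi> i \<in> carrier (T n i)" "\<psi> i \<in> carrier (T n i)" for i using p by (simp_all add: cO)
    then show "Poly_Mapping.lookup (F n (\<lambda>i. \<phi> i \<oplus>\<^bsub>T n i\<^esub> \<psi> i) m) b = Poly_Mapping.lookup ((F n \<phi> + F n \<psi>) m) b"
      by (simp add: lkF[OF addc[OF p]] lkF[OF p(1)] lkF[OF p(2)] lookup_add E(5))
  qed
  have Fsm: "F n (\<lambda>i. a \<odot>\<^bsub>T n i\<^esub> \<phi> i) = act a (F n \<phi>)" if p: "a \<in> carrier A" "\<phi> \<in> carrier (Ob C n)" for n \<phi> a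
  proof (rule ext, rule poly_mapping_eqI)
    fix m b
    have "\<phi> i \<in> carrier (T n i)" for i using p by (simp_all add: cO)
    then show "Poly_Mapping.lookup (F n (\<lambda>i. a \<odot>\<^bsub>T n i\<^esub> \<phi> i) m) b = Poly_Mapping.lookup (act a (F n \<phi>) m) b"
      by (simp add: lkF[OF smc[OF p]] E(7) p(1) act_def lookup_sum lkF[OF p(2)])
  qed
  have Fhp: "\<phi> \<in> hpart (Ob C n) d \<longleftrightarrow> F n \<phi> \<in> hpart (Tm (basis_at S n) (dgu c)) d" if p: "\<phi> \<in> carrier (Ob C n)" for n \<phi> d
  proof -
    have cc: "\<phi> i \<in> carrier (T n i)" for i using p by (simp add: cO)
    have "\<phi> \<in> hpart (Ob C n) d \<longleftrightarrow> (\<forall>i m. \<forall>b\<in>Poly_Mapping.keys (ev n i (\<phi> i) m). dgm m + dgu c b = d)"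
      using p cc by (simp add: hO E(8))
    also have "\<dots> \<longleftrightarrow> (\<forall>m. \<forall>b\<in>Poly_Mapping.keys (F n \<phi> m). dgm m + dgu c b = d)"
    proof (intro iffI allI ballI)
      fix m b assume a: "\<forall>i m. \<forall>b\<in>Poly_Mapping.keys (ev n i (\<phi> i) m). dgm m + dgu c b = d" and "b \<in> Poly_Mapping.keys (F n \<phi> m)"
      then have "b \<in> Poly_Mapping.keys (ev n (fst (snd b)) (\<phi> (fst (snd b))) m)" by (simp add: in_keys_iff lkF[OF p])
      then show "dgm m + dgu c b = d" using a by blast
    next
      fix i m b assume a: "\<forall>m. \<forall>b\<in>Poly_Mapping.keys (F n \<phi> m). dgm m + dgu c b = d" and b: "b \<in> Poly_Mapping.keys (ev n i (\<phi> i) m)"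
      have "fst (snd b) = i" using evk[OF cc] b by (fastforce simp: bsi_def)
      then have "b \<in> Poly_Mapping.keys (F n \<phi> m)" using b by (simp add: in_keys_iff lkF[OF p])
      then show "dgm m + dgu c b = d" using a by blast
    qed
    finally show ?thesis by (simp add: hpart_Tm Fsupp[OF p])
  qed
  have Fdf: "F (n + 1) (Df C n \<phi>) = pw dB (F n \<phi>) + del Y (F n \<phi>)" if p: "\<phi> \<in> carrier (Ob C n)" for n \<phi>
  proof (rule ext, rule poly_mapping_eqI)
    fix m and b :: "'c idx"
    obtain t i j a where b: "b = (t, i, j, a)" by (cases b rule: prod_cases4)
    have cc: "\<phi> i \<in> carrier (T n i)" for i using p by (simp add: cO)
    have d1: "Poly_Mapping.lookup (lin_ext dB (F n \<phi> m)) b = Poly_Mapping.lookup (lin_ext dB (ev n (i - 1) (\<phi> (i - 1)) m)) b"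
    proof -
      let ?pr = "\<lambda>u. lin_ext (\<lambda>b. if fst (snd b) = i - 1 then Poly_Mapping.single b 1 else 0) u :: 'c idx \<Rightarrow>\<^sub>0 'k"
      have pl: "Poly_Mapping.lookup (?pr u) x = (if fst (snd x) = i - 1 then Poly_Mapping.lookup u x else 0)" for u :: "'c idx \<Rightarrow>\<^sub>0 'k" and x
      proof -
        have "Poly_Mapping.lookup (?pr u) x = (\<Sum>b\<in>Poly_Mapping.keys u. if b = x then (if fst (snd x) = i - 1 then Poly_Mapping.lookup u x else 0) else 0)"
          unfolding lookup_lin_ext by (rule sum.cong) (auto simp: lookup_single when_def)
        then show ?thesis by (simp add: in_keys_iff)
      qed
      have e: "Poly_Mapping.lookup (lin_ext dB u) b = Poly_Mapping.lookup (lin_ext dB (?pr u)) b" for u :: "'c idx \<Rightarrow>\<^sub>0 'k"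
        unfolding lin_ext_comp lookup_lin_ext by (rule sum.cong[OF refl]) (auto simp: dB_def b lookup_single when_def split: if_splits)
      have "?pr (F n \<phi> m) = ?pr (ev n (i - 1) (\<phi> (i - 1)) m)"
        by (rule poly_mapping_eqI) (simp add: pl lkF[OF p])
      then show ?thesis using e[of "F n \<phi> m"] e[of "ev n (i - 1) (\<phi> (i - 1)) m"] by simp
    qed
    have d2: "Poly_Mapping.lookup (lin_ext (Y k) (F n \<phi> m')) b = Poly_Mapping.lookup (lin_ext (Y k) (ev n i (\<phi> i) m')) b" if k: "k < v" for k m'
    proof -
      let ?pr = "\<lambda>u. lin_ext (\<lambda>b. if fst (snd b) = i then Poly_Mapping.single b 1 else 0) u :: 'c idx \<Rightarrow>\<^sub>0 'k"
      have pl: "Poly_Mapping.lookup (?pr u) x = (if fst (snd x) = i then Poly_Mapping.lookup u x else 0)" for u :: "'c idx \<Rightarrow>\<^sub>0 'k" and x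
      proof -
        have "Poly_Mapping.lookup (?pr u) x = (\<Sum>b\<in>Poly_Mapping.keys u. if b = x then (if fst (snd x) = i then Poly_Mapping.lookup u x else 0) else 0)"
          unfolding lookup_lin_ext by (rule sum.cong) (auto simp: lookup_single when_def)
        then show ?thesis by (simp add: in_keys_iff)
      qed
      have yz: "Poly_Mapping.lookup (Y k x) b = 0" if "fst (snd x) \<noteq> i" for x
      proof -
        obtain t' i' j' a' where x: "x = (t', i', j', a')" by (cases x rule: prod_cases4)
        have "b \<notin> Poly_Mapping.keys (Y k x)" using Yk[OF k, of t' i' j' a'] that unfolding x b by auto
        then show ?thesis by (simp add: in_keys_iff)
      qed
      have e: "Poly_Mapping.lookup (lin_ext (Y k) u) b = Poly_Mapping.lookup (lin_ext (Y k) (?pr u)) b" for u :: "'c idx \<Rightarrow>\<^sub>0 'k"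
        unfolding lin_ext_comp lookup_lin_ext by (rule sum.cong[OF refl]) (auto simp: yz)
      have "?pr (F n \<phi> m') = ?pr (ev n i (\<phi> i) m')"
        by (rule poly_mapping_eqI) (simp add: pl lkF[OF p])
      then show ?thesis using e[of "F n \<phi> m'"] e[of "ev n i (\<phi> i) m'"] by simp
    qed
    have "Poly_Mapping.lookup (F (n + 1) (Df C n \<phi>) m) b = Poly_Mapping.lookup (ev (n + 1) i (Df C n \<phi> i) m) b"
      using lkF[OF dfc[OF p]] by (simp add: b)
    also have "\<dots> = Poly_Mapping.lookup (lin_ext dB (F n \<phi> m)) b + Poly_Mapping.lookup (del Y (F n \<phi>) m) b"
      using d2 vrD by (simp add: De[OF p] lookup_add pw_def d1 del_def lookup_sum)
    also have "\<dots> = Poly_Mapping.lookup ((pw dB (F n \<phi>) + del Y (F n \<phi>)) m) b" by (simp add: lookup_add pw_def)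
    finally show "Poly_Mapping.lookup (F (n + 1) (Df C n \<phi>) m) b = Poly_Mapping.lookup ((pw dB (F n \<phi>) + del Y (F n \<phi>)) m) b" .
  qed
    have bij: "bij_betw (F n) (carrier (Ob C n)) (supp_in (basis_at S n))" for n
      unfolding bij_betw_def
    proof
      show "inj_on (F n) (carrier (Ob C n))"
      proof (rule inj_onI)
        fix \<phi> \<psi> assume p: "\<phi> \<in> carrier (Ob C n)" "\<psi> \<in> carrier (Ob C n)" and e: "F n \<phi> = F n \<psi>"
        show "\<phi> = \<psi>"
        proof
          fix i
          have cc: "\<phi> i \<in> carrier (T n i)" "\<psi> i \<in> carrier (T n i)" using p by (simp_all add: cO)
          have "ev n i (\<phi> i) = ev n i (\<psi> i)"
          proof (rule ext, rule poly_mapping_eqI)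
            fix m b
            show "Poly_Mapping.lookup (ev n i (\<phi> i) m) b = Poly_Mapping.lookup (ev n i (\<psi> i) m) b"
            proof (cases "fst (snd b) = i")
              case True
              then show ?thesis using lkF[OF p(1), of m b] lkF[OF p(2), of m b] e by simp
            next
              case False
              then have "b \<notin> bsi S i (eta * (n - i))" by (auto simp: bsi_def)
              then have "b \<notin> Poly_Mapping.keys (ev n i (\<phi> i) m)" "b \<notin> Poly_Mapping.keys (ev n i (\<psi> i) m)"
                using evk[OF cc(1)] evk[OF cc(2)] by blast+
              then show ?thesis by (simp add: in_keys_iff)
            qed
          qed
          then show "\<phi> i = \<psi> i" using E(1) cc unfolding bij_betw_def inj_on_def by blast
        qed
      qed
      have "\<exists>\<phi>\<in>carrier (Ob C n). F n \<phi> = q" if q: "q \<in> supp_in (basis_at S n)" for q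
      proof -
        define pr where "pr i = (\<lambda>b. if fst (snd b) = i then Poly_Mapping.single b 1 else 0 :: 'c idx \<Rightarrow>\<^sub>0 'k)" for i
        have pl: "Poly_Mapping.lookup (lin_ext (pr i) u) x = (if fst (snd x) = i then Poly_Mapping.lookup u x else 0)" for i and u :: "'c idx \<Rightarrow>\<^sub>0 'k" and x
        proof -
          have "Poly_Mapping.lookup (lin_ext (pr i) u) x = (\<Sum>b\<in>Poly_Mapping.keys u. if b = x then (if fst (snd x) = i then Poly_Mapping.lookup u x else 0) else 0)"
            unfolding lookup_lin_ext by (rule sum.cong) (auto simp: lookup_single when_def pr_def)
          then show ?thesis by (simp add: in_keys_iff)
        qed
        have qi: "pw (pr i) q \<in> supp_in (bsi S i (eta * (n - i)))" for i unfolding pw_def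
        proof (rule supp_in_comp[OF q])
          fix u :: "'c idx \<Rightarrow>\<^sub>0 'k" assume u: "Poly_Mapping.keys u \<subseteq> basis_at S n"
          show "Poly_Mapping.keys (lin_ext (pr i) u) \<subseteq> bsi S i (eta * (n - i))"
            by (rule keys_lin_ext) (use u eta in \<open>auto simp: pr_def basis_at_def bsi_def split: if_splits\<close>)
        qed simp
        define \<phi> where "\<phi> i = inv_into (carrier (T n i)) (ev n i) (pw (pr i) q)" for i
        have cc: "\<phi> i \<in> carrier (T n i)" and alt_eps: "ev n i (\<phi> i) = pw (pr i) q" for i
          proof -
          have "pw (pr i) q \<in> ev n i ` carrier (T n i)" using E(1) qi unfolding bij_betw_def by metis
          then show "\<phi> i \<in> carrier (T n i)" "ev n i (\<phi> i) = pw (pr i) q"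
            unfolding \<phi>_def by (rule inv_into_into, rule f_inv_into_f)
        qed
        let ?K = "\<Union>m\<in>{m. q m \<noteq> 0}. Poly_Mapping.keys (q m)"
        have fK: "finite ?K" using supp_inD(2)[OF q] by auto
        have "finite {i. \<phi> i \<noteq> \<zero>\<^bsub>T n i\<^esub>}"
        proof (rule finsub[of "(\<lambda>b. fst (snd b)) ` ?K"])
          fix i assume i: "i \<notin> (\<lambda>b. fst (snd b)) ` ?K"
          have "pw (pr i) q = 0"
          proof (rule ext, rule poly_mapping_eqI)
            fix m b
            have "Poly_Mapping.lookup (q m) b = 0" if "fst (snd b) = i"
            proof (rule ccontr)
              assume "Poly_Mapping.lookup (q m) b \<noteq> 0"
              then have "b \<in> Poly_Mapping.keys (q m)" "q m \<noteq> 0" by (simp_all add: in_keys_iff) auto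
              then have "b \<in> ?K" by blast
              then show False using i that by blast
            qed
            then show "Poly_Mapping.lookup (pw (pr i) q m) b = Poly_Mapping.lookup (0 m) b" by (simp add: pw_def pl)
          qed
          then show "\<phi> i = \<zero>\<^bsub>T n i\<^esub>" using alt_eps[of i] E(10)[OF cc] by simp
        qed (use fK in simp)
        then have p: "\<phi> \<in> carrier (Ob C n)" using cc by (simp add: cO)
        have "F n \<phi> = q"
          by (rule ext, rule poly_mapping_eqI) (simp add: lkF[OF p] alt_eps pw_def pl)
        then show ?thesis using p by blast
      qed
      then show "F n ` carrier (Ob C n) = supp_in (basis_at S n)" using Fsupp by auto
    qed
  have zc: "\<zero>\<^bsub>Ob C n\<^esub> \<in> carrier (Ob C n)" for n by (simp add: cO zO E(2))
  have F0: "F n \<zero>\<^bsub>Ob C n\<^esub> = 0" for n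
    by (rule ext, rule poly_mapping_eqI) (simp add: zO lkF[OF zc[unfolded zO]] E(3))
  have "coords (Ob C n) (basis_at S n) (dgu c) (F n)" for n
    unfolding coords_def
  proof (intro conjI ballI allI bij zc F0)
    fix d show "hpart (Ob C n) d = {x \<in> carrier (Ob C n). \<forall>m. \<forall>b\<in>Poly_Mapping.keys (F n x m). dgm m + dgu c b = d}"
    proof (intro subset_antisym subsetI)
      fix x assume x: "x \<in> hpart (Ob C n) d"
      then have xc: "x \<in> carrier (Ob C n)" by (simp add: hO)
      then show "x \<in> {x \<in> carrier (Ob C n). \<forall>m. \<forall>b\<in>Poly_Mapping.keys (F n x m). dgm m + dgu c b = d}"
        using Fhp[OF xc] x by (simp add: hpart_Tm)
    next
      fix x assume "x \<in> {x \<in> carrier (Ob C n). \<forall>m. \<forall>b\<in>Poly_Mapping.keys (F n x m). dgm m + dgu c b = d}"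
      then show "x \<in> hpart (Ob C n) d" using Fhp Fsupp by (simp add: hpart_Tm)
    qed
  qed (simp_all add: aO sO addc smc Fadd Fsm)
  then show ?thesis unfolding coords_complex_def using dfc Fdf by blast
qed

end

section \<open>Coordinates on Hom(E, M)\<close>

lemma scalars_Sym: "scalars (Sym v :: ('k::field) sym graded_ring) sym_const"
proof (rule scalars.intro)
  show "ring (Sym v :: 'k sym graded_ring)" using cring_Sym by (rule cring.axioms(1))
  fix c d :: 'k
  have "sym_const c \<in> carrier (Sym v)" by (simp add: Sym_def sym_const_def)
  moreover have "gcomp (Sym v) 0 (sym_const c) = sym_const c"
    by (rule poly_mapping_eqI) (auto simp: lookup_gcomp_Sym sym_const_def lookup_single when_def mono_deg_zero_iff)
  ultimately show "sym_const c \<in> hom_part (Sym v) 0" by (simp add: hom_part_def)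
qed (simp_all add: Sym_def sym_const_def single_add mult_single)

lemma scalars_Ext: "scalars (Ext v :: ('k::field) ext graded_ring) ext_const"
proof (rule scalars.intro)
  show "ring (Ext v :: 'k ext graded_ring)" by (rule ring_Ext)
  fix c d :: 'k
  have cc: "ext_const c \<in> carrier (Ext v)" for c :: 'k by (auto simp: Ext_def ext_const_def)
  then show "ext_const c \<in> hom_part (Ext v) 0"
    by (auto simp: hom_part_def Ext_def ext_const_def)
  show "ext_const (c + d) = ext_const c \<oplus>\<^bsub>Ext v\<^esub> ext_const d" by (auto simp: Ext_def ext_const_def)
  show "ext_const (c * d) = ext_const c \<otimes>\<^bsub>Ext v\<^esub> ext_const d"
    by (subst ext_const_mult[OF cc]) (auto simp: ext_const_def)
  show "ext_const 1 = \<one>\<^bsub>Ext v\<^esub>" by (simp add: ext_one_const)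
qed

lemma pre_graded_zero_part:
  assumes "pre_graded B M" shows "pre_graded B (zero_part M)"
proof -
  interpret left_module B M using assms by (simp add: pre_graded_def)
  have az: "a \<odot>\<^bsub>M\<^esub> \<zero>\<^bsub>M\<^esub> = \<zero>\<^bsub>M\<^esub>" if "a \<in> carrier B" for a
  proof -
    have "a \<odot>\<^bsub>M\<^esub> \<zero>\<^bsub>M\<^esub> \<oplus>\<^bsub>M\<^esub> a \<odot>\<^bsub>M\<^esub> \<zero>\<^bsub>M\<^esub> = a \<odot>\<^bsub>M\<^esub> \<zero>\<^bsub>M\<^esub>"
      using smult_r_distr[OF that M.zero_closed M.zero_closed] by simp
    then show ?thesis using smult_closed[OF that M.zero_closed] M.add.l_cancel_one by blast
  qed
  have ag: "abelian_group (zero_part M)"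
    by (rule abelian_groupI) (auto simp: zero_part_def)
  interpret Z: abelian_group "zero_part M" by (rule ag)
  have "left_module B (zero_part M)"
    by (intro left_module.intro left_module_axioms.intro R.ring_axioms ag) (auto simp: zero_part_def az)
  moreover have "additive_subgroup (hpart (zero_part M) d) (zero_part M)" for d
  proof (rule additive_subgroup.intro)
    have "hpart (zero_part M) d = carrier (add_monoid (zero_part M))" by (simp add: zero_part_def)
    then show "subgroup (hpart (zero_part M) d) (add_monoid (zero_part M))"
      using group.subgroup_self[OF Z.a_group] by simp
  qed
  ultimately show ?thesis
    by (auto simp: pre_graded_def hom_part_def) (auto simp: zero_part_def az)
qed

lemma kcoordD:
  assumes "kcoord kc M j S \<kappa>"
  shows "bij_betw \<kappa> (hpart M j) {u. Poly_Mapping.keys u \<subseteq> S}"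
    "x \<in> hpart M j \<Longrightarrow> y \<in> hpart M j \<Longrightarrow> \<kappa> (x \<oplus>\<^bsub>M\<^esub> y) = \<kappa> x + \<kappa> y"
    "x \<in> hpart M j \<Longrightarrow> \<kappa> (kc c \<odot>\<^bsub>M\<^esub> x) = scal c (\<kappa> x)"
    "x \<in> hpart M j \<Longrightarrow> Poly_Mapping.keys (\<kappa> x) \<subseteq> S"
    "x \<in> hpart M j \<Longrightarrow> y \<in> hpart M j \<Longrightarrow> \<kappa> x = \<kappa> y \<longleftrightarrow> x = y"
proof -
  show b: "bij_betw \<kappa> (hpart M j) {u. Poly_Mapping.keys u \<subseteq> S}"
    and "x \<in> hpart M j \<Longrightarrow> y \<in> hpart M j \<Longrightarrow> \<kappa> (x \<oplus>\<^bsub>M\<^esub> y) = \<kappa> x + \<kappa> y"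
    and "x \<in> hpart M j \<Longrightarrow> \<kappa> (kc c \<odot>\<^bsub>M\<^esub> x) = scal c (\<kappa> x)"
    using assms by (simp_all add: kcoord_def)
  show "x \<in> hpart M j \<Longrightarrow> Poly_Mapping.keys (\<kappa> x) \<subseteq> S" using bij_betw_apply[OF b] by blast
  show "x \<in> hpart M j \<Longrightarrow> y \<in> hpart M j \<Longrightarrow> \<kappa> x = \<kappa> y \<longleftrightarrow> x = y" using b unfolding bij_betw_def inj_on_def by blast
qed

text \<open>One graded piece of a module with coordinates on it.\<close>

locale coord_piece = scalars B kc for B :: "'s graded_ring" and kc :: "'k::field \<Rightarrow> 's" +
  fixes M :: "('s, 'a) gmodule" and j :: int and S :: "'b set" and \<kappa> :: "'a \<Rightarrow> ('b \<Rightarrow>\<^sub>0 'k)"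
  assumes pg: "pre_graded B M" and kcoord: "kcoord kc M j S \<kappa>"
begin

sublocale L: left_module B M using pg by (simp add: pre_graded_def)
sublocale KS: kspace M "\<lambda>c x. kc c \<odot>\<^bsub>M\<^esub> x" by (rule kspaceI[OF pg])

lemmas kD = kcoordD[OF kcoord]

lemma hc: "x \<in> hpart M j \<Longrightarrow> x \<in> carrier M" by (rule hpart_closed[OF pg])

lemma h_add: "x \<in> hpart M j \<Longrightarrow> y \<in> hpart M j \<Longrightarrow> x \<oplus>\<^bsub>M\<^esub> y \<in> hpart M j"
  and h_scal: "x \<in> hpart M j \<Longrightarrow> kc c \<odot>\<^bsub>M\<^esub> x \<in> hpart M j"
  and h_zero: "\<zero>\<^bsub>M\<^esub> \<in> hpart M j"
  using hpart_subspace[OF pg, of j] by (auto simp: KS.subspace_def)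

lemma k_zero: "\<kappa> \<zero>\<^bsub>M\<^esub> = 0"
  using kD(2)[OF h_zero h_zero] by simp

lemma k_zero_iff: "x \<in> hpart M j \<Longrightarrow> \<kappa> x = 0 \<longleftrightarrow> x = \<zero>\<^bsub>M\<^esub>"
  using kD(5)[OF _ h_zero, of x] k_zero by simp

lemma k_finsum:
  assumes "finite I" "\<And>i. i \<in> I \<Longrightarrow> f i \<in> hpart M j"
  shows "finsum M f I \<in> hpart M j \<and> \<kappa> (finsum M f I) = (\<Sum>i\<in>I. \<kappa> (f i))"
  using assms
proof (induction I rule: finite_induct)
  case (insert i I)
  have "finsum M f (insert i I) = f i \<oplus>\<^bsub>M\<^esub> finsum M f I"
    using insert by (intro L.M.finsum_insert) (auto intro: hc)
  then show ?case using insert by (simp add: h_add kD(2))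
qed (simp add: h_zero k_zero)

definition kinv :: "('b \<Rightarrow>\<^sub>0 'k) \<Rightarrow> 'a" where "kinv = inv_into (hpart M j) \<kappa>"

lemma kinv: "Poly_Mapping.keys u \<subseteq> S \<Longrightarrow> kinv u \<in> hpart M j" "Poly_Mapping.keys u \<subseteq> S \<Longrightarrow> \<kappa> (kinv u) = u"
proof -
  assume "Poly_Mapping.keys u \<subseteq> S"
  then have "u \<in> \<kappa> ` hpart M j" using kD(1) by (auto simp: bij_betw_def)
  then show "kinv u \<in> hpart M j" "\<kappa> (kinv u) = u" unfolding kinv_def by (rule inv_into_into, rule f_inv_into_f)
qed

end

definition ext_mono :: "nat set \<Rightarrow> ('k::field) ext" where "ext_mono J = (\<lambda>I. if I = J then 1 else 0)"

lemma ext_sign_sq [simp]: "ext_sign I J * ext_sign I J = (1 :: 'k::field)"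
  by (simp add: ext_sign_def power_mult_distrib[symmetric])

lemma ext_mono_closed: "J \<subseteq> {..<v} \<Longrightarrow> ext_mono J \<in> carrier (Ext v)"
  by (auto simp: Ext_def ext_mono_def)

lemma ext_mono_mult:
  assumes "finite J"
  shows "(ext_mono X \<otimes>\<^bsub>Ext v\<^esub> f) J = (if X \<subseteq> J then ext_sign X (J - X) * f (J - X) else (0::'k::field))"
proof -
  have "(ext_mono X \<otimes>\<^bsub>Ext v\<^esub> f) J = (\<Sum>I\<in>Pow J. if I = X then ext_sign X (J - X) * f (J - X) else 0)"
    by (auto simp: Ext_def ext_mono_def intro!: sum.cong)
  then show ?thesis using assms by simp
qed

lemma ext_gen_mult_ext_mono:
  assumes X: "X \<subseteq> {..<v}" and k: "k < v"
  shows "ext_gen k \<otimes>\<^bsub>Ext v\<^esub> ext_mono X = (if k \<in> X then \<zero>\<^bsub>Ext v\<^esub> else ext_const (ext_sign {k} X) \<otimes>\<^bsub>Ext v\<^esub> (ext_mono (insert k X) :: ('k::field) ext))"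
proof -
  have g: "ext_gen k = (ext_mono {k} :: 'k ext)" by (simp add: ext_gen_def ext_mono_def)
  have c: "ext_mono (insert k X) \<in> carrier (Ext v)" using X k by (intro ext_mono_closed) auto
  have fX: "finite X" using X finite_subset by blast
  show ?thesis
  proof
    fix J
    show "(ext_gen k \<otimes>\<^bsub>Ext v\<^esub> ext_mono X) J = (if k \<in> X then \<zero>\<^bsub>Ext v\<^esub> else ext_const (ext_sign {k} X) \<otimes>\<^bsub>Ext v\<^esub> (ext_mono (insert k X) :: 'k ext)) J"
    proof (cases "finite J")
      case True
      have "(ext_gen k \<otimes>\<^bsub>Ext v\<^esub> ext_mono X) J = (if {k} \<subseteq> J then ext_sign {k} (J - {k}) * ext_mono X (J - {k}) else (0::'k))"
        unfolding g by (rule ext_mono_mult[OF True])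
      also have "\<dots> = (if k \<in> X then \<zero>\<^bsub>Ext v\<^esub> else (\<lambda>J. ext_sign {k} X * ext_mono (insert k X) J)) J"
        by (auto simp: ext_mono_def Ext_def)
      finally show ?thesis by (simp add: ext_const_mult[OF c])
    next
      case False
      then have "infinite (Pow J)" "J \<noteq> insert k X" using fX by auto
      then show ?thesis by (auto simp: ext_const_mult[OF c]) (auto simp: Ext_def ext_mono_def)
    qed
  qed
qed

lemma ext_lin_expand:
  fixes g :: "('k::field) ext \<Rightarrow> ('b \<Rightarrow>\<^sub>0 'k)"
  assumes add: "\<And>e e'. e \<in> carrier (Ext v) \<Longrightarrow> e' \<in> carrier (Ext v) \<Longrightarrow> g (e \<oplus>\<^bsub>Ext v\<^esub> e') = g e + g e'"
    and sc: "\<And>c e. e \<in> carrier (Ext v) \<Longrightarrow> g (ext_const c \<otimes>\<^bsub>Ext v\<^esub> e) = scal c (g e)"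
    and f: "f \<in> carrier (Ext v)"
  shows "g f = (\<Sum>J\<in>Pow {..<v}. scal (f J) (g (ext_mono J)))"
proof -
  interpret ring "Ext v :: 'k ext graded_ring" by (rule ring_Ext)
  have z: "g \<zero>\<^bsub>Ext v\<^esub> = 0" using add[OF zero_closed zero_closed] by simp
  let ?r = "\<lambda>X. (\<lambda>I. if I \<in> X then f I else 0)"
  have "?r X \<in> carrier (Ext v) \<and> g (?r X) = (\<Sum>J\<in>X. scal (f J) (g (ext_mono J)))" if "finite X" "X \<subseteq> Pow {..<v}" for X
    using that
  proof (induction X rule: finite_induct)
    case empty
    have "?r {} = \<zero>\<^bsub>Ext v\<^esub>" by (simp add: Ext_def)
    then show ?case using z by simp
  next
    case (insert J X)
    have eJ: "ext_mono J \<in> carrier (Ext v)" using insert.prems by (intro ext_mono_closed) auto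
    have cJ: "ext_const (f J) \<otimes>\<^bsub>Ext v\<^esub> ext_mono J \<in> carrier (Ext v)"
      using eJ scalars.kc_closed[OF scalars_Ext] by blast
    have IH: "?r X \<in> carrier (Ext v)" "g (?r X) = (\<Sum>J\<in>X. scal (f J) (g (ext_mono J)))" using insert by auto
    have "?r (insert J X) = ext_const (f J) \<otimes>\<^bsub>Ext v\<^esub> ext_mono J \<oplus>\<^bsub>Ext v\<^esub> ?r X"
      unfolding ext_const_mult[OF eJ] using insert.hyps by (auto simp: Ext_def ext_mono_def)
    then show ?case using add[OF cJ IH(1)] sc[OF eJ] IH insert.hyps a_closed[OF cJ IH(1)] by simp
  qed
  from this[of "Pow {..<v}"] have "g (?r (Pow {..<v})) = (\<Sum>J\<in>Pow {..<v}. scal (f J) (g (ext_mono J)))" by simp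
  moreover have "?r (Pow {..<v}) = f" using f by (auto simp: Ext_def)
  ultimately show ?thesis by simp
qed

text \<open>The self-duality of the exterior algebra in coordinates: a linear map on \<open>E\<close> is recorded by its values
  on the complements of monomials. The sign, that of the product of the complement and the monomial,
  makes the identification linear over \<open>E\<close>.\<close>

definition evR :: "nat \<Rightarrow> ('a \<Rightarrow> ('b \<Rightarrow>\<^sub>0 'k)) \<Rightarrow> (('k::field) ext \<Rightarrow> 'a) \<Rightarrow> nat set \<Rightarrow> ('b \<Rightarrow>\<^sub>0 'k)" where
  "evR v \<kappa> \<alpha> = (\<lambda>I. if I \<subseteq> {..<v} then scal (ext_sign ({..<v} - I) I) (\<kappa> (\<alpha> (ext_mono ({..<v} - I)))) else 0)"

text \<open>The module \<open>HomE v M j\<close> with the coordinates induced from the degree \<open>j\<close> part of \<open>M\<close>.\<close>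

locale hom_piece = coord_piece "Sym v" sym_const M j S \<kappa>
  for v :: nat and M :: "(('k::field) sym, 'a) gmodule" and j :: int and S :: "'b set" and \<kappa> :: "'a \<Rightarrow> ('b \<Rightarrow>\<^sub>0 'k)"
begin

sublocale EA: monomial_algebra "Ext v :: 'k ext graded_ring" "\<lambda>f. f" "Pow {..<v}" Pow ext_sign "{}" "\<lambda>k. {k}" v
     "\<lambda>I. - int (card I)" 1 "- 1" by (rule monomial_algebra_Ext)

sublocale RE: ring "Ext v :: 'k ext graded_ring" by (rule ring_Ext)

abbreviation E where "E \<equiv> (Ext v :: 'k ext graded_ring)"
abbreviation cm where "cm I \<equiv> {..<v} - I"

lemma const_closed: "ext_const c \<in> carrier E" using scalars.kc_closed[OF scalars_Ext] .

lemma mem_HomE: "\<alpha> \<in> carrier (HomE v M j) \<longleftrightarrow> \<alpha> \<in> carrier E \<rightarrow>\<^sub>E hpart M j \<and>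
   (\<forall>e\<in>carrier E. \<forall>e'\<in>carrier E. \<kappa> (\<alpha> (e \<oplus>\<^bsub>E\<^esub> e')) = \<kappa> (\<alpha> e) + \<kappa> (\<alpha> e')) \<and>
   (\<forall>c. \<forall>e\<in>carrier E. \<kappa> (\<alpha> (ext_const c \<otimes>\<^bsub>E\<^esub> e)) = scal c (\<kappa> (\<alpha> e)))"
proof (cases "\<alpha> \<in> carrier E \<rightarrow>\<^sub>E hpart M j")
  case True
  then have h: "\<alpha> e \<in> hpart M j" if "e \<in> carrier E" for e using that by blast
  have 1: "\<kappa> (\<alpha> (e \<oplus>\<^bsub>E\<^esub> e')) = \<kappa> (\<alpha> e) + \<kappa> (\<alpha> e') \<longleftrightarrow> \<alpha> (e \<oplus>\<^bsub>E\<^esub> e') = \<alpha> e \<oplus>\<^bsub>M\<^esub> \<alpha> e'"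
    if "e \<in> carrier E" "e' \<in> carrier E" for e e'
    using that by (simp add: kD(2)[symmetric] h kD(5) h_add)
  have 2: "\<kappa> (\<alpha> (ext_const c \<otimes>\<^bsub>E\<^esub> e)) = scal c (\<kappa> (\<alpha> e)) \<longleftrightarrow> \<alpha> (ext_const c \<otimes>\<^bsub>E\<^esub> e) = sym_const c \<odot>\<^bsub>M\<^esub> \<alpha> e"
    if "e \<in> carrier E" for c e
    using that const_closed[of c] by (simp add: kD(3)[symmetric] h kD(5) h_scal)
  show ?thesis using True by (simp add: HomE_def Let_def 1 2)
qed (simp add: HomE_def Let_def)

lemma HomED:
  assumes "\<alpha> \<in> carrier (HomE v M j)"
  shows "\<alpha> \<in> extensional (carrier E)" "e \<in> carrier E \<Longrightarrow> \<alpha> e \<in> hpart M j"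
   "e \<in> carrier E \<Longrightarrow> e' \<in> carrier E \<Longrightarrow> \<kappa> (\<alpha> (e \<oplus>\<^bsub>E\<^esub> e')) = \<kappa> (\<alpha> e) + \<kappa> (\<alpha> e')"
   "e \<in> carrier E \<Longrightarrow> \<kappa> (\<alpha> (ext_const c \<otimes>\<^bsub>E\<^esub> e)) = scal c (\<kappa> (\<alpha> e))"
  using assms unfolding mem_HomE by (auto simp: PiE_def)

lemma HomE_restrictI:
  assumes "\<And>e. e \<in> carrier E \<Longrightarrow> f e \<in> hpart M j"
    and "\<And>e e'. e \<in> carrier E \<Longrightarrow> e' \<in> carrier E \<Longrightarrow> \<kappa> (f (e \<oplus>\<^bsub>E\<^esub> e')) = \<kappa> (f e) + \<kappa> (f e')"
    and "\<And>c e. e \<in> carrier E \<Longrightarrow> \<kappa> (f (ext_const c \<otimes>\<^bsub>E\<^esub> e)) = scal c (\<kappa> (f e))"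
  shows "(\<lambda>e\<in>carrier E. f e) \<in> carrier (HomE v M j)"
  unfolding mem_HomE using assms const_closed by auto

lemma expand:
  assumes a: "\<alpha> \<in> carrier (HomE v M j)" and f: "f \<in> carrier E"
  shows "\<kappa> (\<alpha> f) = (\<Sum>J\<in>Pow {..<v}. scal (f J) (\<kappa> (\<alpha> (ext_mono J))))"
  by (rule ext_lin_expand[OF HomED(3)[OF a] HomED(4)[OF a] f])

lemma cmcm: "I \<subseteq> {..<v} \<Longrightarrow> cm (cm I) = I" by auto

lemma k_ext_mono:
  assumes a: "\<alpha> \<in> carrier (HomE v M j)" and J: "J \<subseteq> {..<v}"
  shows "\<kappa> (\<alpha> (ext_mono J)) = scal (ext_sign J (cm J)) (evR v \<kappa> \<alpha> (cm J))"
  using J by (simp add: evR_def cmcm)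

lemma HomE_simps:
  "\<zero>\<^bsub>HomE v M j\<^esub> = (\<lambda>e\<in>carrier E. \<zero>\<^bsub>M\<^esub>)"
  "\<alpha> \<oplus>\<^bsub>HomE v M j\<^esub> \<beta> = (\<lambda>e\<in>carrier E. \<alpha> e \<oplus>\<^bsub>M\<^esub> \<beta> e)"
  "f \<odot>\<^bsub>HomE v M j\<^esub> \<alpha> = (\<lambda>e\<in>carrier E. \<alpha> (e \<otimes>\<^bsub>E\<^esub> f))"
  by (simp_all add: HomE_def Let_def)

lemma hpart_HomE: "\<alpha> \<in> hpart (HomE v M j) t \<longleftrightarrow> \<alpha> \<in> carrier (HomE v M j) \<and>
    (\<forall>s. s + t \<noteq> j \<longrightarrow> (\<forall>e\<in>hom_part E s. \<alpha> e = \<zero>\<^bsub>M\<^esub>))"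
  by (simp add: HomE_def Let_def)

lemma evR_supp: "\<alpha> \<in> carrier (HomE v M j) \<Longrightarrow> evR v \<kappa> \<alpha> \<in> EA.supp_in S"
proof -
  assume a: "\<alpha> \<in> carrier (HomE v M j)"
  have "Poly_Mapping.keys (evR v \<kappa> \<alpha> I) \<subseteq> S" for I
  proof (cases "I \<subseteq> {..<v}")
    case True
    have "Poly_Mapping.keys (\<kappa> (\<alpha> (ext_mono (cm I)))) \<subseteq> S"
      by (rule kD(4)[OF HomED(2)[OF a ext_mono_closed]]) auto
    then show ?thesis using True by (simp add: evR_def subset_trans[OF keys_scal])
  qed (simp add: evR_def)
  moreover have "finite {I. evR v \<kappa> \<alpha> I \<noteq> 0}"
    by (rule finite_subset[of _ "Pow {..<v}"]) (auto simp: evR_def)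
  ultimately show ?thesis by (simp add: EA.supp_in_def evR_def)
qed

lemma evR_inj:
  assumes a: "\<alpha> \<in> carrier (HomE v M j)" and b: "\<beta> \<in> carrier (HomE v M j)" and e: "evR v \<kappa> \<alpha> = evR v \<kappa> \<beta>"
  shows "\<alpha> = \<beta>"
proof (rule extensionalityI[OF HomED(1)[OF a] HomED(1)[OF b]])
  fix f assume f: "f \<in> carrier E"
  have "\<kappa> (\<alpha> f) = \<kappa> (\<beta> f)"
    unfolding expand[OF a f] expand[OF b f] by (rule sum.cong) (auto simp: k_ext_mono[OF a] k_ext_mono[OF b] e)
  then show "\<alpha> f = \<beta> f" using kD(5) HomED(2)[OF a f] HomED(2)[OF b f] by blast
qed

lemma evR_surj:
  assumes q: "q \<in> EA.supp_in S"
  shows "\<exists>\<alpha>\<in>carrier (HomE v M j). evR v \<kappa> \<alpha> = q"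
proof
  define s where "s f = (\<Sum>J\<in>Pow {..<v}. scal (f J) (scal (ext_sign J (cm J)) (q (cm J))))" for f :: "'k ext"
  let ?\<alpha> = "\<lambda>f\<in>carrier E. kinv (s f)"
  have k: "Poly_Mapping.keys (s f) \<subseteq> S" for f
    unfolding s_def by (intro keys_sum_subset subset_trans[OF keys_scal] EA.supp_inD(1)[OF q])
  have ad: "s (e \<oplus>\<^bsub>E\<^esub> e') = s e + s e'" for e e'
    by (simp add: s_def Ext_def distrib_right scal_distrib sum.distrib)
  have sc: "s (ext_const c \<otimes>\<^bsub>E\<^esub> e) = scal c (s e)" if "e \<in> carrier E" for c e
    by (simp add: s_def ext_const_mult[OF that] scal_sum mult.assoc)
  show m: "?\<alpha> \<in> carrier (HomE v M j)"
  proof (rule HomE_restrictI)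
    show "kinv (s e) \<in> hpart M j" for e by (rule kinv(1)[OF k])
    show "\<kappa> (kinv (s (e \<oplus>\<^bsub>E\<^esub> e'))) = \<kappa> (kinv (s e)) + \<kappa> (kinv (s e'))" for e e'
      unfolding kinv(2)[OF k] by (rule ad)
    show "\<kappa> (kinv (s (ext_const c \<otimes>\<^bsub>E\<^esub> e))) = scal c (\<kappa> (kinv (s e)))" if "e \<in> carrier E" for c e
      unfolding kinv(2)[OF k] by (rule sc[OF that])
  qed
  show "evR v \<kappa> ?\<alpha> = q"
  proof
    fix I show "evR v \<kappa> ?\<alpha> I = q I"
    proof (cases "I \<subseteq> {..<v}")
      case True
      have "s (ext_mono (cm I)) = (\<Sum>J\<in>Pow {..<v}. if J = cm I then scal (ext_sign (cm I) I) (q I) else 0)"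
        unfolding s_def by (rule sum.cong) (auto simp: ext_mono_def cmcm True)
      then have se: "s (ext_mono (cm I)) = scal (ext_sign (cm I) I) (q I)" by simp
      have "\<kappa> (?\<alpha> (ext_mono (cm I))) = scal (ext_sign (cm I) I) (q I)"
      proof -
        have "(ext_mono (cm I) :: 'k ext) \<in> carrier E" by (rule ext_mono_closed) auto
        then have "\<kappa> (?\<alpha> (ext_mono (cm I))) = s (ext_mono (cm I))" by (simp only: restrict_apply' kinv(2)[OF k])
        then show ?thesis using se by simp
      qed
      then show ?thesis using True by (simp add: evR_def)
    next
      case False
      then show ?thesis using EA.supp_inD(3)[OF q] by (simp add: evR_def)
    qed
  qed
qed

text \<open>Since \<open>(f \<alpha>)(e) = \<alpha>(e f)\<close>, the value at the complement \<open>c\<close> of \<open>m\<close> involves the products \<open>e\<^sub>c e\<^sub>l\<close> with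
  \<open>l\<close> inside \<open>m\<close>; splitting the signs along \<open>m = l \<union> (m - l)\<close> gives the product in \<open>E\<close>.\<close>

lemma smult_HomE:
  assumes f: "f \<in> carrier E" and a: "\<alpha> \<in> carrier (HomE v M j)"
  shows "f \<odot>\<^bsub>HomE v M j\<^esub> \<alpha> \<in> carrier (HomE v M j)" "evR v \<kappa> (f \<odot>\<^bsub>HomE v M j\<^esub> \<alpha>) = EA.act f (evR v \<kappa> \<alpha>)"
proof -
  show "f \<odot>\<^bsub>HomE v M j\<^esub> \<alpha> \<in> carrier (HomE v M j)"
    unfolding HomE_simps
  proof (rule HomE_restrictI)
    fix e e' assume "e \<in> carrier E" "e' \<in> carrier E"
    then show "\<kappa> (\<alpha> ((e \<oplus>\<^bsub>E\<^esub> e') \<otimes>\<^bsub>E\<^esub> f)) = \<kappa> (\<alpha> (e \<otimes>\<^bsub>E\<^esub> f)) + \<kappa> (\<alpha> (e' \<otimes>\<^bsub>E\<^esub> f))"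
      using f HomED(3)[OF a] by (simp add: RE.l_distr)
  next
    fix c e assume "e \<in> carrier E"
    then show "\<kappa> (\<alpha> ((ext_const c \<otimes>\<^bsub>E\<^esub> e) \<otimes>\<^bsub>E\<^esub> f)) = scal c (\<kappa> (\<alpha> (e \<otimes>\<^bsub>E\<^esub> f)))"
      using f HomED(4)[OF a] const_closed by (simp add: RE.m_assoc)
  qed (use f HomED(2)[OF a] in auto)
  show "evR v \<kappa> (f \<odot>\<^bsub>HomE v M j\<^esub> \<alpha>) = EA.act f (evR v \<kappa> \<alpha>)"
  proof
    fix m :: "nat set"
    show "evR v \<kappa> (f \<odot>\<^bsub>HomE v M j\<^esub> \<alpha>) m = EA.act f (evR v \<kappa> \<alpha>) m"
    proof (cases "m \<subseteq> {..<v}")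
      case False
      then show ?thesis by (simp add: evR_def EA.act_def)
    next
      case m: True
      let ?c = "cm m"
      have fin: "finite m" using m finite_subset by blast
      have ebc: "ext_mono ?c \<in> carrier E" by (rule ext_mono_closed) auto
      have ebf: "ext_mono ?c \<otimes>\<^bsub>E\<^esub> f \<in> carrier E" using ebc f by simp
      have "\<kappa> ((f \<odot>\<^bsub>HomE v M j\<^esub> \<alpha>) (ext_mono ?c)) = (\<Sum>J\<in>Pow {..<v}. scal ((ext_mono ?c \<otimes>\<^bsub>E\<^esub> f) J) (\<kappa> (\<alpha> (ext_mono J))))"
        using ebc expand[OF a ebf] by (simp add: HomE_simps)
      also have "\<dots> = (\<Sum>J\<in>{J \<in> Pow {..<v}. ?c \<subseteq> J}. scal (ext_sign ?c (J - ?c) * f (J - ?c)) (\<kappa> (\<alpha> (ext_mono J))))"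
      proof (rule sum.mono_neutral_cong_right)
        fix J assume J: "J \<in> {J \<in> Pow {..<v}. ?c \<subseteq> J}"
        then have "finite J" using finite_subset by blast
        then show "scal ((ext_mono ?c \<otimes>\<^bsub>E\<^esub> f) J) (\<kappa> (\<alpha> (ext_mono J))) = scal (ext_sign ?c (J - ?c) * f (J - ?c)) (\<kappa> (\<alpha> (ext_mono J)))"
          using J by (simp add: ext_mono_mult)
      next
        show "\<forall>J\<in>Pow {..<v} - {J \<in> Pow {..<v}. ?c \<subseteq> J}. scal ((ext_mono ?c \<otimes>\<^bsub>E\<^esub> f) J) (\<kappa> (\<alpha> (ext_mono J))) = 0"
        proof
          fix J assume J: "J \<in> Pow {..<v} - {J \<in> Pow {..<v}. ?c \<subseteq> J}"
          then have "finite J" using finite_subset by blast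
          then show "scal ((ext_mono ?c \<otimes>\<^bsub>E\<^esub> f) J) (\<kappa> (\<alpha> (ext_mono J))) = 0" using J by (auto simp: ext_mono_mult)
        qed
      qed auto
      also have "\<dots> = (\<Sum>l\<in>Pow m. scal (ext_sign ?c l * f l) (\<kappa> (\<alpha> (ext_mono (?c \<union> l)))))"
      proof (rule sum.reindex_bij_witness[where i = "\<lambda>l. ?c \<union> l" and j = "\<lambda>J. J - ?c"], goal_cases)
        case (5 J)
        then have "?c \<union> (J - ?c) = J" by auto
        then show ?case by simp
      qed (use m in auto)
      finally have k: "\<kappa> ((f \<odot>\<^bsub>HomE v M j\<^esub> \<alpha>) (ext_mono ?c)) = (\<Sum>l\<in>Pow m. scal (ext_sign ?c l * f l) (\<kappa> (\<alpha> (ext_mono (?c \<union> l)))))" .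
      have "evR v \<kappa> (f \<odot>\<^bsub>HomE v M j\<^esub> \<alpha>) m = (\<Sum>l\<in>Pow m. scal (ext_sign ?c m * (ext_sign ?c l * f l)) (\<kappa> (\<alpha> (ext_mono (?c \<union> l)))))"
        using m by (simp add: evR_def k scal_sum)
      also have "\<dots> = (\<Sum>l\<in>Pow m. scal (ext_sign l (m - l) * f l) (evR v \<kappa> \<alpha> (m - l)))"
      proof (rule sum.cong[OF refl])
        fix l assume l: "l \<in> Pow m"
        have f2: "finite l" "finite (m - l)" "finite ?c" using l fin by (auto intro: finite_subset)
        have e1: "m = l \<union> (m - l)" "cm (m - l) = ?c \<union> l" using l m by auto
        have s1: "ext_sign ?c m = (ext_sign ?c l * ext_sign ?c (m - l) :: 'k)"
        proof -
          have "ext_sign ?c (l \<union> (m - l)) = (ext_sign ?c l * ext_sign ?c (m - l) :: 'k)"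
            by (rule ext_sign_Un_right) (use f2 in auto)
          then show ?thesis using e1(1) by simp
        qed
        have s2: "ext_sign (?c \<union> l) (m - l) = (ext_sign ?c (m - l) * ext_sign l (m - l) :: 'k)"
          by (rule ext_sign_Un_left) (use f2 l in auto)
        have "evR v \<kappa> \<alpha> (m - l) = scal (ext_sign ?c (m - l) * ext_sign l (m - l)) (\<kappa> (\<alpha> (ext_mono (?c \<union> l))))"
          using m unfolding evR_def e1(2) s2 by auto
        moreover have "ext_sign l (m - l) * f l * (ext_sign ?c (m - l) * ext_sign l (m - l)) =
            f l * ext_sign ?c (m - l) * (ext_sign l (m - l) * ext_sign l (m - l))" by (simp only: mult_ac)
        moreover have "ext_sign ?c m * (ext_sign ?c l * f l) = f l * ext_sign ?c (m - l) * (ext_sign ?c l * ext_sign ?c l)"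
          unfolding s1 by (simp only: mult_ac)
        ultimately show "scal (ext_sign ?c m * (ext_sign ?c l * f l)) (\<kappa> (\<alpha> (ext_mono (?c \<union> l)))) =
            scal (ext_sign l (m - l) * f l) (evR v \<kappa> \<alpha> (m - l))"
          by (simp only: ext_sign_sq scal_simps mult_1_right)
      qed
      also have "\<dots> = EA.act f (evR v \<kappa> \<alpha>) m" using m by (simp add: EA.act_def)
      finally show ?thesis .
    qed
  qed
qed

text \<open>The value on the complement of \<open>m\<close> has degree \<open>j\<close> while the complement has degree \<open>card m - v\<close>; hence the
  generators sit in degree \<open>j + v\<close>.\<close>

lemma HomE_coords:
  assumes dg: "\<And>b. b \<in> S \<Longrightarrow> dg b = j + int v"
  shows "EA.coords (HomE v M j) S dg (evR v \<kappa>)"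
  unfolding EA.coords_def
proof (intro conjI ballI allI)
  show "bij_betw (evR v \<kappa>) (carrier (HomE v M j)) (EA.supp_in S)"
  proof (rule bij_betw_imageI)
    show "inj_on (evR v \<kappa>) (carrier (HomE v M j))" by (rule inj_onI) (rule evR_inj)
    show "evR v \<kappa> ` carrier (HomE v M j) = EA.supp_in S" using evR_supp evR_surj by blast
  qed
  have "\<kappa> \<zero>\<^bsub>M\<^esub> = 0" by (rule k_zero)
  then show zc: "\<zero>\<^bsub>HomE v M j\<^esub> \<in> carrier (HomE v M j)"
    unfolding HomE_simps by (intro HomE_restrictI) (simp_all add: h_zero)
  show "evR v \<kappa> \<zero>\<^bsub>HomE v M j\<^esub> = 0"
    by (rule ext) (simp add: evR_def HomE_simps ext_mono_closed k_zero)
next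
  fix x y assume x: "x \<in> carrier (HomE v M j)" and y: "y \<in> carrier (HomE v M j)"
  have hk: "\<kappa> (x e \<oplus>\<^bsub>M\<^esub> y e) = \<kappa> (x e) + \<kappa> (y e)" if "e \<in> carrier E" for e
    by (rule kD(2)[OF HomED(2)[OF x that] HomED(2)[OF y that]])
  show "x \<oplus>\<^bsub>HomE v M j\<^esub> y \<in> carrier (HomE v M j)"
    unfolding HomE_simps
    by (rule HomE_restrictI) (simp_all add: h_add HomED(2)[OF x] HomED(2)[OF y] hk const_closed HomED(3,4)[OF x] HomED(3,4)[OF y] scal_distrib add_ac)
  show "evR v \<kappa> (x \<oplus>\<^bsub>HomE v M j\<^esub> y) = evR v \<kappa> x + evR v \<kappa> y"
    by (rule ext) (simp add: evR_def HomE_simps ext_mono_closed hk scal_distrib)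
next
  fix d
  show "hpart (HomE v M j) d = {x \<in> carrier (HomE v M j). \<forall>m. \<forall>b\<in>Poly_Mapping.keys (evR v \<kappa> x m). - int (card m) + dg b = d}"
  proof (rule Set.set_eqI)
    fix \<alpha>
    show "\<alpha> \<in> hpart (HomE v M j) d \<longleftrightarrow> \<alpha> \<in> {x \<in> carrier (HomE v M j). \<forall>m. \<forall>b\<in>Poly_Mapping.keys (evR v \<kappa> x m). - int (card m) + dg b = d}"
    proof
      assume h: "\<alpha> \<in> hpart (HomE v M j) d"
      then have a: "\<alpha> \<in> carrier (HomE v M j)" by (simp add: hpart_HomE)
      have "- int (card m) + dg b = d" if b: "b \<in> Poly_Mapping.keys (evR v \<kappa> \<alpha> m)" for m b
      proof -
        have m: "m \<subseteq> {..<v}" using b by (auto simp: evR_def split: if_splits)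
        have bS: "b \<in> S" using EA.supp_inD(1)[OF evR_supp[OF a], of m] b by blast
        have nz: "evR v \<kappa> \<alpha> m \<noteq> 0" using b by auto
        have "\<alpha> (ext_mono (cm m)) \<noteq> \<zero>\<^bsub>M\<^esub>"
        proof
          assume "\<alpha> (ext_mono (cm m)) = \<zero>\<^bsub>M\<^esub>"
          then have "evR v \<kappa> \<alpha> m = 0" by (simp add: evR_def k_zero)
          then show False using nz by simp
        qed
        moreover have "(ext_mono (cm m) :: 'k ext) \<in> carrier E" by (rule ext_mono_closed) auto
        then have "(ext_mono (cm m) :: 'k ext) \<in> hom_part E (- int (card (cm m)))"
          by (simp add: EA.hom_part_iff) (simp add: ext_mono_def)
        ultimately have "- int (card (cm m)) + d = j" using h unfolding hpart_HomE by blast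
        moreover have "card (cm m) = v - card m" using m by (simp add: card_Diff_subset finite_subset)
        moreover have "card m \<le> v" using card_mono[OF _ m] by simp
        ultimately show ?thesis using dg[OF bS] by simp
      qed
      then show "\<alpha> \<in> {x \<in> carrier (HomE v M j). \<forall>m. \<forall>b\<in>Poly_Mapping.keys (evR v \<kappa> x m). - int (card m) + dg b = d}"
        using a by blast
    next
      assume "\<alpha> \<in> {x \<in> carrier (HomE v M j). \<forall>m. \<forall>b\<in>Poly_Mapping.keys (evR v \<kappa> x m). - int (card m) + dg b = d}"
      then have a: "\<alpha> \<in> carrier (HomE v M j)" and h: "\<And>m b. b \<in> Poly_Mapping.keys (evR v \<kappa> \<alpha> m) \<Longrightarrow> - int (card m) + dg b = d" by auto
      have "\<alpha> e = \<zero>\<^bsub>M\<^esub>" if s: "s + d \<noteq> j" and e: "e \<in> hom_part E s" for s e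
      proof -
        have ec: "e \<in> carrier E" using e by (simp add: hom_part_def)
        have eJ: "- int (card J) = s" if "e J \<noteq> 0" for J
          using e that EA.hom_part_iff[of e s] by blast
        have "scal (e J) (\<kappa> (\<alpha> (ext_mono J))) = 0" if J: "J \<in> Pow {..<v}" for J
        proof (rule ccontr)
          assume nz: "scal (e J) (\<kappa> (\<alpha> (ext_mono J))) \<noteq> 0"
          then have n1: "e J \<noteq> 0" by auto
          have "evR v \<kappa> \<alpha> (cm J) \<noteq> 0" using nz k_ext_mono[OF a, of J] J by auto
          then obtain b where b: "b \<in> Poly_Mapping.keys (evR v \<kappa> \<alpha> (cm J))" by (metis all_not_in_conv keys_eq_empty)
          then have "b \<in> S" using EA.supp_inD(1)[OF evR_supp[OF a]] by blast
          then have "- int (card (cm J)) + (j + int v) = d" using h[OF b] dg by simp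
          moreover have "card (cm J) = v - card J" using J by (simp add: card_Diff_subset finite_subset)
          moreover have "card J \<le> v" using card_mono[of "{..<v}" J] J by simp
          ultimately have "int (card J) + j = d" by simp
          then show False using eJ[OF n1] s by simp
        qed
        then have "\<kappa> (\<alpha> e) = 0" unfolding expand[OF a ec] by (intro sum.neutral) blast
        then show ?thesis using k_zero_iff[OF HomED(2)[OF a ec]] by blast
      qed
      then show "\<alpha> \<in> hpart (HomE v M j) d" using a unfolding hpart_HomE by blast
    qed
  qed
qed (use smult_HomE in auto)

end

section \<open>From coordinates to minimal models\<close>

text \<open>A complex in coordinates: in the basis \<open>S\<close> its differential is \<open>dB\<close> and the variables act by the
  matrices \<open>Y\<close>, up to the alternating sign of the total complex. Both the given complex and the
  cohomology modules, viewed as complexes with one term, are of this kind.\<close>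

definition coord_family ::
  "'s graded_ring \<Rightarrow> ('k::field \<Rightarrow> 's) \<Rightarrow> (nat \<Rightarrow> 's) \<Rightarrow> nat \<Rightarrow> int \<Rightarrow> 'k \<Rightarrow> ('s, 'x) gcomplex \<Rightarrow> 'a idx set \<Rightarrow>
    (int \<Rightarrow> int \<Rightarrow> 'x \<Rightarrow> ('a idx \<Rightarrow>\<^sub>0 'k)) \<Rightarrow> (nat \<Rightarrow> 'a idx \<Rightarrow> ('a idx \<Rightarrow>\<^sub>0 'k)) \<Rightarrow> bool" where
  "coord_family B kc yv v eta eps F S \<kappa> Y \<longleftrightarrow> (\<forall>i. pre_graded B (Ob F i)) \<and>
     (\<forall>i j. kcoord kc (Ob F i) j (bsi S i j) (\<kappa> i j)) \<and>
     (\<forall>i j. \<forall>x\<in>hpart (Ob F i) j. Df F i x \<in> hpart (Ob F (i + 1)) j \<and> \<kappa> (i + 1) j (Df F i x) = lin_ext dB (\<kappa> i j x)) \<and>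
     (\<forall>k<v. \<forall>i j. \<forall>x\<in>hpart (Ob F i) j.
        lin_ext (Y k) (\<kappa> i j x) = scal (if even i then eps else - eps) (\<kappa> i (j + eta) (yv k \<odot>\<^bsub>Ob F i\<^esub> x))) \<and>
     (\<forall>k<v. \<forall>t i j a. Poly_Mapping.keys (Y k (t, i, j, a)) \<subseteq> {(t', i', j', a'). i' = i})"

lemma coord_familyD:
  assumes "coord_family B kc yv v eta eps F S \<kappa> Y"
  shows "pre_graded B (Ob F i)" "kcoord kc (Ob F i) j (bsi S i j) (\<kappa> i j)"
    "x \<in> hpart (Ob F i) j \<Longrightarrow> Df F i x \<in> hpart (Ob F (i + 1)) j"
    "x \<in> hpart (Ob F i) j \<Longrightarrow> \<kappa> (i + 1) j (Df F i x) = lin_ext dB (\<kappa> i j x)"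
    "k < v \<Longrightarrow> x \<in> hpart (Ob F i) j \<Longrightarrow>
       lin_ext (Y k) (\<kappa> i j x) = scal (if even i then eps else - eps) (\<kappa> i (j + eta) (yv k \<odot>\<^bsub>Ob F i\<^esub> x))"
    "k < v \<Longrightarrow> Poly_Mapping.keys (Y k (t, i, j, a)) \<subseteq> {(t', i', j', a'). i' = i}"
proof -
  note c = assms[unfolded coord_family_def]
  show "pre_graded B (Ob F i)" by (rule spec[OF conjunct1[OF c]])
  show "kcoord kc (Ob F i) j (bsi S i j) (\<kappa> i j)" by (rule spec[OF spec[OF conjunct1[OF conjunct2[OF c]]]])
  note d = bspec[OF spec[OF spec[OF conjunct1[OF conjunct2[OF conjunct2[OF c]]]]]]
  show "Df F i x \<in> hpart (Ob F (i + 1)) j" if "x \<in> hpart (Ob F i) j" by (rule conjunct1[OF d[OF that]])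
  show "\<kappa> (i + 1) j (Df F i x) = lin_ext dB (\<kappa> i j x)" if "x \<in> hpart (Ob F i) j" by (rule conjunct2[OF d[OF that]])
  note e = conjunct2[OF conjunct2[OF conjunct2[OF c]]]
  show "lin_ext (Y k) (\<kappa> i j x) = scal (if even i then eps else - eps) (\<kappa> i (j + eta) (yv k \<odot>\<^bsub>Ob F i\<^esub> x))"
    if "k < v" "x \<in> hpart (Ob F i) j" by (rule bspec[OF spec[OF spec[OF mp[OF spec[OF conjunct1[OF e]] that(1)]]] that(2)])
  show "Poly_Mapping.keys (Y k (t, i, j, a)) \<subseteq> {(t', i', j', a'). i' = i}" if "k < v"
    by (rule spec[OF spec[OF spec[OF spec[OF mp[OF spec[OF conjunct2[OF e]] that]]]]])
qed

context monomial_algebra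
begin

text \<open>On harmonic indices \<open>dB\<close> vanishes, so the differential of the sum does not mix the summands.\<close>

lemma direct_sum_coords:
  fixes S :: "'c idx set"
  assumes C: "\<And>i. \<exists>F. coords_complex (C i) {b \<in> S. fst (snd b) = i} c Y F"
    and S: "\<And>b. b \<in> S \<Longrightarrow> fst b = Harm"
    and Yk: "\<And>k t i j a. k < v \<Longrightarrow> Poly_Mapping.keys (Y k (t, i, j, a)) \<subseteq> {(t', i', j', a'). i' = i}"
  shows "\<exists>F. coords_complex (direct_sum_complex C) S c Y F"
proof -
  let ?S = "\<lambda>i. {b \<in> S. fst (snd b) = i}"
  have "\<forall>i. \<exists>F. coords_complex (C i) (?S i) c Y F" using C by blast
  from choice[OF this] obtain F where FF: "\<forall>i. coords_complex (C i) (?S i) c Y (F i)" ..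
  then have F: "coords_complex (C i) (?S i) c Y (F i)" for i by (rule spec)
  have eq: "bsi S i (eta * (n - i)) = basis_at (?S i) n" for i n
    using eta by (auto simp: bsi_def basis_at_def)
  have cs: "coords (Ob (C i) n) (basis_at (?S i) n) (dgu c) (F i n)" for i n using F[of i] by (simp add: coords_complex_def)
  have dz: "pw dB (F i n x) = 0" if "x \<in> carrier (Ob (C i) n)" for i n x
  proof
    fix m
    have "Poly_Mapping.keys (F i n x m) \<subseteq> basis_at (?S i) n" by (rule supp_inD(1)[OF coordsD(9)[OF cs that]])
    then have "lin_ext dB (F i n x m) = lin_ext (\<lambda>b. 0) (F i n x m)"
      by (intro lin_ext_cong) (use S in \<open>fastforce simp: basis_at_def dB_def\<close>)
    then show "pw dB (F i n x) m = 0 m" by (simp add: pw_def)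
  qed
  show ?thesis
  proof (rule assembly[where T = "\<lambda>n i. Ob (C i) n" and ev = "\<lambda>n i. F i n"])
    show "Ob (direct_sum_complex C) n = direct_sum (\<lambda>i. Ob (C i) n)" for n by (simp add: direct_sum_complex_def)
    show "coords (Ob (C i) n) (bsi S i (eta * (n - i))) (dgu c) (F i n)" for n i unfolding eq by (rule cs)
    fix n \<phi> i assume p: "\<phi> \<in> carrier (Ob (direct_sum_complex C) n)"
    then have pc: "\<phi> i \<in> carrier (Ob (C i) n)" for i by (simp add: direct_sum_complex_def direct_sum_def)
    have D: "Df (direct_sum_complex C) n \<phi> i = Df (C i) n (\<phi> i)" by (simp add: direct_sum_complex_def)
    show "Df (direct_sum_complex C) n \<phi> i \<in> carrier (Ob (C i) (n + 1))"
      using F[of i] pc by (simp add: coords_complex_def D)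
    show "F i (n + 1) (Df (direct_sum_complex C) n \<phi> i) = pw dB (F (i - 1) n (\<phi> (i - 1))) + del Y (F i n (\<phi> i))"
      using F[of i] pc by (simp add: coords_complex_def D dz)
  qed (rule Yk)
qed

end

lemma kcoord_zero:
  assumes "kcoord kc M j S \<kappa>" "\<zero>\<^bsub>M\<^esub> \<in> hpart M j" "\<zero>\<^bsub>M\<^esub> \<oplus>\<^bsub>M\<^esub> \<zero>\<^bsub>M\<^esub> = \<zero>\<^bsub>M\<^esub>"
  shows "\<kappa> \<zero>\<^bsub>M\<^esub> = 0"
  using kcoordD(2)[OF assms(1,2,2)] assms(3) by simp

context kcomplex_y
begin

lemma bsi_bs: "bsi bs i j = bsb i j" by (simp add: bsi_def bsb_def)

lemma Yc_block: "k < v \<Longrightarrow> Poly_Mapping.keys (Yc k (t, i, j, a)) \<subseteq> {(t', i', j', a'). i' = i}"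
  using Y_keys[of k t i j a] by auto

lemma YH_block: "k < v \<Longrightarrow> Poly_Mapping.keys (YH k (t, i, j, a)) \<subseteq> {(t', i', j', a'). i' = i}"
  unfolding YH_def by (rule keys_lin_ext) (use Yc_block[of k t i j a] in \<open>auto simp: pB_def split: if_splits\<close>)

lemma coord_family_G: "coord_family B kc yv v eta eps G bs kap Yc"
  unfolding coord_family_def
  using pg kcoord_kap d_hpart kap_d Yc_block by (auto simp: bsi_bs Yc_kap alt_eps_def)

text \<open>The coordinates of the complex concentrated in degree \<open>i\<close> with term the cohomology module.\<close>

definition kapO :: "int \<Rightarrow> int \<Rightarrow> int \<Rightarrow> 'a set \<Rightarrow> ('a idx \<Rightarrow>\<^sub>0 'k)" where
  "kapO i i' j X = (if i' = i then kapH i j X else 0)"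

lemma coord_family_one_term:
  "coord_family B kc yv v eta eps (one_term i (H i)) {b \<in> bsH. fst (snd b) = i} (kapO i) YH"
proof -
  interpret L: left_module B "H i" by (rule left_module_H)
  have O: "Ob (one_term i (H i)) i' = (if i' = i then H i else zero_part (H i))" for i' by (simp add: one_term_def)
  have D: "Df (one_term i (H i)) i' x = \<zero>\<^bsub>H i\<^esub>" for i' x by (simp add: one_term_def)
  have zh: "\<zero>\<^bsub>H i\<^esub> \<in> hpart (H i) j" for j
    using additive_subgroup.zero_closed[of "hpart (H i) j" "H i"] pre_graded_H[of i] by (simp add: pre_graded_def)
  have kz: "kapH i j \<zero>\<^bsub>H i\<^esub> = 0" for j by (rule kcoord_zero[OF kcoord_kapH zh]) simp
  have bs: "bsi {b \<in> bsH. fst (snd b) = i} i' j = (if i' = i then bsHb i j else {})" for i' j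
    by (auto simp: bsi_def bsH_def bsHb_def bsb_def)
  have zc: "kcoord kc (zero_part (H i)) j {} (\<lambda>X. 0 :: 'a idx \<Rightarrow>\<^sub>0 'k)" for j
    by (auto simp: kcoord_def zero_part_def bij_betw_def)
  have dk: "lin_ext dB (kapH i j X) = 0" if "X \<in> hpart (H i) j" for j X
  proof -
    have "Poly_Mapping.keys (kapH i j X) \<subseteq> bsHb i j" by (rule kcoordD(4)[OF kcoord_kapH that])
    then have "lin_ext dB (kapH i j X) = lin_ext (\<lambda>b. 0) (kapH i j X)"
      by (intro lin_ext_cong) (auto simp: bsHb_def dB_def)
    then show ?thesis by simp
  qed
  show ?thesis unfolding coord_family_def
  proof (intro conjI allI ballI impI)
    fix i' show "pre_graded B (Ob (one_term i (H i)) i')"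
      by (simp add: O pre_graded_H pre_graded_zero_part)
    fix j show "kcoord kc (Ob (one_term i (H i)) i') j (bsi {b \<in> bsH. fst (snd b) = i} i' j) (kapO i i' j)"
    proof (cases "i' = i")
      case True
      have "kapO i i j = kapH i j" by (rule ext) (simp add: kapO_def)
      then show ?thesis using True kcoord_kapH by (simp add: O bs)
    next
      case False
      then have "kapO i i' j = (\<lambda>X. 0)" by (simp add: kapO_def fun_eq_iff)
      then show ?thesis using False zc by (simp add: O bs)
    qed
    fix x assume x: "x \<in> hpart (Ob (one_term i (H i)) i') j"
    show "Df (one_term i (H i)) i' x \<in> hpart (Ob (one_term i (H i)) (i' + 1)) j"
      by (simp add: O D zh) (simp add: zero_part_def)
    show "kapO i (i' + 1) j (Df (one_term i (H i)) i' x) = lin_ext dB (kapO i i' j x)"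
      using x dk by (auto simp: kapO_def D kz O)
  next
    fix k i' j x assume k: "k < v" and x: "x \<in> hpart (Ob (one_term i (H i)) i') j"
    show "lin_ext (YH k) (kapO i i' j x) = scal (if even i' then eps else - eps) (kapO i i' (j + eta) (yv k \<odot>\<^bsub>Ob (one_term i (H i)) i'\<^esub> x))"
      using Yc_kapH[OF k, of x i j] x by (auto simp: kapO_def O alt_eps_def)
  qed (use YH_block in blast)
qed

text \<open>Basis elements are nonzero, since they are independent; in a degree where the complex vanishes there
  are none.\<close>

lemma basis_bounded_below:
  assumes lb: "\<And>i. i < m0 \<Longrightarrow> carrier (Ob G i) = {\<zero>\<^bsub>Ob G i\<^esub>}"
  shows "\<forall>t i j a. (t, i, j, a) \<in> bs \<longrightarrow> m0 \<le> i"
proof -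
  have ne: "\<zero>\<^bsub>Ob G i\<^esub> \<notin> C" if "rel_basis i N Z C" "\<zero>\<^bsub>Ob G i\<^esub> \<in> N" for i N Z C
  proof
    assume "\<zero>\<^bsub>Ob G i\<^esub> \<in> C"
    moreover have "K.comb i (Poly_Mapping.single \<zero>\<^bsub>Ob G i\<^esub> 1) = \<zero>\<^bsub>Ob G i\<^esub>"
      by (simp add: K.comb_single K.sm_zero_right)
    ultimately have "Poly_Mapping.single \<zero>\<^bsub>Ob G i\<^esub> (1::'k) = 0"
      using that unfolding rel_basis_def by (metis empty_subsetI insert_subset keys_single one_neq_zero)
    then show False by (metis lookup_single_eq lookup_zero one_neq_zero)
  qed
  have z: "\<zero>\<^bsub>Ob G i\<^esub> \<in> Zs i j" "\<zero>\<^bsub>Ob G i\<^esub> \<in> Bs i j" for i j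
    using Zs_subspace[of i j] Bs_subspace[of i j] unfolding K.subspace_def by auto
  have "a \<noteq> \<zero>\<^bsub>Ob G i\<^esub>" if "a \<in> Cb i j \<or> a \<in> Hb i j" for a i j
    using ne[OF Cb z(1)] ne[OF Hb z(2)] that by blast
  moreover have "a \<in> carrier (Ob G i)" if "a \<in> Cb i j \<or> a \<in> Hb i j" for a i j
    using that Cb_sub Hb_sub(2) hcl by blast
  ultimately have "m0 \<le> i" if "a \<in> Cb i j \<or> a \<in> Hb i j" for a i j
    using lb[of i] that by (metis not_le singletonD)
  then show ?thesis by (fastforce simp: bs_def)
qed

text \<open>The common form of the two statements, for a total complex \<open>T\<close> which has the coordinates of the given
  complex and a sum \<open>TH\<close> which has those of the cohomology.\<close>

lemma linear_strand_theorem: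
  fixes T :: "('r, 't) gcomplex" and TH :: "('r, 'u) gcomplex" and cc :: int
  assumes lb: "left_bounded G"
    and T: "\<exists>F. coords_complex T bs cc Yc F" and TH: "\<exists>F. coords_complex TH bsH cc YH F"
  shows "\<exists>X :: ('r, int \<times> 'a) free_data. minimal_model A T X"
    and "\<And>X :: ('r, 'b) free_data. minimal_model A T X \<Longrightarrow>
       chain_isomorphic A (free_complex_of A (linear_part A X)) TH"
proof -
  have iT: "iso_complex A T (total_complex bs cc Yc)" and oT: "op_closed A T" using T coords_complex_iso by blast+
  have iH: "iso_complex A TH (total_complex bsH cc YH)" using TH coords_complex_iso by blast
  have oC: "op_closed A (total_complex bs cc Yc)" by (rule op_closed_iso[OF iT oT]) (auto simp: hpart_Tm)
  obtain m0 where m0: "\<And>i. i < m0 \<Longrightarrow> carrier (Ob G i) = {\<zero>\<^bsub>Ob G i\<^esub>}" using lb by (auto simp: left_bounded_def)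
  have bb: "\<forall>t i j a. (t, i, j, a) \<in> bs \<longrightarrow> m0 \<le> i" by (rule basis_bounded_below) (rule m0)
  note mm = minimal_model_exists[OF bb, of cc]
  have "homotopy_equivalent A (free_complex_of A (Xmin cc)) T"
    by (rule homotopy_equivalent_iso_right[OF conjunct2[OF mm] iso_complex_sym[OF iT] oC])
  then show "\<exists>X :: ('r, int \<times> 'a) free_data. minimal_model A T X" using mm unfolding minimal_model_def by blast
  fix X :: "('r, 'b) free_data" assume "minimal_model A T X"
  then have X: "minimal_free_data A X" "homotopy_equivalent A (free_complex_of A X) T" by (auto simp: minimal_model_def)
  have "homotopy_equivalent A (free_complex_of A X) (total_complex bs cc Yc)"
    by (rule homotopy_equivalent_iso_right[OF X(2) iT oT])
  from linear_part_minimal_model[OF X(1) this]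
  show "chain_isomorphic A (free_complex_of A (linear_part A X)) TH"
    by (intro chain_isomorphic_if_iso_complex iso_complex_trans[OF _ iso_complex_sym[OF iH]])
qed

end

section \<open>The functor R in coordinates\<close>

text \<open>Moving \<open>k\<close> past all elements of \<open>X\<close>.\<close>

lemma ext_sign_anticommute:
  assumes "finite X" "k \<notin> X"
  shows "ext_sign X {k} * ext_sign {k} X = (- 1 :: 'k::field) ^ card X"
  using assms
proof (induction X rule: finite_induct)
  case (insert x X)
  have "ext_sign ({x} \<union> X) {k} = (ext_sign {x} {k} * ext_sign X {k} :: 'k)"
    by (rule ext_sign_Un_left) (use insert.hyps in auto)
  moreover have "ext_sign {k} ({x} \<union> X) = (ext_sign {k} {x} * ext_sign {k} X :: 'k)"
    by (rule ext_sign_Un_right) (use insert.hyps in auto)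
  moreover have "ext_sign {x} {k} = - (ext_sign {k} {x} :: 'k)" by (rule ext_sign_swap) (use insert.prems in auto)
  ultimately have "ext_sign (insert x X) {k} * ext_sign {k} (insert x X) =
      - ((ext_sign {k} {x} * ext_sign {k} {x}) * (ext_sign X {k} * ext_sign {k} X) :: 'k)"
    by (simp add: mult_ac)
  then show ?case using insert by simp
qed simp

lemma sign_power_eq: "even (a + b) \<Longrightarrow> (- 1 :: 'k::field) ^ a = (- 1) ^ b"
  by (cases "even a") auto

text \<open>The sign by which \<open>evR\<close> fails to turn the differential of the functor \<open>R\<close> into \<open>del\<close>. It depends on \<open>v\<close>
  only: by \<open>ext_sign_anticommute\<close> the two sides compare \<open>card m - 1\<close> with \<open>v - card m\<close> transpositions.\<close>

lemma complement_sign: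
  assumes m: "m \<subseteq> {..<v}" and k: "k \<in> m"
  shows "ext_sign (m - {k}) {k} * ext_sign (insert k ({..<v} - m)) (m - {k}) =
    (- 1 :: 'k::field) ^ (v + 1) * (ext_sign ({..<v} - m) m * ext_sign {k} ({..<v} - m))"
proof -
  let ?c = "{..<v} - m" and ?n = "m - {k}"
  have fin: "finite ?n" "finite ?c" using m by (auto intro: finite_subset)
  have s1: "ext_sign (insert k ?c) ?n = (ext_sign {k} ?n * ext_sign ?c ?n :: 'k)"
    using ext_sign_Un_left[of "{k}" ?c ?n] fin k by simp
  have "ext_sign ?c ({k} \<union> ?n) = (ext_sign ?c {k} * ext_sign ?c ?n :: 'k)"
    by (rule ext_sign_Un_right) (use fin in auto)
  moreover have "{k} \<union> ?n = m" using k by auto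
  ultimately have s2: "ext_sign ?c m = (ext_sign ?c {k} * ext_sign ?c ?n :: 'k)" by simp
  have c1: "ext_sign ?n {k} * ext_sign {k} ?n = (- 1 :: 'k) ^ card ?n" by (rule ext_sign_anticommute) (use fin in auto)
  have c2: "ext_sign ?c {k} * ext_sign {k} ?c = (- 1 :: 'k) ^ card ?c" by (rule ext_sign_anticommute) (use fin k in auto)
  have fm: "finite m" using m by (rule finite_subset) simp
  have cc: "card ?c = v - card m" using m fm by (simp add: card_Diff_subset)
  have cn: "Suc (card ?n) = card m" using k fm by (metis card_Suc_Diff1)
  have le: "card m \<le> v" using card_mono[OF _ m] by simp
  have "even (card ?n + (v + 1 + card ?c))" using cc cn le by presburger
  then have p: "(- 1 :: 'k) ^ card ?n = (- 1) ^ (v + 1 + card ?c)" by (rule sign_power_eq)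
  have "ext_sign ?n {k} * ext_sign (insert k ?c) ?n = (ext_sign ?n {k} * ext_sign {k} ?n) * (ext_sign ?c ?n :: 'k)"
    unfolding s1 by (simp only: mult.assoc)
  also have "\<dots> = (- 1) ^ (v + 1) * ((- 1) ^ card ?c * ext_sign ?c ?n)"
    unfolding c1 p power_add by (simp only: mult_ac)
  also have "\<dots> = (- 1) ^ (v + 1) * (ext_sign ?c m * ext_sign {k} ?c)"
    unfolding c2[symmetric] s2 by (simp only: mult_ac)
  finally show ?thesis .
qed

lemma sym_var_part: "k < v \<Longrightarrow> sym_var k \<in> hom_part (Sym v) 1"
proof -
  assume k: "k < v"
  interpret monomial_algebra "Sym v :: ('k::field) sym graded_ring" Poly_Mapping.lookup "{m. Poly_Mapping.keys m \<subseteq> {..<v}}" mono_divisors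
     "\<lambda>_ _. 1" 0 "\<lambda>k. Poly_Mapping.single k 1" v mono_deg "- 1" 1 by (rule monomial_algebra_Sym)
  show ?thesis
    using k by (auto simp: hom_part_iff carrier_Sym sym_var_def lookup_single when_def mono_deg_single split: if_splits)
qed

lemma ext_gen_part: "k < v \<Longrightarrow> (ext_gen k :: ('k::field) ext) \<in> hom_part (Ext v) (- 1)"
  by (auto simp: hom_part_def Ext_def ext_gen_def)

context hom_piece
begin

text \<open>At the complement of \<open>m\<close> only the variables in \<open>m\<close> contribute, and multiplying the complement by such a
  variable gives the complement of \<open>m - {k}\<close>; the signs combine by \<open>complement_sign\<close>.\<close>

lemma R_diff_coords:
  assumes P': "hom_piece v M (j + 1) S' \<kappa>'" and a: "\<alpha> \<in> carrier (HomE v M j)"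
    and Y: "\<And>k x. k < v \<Longrightarrow> x \<in> hpart M j \<Longrightarrow> lin_ext (Y k) (\<kappa> x) = scal s (\<kappa>' (sym_var k \<odot>\<^bsub>M\<^esub> x))"
  shows "R_diff v M \<alpha> \<in> carrier (HomE v M (j + 1))"
    and "EA.del Y (evR v \<kappa> \<alpha>) = (\<lambda>m. scal (s * (- 1) ^ (v + 1)) (evR v \<kappa>' (R_diff v M \<alpha>) m))"
proof -
  interpret P': hom_piece v M "j + 1" S' \<kappa>' by (rule P')
  have yp: "(sym_var k :: 'k sym) \<in> hom_part (Sym v) 1" if "k < v" for k by (rule sym_var_part[OF that])
  have yc: "(sym_var k :: 'k sym) \<in> carrier (Sym v)" if "k < v" for k
    using yp[OF that] by (simp add: hom_part_def)
  have yh: "sym_var k \<odot>\<^bsub>M\<^esub> x \<in> hpart M (j + 1)" if "k < v" "x \<in> hpart M j" for k x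
  proof -
    have "sym_var k \<odot>\<^bsub>M\<^esub> x \<in> hpart M (1 + j)" using pg yp[OF that(1)] that(2) unfolding pre_graded_def by blast
    then show ?thesis by (simp add: add.commute)
  qed
  define u where "u k x = \<kappa>' (sym_var k \<odot>\<^bsub>M\<^esub> x)" for k x
  have u_add: "u k (x \<oplus>\<^bsub>M\<^esub> y) = u k x + u k y" if "k < v" "x \<in> hpart M j" "y \<in> hpart M j" for k x y
    using that by (simp add: u_def L.smult_r_distr yc hc P'.kD(2) yh)
  have u_scal: "u k (sym_const c \<odot>\<^bsub>M\<^esub> x) = scal c (u k x)" if "k < v" "x \<in> hpart M j" for k x c
  proof -
    have cc: "sym_const c \<in> carrier (Sym v)" by (simp add: Sym_def sym_const_def)
    have e: "sym_var k \<otimes>\<^bsub>Sym v\<^esub> sym_const c = (sym_const c \<otimes>\<^bsub>Sym v\<^esub> sym_var k :: 'k sym)"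
      by (simp add: Sym_def mult.commute)
    have "sym_var k \<odot>\<^bsub>M\<^esub> (sym_const c \<odot>\<^bsub>M\<^esub> x) = sym_const c \<odot>\<^bsub>M\<^esub> (sym_var k \<odot>\<^bsub>M\<^esub> x)"
      using L.smult_assoc[OF yc[OF that(1)] cc hc[OF that(2)]] L.smult_assoc[OF cc yc[OF that(1)] hc[OF that(2)]] e by simp
    then show ?thesis using that by (simp add: u_def P'.kD(3) yh)
  qed
  have u_zero: "u k \<zero>\<^bsub>M\<^esub> = 0" if "k < v" for k using u_add[OF that h_zero h_zero] by simp
  have gc: "ext_gen k \<in> carrier E" if "k < v" for k
  proof -
    have "(ext_gen k :: 'k ext) \<in> hom_part (Ext v) (- 1)" by (rule ext_gen_part[OF that])
    then show ?thesis by (simp add: hom_part_def)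
  qed
  have ge: "ext_gen k \<otimes>\<^bsub>E\<^esub> e \<in> carrier E" if "k < v" "e \<in> carrier E" for k e using gc that by blast
  have ah: "\<alpha> e \<in> hpart M j" if "e \<in> carrier E" for e by (rule HomED(2)[OF a that])
  have R: "R_diff v M \<alpha> e \<in> hpart M (j + 1) \<and> \<kappa>' (R_diff v M \<alpha> e) = (\<Sum>k<v. u k (\<alpha> (ext_gen k \<otimes>\<^bsub>E\<^esub> e)))"
    if e: "e \<in> carrier E" for e
    using P'.k_finsum[of "{..<v}" "\<lambda>k. sym_var k \<odot>\<^bsub>M\<^esub> \<alpha> (ext_gen k \<otimes>\<^bsub>E\<^esub> e)"] e
    by (simp add: R_diff_def u_def yh ah ge)
  have Rr: "R_diff v M \<alpha> = (\<lambda>e\<in>carrier E. R_diff v M \<alpha> e)" by (rule ext) (simp add: R_diff_def)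
  have keq: "x = y" if "\<kappa> x = \<kappa> y" "x \<in> hpart M j" "y \<in> hpart M j" for x y using kD(5) that by blast
  have a_add: "\<alpha> (e \<oplus>\<^bsub>E\<^esub> e') = \<alpha> e \<oplus>\<^bsub>M\<^esub> \<alpha> e'" if "e \<in> carrier E" "e' \<in> carrier E" for e e'
    by (rule keq) (use HomED(3)[OF a that] that in \<open>simp_all add: kD(2) ah h_add\<close>)
  have a_sc: "\<alpha> (ext_const c \<otimes>\<^bsub>E\<^esub> e) = sym_const c \<odot>\<^bsub>M\<^esub> \<alpha> e" if "e \<in> carrier E" for c e
    by (rule keq) (use HomED(4)[OF a that] that const_closed[of c] in \<open>simp_all add: kD(3) ah h_scal\<close>)
  have gcomm: "ext_gen k \<otimes>\<^bsub>E\<^esub> (ext_const c \<otimes>\<^bsub>E\<^esub> e) = ext_const c \<otimes>\<^bsub>E\<^esub> (ext_gen k \<otimes>\<^bsub>E\<^esub> e)" if "k < v" "e \<in> carrier E" for k c e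
    using RE.m_assoc[OF gc[OF that(1)] const_closed that(2), of c] RE.m_assoc[OF const_closed gc[OF that(1)] that(2), of c]
    by (simp add: ext_const_mult ext_mult_const gc[OF that(1)])
  show "R_diff v M \<alpha> \<in> carrier (HomE v M (j + 1))"
  proof (subst Rr, rule P'.HomE_restrictI)
    fix e assume e: "e \<in> carrier E"
    show "R_diff v M \<alpha> e \<in> hpart M (j + 1)" using R[OF e] by blast
    fix c
    have "ext_const c \<otimes>\<^bsub>E\<^esub> e \<in> carrier E" using const_closed e by blast
    then have "\<kappa>' (R_diff v M \<alpha> (ext_const c \<otimes>\<^bsub>E\<^esub> e)) = (\<Sum>k<v. u k (\<alpha> (ext_gen k \<otimes>\<^bsub>E\<^esub> (ext_const c \<otimes>\<^bsub>E\<^esub> e))))"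
      using R by blast
    also have "\<dots> = (\<Sum>k<v. scal c (u k (\<alpha> (ext_gen k \<otimes>\<^bsub>E\<^esub> e))))"
      by (rule sum.cong[OF refl]) (simp add: gcomm e a_sc ge u_scal ah)
    also have "\<dots> = scal c (\<kappa>' (R_diff v M \<alpha> e))" using R[OF e] by (simp add: scal_sum)
    finally show "\<kappa>' (R_diff v M \<alpha> (ext_const c \<otimes>\<^bsub>E\<^esub> e)) = scal c (\<kappa>' (R_diff v M \<alpha> e))" .
  next
    fix e e' assume e: "e \<in> carrier E" "e' \<in> carrier E"
    have "\<kappa>' (R_diff v M \<alpha> (e \<oplus>\<^bsub>E\<^esub> e')) = (\<Sum>k<v. u k (\<alpha> (ext_gen k \<otimes>\<^bsub>E\<^esub> (e \<oplus>\<^bsub>E\<^esub> e'))))"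
      using R[OF RE.a_closed[OF e]] by blast
    also have "\<dots> = (\<Sum>k<v. u k (\<alpha> (ext_gen k \<otimes>\<^bsub>E\<^esub> e)) + u k (\<alpha> (ext_gen k \<otimes>\<^bsub>E\<^esub> e')))"
      by (rule sum.cong[OF refl]) (simp add: RE.r_distr gc e a_add ge u_add ah)
    also have "\<dots> = \<kappa>' (R_diff v M \<alpha> e) + \<kappa>' (R_diff v M \<alpha> e')" using R[OF e(1)] R[OF e(2)] by (simp add: sum.distrib)
    finally show "\<kappa>' (R_diff v M \<alpha> (e \<oplus>\<^bsub>E\<^esub> e')) = \<kappa>' (R_diff v M \<alpha> e) + \<kappa>' (R_diff v M \<alpha> e')" .
  qed
  show "EA.del Y (evR v \<kappa> \<alpha>) = (\<lambda>m. scal (s * (- 1) ^ (v + 1)) (evR v \<kappa>' (R_diff v M \<alpha>) m))"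
  proof
    fix m :: "nat set"
    show "EA.del Y (evR v \<kappa> \<alpha>) m = scal (s * (- 1) ^ (v + 1)) (evR v \<kappa>' (R_diff v M \<alpha>) m)"
    proof (cases "m \<subseteq> {..<v}")
      case False
      then have "EA.vr m = {}" by (simp add: EA.vr_def)
      then show ?thesis using False by (simp add: EA.del_def evR_def)
    next
      case m: True
      let ?c = "cm m"
      have vr: "EA.vr m = m" using m by (auto simp: EA.vr_def)
      have ec: "ext_mono ?c \<in> carrier E" by (rule ext_mono_closed) auto
      have "\<kappa>' (R_diff v M \<alpha> (ext_mono ?c)) = (\<Sum>k<v. u k (\<alpha> (ext_gen k \<otimes>\<^bsub>E\<^esub> ext_mono ?c)))" using R[OF ec] by blast
      also have "\<dots> = (\<Sum>k\<in>m. u k (\<alpha> (ext_gen k \<otimes>\<^bsub>E\<^esub> ext_mono ?c)))"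
      proof (rule sum.mono_neutral_right)
        show "\<forall>k\<in>{..<v} - m. u k (\<alpha> (ext_gen k \<otimes>\<^bsub>E\<^esub> ext_mono ?c)) = 0"
        proof
          fix k assume k: "k \<in> {..<v} - m"
          then have "ext_gen k \<otimes>\<^bsub>E\<^esub> ext_mono ?c = \<zero>\<^bsub>E\<^esub>" by (subst ext_gen_mult_ext_mono) auto
          moreover have "\<alpha> \<zero>\<^bsub>E\<^esub> = \<zero>\<^bsub>M\<^esub>"
          proof -
            have "\<kappa> (\<alpha> \<zero>\<^bsub>E\<^esub>) = 0" using HomED(3)[OF a RE.zero_closed RE.zero_closed] by simp
            then show ?thesis using k_zero_iff ah by blast
          qed
          ultimately show "u k (\<alpha> (ext_gen k \<otimes>\<^bsub>E\<^esub> ext_mono ?c)) = 0" using k u_zero by simp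
        qed
      qed (use m in auto)
      also have "\<dots> = (\<Sum>k\<in>m. scal (ext_sign {k} ?c) (u k (\<alpha> (ext_mono (insert k ?c)))))"
      proof (rule sum.cong[OF refl])
        fix k assume k: "k \<in> m"
        then have kv: "k < v" using m by auto
        have ek: "ext_mono (insert k ?c) \<in> carrier E" using kv by (intro ext_mono_closed) auto
        have "ext_gen k \<otimes>\<^bsub>E\<^esub> ext_mono ?c = ext_const (ext_sign {k} ?c) \<otimes>\<^bsub>E\<^esub> ext_mono (insert k ?c)"
          using k kv by (subst ext_gen_mult_ext_mono) auto
        then show "u k (\<alpha> (ext_gen k \<otimes>\<^bsub>E\<^esub> ext_mono ?c)) = scal (ext_sign {k} ?c) (u k (\<alpha> (ext_mono (insert k ?c))))"
          by (simp add: a_sc[OF ek] u_scal[OF kv ah[OF ek]])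
      qed
      finally have k': "\<kappa>' (R_diff v M \<alpha> (ext_mono ?c)) = (\<Sum>k\<in>m. scal (ext_sign {k} ?c) (u k (\<alpha> (ext_mono (insert k ?c)))))" .
      have "EA.del Y (evR v \<kappa> \<alpha>) m = (\<Sum>k\<in>m. scal (ext_sign (m - {k}) {k}) (lin_ext (Y k) (evR v \<kappa> \<alpha> (m - {k}))))"
        by (simp add: EA.del_def vr EA.sg_def)
      also have "\<dots> = (\<Sum>k\<in>m. scal (s * (- 1) ^ (v + 1)) (scal (ext_sign ?c m * ext_sign {k} ?c) (u k (\<alpha> (ext_mono (insert k ?c))))))"
      proof (rule sum.cong[OF refl])
        fix k assume k: "k \<in> m"
        then have kv: "k < v" using m by auto
        have ek: "ext_mono (insert k ?c) \<in> carrier E" using kv by (intro ext_mono_closed) auto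
        have "cm (m - {k}) = insert k ?c" using k m by auto
        then have "evR v \<kappa> \<alpha> (m - {k}) = scal (ext_sign (insert k ?c) (m - {k})) (\<kappa> (\<alpha> (ext_mono (insert k ?c))))"
          using m by (auto simp: evR_def)
        then have "lin_ext (Y k) (evR v \<kappa> \<alpha> (m - {k})) = scal (ext_sign (insert k ?c) (m - {k}) * s) (u k (\<alpha> (ext_mono (insert k ?c))))"
          by (simp add: lin_ext_scal Y[OF kv ah[OF ek]] u_def)
        then have "scal (ext_sign (m - {k}) {k}) (lin_ext (Y k) (evR v \<kappa> \<alpha> (m - {k}))) =
          scal (s * (ext_sign (m - {k}) {k} * ext_sign (insert k ?c) (m - {k}))) (u k (\<alpha> (ext_mono (insert k ?c))))"
          by (simp add: mult_ac)
        then show "scal (ext_sign (m - {k}) {k}) (lin_ext (Y k) (evR v \<kappa> \<alpha> (m - {k}))) =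
          scal (s * (- 1) ^ (v + 1)) (scal (ext_sign ?c m * ext_sign {k} ?c) (u k (\<alpha> (ext_mono (insert k ?c)))))"
          unfolding complement_sign[OF m k] by (simp only: scal_simps mult.assoc)
      qed
      also have "\<dots> = scal (s * (- 1) ^ (v + 1)) (evR v \<kappa>' (R_diff v M \<alpha>) m)"
        using m by (simp only: evR_def if_True k' scal_sum scal_simps mult.assoc)
      finally show ?thesis .
    qed
  qed
qed

end

interpretation GE: monomial_algebra "Ext v :: ('k::field) ext graded_ring" "\<lambda>f. f" "Pow {..<v}" Pow ext_sign "{}" "\<lambda>k. {k}" v
     "\<lambda>I. - int (card I)" 1 "- 1" for v by (rule monomial_algebra_Ext)

interpretation GS: monomial_algebra "Sym v :: ('k::field) sym graded_ring" Poly_Mapping.lookup "{m. Poly_Mapping.keys m \<subseteq> {..<v}}" mono_divisors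
     "\<lambda>_ _. 1" 0 "\<lambda>k. Poly_Mapping.single k 1" v mono_deg "- 1" 1 for v by (rule monomial_algebra_Sym)

text \<open>Coordinates of the summands \<open>HomE v (Ob F i) (n - i)\<close> assemble to those of the total complex; the
  constant \<open>eps\<close> of \<open>coord_family\<close> is chosen to cancel the sign from \<open>R_diff_coords\<close>.\<close>

lemma R_coords:
  fixes F :: "(('k::field) sym, 'x) gcomplex" and S :: "'a idx set"
  assumes cf: "coord_family (Sym v) sym_const sym_var v 1 ((- 1) ^ (v + 1)) F S \<kappa> Y"
  shows "\<exists>Fm. GE.coords_complex v (bgg_R v F) S (int v) Y Fm"
proof -
  note CF = coord_familyD[OF cf]
  have hp: "hom_piece v (Ob F i) j (bsi S i j) (\<kappa> i j)" for i j
    by (intro hom_piece.intro coord_piece.intro coord_piece_axioms.intro scalars_Sym CF(1,2))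
  have cs: "GE.coords v (HomE v (Ob F i) j) (bsi S i j) (dgu (int v)) (evR v (\<kappa> i j))" for i j
    by (rule hom_piece.HomE_coords[OF hp]) (auto simp: bsi_def dgu_def)
  let ?T = "\<lambda>n i. HomE v (Ob F i) (n - i)" and ?ev = "\<lambda>n i. evR v (\<kappa> i (n - i))"
  have main: "Df (bgg_R v F) n \<phi> i \<in> carrier (?T (n + 1) i) \<and>
      ?ev (n + 1) i (Df (bgg_R v F) n \<phi> i) = GE.pw dB (?ev n (i - 1) (\<phi> (i - 1))) + GE.del v Y (?ev n i (\<phi> i))"
    if p: "\<And>i. \<phi> i \<in> carrier (?T n i)" for n \<phi> i
  proof -
    let ?H = "HomE v (Ob F i) (n + 1 - i)"
    interpret P: hom_piece v "Ob F (i - 1)" "n - (i - 1)" "bsi S (i - 1) (n - (i - 1))" "\<kappa> (i - 1) (n - (i - 1))" by (rule hp)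
    interpret Q: hom_piece v "Ob F i" "n - i" "bsi S i (n - i)" "\<kappa> i (n - i)" by (rule hp)
    interpret H: hom_piece v "Ob F i" "n + 1 - i" "bsi S i (n + 1 - i)" "\<kappa> i (n + 1 - i)" by (rule hp)
    have nj: "n - (i - 1) = n + 1 - i" "n - i + 1 = n + 1 - i" by simp_all
    note hcs = cs[of i "n + 1 - i"]
    interpret HA: abelian_group ?H by (rule GE.coords_abelian_group(1)[OF hcs])
    note pa = p[of "i - 1"]
    have pe: "\<phi> (i - 1) e \<in> hpart (Ob F (i - 1)) (n + 1 - i)" if "e \<in> carrier (Ext v)" for e
      using P.HomED(2)[OF pa that] by (simp only: nj)
    have dh: "Df F (i - 1) x \<in> hpart (Ob F i) (n + 1 - i)"
      and dk: "\<kappa> i (n + 1 - i) (Df F (i - 1) x) = lin_ext dB (\<kappa> (i - 1) (n + 1 - i) x)"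
      if "x \<in> hpart (Ob F (i - 1)) (n + 1 - i)" for x
      using CF(3,4)[OF that] by simp_all
    define \<beta> where "\<beta> = (\<lambda>e\<in>carrier (Ext v). Df F (i - 1) (\<phi> (i - 1) e))"
    have ec: "ext_const c \<otimes>\<^bsub>Ext v\<^esub> e \<in> carrier (Ext v)" if "e \<in> carrier (Ext v)" for c :: 'k and e
      using P.RE.m_closed[OF P.const_closed that] .
    have b: "\<beta> \<in> carrier ?H" unfolding \<beta>_def
    proof (rule H.HomE_restrictI)
      fix e e' :: "'k ext" and c assume e: "e \<in> carrier (Ext v)"
      show "Df F (i - 1) (\<phi> (i - 1) e) \<in> hpart (Ob F i) (n + 1 - i)" by (rule dh[OF pe[OF e]])
      show "\<kappa> i (n + 1 - i) (Df F (i - 1) (\<phi> (i - 1) (ext_const c \<otimes>\<^bsub>Ext v\<^esub> e))) =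
          scal c (\<kappa> i (n + 1 - i) (Df F (i - 1) (\<phi> (i - 1) e)))"
        using P.HomED(4)[OF pa e, of c] by (simp add: dk pe e ec lin_ext_scal nj)
      assume e': "e' \<in> carrier (Ext v)"
      show "\<kappa> i (n + 1 - i) (Df F (i - 1) (\<phi> (i - 1) (e \<oplus>\<^bsub>Ext v\<^esub> e'))) =
          \<kappa> i (n + 1 - i) (Df F (i - 1) (\<phi> (i - 1) e)) + \<kappa> i (n + 1 - i) (Df F (i - 1) (\<phi> (i - 1) e'))"
        using P.HomED(3)[OF pa e e'] by (simp add: dk pe e e' P.RE.a_closed lin_ext_add nj)
    qed
    have be: "evR v (\<kappa> i (n + 1 - i)) \<beta> = GE.pw dB (evR v (\<kappa> (i - 1) (n - (i - 1))) (\<phi> (i - 1)))"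
    proof
      fix m :: "nat set"
      have "(ext_mono ({..<v} - m) :: 'k ext) \<in> carrier (Ext v)" by (rule ext_mono_closed) auto
      then show "evR v (\<kappa> i (n + 1 - i)) \<beta> m = GE.pw dB (evR v (\<kappa> (i - 1) (n - (i - 1))) (\<phi> (i - 1))) m"
        by (simp add: evR_def GE.pw_def \<beta>_def dk pe lin_ext_scal nj)
    qed
    define s :: 'k where "s = (if even i then (- 1) ^ (v + 1) else - ((- 1) ^ (v + 1)))"
    have Ys: "lin_ext (Y k) (\<kappa> i (n - i) x) = scal s (\<kappa> i (n + 1 - i) (sym_var k \<odot>\<^bsub>Ob F i\<^esub> x))"
      if "k < v" "x \<in> hpart (Ob F i) (n - i)" for k x
      using CF(5)[OF that] by (simp only: nj s_def)
    have R: "R_diff v (Ob F i) (\<phi> i) \<in> carrier ?H"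
      "GE.del v Y (evR v (\<kappa> i (n - i)) (\<phi> i)) = (\<lambda>m. scal (s * (- 1) ^ (v + 1)) (evR v (\<kappa> i (n + 1 - i)) (R_diff v (Ob F i) (\<phi> i)) m))"
      using Q.R_diff_coords[OF hp[of i "n - i + 1", unfolded nj(2), folded nj(2)] p, of Y s] Ys
      by (simp_all add: nj)
    have s1: "s * (- 1) ^ (v + 1) = (if even i then 1 else - 1)" by (simp add: s_def power_mult_distrib[symmetric])
    have A: "alt_sign ?H i (R_diff v (Ob F i) (\<phi> i)) \<in> carrier ?H"
      "evR v (\<kappa> i (n + 1 - i)) (alt_sign ?H i (R_diff v (Ob F i) (\<phi> i))) = GE.del v Y (evR v (\<kappa> i (n - i)) (\<phi> i))"
    proof -
      show "alt_sign ?H i (R_diff v (Ob F i) (\<phi> i)) \<in> carrier ?H" using R(1) by (simp add: alt_sign_def)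
      show "evR v (\<kappa> i (n + 1 - i)) (alt_sign ?H i (R_diff v (Ob F i) (\<phi> i))) = GE.del v Y (evR v (\<kappa> i (n - i)) (\<phi> i))"
      proof (cases "even i")
        case True
        then show ?thesis unfolding R(2) s1 by (simp add: alt_sign_def)
      next
        case False
        have n: "scal (- 1) w = - w" for w :: "'a idx \<Rightarrow>\<^sub>0 'k" by (rule poly_mapping_eqI) simp
        show ?thesis unfolding R(2) s1 using False
          by (simp add: alt_sign_def GE.coords_abelian_group(2)[OF hcs R(1)] n fun_eq_iff)
      qed
    qed
    have D: "Df (bgg_R v F) n \<phi> i = \<beta> \<oplus>\<^bsub>?H\<^esub> alt_sign ?H i (R_diff v (Ob F i) (\<phi> i))"
      by (simp add: bgg_R_def Let_def \<beta>_def)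
    show ?thesis unfolding D using GE.coordsD(4)[OF hcs b A(1)] GE.coordsD(5)[OF hcs b A(1)] by (simp add: be A(2))
  qed
  show ?thesis
  proof (rule GE.assembly[where T = ?T and ev = ?ev])
    show Ob: "Ob (bgg_R v F) n = direct_sum (?T n)" for n by (simp add: bgg_R_def)
    show "GE.coords v (?T n i) (bsi S i (1 * (n - i))) (dgu (int v)) (?ev n i)" for n i using cs by simp
    fix n \<phi> i assume "\<phi> \<in> carrier (Ob (bgg_R v F) n)"
    then have p: "\<phi> i \<in> carrier (?T n i)" for i unfolding Ob by (simp add: direct_sum_def)
    show "Df (bgg_R v F) n \<phi> i \<in> carrier (?T (n + 1) i)" using main[OF p] by blast
    show "?ev (n + 1) i (Df (bgg_R v F) n \<phi> i) = GE.pw dB (?ev n (i - 1) (\<phi> (i - 1))) + GE.del v Y (?ev n i (\<phi> i))"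
      using main[OF p] by blast
  qed (rule CF(6))
qed

section \<open>The functor L in coordinates\<close>

text \<open>The module \<open>SymTensor v M j\<close> with the coordinates induced from the degree \<open>j\<close> part of \<open>M\<close>, applied to
  each coefficient.\<close>

locale tensor_piece = coord_piece "Ext v" ext_const M j S \<kappa>
  for v :: nat and M :: "(('k::field) ext, 'a) gmodule" and j :: int and S :: "'b set" and \<kappa> :: "'a \<Rightarrow> ('b \<Rightarrow>\<^sub>0 'k)"
begin

lemma SymTensor_simps:
  "\<zero>\<^bsub>SymTensor v M j\<^esub> = (\<lambda>m. \<zero>\<^bsub>M\<^esub>)"
  "q \<oplus>\<^bsub>SymTensor v M j\<^esub> r = (\<lambda>m. q m \<oplus>\<^bsub>M\<^esub> r m)"
  by (simp_all add: SymTensor_def Let_def)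

lemma mem_SymTensor:
  "q \<in> carrier (SymTensor v M j) \<longleftrightarrow> (\<forall>m. q m \<in> hpart M j) \<and> (\<lambda>m. \<kappa> (q m)) \<in> GS.supp_in v S"
proof (cases "\<forall>m. q m \<in> hpart M j")
  case True
  have z: "\<kappa> (q m) = 0 \<longleftrightarrow> q m = \<zero>\<^bsub>M\<^esub>" for m by (rule k_zero_iff) (use True in blast)
  have k: "Poly_Mapping.keys (\<kappa> (q m)) \<subseteq> S" for m by (rule kD(4)) (use True in blast)
  show ?thesis using True k by (simp add: SymTensor_def Let_def GS.supp_in_def z)
qed (auto simp: SymTensor_def Let_def)

lemma SymTensorD: "q \<in> carrier (SymTensor v M j) \<Longrightarrow> q m \<in> hpart M j"
  "q \<in> carrier (SymTensor v M j) \<Longrightarrow> (\<lambda>m. \<kappa> (q m)) \<in> GS.supp_in v S"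
  by (simp_all add: mem_SymTensor)

lemma SymTensor_outside:
  assumes "q \<in> carrier (SymTensor v M j)" "\<not> Poly_Mapping.keys m \<subseteq> {..<v}"
  shows "q m = \<zero>\<^bsub>M\<^esub>"
  using assms by (simp add: SymTensor_def Let_def)

lemma smult_SymTensor:
  assumes a: "a \<in> carrier (Sym v)" and q: "q \<in> carrier (SymTensor v M j)"
  shows "a \<odot>\<^bsub>SymTensor v M j\<^esub> q \<in> carrier (SymTensor v M j)"
    and "(\<lambda>m. \<kappa> ((a \<odot>\<^bsub>SymTensor v M j\<^esub> q) m)) = GS.act v a (\<lambda>m. \<kappa> (q m))"
proof -
  note qh = SymTensorD(1)[OF q]
  let ?K = "\<lambda>m. {l \<in> Poly_Mapping.keys a. \<exists>b. m = l + b}"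
  have sm: "(a \<odot>\<^bsub>SymTensor v M j\<^esub> q) m = (\<Oplus>\<^bsub>M\<^esub>l\<in>?K m. ext_const (Poly_Mapping.lookup a l) \<odot>\<^bsub>M\<^esub> q (m - l))" for m
    by (simp add: SymTensor_def Let_def)
  have fin: "finite (?K m)" for m by simp
  have h: "(a \<odot>\<^bsub>SymTensor v M j\<^esub> q) m \<in> hpart M j \<and>
      \<kappa> ((a \<odot>\<^bsub>SymTensor v M j\<^esub> q) m) = (\<Sum>l\<in>?K m. scal (Poly_Mapping.lookup a l) (\<kappa> (q (m - l))))" for m
    using k_finsum[OF fin[of m], of "\<lambda>l. ext_const (Poly_Mapping.lookup a l) \<odot>\<^bsub>M\<^esub> q (m - l)"]
    by (simp add: sm h_scal qh kD(3))
  show e: "(\<lambda>m. \<kappa> ((a \<odot>\<^bsub>SymTensor v M j\<^esub> q) m)) = GS.act v a (\<lambda>m. \<kappa> (q m))"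
  proof
    fix m :: "nat \<Rightarrow>\<^sub>0 nat"
    show "\<kappa> ((a \<odot>\<^bsub>SymTensor v M j\<^esub> q) m) = GS.act v a (\<lambda>m. \<kappa> (q m)) m"
    proof (cases "Poly_Mapping.keys m \<subseteq> {..<v}")
      case True
      have "(\<Sum>l\<in>?K m. scal (Poly_Mapping.lookup a l) (\<kappa> (q (m - l)))) = (\<Sum>l\<in>mono_divisors m. scal (Poly_Mapping.lookup a l) (\<kappa> (q (m - l))))"
        by (rule sum.mono_neutral_left, rule finite_mono_divisors) (auto simp: mono_divisors_def in_keys_iff simp del: lookup_not_eq_zero_eq_in_keys)
      then show ?thesis using h True by (simp add: GS.act_def)
    next
      case False
      have "scal (Poly_Mapping.lookup a l) (\<kappa> (q (m - l))) = 0" if l: "l \<in> ?K m" for l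
      proof -
        have "Poly_Mapping.keys l \<subseteq> {..<v}" using l a by (auto simp: Sym_def)
        moreover have "m = l + (m - l)" using l by auto
        then have "Poly_Mapping.keys m \<subseteq> Poly_Mapping.keys l \<union> Poly_Mapping.keys (m - l)" by (metis Poly_Mapping.keys_add)
        ultimately have "\<not> Poly_Mapping.keys (m - l) \<subseteq> {..<v}" using False by blast
        then show ?thesis by (simp add: SymTensor_outside[OF q] k_zero)
      qed
      then have "\<kappa> ((a \<odot>\<^bsub>SymTensor v M j\<^esub> q) m) = 0" using h by (simp add: sum.neutral)
      then show ?thesis using False by (simp add: GS.act_def)
    qed
  qed
  show "a \<odot>\<^bsub>SymTensor v M j\<^esub> q \<in> carrier (SymTensor v M j)"
    unfolding mem_SymTensor e using h GS.supp_in_act[OF a SymTensorD(2)[OF q]] by blast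
qed

lemma SymTensor_coords:
  assumes dg: "\<And>b. b \<in> S \<Longrightarrow> dg b = j"
  shows "GS.coords v (SymTensor v M j) S dg (\<lambda>q m. \<kappa> (q m))"
  unfolding GS.coords_def
proof (intro conjI ballI allI)
  show "bij_betw (\<lambda>q m. \<kappa> (q m)) (carrier (SymTensor v M j)) (GS.supp_in v S)"
  proof (rule bij_betw_imageI)
    show "inj_on (\<lambda>q m. \<kappa> (q m)) (carrier (SymTensor v M j))"
    proof (rule inj_onI, rule ext)
      fix q r m assume q: "q \<in> carrier (SymTensor v M j)" "r \<in> carrier (SymTensor v M j)" and e: "(\<lambda>m. \<kappa> (q m)) = (\<lambda>m. \<kappa> (r m))"
      then show "q m = r m" using kD(5)[OF SymTensorD(1)[OF q(1)] SymTensorD(1)[OF q(2)]] fun_cong[OF e, of m] by blast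
    qed
    show "(\<lambda>q m. \<kappa> (q m)) ` carrier (SymTensor v M j) = GS.supp_in v S"
    proof (intro subset_antisym subsetI)
      fix p assume "p \<in> (\<lambda>q m. \<kappa> (q m)) ` carrier (SymTensor v M j)"
      then show "p \<in> GS.supp_in v S" using SymTensorD(2) by blast
    next
      fix p :: "(nat \<Rightarrow>\<^sub>0 nat) \<Rightarrow> ('b \<Rightarrow>\<^sub>0 'k)" assume p: "p \<in> GS.supp_in v S"
      note k = kinv[OF GS.supp_inD(1)[OF p]]
      have c: "(\<lambda>m. kinv (p m)) \<in> carrier (SymTensor v M j)" unfolding mem_SymTensor using k p by simp
      have "(\<lambda>m. \<kappa> (kinv (p m))) = p" using k by simp
      then show "p \<in> (\<lambda>q m. \<kappa> (q m)) ` carrier (SymTensor v M j)" using imageI[OF c, of "\<lambda>q m. \<kappa> (q m)"] by simp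
    qed
  qed
  have z: "(\<lambda>m. \<kappa> (\<zero>\<^bsub>SymTensor v M j\<^esub> m)) = 0" by (rule ext) (simp add: SymTensor_simps k_zero)
  then show "(\<lambda>m. \<kappa> (\<zero>\<^bsub>SymTensor v M j\<^esub> m)) = 0" .
  show "\<zero>\<^bsub>SymTensor v M j\<^esub> \<in> carrier (SymTensor v M j)"
    unfolding mem_SymTensor z using GS.supp_in_zero by (simp add: SymTensor_simps h_zero)
next
  fix q r assume q: "q \<in> carrier (SymTensor v M j)" and r: "r \<in> carrier (SymTensor v M j)"
  show e: "(\<lambda>m. \<kappa> ((q \<oplus>\<^bsub>SymTensor v M j\<^esub> r) m)) = (\<lambda>m. \<kappa> (q m)) + (\<lambda>m. \<kappa> (r m))"
    by (rule ext) (simp add: SymTensor_simps kD(2) SymTensorD(1)[OF q] SymTensorD(1)[OF r])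
  show "q \<oplus>\<^bsub>SymTensor v M j\<^esub> r \<in> carrier (SymTensor v M j)"
    unfolding mem_SymTensor e using GS.supp_in_add[OF SymTensorD(2)[OF q] SymTensorD(2)[OF r]]
    by (simp add: SymTensor_simps h_add SymTensorD(1)[OF q] SymTensorD(1)[OF r])
next
  fix t
  show "hpart (SymTensor v M j) t = {q \<in> carrier (SymTensor v M j). \<forall>m. \<forall>b\<in>Poly_Mapping.keys (\<kappa> (q m)). mono_deg m + dg b = t}"
  proof (rule Set.set_eqI)
    fix q
    have "(\<forall>m. mono_deg m + j \<noteq> t \<longrightarrow> q m = \<zero>\<^bsub>M\<^esub>) \<longleftrightarrow> (\<forall>m. \<forall>b\<in>Poly_Mapping.keys (\<kappa> (q m)). mono_deg m + dg b = t)"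
      if q: "q \<in> carrier (SymTensor v M j)"
    proof (rule iff_allI)
      fix m
      have S: "Poly_Mapping.keys (\<kappa> (q m)) \<subseteq> S" by (rule kD(4)[OF SymTensorD(1)[OF q]])
      have z: "q m = \<zero>\<^bsub>M\<^esub> \<longleftrightarrow> (\<forall>b. b \<notin> Poly_Mapping.keys (\<kappa> (q m)))"
        using k_zero_iff[OF SymTensorD(1)[OF q], of m] by (metis all_not_in_conv keys_eq_empty)
      have d: "dg b = j" if "b \<in> Poly_Mapping.keys (\<kappa> (q m))" for b using dg S that by blast
      show "(mono_deg m + j \<noteq> t \<longrightarrow> q m = \<zero>\<^bsub>M\<^esub>) \<longleftrightarrow> (\<forall>b\<in>Poly_Mapping.keys (\<kappa> (q m)). mono_deg m + dg b = t)"
        unfolding z using d by metis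
    qed
    moreover have "q \<in> hpart (SymTensor v M j) t \<longleftrightarrow> q \<in> carrier (SymTensor v M j) \<and> (\<forall>m. mono_deg m + j \<noteq> t \<longrightarrow> q m = \<zero>\<^bsub>M\<^esub>)"
      by (simp add: SymTensor_def Let_def)
    ultimately show "q \<in> hpart (SymTensor v M j) t \<longleftrightarrow>
        q \<in> {q \<in> carrier (SymTensor v M j). \<forall>m. \<forall>b\<in>Poly_Mapping.keys (\<kappa> (q m)). mono_deg m + dg b = t}" by blast
  qed
qed (use smult_SymTensor in auto)

text \<open>Both sides run over the variables dividing the monomial \<open>m\<close>; in the symmetric algebra there is no sign.\<close>

lemma L_diff_coords:
  assumes P': "tensor_piece v M (j - 1) S' \<kappa>'" and q: "q \<in> carrier (SymTensor v M j)"
    and Y: "\<And>k x. k < v \<Longrightarrow> x \<in> hpart M j \<Longrightarrow> lin_ext (Y k) (\<kappa> x) = scal s (\<kappa>' (ext_gen k \<odot>\<^bsub>M\<^esub> x))"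
  shows "L_diff v M q \<in> carrier (SymTensor v M (j - 1))"
    and "GS.del v Y (\<lambda>m. \<kappa> (q m)) = (\<lambda>m. scal s (\<kappa>' (L_diff v M q m)))"
proof -
  interpret P': tensor_piece v M "j - 1" S' \<kappa>' by (rule P')
  note qh = SymTensorD(1)[OF q]
  have yh: "ext_gen k \<odot>\<^bsub>M\<^esub> x \<in> hpart M (j - 1)" if "k < v" "x \<in> hpart M j" for k x
  proof -
    have "(ext_gen k :: 'k ext) \<in> hom_part (Ext v) (- 1)" by (rule ext_gen_part[OF that(1)])
    then have "ext_gen k \<odot>\<^bsub>M\<^esub> x \<in> hpart M (- 1 + j)" using pg that(2) unfolding pre_graded_def by blast
    then show ?thesis by simp
  qed
  have yz: "\<kappa>' (ext_gen k \<odot>\<^bsub>M\<^esub> \<zero>\<^bsub>M\<^esub>) = 0" if "k < v" for k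
  proof -
    have "ext_gen k \<in> carrier (Ext v)" using that by (auto simp: Ext_def ext_gen_def)
    then have "ext_gen k \<odot>\<^bsub>M\<^esub> (\<zero>\<^bsub>M\<^esub> \<oplus>\<^bsub>M\<^esub> \<zero>\<^bsub>M\<^esub>) = ext_gen k \<odot>\<^bsub>M\<^esub> \<zero>\<^bsub>M\<^esub> \<oplus>\<^bsub>M\<^esub> ext_gen k \<odot>\<^bsub>M\<^esub> \<zero>\<^bsub>M\<^esub>"
      by (intro L.smult_r_distr) auto
    then have "\<kappa>' (ext_gen k \<odot>\<^bsub>M\<^esub> \<zero>\<^bsub>M\<^esub>) = \<kappa>' (ext_gen k \<odot>\<^bsub>M\<^esub> \<zero>\<^bsub>M\<^esub>) + \<kappa>' (ext_gen k \<odot>\<^bsub>M\<^esub> \<zero>\<^bsub>M\<^esub>)"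
      using P'.kD(2)[OF yh[OF that h_zero] yh[OF that h_zero]] by simp
    then show ?thesis by simp
  qed
  let ?I = "\<lambda>m. {k. k < v \<and> 0 < Poly_Mapping.lookup m k}" and ?x = "\<lambda>k. Poly_Mapping.single k (1::nat)"
  have L: "L_diff v M q m \<in> hpart M (j - 1) \<and> \<kappa>' (L_diff v M q m) = (\<Sum>k\<in>?I m. \<kappa>' (ext_gen k \<odot>\<^bsub>M\<^esub> q (m - ?x k)))" for m
    using P'.k_finsum[of "?I m" "\<lambda>k. ext_gen k \<odot>\<^bsub>M\<^esub> q (m - ?x k)"] by (simp add: L_diff_def yh qh)
  have split_var: "m = ?x k + (m - ?x k)" if "0 < Poly_Mapping.lookup m k" for m k
    by (rule poly_mapping_eqI) (use that in \<open>auto simp: lookup_add lookup_minus lookup_single when_def\<close>)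
  have out: "\<kappa>' (L_diff v M q m) = 0" if m: "\<not> Poly_Mapping.keys m \<subseteq> {..<v}" for m
  proof -
    have "\<kappa>' (ext_gen k \<odot>\<^bsub>M\<^esub> q (m - ?x k)) = 0" if k: "k \<in> ?I m" for k
    proof -
      have "Poly_Mapping.keys m \<subseteq> Poly_Mapping.keys (?x k) \<union> Poly_Mapping.keys (m - ?x k)"
        using split_var[of m k] k Poly_Mapping.keys_add[of "?x k" "m - ?x k"] by simp
      then have "\<not> Poly_Mapping.keys (m - ?x k) \<subseteq> {..<v}" using m k by (auto split: if_splits)
      then show ?thesis using k yz by (simp add: SymTensor_outside[OF q])
    qed
    then show ?thesis using L by (simp add: sum.neutral)
  qed
  show "L_diff v M q \<in> carrier (SymTensor v M (j - 1))"
    unfolding P'.mem_SymTensor GS.supp_in_def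
  proof (intro conjI allI CollectI impI)
    fix m show "L_diff v M q m \<in> hpart M (j - 1)" using L by blast
    then show "Poly_Mapping.keys (\<kappa>' (L_diff v M q m)) \<subseteq> S'" by (rule P'.kD(4))
    show "\<kappa>' (L_diff v M q m) = 0" if "m \<notin> {m. Poly_Mapping.keys m \<subseteq> {..<v}}" using that out by blast
  next
    have fq: "finite {m. \<kappa> (q m) \<noteq> 0}" by (rule GS.supp_inD(2)[OF SymTensorD(2)[OF q]])
    have "{m. \<kappa>' (L_diff v M q m) \<noteq> 0} \<subseteq> (\<Union>k<v. (\<lambda>n. ?x k + n) ` {m. \<kappa> (q m) \<noteq> 0})"
    proof
      fix m assume "m \<in> {m. \<kappa>' (L_diff v M q m) \<noteq> 0}"
      then have "(\<Sum>k\<in>?I m. \<kappa>' (ext_gen k \<odot>\<^bsub>M\<^esub> q (m - ?x k))) \<noteq> 0" using L by simp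
      then obtain k where k: "k \<in> ?I m" "\<kappa>' (ext_gen k \<odot>\<^bsub>M\<^esub> q (m - ?x k)) \<noteq> 0" by (meson sum.neutral)
      then have "q (m - ?x k) \<noteq> \<zero>\<^bsub>M\<^esub>" using yz by auto
      then have "m - ?x k \<in> {m. \<kappa> (q m) \<noteq> 0}" using k_zero_iff[OF qh] by simp
      moreover have "m = ?x k + (m - ?x k)" by (rule split_var) (use k in simp)
      ultimately show "m \<in> (\<Union>k<v. (\<lambda>n. ?x k + n) ` {m. \<kappa> (q m) \<noteq> 0})" using k by blast
    qed
    then show "finite {m. \<kappa>' (L_diff v M q m) \<noteq> 0}" by (rule finite_subset) (use fq in simp)
  qed
  show "GS.del v Y (\<lambda>m. \<kappa> (q m)) = (\<lambda>m. scal s (\<kappa>' (L_diff v M q m)))"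
  proof
    fix m
    show "GS.del v Y (\<lambda>m. \<kappa> (q m)) m = scal s (\<kappa>' (L_diff v M q m))"
    proof (cases "Poly_Mapping.keys m \<subseteq> {..<v}")
      case True
      have "?x k \<in> mono_divisors m \<longleftrightarrow> 0 < Poly_Mapping.lookup m k" for k
        using split_var[of m k] by (auto simp: mono_divisors_def lookup_add lookup_single)
      then have vr: "GS.vr v m = ?I m" unfolding GS.vr_def using True by auto
      have "GS.del v Y (\<lambda>m. \<kappa> (q m)) m = (\<Sum>k\<in>?I m. scal s (\<kappa>' (ext_gen k \<odot>\<^bsub>M\<^esub> q (m - ?x k))))"
        unfolding GS.del_def vr GS.sg_def by (rule sum.cong) (simp_all add: Y qh)
      then show ?thesis using L by (simp add: scal_sum)
    next
      case False
      then show ?thesis unfolding GS.del_def GS.vr_def using out by simp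
    qed
  qed
qed

end

lemma L_coords:
  fixes F :: "(('k::field) ext, 'x) gcomplex" and S :: "'a idx set"
  assumes cf: "coord_family (Ext v) ext_const ext_gen v (- 1) 1 F S \<kappa> Y"
  shows "\<exists>Fm. GS.coords_complex v (bgg_L v F) S 0 Y Fm"
proof -
  note CF = coord_familyD[OF cf]
  have hp: "tensor_piece v (Ob F i) j (bsi S i j) (\<kappa> i j)" for i j
    by (intro tensor_piece.intro coord_piece.intro coord_piece_axioms.intro scalars_Ext CF(1,2))
  have cs: "GS.coords v (SymTensor v (Ob F i) j) (bsi S i j) (dgu 0) (\<lambda>q m. \<kappa> i j (q m))" for i j
    by (rule tensor_piece.SymTensor_coords[OF hp]) (auto simp: bsi_def dgu_def)
  let ?T = "\<lambda>n i. SymTensor v (Ob F i) (i - n)" and ?ev = "\<lambda>n i q m. \<kappa> i (i - n) (q m)"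
  have main: "Df (bgg_L v F) n \<phi> i \<in> carrier (?T (n + 1) i) \<and>
      ?ev (n + 1) i (Df (bgg_L v F) n \<phi> i) = GS.pw dB (?ev n (i - 1) (\<phi> (i - 1))) + GS.del v Y (?ev n i (\<phi> i))"
    if p: "\<And>i. \<phi> i \<in> carrier (?T n i)" for n \<phi> i
  proof -
    let ?j = "i - (n + 1)"
    let ?H = "SymTensor v (Ob F i) ?j"
    have nj: "i - 1 - n = ?j" "i - n - 1 = ?j" by simp_all
    interpret P: tensor_piece v "Ob F (i - 1)" ?j "bsi S (i - 1) ?j" "\<kappa> (i - 1) ?j" by (rule hp)
    interpret Q: tensor_piece v "Ob F i" "i - n" "bsi S i (i - n)" "\<kappa> i (i - n)" by (rule hp)
    interpret H: tensor_piece v "Ob F i" ?j "bsi S i ?j" "\<kappa> i ?j" by (rule hp)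
    note hcs = cs[of i ?j]
    interpret HA: abelian_group ?H by (rule GS.coords_abelian_group(1)[OF hcs])
    have pa: "\<phi> (i - 1) \<in> carrier (SymTensor v (Ob F (i - 1)) ?j)" using p[of "i - 1"] by (simp only: nj)
    have dh: "Df F (i - 1) x \<in> hpart (Ob F i) ?j"
      and dk: "\<kappa> i ?j (Df F (i - 1) x) = lin_ext dB (\<kappa> (i - 1) ?j x)"
      if "x \<in> hpart (Ob F (i - 1)) ?j" for x
      using CF(3,4)[OF that] by simp_all
    define \<beta> where "\<beta> = (\<lambda>m. Df F (i - 1) (\<phi> (i - 1) m))"
    note ph = P.SymTensorD(1)[OF pa]
    have be: "(\<lambda>m. \<kappa> i ?j (\<beta> m)) = GS.pw dB (\<lambda>m. \<kappa> (i - 1) ?j (\<phi> (i - 1) m))"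
      by (rule ext) (simp only: \<beta>_def GS.pw_def dk[OF ph])
    have b: "\<beta> \<in> carrier ?H" unfolding H.mem_SymTensor be GS.pw_def
    proof
      show "\<forall>m. \<beta> m \<in> hpart (Ob F i) ?j" using dh[OF ph] by (simp add: \<beta>_def)
      have "(\<lambda>m. lin_ext dB (\<kappa> (i - 1) ?j (\<phi> (i - 1) m))) = (\<lambda>m. \<kappa> i ?j (\<beta> m))"
        by (rule ext) (simp only: \<beta>_def dk[OF ph])
      moreover have "Poly_Mapping.keys (\<kappa> i ?j (\<beta> m)) \<subseteq> bsi S i ?j" for m
        unfolding \<beta>_def by (rule H.kD(4)[OF dh[OF ph]])
      ultimately have k: "Poly_Mapping.keys (lin_ext dB (\<kappa> (i - 1) ?j (\<phi> (i - 1) m))) \<subseteq> bsi S i ?j" for m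
        by metis
      have s: "(\<lambda>m. lin_ext dB (\<kappa> (i - 1) ?j (\<phi> (i - 1) m))) \<in> GS.supp_in v UNIV"
        by (rule GS.supp_in_comp[OF P.SymTensorD(2)[OF pa]]) simp_all
      show "(\<lambda>m. lin_ext dB (\<kappa> (i - 1) ?j (\<phi> (i - 1) m))) \<in> GS.supp_in v (bsi S i ?j)"
        using k GS.supp_inD(2,3)[OF s] by (simp add: GS.supp_in_def)
    qed
    define s :: 'k where "s = (if even i then 1 else - 1)"
    have Ys: "lin_ext (Y k) (\<kappa> i (i - n) x) = scal s (\<kappa> i ?j (ext_gen k \<odot>\<^bsub>Ob F i\<^esub> x))"
      if "k < v" "x \<in> hpart (Ob F i) (i - n)" for k x
    proof -
      have "i - n + - 1 = ?j" by simp
      then show ?thesis using CF(5)[OF that] by (simp only: s_def)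
    qed
    have L: "L_diff v (Ob F i) (\<phi> i) \<in> carrier ?H"
      "GS.del v Y (\<lambda>m. \<kappa> i (i - n) (\<phi> i m)) = (\<lambda>m. scal s (\<kappa> i ?j (L_diff v (Ob F i) (\<phi> i) m)))"
      using Q.L_diff_coords[of "bsi S i ?j" "\<kappa> i ?j" "\<phi> i" Y s] H.tensor_piece_axioms p Ys
      by (simp_all add: nj)
    have A: "alt_sign ?H i (L_diff v (Ob F i) (\<phi> i)) \<in> carrier ?H"
      "(\<lambda>m. \<kappa> i ?j (alt_sign ?H i (L_diff v (Ob F i) (\<phi> i)) m)) = GS.del v Y (\<lambda>m. \<kappa> i (i - n) (\<phi> i m))"
    proof -
      show "alt_sign ?H i (L_diff v (Ob F i) (\<phi> i)) \<in> carrier ?H" using L(1) by (simp add: alt_sign_def)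
      show "(\<lambda>m. \<kappa> i ?j (alt_sign ?H i (L_diff v (Ob F i) (\<phi> i)) m)) = GS.del v Y (\<lambda>m. \<kappa> i (i - n) (\<phi> i m))"
      proof (cases "even i")
        case True
        then show ?thesis unfolding L(2) by (simp add: alt_sign_def s_def)
      next
        case False
        have n: "scal (- 1) w = - w" for w :: "'a idx \<Rightarrow>\<^sub>0 'k" by (rule poly_mapping_eqI) simp
        show ?thesis unfolding L(2) using False GS.coords_abelian_group(2)[OF hcs L(1)]
          by (simp add: alt_sign_def n fun_eq_iff s_def)
      qed
    qed
    have D: "Df (bgg_L v F) n \<phi> i = \<beta> \<oplus>\<^bsub>?H\<^esub> alt_sign ?H i (L_diff v (Ob F i) (\<phi> i))"
      by (simp add: bgg_L_def Let_def \<beta>_def)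
    show ?thesis unfolding D using GS.coordsD(4)[OF hcs b A(1)] GS.coordsD(5)[OF hcs b A(1)] by (simp only: be A(2) nj)
  qed
  show ?thesis
  proof (rule GS.assembly[where T = ?T and ev = ?ev])
    show Ob: "Ob (bgg_L v F) n = direct_sum (?T n)" for n by (simp add: bgg_L_def)
    show "GS.coords v (?T n i) (bsi S i (- 1 * (n - i))) (dgu 0) (?ev n i)" for n i using cs[of i "i - n"] by simp
    fix n \<phi> i assume "\<phi> \<in> carrier (Ob (bgg_L v F) n)"
    then have p: "\<phi> i \<in> carrier (?T n i)" for i unfolding Ob by (simp add: direct_sum_def)
    show "Df (bgg_L v F) n \<phi> i \<in> carrier (?T (n + 1) i)" using main[OF p] by blast
    show "?ev (n + 1) i (Df (bgg_L v F) n \<phi> i) = GS.pw dB (?ev n (i - 1) (\<phi> (i - 1))) + GS.del v Y (?ev n i (\<phi> i))"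
      using main[OF p] by blast
  qed (rule CF(6))
qed

section \<open>The two functors and linear parts\<close>

context kcomplex_y
begin

lemma bsH_harmonic: "b \<in> bsH \<Longrightarrow> fst b = Harm" by (simp add: bsH_def)

end

text \<open>The condition on squares is void: the square of a variable divides no monomial of the exterior
  algebra.\<close>

lemma kcomplex_y_R:
  fixes G :: "(('k::field) sym, 'a) gcomplex"
  assumes "graded_complex (Sym v) G"
  shows "kcomplex_y (Ext v) (\<lambda>f. f) (Pow {..<v}) Pow ext_sign {} (\<lambda>k. {k}) v (\<lambda>I. - int (card I)) 1 (- 1)
     (Sym v) sym_const G sym_var ((- 1) ^ (v + 1))"
proof (intro kcomplex_y.intro kcomplex_y_axioms.intro kcomplex.intro kcomplex_axioms.intro
    monomial_algebra_Ext scalars_Sym assms)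
  fix k l :: nat and x :: 'k
  show "sym_var k \<in> hom_part (Sym v) 1" if "k < v" using that by (rule sym_var_part)
  show "sym_const x \<otimes>\<^bsub>Sym v\<^esub> sym_var k = sym_var k \<otimes>\<^bsub>Sym v\<^esub> sym_const x"
    by (simp add: Sym_def mult.commute)
  show "sym_var k \<otimes>\<^bsub>Sym v\<^esub> sym_var l = sym_const (- (- 1)) \<otimes>\<^bsub>Sym v\<^esub> (sym_var l \<otimes>\<^bsub>Sym v\<^esub> sym_var k :: 'k sym)"
    by (simp add: Sym_def mult.commute sym_const_def flip: single_one)
  show "(- 1) ^ (v + 1) * (- 1) ^ (v + 1) = (1 :: 'k)" by (simp add: power_mult_distrib[symmetric])
  fix m :: "nat set" assume "{k} \<in> Pow (m - {k})"
  then show "sym_var k \<otimes>\<^bsub>Sym v\<^esub> sym_var k = (\<zero>\<^bsub>Sym v\<^esub> :: 'k sym)" by simp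
qed

lemma kcomplex_y_L:
  fixes P :: "(('k::field) ext, 'a) gcomplex"
  assumes "graded_complex (Ext v) P"
  shows "kcomplex_y (Sym v) Poly_Mapping.lookup {m. Poly_Mapping.keys m \<subseteq> {..<v}} mono_divisors (\<lambda>_ _. 1) 0
     (\<lambda>k. Poly_Mapping.single k 1) v mono_deg (- 1) 1 (Ext v) ext_const P ext_gen 1"
proof (intro kcomplex_y.intro kcomplex_y_axioms.intro kcomplex.intro kcomplex_axioms.intro
    monomial_algebra_Sym scalars_Ext assms)
  fix k l :: nat and x :: 'k
  have gc: "(ext_gen k :: 'k ext) \<in> carrier (Ext v)" if "k < v" for k
    using that by (auto simp: Ext_def ext_gen_def)
  show "(ext_gen k :: 'k ext) \<in> hom_part (Ext v) (- 1)" if "k < v" using that by (rule ext_gen_part)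
  show "ext_const x \<otimes>\<^bsub>Ext v\<^esub> ext_gen k = ext_gen k \<otimes>\<^bsub>Ext v\<^esub> ext_const x" if "k < v"
    by (simp add: ext_const_mult ext_mult_const gc[OF that])
  show "ext_gen k \<otimes>\<^bsub>Ext v\<^esub> ext_gen l = ext_const (- 1) \<otimes>\<^bsub>Ext v\<^esub> (ext_gen l \<otimes>\<^bsub>Ext v\<^esub> ext_gen k :: 'k ext)"
    if "k < v" "l < v" "k \<noteq> l"
  proof -
    have c: "(ext_gen l \<otimes>\<^bsub>Ext v\<^esub> ext_gen k :: 'k ext) \<in> carrier (Ext v)"
      by (rule ring.ring_simprules(5)[OF ring_Ext gc[OF that(2)] gc[OF that(1)]])
    show ?thesis unfolding ext_const_mult[OF c] using that(3)
      by (simp add: ext_gen_mult insert_commute fun_eq_iff)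
  qed
  show "ext_gen k \<otimes>\<^bsub>Ext v\<^esub> ext_gen k = (\<zero>\<^bsub>Ext v\<^esub> :: 'k ext)" by (rule ext_gen_square)
qed simp

theorem corollary3p6:
  fixes v :: nat
    and G :: "(('k::field) sym, 'a) gcomplex"
    and P :: "('k ext, 'c) gcomplex"
  shows
    "(graded_complex (Sym v) G \<and> left_bounded G \<longrightarrow>
        (\<exists>X :: ('k ext, int \<times> 'a) free_data. minimal_model (Ext v) (bgg_R v G) X) \<and>
        (\<forall>X :: ('k ext, 'b) free_data. minimal_model (Ext v) (bgg_R v G) X \<longrightarrow>
           chain_isomorphic (Ext v)
             (free_complex_of (Ext v) (linear_part (Ext v) X))
             (direct_sum_complex (\<lambda>i. bgg_R v (one_term i (cohomology G i)))))) \<and>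
     (graded_complex (Ext v) P \<and> left_bounded P \<longrightarrow>
        (\<exists>X :: ('k sym, int \<times> 'c) free_data. minimal_model (Sym v) (bgg_L v P) X) \<and>
        (\<forall>X :: ('k sym, 'd) free_data. minimal_model (Sym v) (bgg_L v P) X \<longrightarrow>
           chain_isomorphic (Sym v)
             (free_complex_of (Sym v) (linear_part (Sym v) X))
             (direct_sum_complex (\<lambda>i. bgg_L v (one_term i (cohomology P i))))))"
proof (intro conjI impI allI; elim conjE)
  assume "graded_complex (Sym v) G" and lb: "left_bounded G"
  then interpret kcomplex_y "Ext v" "\<lambda>f. f" "Pow {..<v}" Pow ext_sign "{}" "\<lambda>k. {k}" v "\<lambda>I. - int (card I)" 1 "- 1"
     "Sym v" sym_const G sym_var "(- 1) ^ (v + 1)" by (intro kcomplex_y_R)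
  note T = R_coords[OF coord_family_G]
  have TH: "\<exists>F. GE.coords_complex v (direct_sum_complex (\<lambda>i. bgg_R v (one_term i (H i)))) bsH (int v) YH F"
    by (rule GE.direct_sum_coords[OF R_coords[OF coord_family_one_term]]) (erule bsH_harmonic, erule YH_block)
  note strand = linear_strand_theorem[OF lb T TH]
  show "\<exists>X :: ('k ext, int \<times> 'a) free_data. minimal_model (Ext v) (bgg_R v G) X" by (rule strand(1))
  show "chain_isomorphic (Ext v) (free_complex_of (Ext v) (linear_part (Ext v) X))
      (direct_sum_complex (\<lambda>i. bgg_R v (one_term i (cohomology G i))))"
    if "minimal_model (Ext v) (bgg_R v G) X" for X :: "('k ext, 'b) free_data" by (rule strand(2)[OF that])
next
  assume "graded_complex (Ext v) P" and lb: "left_bounded P"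
  then interpret kcomplex_y "Sym v" Poly_Mapping.lookup "{m. Poly_Mapping.keys m \<subseteq> {..<v}}" mono_divisors "\<lambda>_ _. 1" 0
     "\<lambda>k. Poly_Mapping.single k 1" v mono_deg "- 1" 1 "Ext v" ext_const P ext_gen 1 by (intro kcomplex_y_L)
  note T = L_coords[OF coord_family_G]
  have TH: "\<exists>F. GS.coords_complex v (direct_sum_complex (\<lambda>i. bgg_L v (one_term i (H i)))) bsH (0) YH F"
    by (rule GS.direct_sum_coords[OF L_coords[OF coord_family_one_term]]) (erule bsH_harmonic, erule YH_block)
  note strand = linear_strand_theorem[OF lb T TH]
  show "\<exists>X :: ('k sym, int \<times> 'c) free_data. minimal_model (Sym v) (bgg_L v P) X" by (rule strand(1))
  show "chain_isomorphic (Sym v) (free_complex_of (Sym v) (linear_part (Sym v) X))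
      (direct_sum_complex (\<lambda>i. bgg_L v (one_term i (cohomology P i))))"
    if "minimal_model (Sym v) (bgg_L v P) X" for X :: "('k sym, 'd) free_data" by (rule strand(2)[OF that])
qed

end
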